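(* Let $X$ be a complex projective manifold of dimension $n$, let $D_1,\dots,D_r$ be divisors on $X$ as in the context, and let $\psi_i$ be a continuous metric on $\mathcal{O}_X(D_i)$ for $1\le i\le r$. For rational $a=(a_1,\dots,a_r)\in\mathbb{Q}^r$ (with $(p,a)\in\Sigma(\Gamma(X))^\circ$), the global Chebyshev transform $c[\psi_1,\dots,\psi_r](p,a)$ coincides with $c\left[\sum a_i\psi_i\right](p)$, the Chebyshev transform of the metrized big $\mathbb{Q}$-divisor $(\sum a_iD_i,\sum a_i\psi_i)$.
   Context: $X$ is a (connected) complex projective manifold of dimension $n$; $kL=L^{\otimes k}$. $D_1,\dots,D_r$ are divisors such that every divisor on $X$ is numerically equivalent to a unique sum $\sum a_iD_i$, $a_i\in\mathbb{Z}$, chosen so that for effective divisors the coefficients $a_i$ are non-negative. A continuous hermitian metric $h=e^{-\psi}$ on a line bundle is denoted by $\psi$ (for a local frame $f$, $|f|_h^2=e^{-\psi_f}$, $\psi_f$ continuous); metrics are combined additively. Fix a point $x_0\in X$, local holomorphic coordinates $z_1,\dots,z_n$ centered at $x_0$ and local trivializations of the $\mathcal{O}_X(D_i)$ near $x_0$ (inducing trivializations of all integral combinations). A nonzero section $s$ is expanded as $s=\sum_\alpha b_\alpha z^\alpha$; $v(s)\in\mathbb{N}^n$ is the lexicographically smallest $\alpha$ with $b_\alpha\neq0$. Global transform: $\Gamma(X):=\bigcup_{a\in\mathbb{N}^r}\left(v(H^0(\mathcal{O}_X(\sum a_iD_i)))\times\{a\}\right)\subseteq\mathbb{Z}^{n+r}$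 ($v$ evaluated on nonzero sections); $\Sigma(\Gamma(X))$ is the closed convex cone it spans, with interior $\Sigma(\Gamma(X))^\circ$. For $(\alpha,a)\in\Gamma(X)$, $F[\psi_1,\dots,\psi_r](\alpha,a):=\inf\ln\sup_X(|s|^2e^{-\sum a_i\psi_i})$ over $s\in H^0(\mathcal{O}_X(\sum a_iD_i))$ of the form $z^\alpha+$ (lexicographically) higher order terms. $c[\psi_1,\dots,\psi_r]$ is the convex envelope of $F[\psi_1,\dots,\psi_r]$ on $\Sigma(\Gamma(X))^\circ$: the supremum of all linear (equivalently, convex one-homogeneous) functions on $\Sigma(\Gamma(X))^\circ$ that are $\le F[\psi_1,\dots,\psi_r]$ on $\Gamma(X)\cap\Sigma(\Gamma(X))^\circ$. Transform of one metrized $\mathbb{Q}$-divisor: for a big line bundle $L$ with continuous metric $\psi$ put $\Delta_k(L):=\frac1k\{v(s):0\ne s\in H^0(kL)\}$, let $\Delta(L)$ (Okounkov body) be the closed convex hull of $\bigcup_{k\ge1}\Delta_k(L)$, and for $p\in\Delta(L)^\circ$, $c[\psi](p):=\lim_{k\to\infty}\frac1k\inf\{\ln\sup_X(|s|^2e^{-k\psi}):s\in H^0(kL),\ s=z^{k\alpha(k)}+\text{higher order terms}\}$ for any $\alpha(k)\in\Delta_k(L)$ with $\alpha(k)\to p$ (well defined). For a big $\mathbb{Q}$-divisor $D$ with metric $\psi$: $\Delta(D):=\frac1q\Delta(qD)$ and $c[\psi](p):=\frac1qc[q\psi](qp)$, $p\in\Delta(D)^\circ$, for any positive integer $q$ clearing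 the denominators of $D$. For $(p,a)\in\Sigma(\Gamma(X))^\circ$ with $a$ rational, $\sum a_iD_i$ is big and $p\in\Delta(\sum a_iD_i)^\circ$. *)

theory Defs
  imports "HOL-Complex_Analysis.Complex_Analysis"
begin

no_notation fps_nth (infixl \<open>$\<close> 75)

section \<open>Complex manifolds\<close>

definition mholomorphic_on :: "(complex^'n::finite \<Rightarrow> complex) \<Rightarrow> (complex^'n) set \<Rightarrow> bool"
    (infixl "mholomorphic'_on" 50) where
  "f mholomorphic_on S \<longleftrightarrow>
     (\<forall>z\<in>S. \<exists>f'. (f has_derivative f') (at z) \<and> (\<forall>c v. f' (c *s v) = c * f' v))"

type_synonym ('a, 'n) chart = "'a set \<times> ('a \<Rightarrow> complex^'n)"

record ('a, 'n) cmanifold =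
  topol :: "'a topology"
  atlas :: "('a, 'n) chart set"

abbreviation points :: "('a, 'n) cmanifold \<Rightarrow> 'a set" where
  "points X \<equiv> topspace (topol X)"

definition chart_inv :: "('a, 'n::finite) chart \<Rightarrow> complex^'n \<Rightarrow> 'a" where
  "chart_inv \<kappa> = inv_into (fst \<kappa>) (snd \<kappa>)"

definition chart_on :: "'a topology \<Rightarrow> ('a, 'n::finite) chart \<Rightarrow> bool" where
  "chart_on T \<kappa> \<longleftrightarrow> openin T (fst \<kappa>) \<and> open (snd \<kappa> ` fst \<kappa>) \<and>
     homeomorphic_map (subtopology T (fst \<kappa>)) (top_of_set (snd \<kappa> ` fst \<kappa>)) (snd \<kappa>)"

definition holomorphic_transition :: "('a, 'n::finite) chart \<Rightarrow> ('a, 'n) chart \<Rightarrow> bool" where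
  "holomorphic_transition \<kappa> \<mu> \<longleftrightarrow>
     (\<forall>i. (\<lambda>w. snd \<mu> (chart_inv \<kappa> w) $ i) mholomorphic_on (snd \<kappa> ` (fst \<kappa> \<inter> fst \<mu>)))"

definition complex_manifold :: "('a, 'n::finite) cmanifold \<Rightarrow> bool" where
  "complex_manifold X \<longleftrightarrow>
     Hausdorff_space (topol X) \<and> second_countable (topol X) \<and>
     (\<forall>\<kappa>\<in>atlas X. chart_on (topol X) \<kappa>) \<and>
     (\<Union>(fst ` atlas X) = points X) \<and>
     (\<forall>\<kappa>\<in>atlas X. \<forall>\<mu>\<in>atlas X. holomorphic_transition \<kappa> \<mu>)"

text \<open>Local holomorphic coordinates centered at a point: a chart of the maximal atlas.\<close>

definition coordinates_at :: "('a, 'n::finite) cmanifold \<Rightarrow> 'a \<Rightarrow> ('a, 'n) chart \<Rightarrow> bool" where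
  "coordinates_at X x \<kappa> \<longleftrightarrow> chart_on (topol X) \<kappa> \<and>
     (\<forall>\<mu>\<in>atlas X. holomorphic_transition \<kappa> \<mu> \<and> holomorphic_transition \<mu> \<kappa>) \<and>
     x \<in> fst \<kappa> \<and> snd \<kappa> x = 0"

definition holomorphic_fun :: "('a, 'n::finite) cmanifold \<Rightarrow> 'a set \<Rightarrow> ('a \<Rightarrow> complex) \<Rightarrow> bool" where
  "holomorphic_fun X U f \<longleftrightarrow>
     (\<forall>\<kappa>\<in>atlas X. (\<lambda>w. f (chart_inv \<kappa> w)) mholomorphic_on (snd \<kappa> ` (fst \<kappa> \<inter> U)))"

definition holomorphic_map ::
    "('b, 'm::finite) cmanifold \<Rightarrow> ('a, 'n::finite) cmanifold \<Rightarrow> ('b \<Rightarrow> 'a) \<Rightarrow> bool" where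
  "holomorphic_map C X f \<longleftrightarrow> continuous_map (topol C) (topol X) f \<and>
     (\<forall>\<kappa>\<in>atlas C. \<forall>\<mu>\<in>atlas X. \<forall>i.
        (\<lambda>w. snd \<mu> (f (chart_inv \<kappa> w)) $ i) mholomorphic_on
          (snd \<kappa> ` {y\<in>fst \<kappa>. f y \<in> fst \<mu>}))"

text \<open>
  A holomorphic map to the projective space of dimension \<open>N\<close> is given by local lifts
  \<open>(U, F)\<close>, where \<open>F 0, \<dots>, F N\<close> are homogeneous coordinates without common zero on \<open>U\<close>.
  Two points have the same image iff their homogeneous coordinates are proportional: in the
  third clause, the direction from equality of points says that the lifts agree on overlaps,
  and the other one that the map is injective.  The last clause says that its differential is
  injective, a tangent vector being in the kernel iff the derivative of the lift is
  proportional to the lift.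
\<close>

definition projective_embedding ::
    "('a, 'n::finite) cmanifold \<Rightarrow> nat \<Rightarrow> ('a set \<times> (nat \<Rightarrow> 'a \<Rightarrow> complex)) set \<Rightarrow> bool" where
  "projective_embedding X N E \<longleftrightarrow>
     \<Union>(fst ` E) = points X \<and>
     (\<forall>(U, F)\<in>E. openin (topol X) U \<and> (\<forall>j\<le>N. holomorphic_fun X U (F j)) \<and>
        (\<forall>x\<in>U. \<exists>j\<le>N. F j x \<noteq> 0)) \<and>
     (\<forall>(U, F)\<in>E. \<forall>(V, G)\<in>E. \<forall>x\<in>U. \<forall>y\<in>V.
        (\<forall>i\<le>N. \<forall>j\<le>N. F i x * G j y = F j x * G i y) \<longleftrightarrow> x = y) \<and>
     (\<forall>(U, F)\<in>E. \<forall>\<kappa>\<in>atlas X. \<forall>x\<in>U \<inter> fst \<kappa>. \<forall>v.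
        (let dF = (\<lambda>j. frechet_derivative (\<lambda>w. F j (chart_inv \<kappa> w)) (at (snd \<kappa> x)) v)
         in (\<forall>i\<le>N. \<forall>j\<le>N. F i x * dF j = F j x * dF i) \<longrightarrow> v = 0))"

definition projective_manifold :: "('a, 'n::finite) cmanifold \<Rightarrow> bool" where
  "projective_manifold X \<longleftrightarrow> complex_manifold X \<and>
     compact_space (topol X) \<and> connected_space (topol X) \<and> (\<exists>N E. projective_embedding X N E)"


section \<open>Divisors and their line bundles\<close>

text \<open>
  Divisors are Cartier divisors: on the open set \<open>opn D i\<close>, the divisor is that of the
  meromorphic function \<open>numer D i / denom D i\<close>.
\<close>

record ('a, 'i) divisor =
  idx :: "'i set"
  opn :: "'i \<Rightarrow> 'a set"
  numer :: "'i \<Rightarrow> 'a \<Rightarrow> complex"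
  denom :: "'i \<Rightarrow> 'a \<Rightarrow> complex"

definition nowhere_locally_zero :: "'a topology \<Rightarrow> 'a set \<Rightarrow> ('a \<Rightarrow> complex) \<Rightarrow> bool" where
  "nowhere_locally_zero T U f \<longleftrightarrow> (\<forall>V. openin T V \<and> V \<noteq> {} \<and> V \<subseteq> U \<longrightarrow> (\<exists>x\<in>V. f x \<noteq> 0))"

definition is_transition ::
    "('a, 'n::finite) cmanifold \<Rightarrow> ('a, 'i) divisor \<Rightarrow> 'i \<Rightarrow> 'i \<Rightarrow> ('a \<Rightarrow> complex) \<Rightarrow> bool" where
  "is_transition X D i j u \<longleftrightarrow> holomorphic_fun X (opn D i \<inter> opn D j) u \<and>
     (\<forall>x\<in>opn D i \<inter> opn D j. u x \<noteq> 0 \<and>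
        numer D i x * denom D j x = u x * (numer D j x * denom D i x))"

definition is_divisor :: "('a, 'n::finite) cmanifold \<Rightarrow> ('a, 'i) divisor \<Rightarrow> bool" where
  "is_divisor X D \<longleftrightarrow> \<Union>(opn D ` idx D) = points X \<and>
     (\<forall>i\<in>idx D. openin (topol X) (opn D i) \<and>
        holomorphic_fun X (opn D i) (numer D i) \<and> holomorphic_fun X (opn D i) (denom D i) \<and>
        nowhere_locally_zero (topol X) (opn D i) (numer D i) \<and>
        nowhere_locally_zero (topol X) (opn D i) (denom D i)) \<and>
     (\<forall>i\<in>idx D. \<forall>j\<in>idx D. \<exists>u. is_transition X D i j u)"

definition effective :: "('a, 'n::finite) cmanifold \<Rightarrow> ('a, 'i) divisor \<Rightarrow> bool" where
  "effective X D \<longleftrightarrow> (\<forall>i\<in>idx D. \<exists>g. holomorphic_fun X (opn D i) g \<and>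
     (\<forall>x\<in>opn D i. numer D i x = g x * denom D i x))"

text \<open>
  The cocycle of the line bundle \<open>\<O>(D)\<close>; the function is uniquely determined on
  \<open>opn D i \<inter> opn D j\<close>.  On \<open>opn D i\<close> a section of \<open>\<O>(D)\<close> is a function \<open>s i\<close>, the
  corresponding meromorphic function on the manifold being \<open>s i * denom D i / numer D i\<close>.
\<close>

definition transition ::
    "('a, 'n::finite) cmanifold \<Rightarrow> ('a, 'i) divisor \<Rightarrow> 'i \<Rightarrow> 'i \<Rightarrow> 'a \<Rightarrow> complex" where
  "transition X D i j = (SOME u. is_transition X D i j u)"

definition H0 :: "('a, 'n::finite) cmanifold \<Rightarrow> ('a, 'i) divisor \<Rightarrow> ('i \<Rightarrow> 'a \<Rightarrow> complex) set" where
  "H0 X D = {s. (\<forall>i\<in>idx D. holomorphic_fun X (opn D i) (s i)) \<and>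
     (\<forall>i\<in>idx D. \<forall>j\<in>idx D. \<forall>x\<in>opn D i \<inter> opn D j. s i x = transition X D i j x * s j x)}"

definition nonzero_section :: "('a, 'i) divisor \<Rightarrow> ('i \<Rightarrow> 'a \<Rightarrow> complex) \<Rightarrow> bool" where
  "nonzero_section D s \<longleftrightarrow> (\<exists>i\<in>idx D. \<exists>x\<in>opn D i. s i x \<noteq> 0)"

text \<open>A local trivialization of \<open>\<O>(D)\<close> near \<open>x\<close>, given by a nowhere vanishing section \<open>e\<close>.\<close>

definition local_frame ::
    "('a, 'n::finite) cmanifold \<Rightarrow> ('a, 'i) divisor \<Rightarrow> 'a \<Rightarrow> ('i \<Rightarrow> 'a \<Rightarrow> complex) \<Rightarrow> bool" where
  "local_frame X D x e \<longleftrightarrow> (\<exists>W. openin (topol X) W \<and> x \<in> W \<and>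
     (\<forall>i\<in>idx D. holomorphic_fun X (W \<inter> opn D i) (e i) \<and> (\<forall>y\<in>W \<inter> opn D i. e i y \<noteq> 0)) \<and>
     (\<forall>i\<in>idx D. \<forall>j\<in>idx D. \<forall>y\<in>W \<inter> opn D i \<inter> opn D j. e i y = transition X D i j y * e j y))"

text \<open>
  A continuous metric \<open>\<psi>\<close>: the squared length of a section \<open>s\<close> is
  \<open>(norm (s i x))\<^sup>2 * exp (- \<psi> i x)\<close> on \<open>opn D i\<close>.
\<close>

definition continuous_metric ::
    "('a, 'n::finite) cmanifold \<Rightarrow> ('a, 'i) divisor \<Rightarrow> ('i \<Rightarrow> 'a \<Rightarrow> real) \<Rightarrow> bool" where
  "continuous_metric X D \<psi> \<longleftrightarrow>
     (\<forall>i\<in>idx D. continuous_map (subtopology (topol X) (opn D i)) euclideanreal (\<psi> i)) \<and>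
     (\<forall>i\<in>idx D. \<forall>j\<in>idx D. \<forall>x\<in>opn D i \<inter> opn D j.
        (norm (transition X D i j x))\<^sup>2 * exp (- \<psi> i x) = exp (- \<psi> j x))"

definition sup_norm2 ::
    "('a, 'i) divisor \<Rightarrow> ('i \<Rightarrow> 'a \<Rightarrow> real) \<Rightarrow> ('i \<Rightarrow> 'a \<Rightarrow> complex) \<Rightarrow> real" where
  "sup_norm2 D \<psi> s = Sup {(norm (s i x))\<^sup>2 * exp (- \<psi> i x) | i x. i \<in> idx D \<and> x \<in> opn D i}"

text \<open>
  Linear combinations \<open>\<Sum>j. a j * D j\<close>, on the common refinement of the given covers, and the
  frames and metrics they inherit by multiplicativity.
\<close>

definition comb_divisor ::
    "('r::finite \<Rightarrow> ('a, 'i) divisor) \<Rightarrow> ('r \<Rightarrow> int) \<Rightarrow> ('a, 'r \<Rightarrow> 'i) divisor" where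
  "comb_divisor D a = \<lparr>
     idx = {t. \<forall>j. t j \<in> idx (D j)},
     opn = (\<lambda>t. \<Inter>j. opn (D j) (t j)),
     numer = (\<lambda>t x. \<Prod>j\<in>UNIV. numer (D j) (t j) x ^ nat (a j) * denom (D j) (t j) x ^ nat (- a j)),
     denom = (\<lambda>t x. \<Prod>j\<in>UNIV. denom (D j) (t j) x ^ nat (a j) * numer (D j) (t j) x ^ nat (- a j))\<rparr>"

definition comb_frame ::
    "('r::finite \<Rightarrow> 'i \<Rightarrow> 'a \<Rightarrow> complex) \<Rightarrow> ('r \<Rightarrow> int) \<Rightarrow> ('r \<Rightarrow> 'i) \<Rightarrow> 'a \<Rightarrow> complex" where
  "comb_frame e a t x = (\<Prod>j\<in>UNIV. e j (t j) x powi a j)"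

definition comb_metric ::
    "('r::finite \<Rightarrow> 'i \<Rightarrow> 'a \<Rightarrow> real) \<Rightarrow> ('r \<Rightarrow> real) \<Rightarrow> ('r \<Rightarrow> 'i) \<Rightarrow> 'a \<Rightarrow> real" where
  "comb_metric \<psi> a t x = (\<Sum>j\<in>UNIV. a j * \<psi> j (t j) x)"

definition mult_divisor :: "nat \<Rightarrow> ('a, 'i) divisor \<Rightarrow> ('a, 'i) divisor" where
  "mult_divisor k D =
     D\<lparr>numer := (\<lambda>i x. numer D i x ^ k), denom := (\<lambda>i x. denom D i x ^ k)\<rparr>"


section \<open>Numerical equivalence\<close>

text \<open>
  Irreducible curves in \<open>X\<close> are given by their normalizations: holomorphic maps from a compact
  connected Riemann surface that are injective outside a finite set.  Since such a surface has
  the cardinality of the continuum, its points may be taken in the type of complex numbers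
  (with an arbitrary topology).
\<close>

definition curve_in ::
    "('a, 'n::finite) cmanifold \<Rightarrow> (complex, 1) cmanifold \<Rightarrow> (complex \<Rightarrow> 'a) \<Rightarrow> bool" where
  "curve_in X C f \<longleftrightarrow> complex_manifold C \<and>
     compact_space (topol C) \<and> connected_space (topol C) \<and> points C \<noteq> {} \<and>
     holomorphic_map C X f \<and> (\<exists>A. finite A \<and> inj_on f (points C - A))"

text \<open>Meromorphic sections \<open>\<sigma> \<noteq> 0\<close> of the pullback of \<open>\<O>(D)\<close> by \<open>f\<close>.\<close>

definition pullback_meromorphic_section ::
    "('a, 'n::finite) cmanifold \<Rightarrow> ('a, 'i) divisor \<Rightarrow> (complex, 1) cmanifold \<Rightarrow> (complex \<Rightarrow> 'a) \<Rightarrow>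
     ('i \<Rightarrow> complex \<Rightarrow> complex) \<Rightarrow> bool" where
  "pullback_meromorphic_section X D C f \<sigma> \<longleftrightarrow>
     (let P = (\<lambda>i. {y\<in>points C. f y \<in> opn D i}) in
       (\<forall>i\<in>idx D. \<forall>\<kappa>\<in>atlas C.
          (\<lambda>w. \<sigma> i (chart_inv \<kappa> (vec w))) meromorphic_on {w. vec w \<in> snd \<kappa> ` (fst \<kappa> \<inter> P i)}) \<and>
       (\<forall>i\<in>idx D. nowhere_locally_zero (topol C) (P i) (\<sigma> i)) \<and>
       (\<forall>i\<in>idx D. \<forall>j\<in>idx D. \<forall>y\<in>P i \<inter> P j. \<sigma> i y = transition X D i j (f y) * \<sigma> j y))"

text \<open>
  The intersection number is the degree of the pullback of \<open>\<O>(D)\<close> to the normalization, i.e.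
  the degree of the divisor of any meromorphic section; \<open>ord y\<close> is the order at \<open>y\<close>.
\<close>

definition intersection_number ::
    "('a, 'n::finite) cmanifold \<Rightarrow> ('a, 'i) divisor \<Rightarrow> (complex, 1) cmanifold \<Rightarrow> (complex \<Rightarrow> 'a) \<Rightarrow> int"
  where
  "intersection_number X D C f =
     (THE d. \<exists>\<sigma> ord. pullback_meromorphic_section X D C f \<sigma> \<and>
        (\<forall>i\<in>idx D. \<forall>\<kappa>\<in>atlas C. \<forall>y\<in>fst \<kappa>. f y \<in> opn D i \<longrightarrow>
           ord y = zorder (\<lambda>w. \<sigma> i (chart_inv \<kappa> (vec w))) (snd \<kappa> y $ 1)) \<and>
        d = (\<Sum>y\<in>{y\<in>points C. ord y \<noteq> 0}. ord y))"

definition num_equiv ::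
    "('a, 'n::finite) cmanifold \<Rightarrow> ('a, 'i) divisor \<Rightarrow> ('a, 'j) divisor \<Rightarrow> bool" where
  "num_equiv X D E \<longleftrightarrow>
     (\<forall>C f. curve_in X C f \<longrightarrow> intersection_number X D C f = intersection_number X E C f)"

text \<open>Countable index sets suffice to describe all divisors, as manifolds are second countable.\<close>

definition numerical_basis ::
    "('a, 'n::finite) cmanifold \<Rightarrow> ('r::finite \<Rightarrow> ('a, nat) divisor) \<Rightarrow> bool" where
  "numerical_basis X D \<longleftrightarrow> (\<forall>j. is_divisor X (D j)) \<and>
     (\<forall>E :: ('a, nat) divisor. is_divisor X E \<longrightarrow>
        (\<exists>!a. num_equiv X E (comb_divisor D a)) \<and>
        (\<forall>a. effective X E \<and> num_equiv X E (comb_divisor D a) \<longrightarrow> (\<forall>j. 0 \<le> a j)))"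


section \<open>Leading exponents\<close>

definition lex_less :: "(nat, 'n::{finite, linorder}) vec \<Rightarrow> (nat, 'n) vec \<Rightarrow> bool" where
  "lex_less \<alpha> \<beta> \<longleftrightarrow> (\<exists>i. \<alpha> $ i < \<beta> $ i \<and> (\<forall>j<i. \<alpha> $ j = \<beta> $ j))"

definition power_series_at_0 :: "(complex^'n::finite \<Rightarrow> complex) \<Rightarrow> (nat^'n \<Rightarrow> complex) \<Rightarrow> bool" where
  "power_series_at_0 f b \<longleftrightarrow>
     (\<exists>\<epsilon>>0. \<forall>z\<in>ball 0 \<epsilon>. ((\<lambda>\<alpha>. b \<alpha> * (\<Prod>i\<in>UNIV. (z $ i) ^ (\<alpha> $ i))) has_sum f z) UNIV)"

text \<open>
  Coefficients of a section in the coordinates \<open>\<kappa>\<close> and the frame \<open>e\<close>; the point at which the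
  coordinates are centered is \<open>chart_inv \<kappa> 0\<close>.
\<close>

definition coeffs ::
    "('a, 'n::finite) chart \<Rightarrow> ('a, 'i) divisor \<Rightarrow> ('i \<Rightarrow> 'a \<Rightarrow> complex) \<Rightarrow> ('i \<Rightarrow> 'a \<Rightarrow> complex) \<Rightarrow>
     nat^'n \<Rightarrow> complex" where
  "coeffs \<kappa> D e s = (THE b. \<forall>i\<in>idx D. chart_inv \<kappa> 0 \<in> opn D i \<longrightarrow>
     power_series_at_0 (\<lambda>w. s i (chart_inv \<kappa> w) / e i (chart_inv \<kappa> w)) b)"

definition lead_exp ::
    "('a, 'n::{finite, linorder}) chart \<Rightarrow> ('a, 'i) divisor \<Rightarrow> ('i \<Rightarrow> 'a \<Rightarrow> complex) \<Rightarrow>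
     ('i \<Rightarrow> 'a \<Rightarrow> complex) \<Rightarrow> (nat, 'n) vec" where
  "lead_exp \<kappa> D e s = (THE \<alpha>. coeffs \<kappa> D e s \<alpha> \<noteq> 0 \<and>
     (\<forall>\<beta>. coeffs \<kappa> D e s \<beta> \<noteq> 0 \<longrightarrow> \<beta> = \<alpha> \<or> lex_less \<alpha> \<beta>))"

definition lead_exps ::
    "('a, 'n::{finite, linorder}) cmanifold \<Rightarrow> ('a, 'n) chart \<Rightarrow> ('a, 'i) divisor \<Rightarrow>
     ('i \<Rightarrow> 'a \<Rightarrow> complex) \<Rightarrow> ((nat, 'n) vec) set" where
  "lead_exps X \<kappa> D e = lead_exp \<kappa> D e ` {s \<in> H0 X D. nonzero_section D s}"

text \<open>Sections of the form \<open>z\<^sup>\<alpha>\<close> + higher order terms.\<close>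

definition monic_sections ::
    "('a, 'n::{finite, linorder}) cmanifold \<Rightarrow> ('a, 'n) chart \<Rightarrow> ('a, 'i) divisor \<Rightarrow>
     ('i \<Rightarrow> 'a \<Rightarrow> complex) \<Rightarrow> (nat, 'n) vec \<Rightarrow> ('i \<Rightarrow> 'a \<Rightarrow> complex) set" where
  "monic_sections X \<kappa> D e \<alpha> = {s \<in> H0 X D. coeffs \<kappa> D e s \<alpha> = 1 \<and>
     (\<forall>\<beta>. coeffs \<kappa> D e s \<beta> \<noteq> 0 \<longrightarrow> \<beta> = \<alpha> \<or> lex_less \<alpha> \<beta>)}"

definition min_log_norm ::
    "('a, 'n::{finite, linorder}) cmanifold \<Rightarrow> ('a, 'n) chart \<Rightarrow> ('a, 'i) divisor \<Rightarrow>
     ('i \<Rightarrow> 'a \<Rightarrow> complex) \<Rightarrow> ('i \<Rightarrow> 'a \<Rightarrow> real) \<Rightarrow> (nat, 'n) vec \<Rightarrow> real" where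
  "min_log_norm X \<kappa> D e \<psi> \<alpha> = (INF s\<in>monic_sections X \<kappa> D e \<alpha>. ln (sup_norm2 D \<psi> s))"

definition real_vec :: "nat^'n::finite \<Rightarrow> real^'n" where
  "real_vec \<alpha> = (\<chi> i. real (\<alpha> $ i))"


section \<open>The Chebyshev transform of a metrized line bundle or rational divisor\<close>

text \<open>
  With \<open>L = \<O>(D)\<close>, the points \<open>\<alpha>(k)\<close> of \<open>\<Delta>\<^sub>k(L)\<close> are \<open>real_vec (m k) /\<^sub>R real k\<close>, where \<open>m k\<close> is a
  leading exponent of \<open>kL\<close>; these exist for large \<open>k\<close> only.  The value is meaningful for \<open>L\<close>
  big and \<open>p\<close> in the interior of its Okounkov body.
\<close>

definition chebyshev ::
    "('a, 'n::{finite, linorder}) cmanifold \<Rightarrow> ('a, 'n) chart \<Rightarrow> ('a, 'i) divisor \<Rightarrow>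
     ('i \<Rightarrow> 'a \<Rightarrow> complex) \<Rightarrow> ('i \<Rightarrow> 'a \<Rightarrow> real) \<Rightarrow> (real, 'n) vec \<Rightarrow> real" where
  "chebyshev X \<kappa> D e \<psi> p = (THE c. \<forall>m.
     (\<forall>\<^sub>F k in sequentially. m k \<in> lead_exps X \<kappa> (mult_divisor k D) (\<lambda>i x. e i x ^ k)) \<longrightarrow>
     (\<lambda>k. real_vec (m k) /\<^sub>R real k) \<longlonglongrightarrow> p \<longrightarrow>
     (\<lambda>k. min_log_norm X \<kappa> (mult_divisor k D) (\<lambda>i x. e i x ^ k) (\<lambda>i x. real k * \<psi> i x) (m k)
          / real k) \<longlonglongrightarrow> c)"

text \<open>
  The transform of the rational divisor \<open>\<Sum>j. a j * D j\<close> with its metric \<open>\<Sum>j. a j * \<psi> j\<close>,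
  computed with a positive integer \<open>q\<close> such that all \<open>q * a j\<close> are integers.
\<close>

definition rational_chebyshev ::
    "('a, 'n::{finite, linorder}) cmanifold \<Rightarrow> ('a, 'n) chart \<Rightarrow>
     ('r::finite \<Rightarrow> ('a, 'i) divisor) \<Rightarrow> ('r \<Rightarrow> 'i \<Rightarrow> 'a \<Rightarrow> complex) \<Rightarrow>
     ('r \<Rightarrow> 'i \<Rightarrow> 'a \<Rightarrow> real) \<Rightarrow> rat^'r \<Rightarrow> nat \<Rightarrow> (real, 'n) vec \<Rightarrow> real" where
  "rational_chebyshev X \<kappa> D e \<psi> a q p =
     (let qa = (\<lambda>j. \<lfloor>of_nat q * a $ j\<rfloor>) in
      chebyshev X \<kappa> (comb_divisor D qa) (comb_frame e qa)
        (\<lambda>t x. real q * comb_metric \<psi> (\<lambda>j. of_rat (a $ j)) t x) (real q *\<^sub>R p) / real q)"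


section \<open>The global Chebyshev transform\<close>

definition global_semigroup ::
    "('a, 'n::{finite, linorder}) cmanifold \<Rightarrow> ('a, 'n) chart \<Rightarrow>
     ('r::finite \<Rightarrow> ('a, 'i) divisor) \<Rightarrow> ('r \<Rightarrow> 'i \<Rightarrow> 'a \<Rightarrow> complex) \<Rightarrow> ((nat, 'n) vec \<times> (nat^'r)) set" where
  "global_semigroup X \<kappa> D e = {(\<alpha>, a).
     \<alpha> \<in> lead_exps X \<kappa> (comb_divisor D (\<lambda>j. int (a $ j))) (comb_frame e (\<lambda>j. int (a $ j)))}"

definition global_cone ::
    "('a, 'n::{finite, linorder}) cmanifold \<Rightarrow> ('a, 'n) chart \<Rightarrow>
     ('r::finite \<Rightarrow> ('a, 'i) divisor) \<Rightarrow> ('r \<Rightarrow> 'i \<Rightarrow> 'a \<Rightarrow> complex) \<Rightarrow> ((real, 'n) vec \<times> (real^'r)) set" where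
  "global_cone X \<kappa> D e = (\<lambda>S. convex_cone S \<and> closed S) hull
     (map_prod real_vec real_vec ` global_semigroup X \<kappa> D e)"

definition global_F ::
    "('a, 'n::{finite, linorder}) cmanifold \<Rightarrow> ('a, 'n) chart \<Rightarrow>
     ('r::finite \<Rightarrow> ('a, 'i) divisor) \<Rightarrow> ('r \<Rightarrow> 'i \<Rightarrow> 'a \<Rightarrow> complex) \<Rightarrow>
     ('r \<Rightarrow> 'i \<Rightarrow> 'a \<Rightarrow> real) \<Rightarrow> (nat, 'n) vec \<Rightarrow> nat^'r \<Rightarrow> real" where
  "global_F X \<kappa> D e \<psi> \<alpha> a =
     min_log_norm X \<kappa> (comb_divisor D (\<lambda>j. int (a $ j))) (comb_frame e (\<lambda>j. int (a $ j)))
       (comb_metric \<psi> (\<lambda>j. real (a $ j))) \<alpha>"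

definition global_chebyshev ::
    "('a, 'n::{finite, linorder}) cmanifold \<Rightarrow> ('a, 'n) chart \<Rightarrow>
     ('r::finite \<Rightarrow> ('a, 'i) divisor) \<Rightarrow> ('r \<Rightarrow> 'i \<Rightarrow> 'a \<Rightarrow> complex) \<Rightarrow>
     ('r \<Rightarrow> 'i \<Rightarrow> 'a \<Rightarrow> real) \<Rightarrow> (real, 'n) vec \<times> (real^'r) \<Rightarrow> real" where
  "global_chebyshev X \<kappa> D e \<psi> y = Sup {l y | l :: (real, 'n) vec \<times> (real^'r) \<Rightarrow> real. linear l \<and>
     (\<forall>(\<alpha>, a)\<in>global_semigroup X \<kappa> D e.
        (real_vec \<alpha>, real_vec a) \<in> interior (global_cone X \<kappa> D e) \<longrightarrow>
        l (real_vec \<alpha>, real_vec a) \<le> global_F X \<kappa> D e \<psi> \<alpha> a)}"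

end

theory Submission
  imports Defs
begin

text \<open>Both transforms are values of one limit.  Write \<open>\<Gamma>\<close> for the global semigroup.  The product of two sections
  of the forms \<open>z\<^sup>\<alpha> + \<dots>\<close> and \<open>z\<^sup>\<beta> + \<dots>\<close> is \<open>z\<^sup>\<alpha>\<^sup>+\<^sup>\<beta> + \<dots>\<close>, and sup norms are submultiplicative, so the
  function \<open>F\<close> of minimal logarithmic norms is subadditive on \<open>\<Gamma>\<close>; by Cauchy's estimates at the
  center of the coordinates it is bounded below by a linear function.  For a subadditive function
  on a discrete semigroup, \<open>F (x k) / t k\<close> converges to the convex envelope of \<open>F\<close> at \<open>y\<close> whenever
  \<open>x k \<in> \<Gamma>\<close>, \<open>t k \<rightarrow> \<infinity>\<close> and \<open>x k / t k \<rightarrow> y\<close>, for \<open>y\<close> in the interior of the cone (\<open>envelope_limit\<close>).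

  Put \<open>l = q a\<close>, which is integral, and nonnegative because \<open>(p, a)\<close> lies in the cone.  The
  Chebyshev transform of \<open>\<Sum>j. l j * D j\<close> at \<open>q p\<close> is a limit along sequences \<open>(m k, k l)\<close> in \<open>\<Gamma>\<close> with
  \<open>m k / k \<rightarrow> q p\<close>.  With \<open>t k = k\<close> the limit is the envelope at \<open>(q p, l)\<close>, with \<open>t k = q k\<close> it is the
  envelope at \<open>(p, a)\<close>, so the two differ by the factor \<open>q\<close> that is divided out in the
  definition of the transform of a rational divisor.

  It remains to see that such sequences exist, since otherwise no value would be singled out
  (\<open>exponent_sequence\<close>).  Near an interior direction \<open>\<Gamma>\<close> contains all elements of the group it
  generates, so one needs an element of this group of the form \<open>(\<eta>, l)\<close>.  That \<open>(q p, l)\<close> is interior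
  yields only multiples: sections of \<open>M l\<close> with leading exponents \<open>\<alpha>0\<close> and \<open>\<alpha>0 + m e\<^sub>i\<close>, for some \<open>M\<close> and
  \<open>m > 0\<close>.  To get from \<open>M l\<close> to \<open>K M l + l\<close>, let \<open>\<sigma>\<close> be the tautological meromorphic section
  \<open>numer / denom\<close> of \<open>l\<close>.  The monomials of a given degree in these sections have distinct leading exponents, so
  they are linearly independent; multiplied with powers of \<open>\<sigma>\<^sup>M\<close> they form a family that grows faster
  than the number of conditions for vanishing to high order at a fixed finite set of points, and a
  Schwarz lemma (\<open>Schwarz_vanishing\<close>) turns high order vanishing into vanishing, as in Siegel's proof that
  \<open>n + 1\<close> meromorphic functions are algebraically dependent.  Hence
  \<open>\<Sum>j\<le>J. P j * \<sigma>\<^sup>M\<^sup>j = 0\<close> with sections \<open>P j\<close> and \<open>P J \<noteq> 0\<close>.  Then \<open>P J * \<sigma>\<^sup>M\<close> is integral over holomorphic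
  functions and locally bounded, therefore \<open>P J * \<sigma>\<close> is locally bounded too, and it is a
  holomorphic section by Riemann's extension theorem (\<open>section_of_multiple_succ\<close>).\<close>

section \<open>Subadditive functions on discrete semigroups\<close>

lemma convex_cone_hull_finite_sum:
  assumes "x \<in> convex_cone hull G"
  shows "\<exists>\<Phi> c. finite \<Phi> \<and> \<Phi> \<subseteq> G \<and> (\<forall>\<phi>\<in>\<Phi>. 0 \<le> c \<phi>) \<and> x = (\<Sum>\<phi>\<in>\<Phi>. c \<phi> *\<^sub>R \<phi>)"
proof -
  define T where "T = {x. \<exists>\<Phi> c. finite \<Phi> \<and> \<Phi> \<subseteq> G \<and> (\<forall>\<phi>\<in>\<Phi>. (0::real) \<le> c \<phi>) \<and> x = (\<Sum>\<phi>\<in>\<Phi>. c \<phi> *\<^sub>R \<phi>)}"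
  have "convex_cone T"
    unfolding convex_cone_iff
  proof (intro conjI ballI allI impI)
    show "0 \<in> T"
      unfolding T_def by (auto intro!: exI[of _ "{}"])
  next
    fix x y assume "x \<in> T" "y \<in> T"
    then obtain \<Phi> c \<Psi> d where *: "finite \<Phi>" "\<Phi> \<subseteq> G" "\<forall>\<phi>\<in>\<Phi>. 0 \<le> c \<phi>" "x = (\<Sum>\<phi>\<in>\<Phi>. c \<phi> *\<^sub>R \<phi>)"
      "finite \<Psi>" "\<Psi> \<subseteq> G" "\<forall>\<phi>\<in>\<Psi>. 0 \<le> d \<phi>" "y = (\<Sum>\<phi>\<in>\<Psi>. d \<phi> *\<^sub>R \<phi>)"
      unfolding T_def by blast
    define e where "e \<phi> = (if \<phi> \<in> \<Phi> then c \<phi> else 0) + (if \<phi> \<in> \<Psi> then d \<phi> else 0)" for \<phi>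
    have "x = (\<Sum>\<phi>\<in>\<Phi> \<union> \<Psi>. (if \<phi> \<in> \<Phi> then c \<phi> else 0) *\<^sub>R \<phi>)"
      using * by (auto intro!: sum.mono_neutral_cong_left)
    moreover have "y = (\<Sum>\<phi>\<in>\<Phi> \<union> \<Psi>. (if \<phi> \<in> \<Psi> then d \<phi> else 0) *\<^sub>R \<phi>)"
      using * by (auto intro!: sum.mono_neutral_cong_left)
    ultimately have "x + y = (\<Sum>\<phi>\<in>\<Phi> \<union> \<Psi>. e \<phi> *\<^sub>R \<phi>)"
      by (simp add: e_def scaleR_left_distrib sum.distrib)
    moreover have "\<forall>\<phi>\<in>\<Phi> \<union> \<Psi>. 0 \<le> e \<phi>" using * by (auto simp: e_def)
    ultimately show "x + y \<in> T"
      unfolding T_def using * by (intro CollectI exI[of _ "\<Phi> \<union> \<Psi>"] exI[of _ e]) auto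
  next
    fix x and t :: real assume "x \<in> T" "0 \<le> t"
    then obtain \<Phi> c where *: "finite \<Phi>" "\<Phi> \<subseteq> G" "\<forall>\<phi>\<in>\<Phi>. 0 \<le> c \<phi>" "x = (\<Sum>\<phi>\<in>\<Phi>. c \<phi> *\<^sub>R \<phi>)"
      unfolding T_def by blast
    then have "t *\<^sub>R x = (\<Sum>\<phi>\<in>\<Phi>. (t * c \<phi>) *\<^sub>R \<phi>)" by (simp add: scaleR_sum_right)
    then show "t *\<^sub>R x \<in> T"
      unfolding T_def using * \<open>0 \<le> t\<close> by (intro CollectI exI[of _ \<Phi>] exI[of _ "\<lambda>\<phi>. t * c \<phi>"]) auto
  qed
  moreover have "G \<subseteq> T"
  proof
    fix g assume "g \<in> G"
    then show "g \<in> T" unfolding T_def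
      by (intro CollectI exI[of _ "{g}"] exI[of _ "\<lambda>_. 1"]) auto
  qed
  ultimately have "convex_cone hull G \<subseteq> T" by (rule hull_minimal[rotated])
  then show ?thesis using assms unfolding T_def by blast
qed

text \<open>A convex set and its closure have the same interior, so interior points of the closed cone
  are finite nonnegative combinations of generators.\<close>

lemma interior_closed_cone_hull:
  fixes G :: "'v::euclidean_space set"
  shows "interior ((\<lambda>S. convex_cone S \<and> closed S) hull G) \<subseteq> interior (convex_cone hull G)"
proof -
  let ?C = "convex_cone hull G"
  have cc: "convex_cone ?C" by (rule convex_cone_convex_cone_hull)
  have "convex_cone (closure ?C)"
  proof (rule iffD2[OF convex_cone_iff], intro conjI ballI allI impI)
    show "0 \<in> closure ?C" using convex_cone_hull_contains_0 closure_subset by blast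
  next
    fix x y assume "x \<in> closure ?C" "y \<in> closure ?C"
    then obtain f g where "\<forall>n. f n \<in> ?C" "f \<longlonglongrightarrow> x" "\<forall>n. g n \<in> ?C" "g \<longlonglongrightarrow> y"
      unfolding closure_sequential by blast
    then show "x + y \<in> closure ?C"
      unfolding closure_sequential
      by (intro exI[of _ "\<lambda>n. f n + g n"]) (auto intro: tendsto_add convex_cone_hull_add)
  next
    fix x and c :: real assume "x \<in> closure ?C" "0 \<le> c"
    then obtain f where "\<forall>n. f n \<in> ?C" "f \<longlonglongrightarrow> x"
      unfolding closure_sequential by blast
    then show "c *\<^sub>R x \<in> closure ?C"
      unfolding closure_sequential using \<open>0 \<le> c\<close>
      by (intro exI[of _ "\<lambda>n. c *\<^sub>R f n"]) (auto intro: tendsto_scaleR convex_cone_hull_mul)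
  qed
  then have "(\<lambda>S. convex_cone S \<and> closed S) hull G \<subseteq> closure ?C"
    using order_trans[OF hull_subset closure_subset, of G convex_cone] by (intro hull_minimal) auto
  then have "interior ((\<lambda>S. convex_cone S \<and> closed S) hull G) \<subseteq> interior (closure ?C)"
    by (rule interior_mono)
  also have "\<dots> = interior ?C"
    using cc by (intro convex_interior_closure) (simp add: convex_cone_def)
  finally show ?thesis .
qed

text \<open>The functional \<open>s\<close> plays the role of a degree: it bounds the number of generators in a sum.
  Discreteness is required of the generated group, in a form that speaks of the semigroup only.\<close>

locale discrete_semigroup =
  fixes G :: "'v::euclidean_space set" and s :: "'v \<Rightarrow> real"
  assumes zero_mem: "0 \<in> G"
    and add_mem: "x \<in> G \<Longrightarrow> y \<in> G \<Longrightarrow> x + y \<in> G"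
    and linear_s: "linear s"
    and s_ge_1: "x \<in> G \<Longrightarrow> x \<noteq> 0 \<Longrightarrow> 1 \<le> s x"
    and discrete: "finite {x - y | x y. x \<in> G \<and> y \<in> G \<and> norm (x - y) \<le> R}"
begin

definition cone where "cone = (\<lambda>S. convex_cone S \<and> closed S) hull G"

definition grp where "grp = {x - y | x y. x \<in> G \<and> y \<in> G}"

lemma G_subset_cone: "G \<subseteq> cone"
  unfolding cone_def by (rule hull_subset)

lemma convex_cone_cone: "convex_cone cone"
proof -
  have "convex_cone (\<Inter>F) \<and> closed (\<Inter>F)" if "\<And>S. S \<in> F \<Longrightarrow> convex_cone S \<and> closed S" for F :: "'v set set"
    using that by (auto intro: convex_cone_Inter closed_Inter)
  then show ?thesis unfolding cone_def
    using hull_in[of "\<lambda>S. convex_cone S \<and> closed S" G] by blast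
qed

lemma grp_add: "x \<in> grp \<Longrightarrow> y \<in> grp \<Longrightarrow> x + y \<in> grp"
  unfolding grp_def using add_mem by (smt (verit) add_diff_add mem_Collect_eq)

lemma G_subset_grp: "G \<subseteq> grp"
  unfolding grp_def using zero_mem by force

lemma grp_uminus: "x \<in> grp \<Longrightarrow> - x \<in> grp"
  unfolding grp_def by (smt (verit) mem_Collect_eq minus_diff_eq)

lemma grp_diff: "x \<in> grp \<Longrightarrow> y \<in> grp \<Longrightarrow> x - y \<in> grp"
  using grp_add[of x "- y"] grp_uminus[of y] by simp

lemma sum_mem:
  assumes "finite I" "\<And>i. i \<in> I \<Longrightarrow> f i \<in> G"
  shows "(\<Sum>i\<in>I. f i) \<in> G"
  using assms by (induction I rule: finite_induct) (auto simp: zero_mem add_mem)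

lemma scale_mem: "g \<in> G \<Longrightarrow> real n *\<^sub>R g \<in> G"
  by (induction n) (auto simp: zero_mem add_mem scaleR_left_distrib)

lemma subadditive_sum:
  assumes F: "\<And>x y. x \<in> G \<Longrightarrow> y \<in> G \<Longrightarrow> F (x + y) \<le> F x + F y"
    and "finite I" "\<And>i. i \<in> I \<Longrightarrow> f i \<in> G" "g \<in> G"
  shows "F ((\<Sum>i\<in>I. real (n i) *\<^sub>R f i) + g) \<le> (\<Sum>i\<in>I. real (n i) * F (f i)) + (F g :: real)"
  using assms(2,3)
proof (induction I rule: finite_induct)
  case empty then show ?case by simp
next
  case (insert i I)
  let ?r = "(\<Sum>i\<in>I. real (n i) *\<^sub>R f i) + g"
  have r: "?r \<in> G" using insert assms(4) by (intro add_mem sum_mem scale_mem) auto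
  have *: "F (real m *\<^sub>R f i + ?r) \<le> real m * F (f i) + F ?r" for m
  proof (induction m)
    case (Suc m)
    have "F (f i + (real m *\<^sub>R f i + ?r)) \<le> F (f i) + F (real m *\<^sub>R f i + ?r)"
      using insert.prems by (intro F add_mem[OF scale_mem r]) auto
    then show ?case using Suc by (simp add: algebra_simps)
  qed simp
  have IH: "F ?r \<le> (\<Sum>i\<in>I. real (n i) * F (f i)) + F g"
    using insert.prems by (intro insert.IH) auto
  show ?case using *[of "n i"] IH insert.hyps by (simp add: add.assoc)
qed

text \<open>A small cube around \<open>y\<close> is the convex hull of its finitely many vertices, each of which needs
  only finitely many elements of \<open>G\<close>.\<close>

lemma finitely_generated_near_interior:
  assumes "y \<in> interior cone"
  obtains \<Phi> r where "finite \<Phi>" "\<Phi> \<subseteq> G" "0 < r"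
    "\<forall>x. norm (x - y) < r \<longrightarrow> (\<exists>c. (\<forall>\<phi>\<in>\<Phi>. (0::real) \<le> c \<phi>) \<and> x = (\<Sum>\<phi>\<in>\<Phi>. c \<phi> *\<^sub>R \<phi>))"
proof -
  have "y \<in> interior (convex_cone hull G)"
    using assms interior_closed_cone_hull unfolding cone_def by blast
  then obtain e where e: "e > 0" "cball y e \<subseteq> convex_cone hull G"
    by (auto simp: mem_interior_cball)
  define d where "d = e / real DIM('v)"
  have d: "d > 0" using e by (simp add: d_def)
  obtain S :: "'v set" where S: "finite S"
    "cbox (y - (\<Sum>i\<in>Basis. d*\<^sub>Ri)) (y + (\<Sum>i\<in>Basis. d*\<^sub>Ri)) = convex hull S"
    using cube_convex_hull[OF d] by metis
  let ?B = "cbox (y - (\<Sum>i\<in>Basis. d*\<^sub>Ri)) (y + (\<Sum>i\<in>Basis. d*\<^sub>Ri))"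
  have B: "x \<in> ?B \<longleftrightarrow> (\<forall>i\<in>Basis. \<bar>(x - y) \<bullet> i\<bar> \<le> d)" for x
    by (auto simp: mem_box inner_simps inner_sum_left inner_Basis if_distrib cong: if_cong)
  have "S \<subseteq> convex_cone hull G"
  proof
    fix x assume "x \<in> S"
    then have "x \<in> convex hull S" by (rule hull_inc)
    then have "x \<in> ?B" unfolding S(2) .
    then have "norm (x - y) \<le> (\<Sum>i\<in>(Basis::'v set). d)"
      unfolding B by (intro order_trans[OF norm_le_l1] sum_mono) auto
    also have "\<dots> = e" by (simp add: d_def)
    finally show "x \<in> convex_cone hull G" using e by (auto simp: dist_norm norm_minus_commute)
  qed
  then have "\<forall>x\<in>S. \<exists>\<Phi> c. finite \<Phi> \<and> \<Phi> \<subseteq> G \<and> (\<forall>\<phi>\<in>\<Phi>. (0::real) \<le> c \<phi>) \<and> x = (\<Sum>\<phi>\<in>\<Phi>. c \<phi> *\<^sub>R \<phi>)"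
    using convex_cone_hull_finite_sum by blast
  then obtain \<Phi> where \<Phi>: "\<And>x. x \<in> S \<Longrightarrow> finite (\<Phi> x) \<and> \<Phi> x \<subseteq> G \<and>
       (\<exists>c. (\<forall>\<phi>\<in>\<Phi> x. (0::real) \<le> c \<phi>) \<and> x = (\<Sum>\<phi>\<in>\<Phi> x. c \<phi> *\<^sub>R \<phi>))"
    by metis
  let ?\<Phi> = "\<Union>x\<in>S. \<Phi> x"
  have fin: "finite ?\<Phi>" using S \<Phi> by auto
  have "S \<subseteq> convex_cone hull ?\<Phi>"
  proof
    fix x assume x: "x \<in> S"
    then obtain c where c: "\<forall>\<phi>\<in>\<Phi> x. (0::real) \<le> c \<phi>" "x = (\<Sum>\<phi>\<in>\<Phi> x. c \<phi> *\<^sub>R \<phi>)"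
      using \<Phi> by blast
    have "(\<Sum>\<phi>\<in>A. c \<phi> *\<^sub>R \<phi>) \<in> convex_cone hull ?\<Phi>" if "finite A" "A \<subseteq> \<Phi> x" for A
      using that
    proof (induction A rule: finite_induct)
      case empty then show ?case by (simp add: convex_cone_hull_contains_0)
    next
      case (insert a A)
      have "a \<in> convex_cone hull ?\<Phi>" using insert.prems x by (intro hull_inc) auto
      then show ?case using insert c
        by (simp add: convex_cone_hull_add convex_cone_hull_mul)
    qed
    then show "x \<in> convex_cone hull ?\<Phi>" using c \<Phi>[OF x] by (metis subset_refl)
  qed
  then have sub: "?B \<subseteq> convex_cone hull ?\<Phi>"
    unfolding S(2) using convex_cone_convex_cone_hull by (intro hull_minimal) (auto simp: convex_cone_def)
  show ?thesis
  proof
    show "finite ?\<Phi>" by fact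
    show "?\<Phi> \<subseteq> G" using \<Phi> by auto
    show "0 < d" by fact
    show "\<forall>x. norm (x - y) < d \<longrightarrow> (\<exists>c. (\<forall>\<phi>\<in>?\<Phi>. (0::real) \<le> c \<phi>) \<and> x = (\<Sum>\<phi>\<in>?\<Phi>. c \<phi> *\<^sub>R \<phi>))"
    proof (intro allI impI)
    fix x assume "norm (x - y) < d"
    then have "x \<in> ?B" unfolding B using Basis_le_norm order_trans less_imp_le by metis
    then have "x \<in> convex_cone hull ?\<Phi>" using sub by blast
    then obtain \<Psi> c where \<Psi>: "finite \<Psi>" "\<Psi> \<subseteq> ?\<Phi>" "\<forall>\<phi>\<in>\<Psi>. (0::real) \<le> c \<phi>" "x = (\<Sum>\<phi>\<in>\<Psi>. c \<phi> *\<^sub>R \<phi>)"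
      using convex_cone_hull_finite_sum[OF \<open>x \<in> convex_cone hull ?\<Phi>\<close>] by metis
    have "x = (\<Sum>\<phi>\<in>?\<Phi>. (if \<phi> \<in> \<Psi> then c \<phi> else 0) *\<^sub>R \<phi>)"
      unfolding \<Psi>(4) using fin \<Psi>(2) by (intro sum.mono_neutral_cong_left) auto
    then show "\<exists>c. (\<forall>\<phi>\<in>?\<Phi>. (0::real) \<le> c \<phi>) \<and> x = (\<Sum>\<phi>\<in>?\<Phi>. c \<phi> *\<^sub>R \<phi>)"
      using \<Psi>(3) by (intro exI[of _ "\<lambda>\<phi>. if \<phi> \<in> \<Psi> then c \<phi> else 0"]) simp
    qed
  qed
qed

text \<open>Khovanskii's argument.  Write a group element \<open>x\<close> near the ray of \<open>y\<close>, shifted by a fixed \<open>g0\<close>, as a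
  nonnegative combination of finitely many generators and split off integer parts.  The remainder is a
  group element of bounded size, hence one of finitely many, and \<open>g0\<close> is chosen to move all of them
  into \<open>G\<close>.  The same decomposition bounds \<open>F x\<close>, the multiplicities being bounded by means of \<open>s\<close>.\<close>

lemma semigroup_near_interior:
  assumes F: "\<And>x y. x \<in> G \<Longrightarrow> y \<in> G \<Longrightarrow> F (x + y) \<le> F x + (F y :: real)"
    and y: "y \<in> interior cone"
  obtains \<rho> C N where "0 < \<rho>" "0 \<le> C" "0 < N"
    "\<forall>t x. N \<le> t \<longrightarrow> x \<in> grp \<longrightarrow> norm (x /\<^sub>R t - y) < \<rho> \<longrightarrow> x \<in> G \<and> F x \<le> C * t"
proof -
  obtain \<Phi>0 r where \<Phi>0: "finite \<Phi>0" "\<Phi>0 \<subseteq> G" "0 < r"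
    "\<forall>x. norm (x - y) < r \<longrightarrow> (\<exists>c. (\<forall>\<phi>\<in>\<Phi>0. (0::real) \<le> c \<phi>) \<and> x = (\<Sum>\<phi>\<in>\<Phi>0. c \<phi> *\<^sub>R \<phi>))"
    by (rule finitely_generated_near_interior[OF y])
  define \<Phi> where "\<Phi> = \<Phi>0 - {0}"
  have \<Phi>: "finite \<Phi>" "\<Phi> \<subseteq> G" "\<And>\<phi>. \<phi> \<in> \<Phi> \<Longrightarrow> 1 \<le> s \<phi>"
    using \<Phi>0 s_ge_1 by (auto simp: \<Phi>_def)
  have \<Phi>r: "\<exists>c. (\<forall>\<phi>\<in>\<Phi>. (0::real) \<le> c \<phi>) \<and> x = (\<Sum>\<phi>\<in>\<Phi>. c \<phi> *\<^sub>R \<phi>)" if nr: "norm (x - y) < r" for x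
  proof -
    obtain c where c: "\<forall>\<phi>\<in>\<Phi>0. (0::real) \<le> c \<phi>" "x = (\<Sum>\<phi>\<in>\<Phi>0. c \<phi> *\<^sub>R \<phi>)" using \<Phi>0(4)[rule_format, OF nr] by blast
    then have "x = (\<Sum>\<phi>\<in>\<Phi>. c \<phi> *\<^sub>R \<phi>)"
      unfolding \<Phi>_def c(2) using \<Phi>0(1) by (intro sum.mono_neutral_right) auto
    then show ?thesis using c by (auto simp: \<Phi>_def)
  qed
  define B where "B = (\<Sum>\<phi>\<in>\<Phi>. norm \<phi>)"
  define Rm where "Rm = {h \<in> grp. norm h \<le> B}"
  have "Rm = {x - y | x y. x \<in> G \<and> y \<in> G \<and> norm (x - y) \<le> B}"
    unfolding Rm_def grp_def by auto
  then have fin: "finite Rm" using discrete by simp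
  have "\<forall>h\<in>Rm. \<exists>g. g \<in> G \<and> h + g \<in> G" unfolding Rm_def grp_def by force
  then obtain gm where gm: "\<And>h. h \<in> Rm \<Longrightarrow> gm h \<in> G \<and> h + gm h \<in> G" by metis
  \<comment> \<open>Adding one fixed element moves all of the finitely many remainders into the semigroup.\<close>
  define g0 where "g0 = (\<Sum>h\<in>Rm. gm h)"
  have hg0: "h + g0 \<in> G" if "h \<in> Rm" for h
  proof -
    have eq: "h + g0 = (h + gm h) + (\<Sum>h\<in>Rm - {h}. gm h)"
      unfolding g0_def using fin that by (simp add: sum.remove)
    have "h + gm h \<in> G" "(\<Sum>h\<in>Rm - {h}. gm h) \<in> G" using gm that fin by (auto intro!: sum_mem)
    then show ?thesis unfolding eq by (rule add_mem)
  qed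
  have bl: "bounded_linear s" using linear_s by (simp add: linear_conv_bounded_linear)
  obtain Cs where Cs: "Cs > 0" "\<And>x. \<bar>s x\<bar> \<le> norm x * Cs"
    using bounded_linear.pos_bounded[OF bl] by auto
  define C1 where "C1 = (\<Sum>\<phi>\<in>\<Phi>. \<bar>F \<phi>\<bar>)"
  define C2 where "C2 = (\<Sum>h\<in>Rm. \<bar>F (h + g0)\<bar>)"
  \<comment> \<open>For \<open>t \<ge> N\<close> the shift by \<open>g0\<close> changes \<open>x /\<^sub>R t\<close> by less than \<open>r / 2\<close>.\<close>
  define N where "N = 2 * norm g0 / r + 1"
  define C where "C = C1 * ((norm y + r) * Cs) + C2"
  have pos: "C1 \<ge> 0" "C2 \<ge> 0" "N \<ge> 1" "C \<ge> 0"
    unfolding C1_def C2_def N_def C_def using \<Phi>0(3) Cs by (auto intro!: sum_nonneg add_nonneg_nonneg mult_nonneg_nonneg)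
  show ?thesis
  proof
    show "0 < r / 2" "0 \<le> C" "0 < N" using \<Phi>0 pos by auto
    show "\<forall>t x. N \<le> t \<longrightarrow> x \<in> grp \<longrightarrow> norm (x /\<^sub>R t - y) < r / 2 \<longrightarrow> x \<in> G \<and> F x \<le> C * t"
    proof (intro allI impI)
    fix t x assume t: "N \<le> t" and x: "x \<in> grp" and near: "norm (x /\<^sub>R t - y) < r / 2"
    have t1: "t \<ge> 1" using t pos by linarith
    have "norm g0 / t < r / 2"
    proof -
      have "2 * norm g0 / r < t" using t by (simp add: N_def)
      then show ?thesis using t1 \<Phi>0(3) by (simp add: field_simps)
    qed
    then have "norm ((x - g0) /\<^sub>R t - y) < r"
    proof -
      have "norm ((x - g0) /\<^sub>R t - y) \<le> norm (x /\<^sub>R t - y) + norm (g0 /\<^sub>R t)"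
        using norm_triangle_ineq4[of "x /\<^sub>R t - y" "g0 /\<^sub>R t"] by (simp add: algebra_simps)
      moreover have "norm (g0 /\<^sub>R t) = norm g0 / t" using t1 by (simp add: field_simps)
      ultimately show ?thesis using near \<open>norm g0 / t < r / 2\<close> by linarith
    qed
    note near2 = this
    obtain c' where c': "\<forall>\<phi>\<in>\<Phi>. (0::real) \<le> c' \<phi>" "(x - g0) /\<^sub>R t = (\<Sum>\<phi>\<in>\<Phi>. c' \<phi> *\<^sub>R \<phi>)"
      using \<Phi>r[OF near2] by blast
    define c where "c \<phi> = t * c' \<phi>" for \<phi>
    have c0: "0 \<le> c \<phi>" if "\<phi> \<in> \<Phi>" for \<phi> using c' that t1 by (simp add: c_def)
    have xg: "x - g0 = (\<Sum>\<phi>\<in>\<Phi>. c \<phi> *\<^sub>R \<phi>)"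
    proof -
      have "x - g0 = t *\<^sub>R ((x - g0) /\<^sub>R t)" using t1 by simp
      then show ?thesis unfolding c'(2) c_def by (simp add: scaleR_sum_right)
    qed
    define n where "n \<phi> = nat \<lfloor>c \<phi>\<rfloor>" for \<phi>
    have n: "real (n \<phi>) \<le> c \<phi>" "c \<phi> - real (n \<phi>) \<le> 1" if "\<phi> \<in> \<Phi>" for \<phi>
      using c0[OF that] unfolding n_def by linarith+
    define h where "h = x - g0 - (\<Sum>\<phi>\<in>\<Phi>. real (n \<phi>) *\<^sub>R \<phi>)"
    have "(\<Sum>\<phi>\<in>\<Phi>. real (n \<phi>) *\<^sub>R \<phi>) \<in> G" using \<Phi> by (intro sum_mem scale_mem) auto
    moreover have "g0 \<in> G" unfolding g0_def using fin gm by (intro sum_mem) auto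
    ultimately have "h \<in> grp" unfolding h_def using x G_subset_grp by (auto intro!: grp_diff)
    moreover have "norm h \<le> B"
    proof -
      have "h = (\<Sum>\<phi>\<in>\<Phi>. (c \<phi> - real (n \<phi>)) *\<^sub>R \<phi>)"
        unfolding h_def xg by (simp add: scaleR_left_diff_distrib sum_subtractf)
      also have "norm \<dots> \<le> (\<Sum>\<phi>\<in>\<Phi>. norm ((c \<phi> - real (n \<phi>)) *\<^sub>R \<phi>))" by (rule norm_sum)
      also have "\<dots> \<le> B" unfolding B_def
        using n by (intro sum_mono) (auto intro!: mult_left_le_one_le)
      finally show ?thesis .
    qed
    ultimately have hR: "h \<in> Rm" by (simp add: Rm_def)
    have xe: "x = (\<Sum>\<phi>\<in>\<Phi>. real (n \<phi>) *\<^sub>R \<phi>) + (h + g0)" by (simp add: h_def)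
    have xG: "x \<in> G" by (subst xe, rule add_mem[OF \<open>(\<Sum>\<phi>\<in>\<Phi>. real (n \<phi>) *\<^sub>R \<phi>) \<in> G\<close> hg0[OF hR]])
    have "F x \<le> (\<Sum>\<phi>\<in>\<Phi>. real (n \<phi>) * F \<phi>) + F (h + g0)"
      by (subst xe, rule subadditive_sum[OF F]) (use \<Phi> hg0[OF hR] in auto)
    also have "F (h + g0) \<le> C2"
      unfolding C2_def using member_le_sum[of h Rm "\<lambda>h. \<bar>F (h + g0)\<bar>"] hR fin by auto
    also have "(\<Sum>\<phi>\<in>\<Phi>. real (n \<phi>) * F \<phi>) \<le> (\<Sum>\<phi>\<in>\<Phi>. (t * ((norm y + r) * Cs)) * \<bar>F \<phi>\<bar>)"
    proof (rule sum_mono)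
      fix \<phi> assume \<phi>: "\<phi> \<in> \<Phi>"
      have "real (n \<phi>) \<le> c \<phi>" using n \<phi> by simp
      also have "\<dots> \<le> c \<phi> * s \<phi>" using \<Phi>(3)[OF \<phi>] c0[OF \<phi>] by (simp add: mult_le_cancel_left1)
      also have "\<dots> \<le> (\<Sum>\<phi>\<in>\<Phi>. c \<phi> * s \<phi>)"
      proof (rule member_le_sum[OF \<phi>])
        show "0 \<le> c x * s x" if "x \<in> \<Phi> - {\<phi>}" for x
          using that c0[of x] \<Phi>(3)[of x] by simp
      qed (use \<Phi> in auto)
      also have "\<dots> = s (x - g0)" unfolding xg
        using linear_s by (simp add: linear_sum linear_scale)
      also have "\<dots> = t * s ((x - g0) /\<^sub>R t)" using linear_s t1 by (simp add: linear_scale)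
      also have "\<dots> \<le> t * ((norm y + r) * Cs)"
      proof (rule mult_left_mono)
        have "norm ((x - g0) /\<^sub>R t) \<le> norm y + r"
          using near2 norm_triangle_sub[of "(x - g0) /\<^sub>R t" y] by linarith
        then have "norm ((x - g0) /\<^sub>R t) * Cs \<le> (norm y + r) * Cs" using Cs(1) by simp
        then show "s ((x - g0) /\<^sub>R t) \<le> (norm y + r) * Cs" using Cs(2)[of "(x - g0) /\<^sub>R t"] by linarith
      qed (use t1 in simp)
      finally have *: "real (n \<phi>) \<le> t * ((norm y + r) * Cs)" .
      have "real (n \<phi>) * F \<phi> \<le> real (n \<phi>) * \<bar>F \<phi>\<bar>" by (intro mult_left_mono) auto
      also have "\<dots> \<le> (t * ((norm y + r) * Cs)) * \<bar>F \<phi>\<bar>" using * by (intro mult_right_mono) auto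
      finally show "real (n \<phi>) * F \<phi> \<le> (t * ((norm y + r) * Cs)) * \<bar>F \<phi>\<bar>" .
    qed
    also have "(\<Sum>\<phi>\<in>\<Phi>. (t * ((norm y + r) * Cs)) * \<bar>F \<phi>\<bar>) + C2 \<le> C * t"
    proof -
      have "C2 \<le> C2 * t" using pos t1 by (simp add: mult_le_cancel_left1)
      then show ?thesis unfolding C_def C1_def by (simp only: sum_distrib_left[symmetric]) (simp add: algebra_simps)
    qed
    finally show "x \<in> G \<and> F x \<le> C * t" using xG by simp
    qed
  qed
qed

definition envelope :: "('v \<Rightarrow> real) \<Rightarrow> 'v \<Rightarrow> real" where
  "envelope F y = Sup {l y | l. linear l \<and> (\<forall>\<gamma>\<in>G. \<gamma> \<in> interior cone \<longrightarrow> l \<gamma> \<le> F \<gamma>)}"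

lemma linear_nonneg_on_cone:
  assumes "linear u" "\<And>\<gamma>. \<gamma> \<in> G \<Longrightarrow> 0 \<le> u \<gamma>" "x \<in> cone"
  shows "(0::real) \<le> u x"
proof -
  have "convex_cone {x. 0 \<le> u x}" unfolding convex_cone_iff using assms(1)
    by (auto simp: linear_0 linear_add linear_scale)
  moreover have "closed {x. 0 \<le> u x}"
    using assms(1) by (intro closed_Collect_le continuous_on_const linear_continuous_on)
      (simp add: linear_conv_bounded_linear)
  ultimately have "cone \<subseteq> {x. 0 \<le> u x}"
    unfolding cone_def using assms(2) by (intro hull_minimal) auto
  then show ?thesis using assms(3) by auto
qed

lemma interior_cone_add:
  assumes "x \<in> interior cone" "z \<in> cone"
  shows "x + z \<in> interior cone"
proof -
  have "(\<lambda>w. w + z) ` interior cone \<subseteq> cone"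
    using interior_subset convex_cone_cone assms(2) by (auto simp: convex_cone_iff)
  moreover have "open ((\<lambda>w. w + z) ` interior cone)"
    using open_translation[of "interior cone" z] by (simp add: add.commute)
  ultimately have "(\<lambda>w. w + z) ` interior cone \<subseteq> interior cone" by (rule interior_maximal)
  then show ?thesis using assms(1) by auto
qed

lemma interior_cone_scale:
  assumes "x \<in> interior cone" "c > 0"
  shows "c *\<^sub>R x \<in> interior cone"
proof -
  have "(\<lambda>w. c *\<^sub>R w) ` interior cone \<subseteq> cone"
    using interior_subset[of cone] assms(2) by (auto intro!: convex_cone_scaleR[OF convex_cone_cone])
  moreover have "open ((\<lambda>w. c *\<^sub>R w) ` interior cone)"
    using assms(2) by (intro open_scaling) auto
  ultimately have "(\<lambda>w. c *\<^sub>R w) ` interior cone \<subseteq> interior cone" by (rule interior_maximal)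
  then show ?thesis using assms(1) by auto
qed

lemma interior_cone_scale_iff: "c > 0 \<Longrightarrow> c *\<^sub>R x \<in> interior cone \<longleftrightarrow> x \<in> interior cone"
  using interior_cone_scale[of x c] interior_cone_scale[of "c *\<^sub>R x" "1 / c"] by auto

text \<open>Excludes vertical separating hyperplanes: a functional that is nonnegative on the cone and
  not positive at an interior point vanishes.\<close>

lemma linear_eq_0_if_nonneg:
  assumes "linear u" "\<And>\<gamma>. \<gamma> \<in> G \<Longrightarrow> (0::real) \<le> u \<gamma>" "y \<in> interior cone" "u y \<le> 0"
  shows "u z = 0"
proof -
  obtain e where e: "e > 0" "cball y e \<subseteq> cone" using assms(3) by (auto simp: mem_interior_cball)
  have *: "0 \<le> u v" for v
  proof (cases "v = 0")
    case False
    have "y + (e / norm v) *\<^sub>R v \<in> cone" using e False by (intro subsetD[OF e(2)]) (auto simp: dist_norm)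
    then have "0 \<le> u (y + (e / norm v) *\<^sub>R v)" using linear_nonneg_on_cone assms(1,2) by blast
    also have "\<dots> = u y + (e / norm v) * u v" using assms(1) by (simp add: linear_add linear_scale)
    finally have "0 \<le> (e / norm v) * u v" using assms(4) by simp
    then show ?thesis using e False by (simp add: zero_le_mult_iff zero_le_divide_iff)
  qed (use assms(1) in \<open>simp add: linear_0\<close>)
  show ?thesis using *[of z] *[of "- z"] assms(1) by (simp add: linear_neg)
qed

lemma floor_tendsto:
  assumes "filterlim t at_top sequentially" "0 \<le> (a::real)"
  shows "(\<lambda>k. real (nat \<lfloor>a * t k\<rfloor>) / t k) \<longlonglongrightarrow> a"
proof (rule Lim_transform_eventually)
  have "(\<lambda>k. 1 / t k) \<longlonglongrightarrow> 0"
    using tendsto_inverse_0_at_top[OF assms(1)] by (simp add: inverse_eq_divide)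
  then have "(\<lambda>k. frac (a * t k) * (1 / t k)) \<longlonglongrightarrow> 0"
  proof (rule Lim_null_comparison[rotated])
    show "\<forall>\<^sub>F k in sequentially. norm (frac (a * t k) * (1 / t k)) \<le> 1 / t k"
      using filterlim_at_top_dense[THEN iffD1, OF assms(1), rule_format, of 0]
    proof eventually_elim
      case (elim k)
      have "frac (a * t k) * (1 / t k) \<le> 1 * (1 / t k)"
        using elim frac_lt_1[of "a * t k"] by (intro mult_right_mono) auto
      then show ?case using elim by (simp add: frac_ge_0)
    qed
  qed
  then show "(\<lambda>k. a - frac (a * t k) * (1 / t k)) \<longlonglongrightarrow> a"
    using tendsto_diff[OF tendsto_const[of a]] by fastforce
  show "\<forall>\<^sub>F k in sequentially. a - frac (a * t k) * (1 / t k) = real (nat \<lfloor>a * t k\<rfloor>) / t k"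
    using filterlim_at_top_dense[THEN iffD1, OF assms(1), rule_format, of 0]
  proof eventually_elim
    case (elim k)
    then have "0 \<le> \<lfloor>a * t k\<rfloor>" using assms(2) by simp
    then show ?case using elim by (simp add: frac_def field_simps)
  qed
qed

text \<open>Linear minorants of \<open>F\<close> show that the limit inferior is at least the envelope.  Conversely, for
  \<open>\<tau>\<close> above the envelope, separation of convex sets puts \<open>(y, \<tau>)\<close> into the cone over the epigraph of \<open>F\<close>, so
  \<open>y = (\<Sum>p\<in>\<Phi>. c p *\<^sub>R fst p)\<close> with \<open>\<Sum>p\<in>\<Phi>. c p * F (fst p) \<le> \<tau>\<close>.  Spend the fraction \<open>1 - \<epsilon>\<close> of \<open>x k\<close> on the
  generators \<open>fst p\<close> with the multiplicities dictated by \<open>c\<close>.  The rest still points in the direction of \<open>y\<close>,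
  so it lies in \<open>G\<close> and costs only \<open>O(\<epsilon> * t k)\<close> by the previous estimate.\<close>

theorem envelope_limit:
  assumes F: "\<And>x y. x \<in> G \<Longrightarrow> y \<in> G \<Longrightarrow> F (x + y) \<le> F x + (F y :: real)"
    and l0: "linear l0" "\<And>\<gamma>. \<gamma> \<in> G \<Longrightarrow> l0 \<gamma> \<le> F \<gamma>"
    and y: "y \<in> interior cone"
    and x: "\<forall>\<^sub>F k in sequentially. x k \<in> G"
    and t: "filterlim t at_top sequentially"
    and lim: "(\<lambda>k. x k /\<^sub>R t k) \<longlonglongrightarrow> y"
  shows "(\<lambda>k. F (x k) / t k) \<longlonglongrightarrow> envelope F y"
proof -
  let ?E = "{l y | l. linear l \<and> (\<forall>\<gamma>\<in>G. \<gamma> \<in> interior cone \<longrightarrow> l \<gamma> \<le> F \<gamma>)}"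
  obtain \<rho> C N where K: "0 < \<rho>" "0 \<le> C" "0 < N"
    "\<forall>t x. N \<le> t \<longrightarrow> x \<in> grp \<longrightarrow> norm (x /\<^sub>R t - y) < \<rho> \<longrightarrow> x \<in> G \<and> F x \<le> C * t"
    by (rule semigroup_near_interior[OF F y])
  note K = K(1-3) K(4)[rule_format]
  have tN: "\<forall>\<^sub>F k in sequentially. max 1 N' < t k" for N'
    using filterlim_at_top_dense[THEN iffD1, OF t] by blast
  have near: "\<forall>\<^sub>F k in sequentially. norm (x k /\<^sub>R t k - y) < \<rho>"
    using tendstoD[OF lim K(1)] by (simp add: dist_norm)
  have int: "\<forall>\<^sub>F k in sequentially. x k \<in> interior cone"
  proof -
    have "\<forall>\<^sub>F k in sequentially. x k /\<^sub>R t k \<in> interior cone"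
      using topological_tendstoD[OF lim open_interior y] .
    then show ?thesis using tN[of 1]
    proof eventually_elim
      case (elim k)
      have "x k /\<^sub>R t k = inverse (t k) *\<^sub>R x k" by simp
      then show ?case using elim interior_cone_scale_iff[of "inverse (t k)" "x k"] by simp
    qed
  qed
  have l_lim: "(\<lambda>k. l (x k) / t k) \<longlonglongrightarrow> l y" if "linear l" for l
  proof -
    have "(\<lambda>k. l (x k /\<^sub>R t k)) \<longlonglongrightarrow> l y"
      using that by (intro bounded_linear.tendsto[OF _ lim]) (simp add: linear_conv_bounded_linear)
    then show ?thesis using that by (simp add: linear_scale divide_inverse mult.commute)
  qed
  have bdd: "bdd_above ?E"
  proof (rule bdd_aboveI)
    fix v assume "v \<in> ?E"
    then obtain l where l: "v = l y" "linear l" "\<forall>\<gamma>\<in>G. \<gamma> \<in> interior cone \<longrightarrow> l \<gamma> \<le> F \<gamma>" by blast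
    have "\<forall>\<^sub>F k in sequentially. l (x k) / t k \<le> C"
      using x int near tN[of N]
    proof eventually_elim
      case (elim k)
      then have "l (x k) \<le> F (x k)" using l by blast
      also have "\<dots> \<le> C * t k" using K(4)[of "t k" "x k"] elim G_subset_grp by auto
      finally show ?case using elim by (simp add: field_simps)
    qed
    then show "v \<le> C" unfolding l(1) by (intro tendsto_upperbound[OF l_lim[OF l(2)]]) auto
  qed
  have ne: "?E \<noteq> {}" using l0 by blast
  show ?thesis
  proof (rule order_tendstoI)
    fix \<eta> assume "\<eta> < envelope F y"
    then obtain v where "v \<in> ?E" "\<eta> < v" unfolding envelope_def using less_cSup_iff[OF ne bdd] by blast
    then obtain l where l: "\<eta> < l y" "linear l" "\<forall>\<gamma>\<in>G. \<gamma> \<in> interior cone \<longrightarrow> l \<gamma> \<le> F \<gamma>" by blast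
    show "\<forall>\<^sub>F k in sequentially. \<eta> < F (x k) / t k"
      using order_tendstoD(1)[OF l_lim[OF l(2)] l(1)] x int tN[of 1]
    proof eventually_elim
      case (elim k)
      have "l (x k) / t k \<le> F (x k) / t k" using elim l(3) by (intro divide_right_mono) auto
      then show ?case using elim by linarith
    qed
  next
    fix \<eta> assume "envelope F y < \<eta>"
    then obtain \<tau> where \<tau>: "envelope F y < \<tau>" "\<tau> < \<eta>" using dense by blast
    \<comment> \<open>The epigraph of \<open>F\<close>, over interior points only, as in the definition of the envelope.\<close>
    define A where "A = {(\<gamma>, F \<gamma> + r) | \<gamma> r. \<gamma> \<in> G \<and> \<gamma> \<in> interior cone \<and> 0 \<le> r}"
    have "(y, \<tau>) \<in> convex_cone hull A"
    proof (rule ccontr)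
      assume "(y, \<tau>) \<notin> convex_cone hull A"
      then have "convex_cone hull A \<inter> {(y, \<tau>)} = {}" by simp
      then obtain a b where ab: "a \<noteq> 0" "\<forall>p\<in>convex_cone hull A. a \<bullet> p \<le> b" "b \<le> a \<bullet> (y, \<tau>)"
        using separating_hyperplane_sets[OF convex_convex_cone_hull[of A] convex_singleton[of "(y, \<tau>)"] convex_cone_hull_nonempty]
        by auto
      have b0: "0 \<le> b" using ab(2) convex_cone_hull_contains_0[of A] by force
      have neg: "a \<bullet> p \<le> 0" if p: "p \<in> convex_cone hull A" for p
      proof (rule ccontr)
        assume c: "\<not> a \<bullet> p \<le> 0"
        have "a \<bullet> (((b + 1) / (a \<bullet> p)) *\<^sub>R p) \<le> b"
          using c b0 p by (intro bspec[OF ab(2)] convex_cone_hull_mul) auto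
        then show False using c by simp
      qed
      define u w where "u = - fst a" and "w = - snd a"
      have uw: "0 \<le> u \<bullet> \<gamma> + w * (F \<gamma> + r)" if "\<gamma> \<in> G" "\<gamma> \<in> interior cone" "0 \<le> r" for \<gamma> r
      proof -
        have "(\<gamma>, F \<gamma> + r) \<in> convex_cone hull A" using that by (intro hull_inc) (auto simp: A_def)
        then show ?thesis using neg by (force simp: u_def w_def inner_prod_def)
      qed
      have uy: "u \<bullet> y + w * \<tau> \<le> 0"
        using ab(3) b0 by (cases a) (simp add: u_def w_def inner_prod_def)
      obtain k where "x k \<in> G" "x k \<in> interior cone"
        using eventually_happens'[OF sequentially_bot eventually_conj[OF x int]] by blast
      then obtain \<gamma>' where \<gamma>': "\<gamma>' \<in> G" "\<gamma>' \<in> interior cone" by blast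
      have w0: "0 \<le> w"
      proof (rule ccontr)
        assume w: "\<not> 0 \<le> w"
        define q where "q = u \<bullet> \<gamma>' + w * F \<gamma>'"
        have "0 \<le> q" using uw[OF \<gamma>', of 0] by (simp add: q_def)
        then have "0 \<le> - q / w + 1" using w by (simp add: divide_nonneg_neg)
        from uw[OF \<gamma>' this] have "0 \<le> q + w * (- q / w + 1)" by (simp add: q_def algebra_simps)
        then show False using w by (simp add: algebra_simps)
      qed
      show False
      proof (cases "w = 0")
        case True
        \<comment> \<open>Elements of \<open>G\<close> outside the interior are tested by means of the interior elements \<open>\<gamma>' + n \<gamma>\<close>.\<close>
        have "0 \<le> u \<bullet> \<gamma>" if "\<gamma> \<in> G" for \<gamma>
        proof (rule ccontr)
          assume c: "\<not> 0 \<le> u \<bullet> \<gamma>"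
          obtain n :: nat where n: "u \<bullet> \<gamma>' < real n * (- (u \<bullet> \<gamma>))"
            using reals_Archimedean3[of "- (u \<bullet> \<gamma>)"] c by auto
          have "\<gamma>' + real n *\<^sub>R \<gamma> \<in> G" "\<gamma>' + real n *\<^sub>R \<gamma> \<in> interior cone"
            using \<gamma>' that scale_mem[of \<gamma> n] G_subset_cone by (auto intro!: add_mem interior_cone_add)
          then show False using uw[of "\<gamma>' + real n *\<^sub>R \<gamma>" 0] n True by (simp add: inner_simps)
        qed
        then have "u \<bullet> u = 0"
          using uy True y bounded_linear_inner_right[of u]
          by (intro linear_eq_0_if_nonneg[of "\<lambda>x. u \<bullet> x"]) (auto simp: linear_conv_bounded_linear)
        then show False using ab(1) True by (cases a) (simp add: u_def w_def zero_prod_def)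
      next
        case False
        then have w: "w > 0" using w0 by simp
        define l where "l v = - (u \<bullet> v) / w" for v
        have "linear l" unfolding l_def
          by (rule linearI) (auto simp: inner_simps add_divide_distrib diff_divide_distrib)
        moreover have "l \<gamma> \<le> F \<gamma>" if "\<gamma> \<in> G" "\<gamma> \<in> interior cone" for \<gamma>
          using uw[OF that, of 0] w by (simp add: l_def field_simps)
        ultimately have "l y \<le> envelope F y" unfolding envelope_def by (intro cSup_upper bdd) blast
        moreover have "\<tau> \<le> l y" using uy w by (simp add: l_def field_simps)
        ultimately show False using \<tau> by simp
      qed
    qed
    then obtain \<Phi> c where \<Phi>: "finite \<Phi>" "\<Phi> \<subseteq> A" "\<forall>p\<in>\<Phi>. 0 \<le> c p" "(y, \<tau>) = (\<Sum>p\<in>\<Phi>. c p *\<^sub>R p)"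
      using convex_cone_hull_finite_sum[of "(y, \<tau>)" A] by auto
    have \<Phi>A: "fst p \<in> G" "F (fst p) \<le> snd p" if "p \<in> \<Phi>" for p
      using \<Phi>(2) that by (auto simp: A_def)
    have y_eq: "y = (\<Sum>p\<in>\<Phi>. c p *\<^sub>R fst p)"
      using arg_cong[OF \<Phi>(4), of fst] by (simp add: fst_sum)
    define \<tau>' where "\<tau>' = (\<Sum>p\<in>\<Phi>. c p * F (fst p))"
    have "\<tau> = (\<Sum>p\<in>\<Phi>. c p * snd p)"
      using arg_cong[OF \<Phi>(4), of snd] by (simp add: snd_sum)
    then have \<tau>': "\<tau>' \<le> \<tau>" unfolding \<tau>'_def using \<Phi>A \<Phi>(3) by (auto intro!: sum_mono mult_left_mono)
    define \<epsilon> where "\<epsilon> = min (1 / 2) ((\<eta> - \<tau>) / (2 * (C + \<bar>\<tau>'\<bar> + 1)))"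
    have \<epsilon>: "0 < \<epsilon>" "\<epsilon> < 1" using \<tau> K(2) by (auto simp: \<epsilon>_def)
    have "\<epsilon> * (C + \<bar>\<tau>'\<bar> + 1) \<le> (\<eta> - \<tau>) / (2 * (C + \<bar>\<tau>'\<bar> + 1)) * (C + \<bar>\<tau>'\<bar> + 1)"
      using K(2) by (intro mult_right_mono) (auto simp: \<epsilon>_def)
    also have "\<dots> = (\<eta> - \<tau>) / 2" using K(2) by (simp add: field_simps)
    finally have "\<epsilon> * (C + \<bar>\<tau>'\<bar> + 1) \<le> (\<eta> - \<tau>) / 2" .
    moreover have "\<epsilon> * (C - \<tau>') \<le> \<epsilon> * (C + \<bar>\<tau>'\<bar> + 1)" using \<epsilon> by (intro mult_left_mono) auto
    ultimately have small: "(1 - \<epsilon>) * \<tau>' + C * \<epsilon> < \<eta>"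
      using \<tau> \<tau>' by (simp add: algebra_simps)
    define n where "n k p = nat \<lfloor>((1 - \<epsilon>) * c p) * t k\<rfloor>" for k p
    have n_lim: "(\<lambda>k. real (n k p) / t k) \<longlonglongrightarrow> (1 - \<epsilon>) * c p" if "p \<in> \<Phi>" for p
      unfolding n_def using \<Phi>(3) that \<epsilon> by (intro floor_tendsto t) auto
    define \<delta> where "\<delta> k = x k - (\<Sum>p\<in>\<Phi>. real (n k p) *\<^sub>R fst p)" for k
    have "(\<lambda>k. (x k /\<^sub>R t k - (\<Sum>p\<in>\<Phi>. (real (n k p) / t k) *\<^sub>R fst p)) /\<^sub>R \<epsilon>)
       \<longlonglongrightarrow> (y - (\<Sum>p\<in>\<Phi>. ((1 - \<epsilon>) * c p) *\<^sub>R fst p)) /\<^sub>R \<epsilon>"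
      by (intro tendsto_intros lim n_lim)
    also have "(\<Sum>p\<in>\<Phi>. ((1 - \<epsilon>) * c p) *\<^sub>R fst p) = (1 - \<epsilon>) *\<^sub>R y"
      unfolding y_eq by (simp add: scaleR_sum_right)
    also have "(y - (1 - \<epsilon>) *\<^sub>R y) /\<^sub>R \<epsilon> = y" using \<epsilon> by (simp add: algebra_simps)
    finally have "(\<lambda>k. \<delta> k /\<^sub>R (\<epsilon> * t k)) \<longlonglongrightarrow> y"
      unfolding \<delta>_def by (simp add: scaleR_diff_right scaleR_sum_right divide_inverse mult_ac)
    from tendstoD[OF this K(1)]
    have \<delta>near: "\<forall>\<^sub>F k in sequentially. norm (\<delta> k /\<^sub>R (\<epsilon> * t k) - y) < \<rho>" by (simp add: dist_norm)
    have "(\<lambda>k. (\<Sum>p\<in>\<Phi>. (real (n k p) / t k) * F (fst p)) + C * \<epsilon>)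
        \<longlonglongrightarrow> (\<Sum>p\<in>\<Phi>. ((1 - \<epsilon>) * c p) * F (fst p)) + C * \<epsilon>"
      by (intro tendsto_intros n_lim)
    also have "(\<Sum>p\<in>\<Phi>. ((1 - \<epsilon>) * c p) * F (fst p)) = (1 - \<epsilon>) * \<tau>'"
      by (simp add: \<tau>'_def sum_distrib_left mult_ac)
    finally have ev: "\<forall>\<^sub>F k in sequentially. (\<Sum>p\<in>\<Phi>. (real (n k p) / t k) * F (fst p)) + C * \<epsilon> < \<eta>"
      using small by (rule order_tendstoD(2))
    show "\<forall>\<^sub>F k in sequentially. F (x k) / t k < \<eta>"
      using ev \<delta>near x tN[of "N / \<epsilon>"]
    proof eventually_elim
      case (elim k)
      have t0: "t k > 0" "N \<le> \<epsilon> * t k" using elim \<epsilon> by (auto simp: field_simps)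
      have "(\<Sum>p\<in>\<Phi>. real (n k p) *\<^sub>R fst p) \<in> G"
        using \<Phi>(1) \<Phi>A by (intro sum_mem scale_mem) auto
      then have "\<delta> k \<in> grp" unfolding \<delta>_def using elim G_subset_grp by (auto intro!: grp_diff)
      then have \<delta>: "\<delta> k \<in> G" "F (\<delta> k) \<le> C * (\<epsilon> * t k)" using K(4)[OF t0(2)] elim by auto
      have "F (x k) = F ((\<Sum>p\<in>\<Phi>. real (n k p) *\<^sub>R fst p) + \<delta> k)" by (simp add: \<delta>_def)
      also have "\<dots> \<le> (\<Sum>p\<in>\<Phi>. real (n k p) * F (fst p)) + F (\<delta> k)"
        by (rule subadditive_sum[OF F]) (use \<Phi>(1) \<Phi>A \<delta> in auto)
      also have "\<dots> \<le> (\<Sum>p\<in>\<Phi>. real (n k p) * F (fst p)) + C * (\<epsilon> * t k)" using \<delta> by simp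
      finally have "F (x k) / t k \<le> ((\<Sum>p\<in>\<Phi>. real (n k p) * F (fst p)) + C * (\<epsilon> * t k)) / t k"
        using t0 by (intro divide_right_mono) auto
      also have "\<dots> = (\<Sum>p\<in>\<Phi>. (real (n k p) / t k) * F (fst p)) + C * \<epsilon>"
        using t0 by (simp add: add_divide_distrib sum_divide_distrib)
      finally show ?case using elim by linarith
    qed
  qed
qed

text \<open>The multiples of \<open>x\<close>, reduced by integer parts modulo generators, are lattice points of bounded
  size; by the pigeonhole principle two of them agree.\<close>

lemma multiple_in_group:
  assumes L: "\<And>x y. x \<in> L \<Longrightarrow> y \<in> L \<Longrightarrow> x - y \<in> L" "G \<subseteq> L" "\<And>R. finite {x \<in> L. norm x \<le> R}"
    and y: "y \<in> interior cone" and x: "x \<in> L"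
  obtains m :: nat where "0 < m" "real m *\<^sub>R x \<in> grp"
proof -
  obtain \<Phi> r where \<Phi>: "finite \<Phi>" "\<Phi> \<subseteq> G" "0 < r"
    "\<forall>x. norm (x - y) < r \<longrightarrow> (\<exists>c. (\<forall>\<phi>\<in>\<Phi>. (0::real) \<le> c \<phi>) \<and> x = (\<Sum>\<phi>\<in>\<Phi>. c \<phi> *\<^sub>R \<phi>))"
    by (rule finitely_generated_near_interior[OF y])
  define e where "e = r / (2 * (norm x + 1))"
  have e: "e > 0" using \<Phi>(3) by (simp add: e_def add_nonneg_pos)
  have "norm (e *\<^sub>R x) < r"
  proof -
    have "norm (e *\<^sub>R x) = e * norm x" using e by simp
    also have "\<dots> \<le> e * (norm x + 1)" using e by (intro mult_left_mono) auto
    also have "\<dots> = r / 2" by (simp add: e_def add_nonneg_eq_0_iff divide_simps)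
    finally show ?thesis using \<Phi>(3) by linarith
  qed
  then have "norm ((y + e *\<^sub>R x) - y) < r" by simp
  from \<Phi>(4)[rule_format, OF this] obtain c1 where c1: "y + e *\<^sub>R x = (\<Sum>\<phi>\<in>\<Phi>. c1 \<phi> *\<^sub>R \<phi>)" by blast
  have "norm (y - y) < r" using \<Phi>(3) by simp
  from \<Phi>(4)[rule_format, OF this] obtain c2 where c2: "y = (\<Sum>\<phi>\<in>\<Phi>. c2 \<phi> *\<^sub>R \<phi>)" by blast
  define d where "d \<phi> = (c1 \<phi> - c2 \<phi>) / e" for \<phi>
  have "e *\<^sub>R x = (\<Sum>\<phi>\<in>\<Phi>. c1 \<phi> *\<^sub>R \<phi>) - (\<Sum>\<phi>\<in>\<Phi>. c2 \<phi> *\<^sub>R \<phi>)" using c1 c2 by (metis add_diff_cancel_left')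
  also have "\<dots> = e *\<^sub>R (\<Sum>\<phi>\<in>\<Phi>. d \<phi> *\<^sub>R \<phi>)"
    using e by (simp add: d_def scaleR_sum_right scaleR_left_diff_distrib sum_subtractf)
  finally have xd: "x = (\<Sum>\<phi>\<in>\<Phi>. d \<phi> *\<^sub>R \<phi>)" using e by simp
  have int_scale: "of_int j *\<^sub>R \<phi> \<in> grp" if "\<phi> \<in> G" for j \<phi>
    using scale_mem[OF that] G_subset_grp grp_uminus by (cases j rule: int_cases2) force+
  have sum_grp: "(\<Sum>\<phi>\<in>\<Phi>. of_int (j \<phi>) *\<^sub>R \<phi>) \<in> grp" for j
    using \<Phi>(1,2)
  proof (induction \<Phi> rule: finite_induct)
    case empty then show ?case using zero_mem G_subset_grp by auto
  qed (auto intro!: grp_add int_scale)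
  have L0: "0 \<in> L" using L(2) zero_mem by auto
  have Ladd: "a + b \<in> L" if "a \<in> L" "b \<in> L" for a b
    using L(1)[OF that(1) L(1)[OF L0 that(2)]] by simp
  have grpL: "grp \<subseteq> L" using L(1,2) by (auto simp: grp_def)
  have mx: "real m *\<^sub>R x \<in> L" for m
    by (induction m) (auto simp: L0 scaleR_left_distrib intro!: Ladd x)
  define h where "h m = real m *\<^sub>R x - (\<Sum>\<phi>\<in>\<Phi>. of_int \<lfloor>real m * d \<phi>\<rfloor> *\<^sub>R \<phi>)" for m
  have "range h \<subseteq> {x \<in> L. norm x \<le> (\<Sum>\<phi>\<in>\<Phi>. norm \<phi>)}"
  proof clarify
    fix m
    have "h m \<in> L" unfolding h_def by (intro L(1) mx subsetD[OF grpL] sum_grp)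
    moreover have "norm (h m) \<le> (\<Sum>\<phi>\<in>\<Phi>. norm \<phi>)"
    proof -
      have "h m = (\<Sum>\<phi>\<in>\<Phi>. (real m * d \<phi> - of_int \<lfloor>real m * d \<phi>\<rfloor>) *\<^sub>R \<phi>)"
        unfolding h_def by (subst xd) (simp add: scaleR_sum_right scaleR_left_diff_distrib sum_subtractf)
      also have "norm \<dots> \<le> (\<Sum>\<phi>\<in>\<Phi>. norm ((real m * d \<phi> - of_int \<lfloor>real m * d \<phi>\<rfloor>) *\<^sub>R \<phi>))" by (rule norm_sum)
      also have "\<dots> \<le> (\<Sum>\<phi>\<in>\<Phi>. norm \<phi>)"
      proof (rule sum_mono)
        fix \<phi>
        have "\<bar>real m * d \<phi> - of_int \<lfloor>real m * d \<phi>\<rfloor>\<bar> \<le> 1" by linarith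
        then show "norm ((real m * d \<phi> - of_int \<lfloor>real m * d \<phi>\<rfloor>) *\<^sub>R \<phi>) \<le> norm \<phi>"
          by (simp add: mult_left_le_one_le)
      qed
      finally show ?thesis .
    qed
    ultimately show "h m \<in> L \<and> norm (h m) \<le> (\<Sum>\<phi>\<in>\<Phi>. norm \<phi>)" by simp
  qed
  then have "finite (range h)" using L(3) finite_subset by blast
  then have "\<not> inj h" using finite_imageD infinite_UNIV_nat by blast
  then obtain m1 m2 where m: "m1 < m2" "h m1 = h m2"
    unfolding inj_def by (metis linorder_neqE_nat)
  have "real (m2 - m1) *\<^sub>R x = (\<Sum>\<phi>\<in>\<Phi>. of_int \<lfloor>real m2 * d \<phi>\<rfloor> *\<^sub>R \<phi>) - (\<Sum>\<phi>\<in>\<Phi>. of_int \<lfloor>real m1 * d \<phi>\<rfloor> *\<^sub>R \<phi>)"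
    using m by (simp add: h_def of_nat_diff scaleR_left_diff_distrib algebra_simps)
  then have "real (m2 - m1) *\<^sub>R x \<in> grp" using sum_grp grp_diff by simp
  then show ?thesis using m that[of "m2 - m1"] by simp
qed

end

section \<open>Holomorphic functions of several variables\<close>

text \<open>Complex differentiability at a point, the pointwise form of \<open>mholomorphic_on\<close>.\<close>

definition cdiff :: "(complex^'n::finite \<Rightarrow> complex) \<Rightarrow> complex^'n \<Rightarrow> bool" where
  "cdiff f z \<longleftrightarrow> (\<exists>f'. (f has_derivative f') (at z) \<and> (\<forall>c v. f' (c *s v) = c * f' v))"

lemma mholomorphic_on_iff_cdiff: "f mholomorphic_on S \<longleftrightarrow> (\<forall>z\<in>S. cdiff f z)"
  unfolding mholomorphic_on_def cdiff_def ..

lemma cdiff_const [simp, intro]: "cdiff (\<lambda>z. c) z"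
  unfolding cdiff_def by (intro exI[of _ "\<lambda>_. 0"]) auto

lemma cdiff_nth [simp, intro]: "cdiff (\<lambda>z. z $ i) z"
  unfolding cdiff_def
  by (intro exI[of _ "\<lambda>v. v $ i"]) (auto intro!: bounded_linear_imp_has_derivative bounded_linear_vec_nth)

lemma cdiff_add: "cdiff f z \<Longrightarrow> cdiff g z \<Longrightarrow> cdiff (\<lambda>z. f z + g z) z"
  unfolding cdiff_def
  apply (elim exE conjE)
  subgoal for f' g'
    by (intro exI[of _ "\<lambda>v. f' v + g' v"]) (auto intro!: has_derivative_add simp: algebra_simps)
  done

lemma cdiff_mult: "cdiff f z \<Longrightarrow> cdiff g z \<Longrightarrow> cdiff (\<lambda>z. f z * g z) z"
  unfolding cdiff_def
  apply (elim exE conjE)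
  subgoal for f' g'
    by (intro exI[of _ "\<lambda>v. f z * g' v + f' v * g z"]) (auto intro!: has_derivative_mult simp: algebra_simps)
  done

lemma cdiff_inverse: "cdiff f z \<Longrightarrow> f z \<noteq> 0 \<Longrightarrow> cdiff (\<lambda>z. inverse (f z)) z"
  unfolding cdiff_def
  apply (elim exE conjE)
  subgoal for f'
    by (intro exI[of _ "\<lambda>v. - (inverse (f z) * f' v * inverse (f z))"] conjI,
        rule Deriv.has_derivative_inverse) (auto simp: algebra_simps)
  done

lemma cdiff_divide: "cdiff f z \<Longrightarrow> cdiff g z \<Longrightarrow> g z \<noteq> 0 \<Longrightarrow> cdiff (\<lambda>z. f z / g z) z"
  unfolding divide_inverse by (intro cdiff_mult cdiff_inverse)

lemma cdiff_power: "cdiff f z \<Longrightarrow> cdiff (\<lambda>z. f z ^ k) z"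
  by (induction k) (auto intro: cdiff_mult)

lemma cdiff_sum: "(\<And>i. i \<in> I \<Longrightarrow> cdiff (f i) z) \<Longrightarrow> cdiff (\<lambda>z. \<Sum>i\<in>I. f i z) z"
  by (induction I rule: infinite_finite_induct) (auto intro: cdiff_add)

lemma cdiff_prod: "(\<And>i. i \<in> I \<Longrightarrow> cdiff (f i) z) \<Longrightarrow> cdiff (\<lambda>z. \<Prod>i\<in>I. f i z) z"
  by (induction I rule: infinite_finite_induct) (auto intro: cdiff_mult)

lemma cdiff_transform:
  assumes "cdiff f z" "open U" "z \<in> U" "\<And>w. w \<in> U \<Longrightarrow> f w = g w"
  shows "cdiff g z"
proof -
  obtain f' where f': "(f has_derivative f') (at z)" "\<forall>c v. f' (c *s v) = c * f' v"
    using assms(1) unfolding cdiff_def by blast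
  have "(g has_derivative f') (at z)"
    by (rule has_derivative_transform_within_open[OF f'(1) assms(2-4)])
  then show ?thesis unfolding cdiff_def using f'(2) by blast
qed

lemma cdiff_continuous: "cdiff f z \<Longrightarrow> isCont f z"
  unfolding cdiff_def using has_derivative_continuous by blast

lemma mholomorphic_on_continuous: "f mholomorphic_on S \<Longrightarrow> continuous_on S f"
  unfolding mholomorphic_on_iff_cdiff
  by (intro continuous_at_imp_continuous_on ballI cdiff_continuous) auto

lemma vec_eq_sum_axis: "(z :: 'a::comm_monoid_add^'n::finite) = (\<Sum>i\<in>UNIV. axis i (z $ i))"
  by (simp add: vec_eq_iff sum_component axis_def if_distrib[of "\<lambda>g. g $ _"] cong: if_cong)

lemma norm_smult_vec: "norm (c *s (v :: complex^'n::finite)) = norm c * norm v"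
  by (simp add: norm_vec_def L2_set_def norm_mult power_mult_distrib real_sqrt_mult flip: sum_distrib_left)

lemma bounded_linear_axis: "bounded_linear (axis i :: complex \<Rightarrow> complex^'n::finite)"
proof (rule bounded_linear_intro[where K = 1])
  fix x y :: complex and r :: real
  show "(axis i (x + y) :: complex^'n) = axis i x + axis i y" by (simp add: vec_eq_iff axis_def)
  show "(axis i (r *\<^sub>R x) :: complex^'n) = r *\<^sub>R axis i x" by (simp add: vec_eq_iff axis_def)
  have "axis i x = x *s (axis i 1 :: complex^'n)" by (simp add: vec_eq_iff axis_def)
  then show "norm (axis i x :: complex^'n) \<le> norm x * 1" by (simp add: norm_smult_vec)
qed

lemma has_derivative_components:
  fixes F :: "complex^'n::finite \<Rightarrow> complex^'m::finite"
  assumes "\<And>i. ((\<lambda>z. F z $ i) has_derivative F' i) (at z)"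
  shows "(F has_derivative (\<lambda>v. \<chi> i. F' i v)) (at z)"
proof -
  have "((\<lambda>z. \<Sum>i\<in>UNIV. axis i (F z $ i)) has_derivative (\<lambda>v. \<Sum>i\<in>UNIV. axis i (F' i v))) (at z)"
    by (intro has_derivative_sum bounded_linear.has_derivative[OF bounded_linear_axis] assms)
  moreover have "(\<lambda>v. \<Sum>i\<in>UNIV. axis i (F' i v)) = (\<lambda>v. \<chi> i. F' i v)"
    using vec_eq_sum_axis[of "\<chi> i. F' i v" for v] by (auto simp: fun_eq_iff)
  ultimately show ?thesis by (simp flip: vec_eq_sum_axis)
qed

lemma cdiff_compose:
  assumes "\<And>i. cdiff (\<lambda>z. F z $ i) z" "cdiff g (F z)"
  shows "cdiff (\<lambda>z. g (F z)) z"
proof -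
  from assms(1) have "\<forall>i. \<exists>F'. ((\<lambda>z. F z $ i) has_derivative F') (at z) \<and> (\<forall>c v. F' (c *s v) = c * F' v)"
    by (simp add: cdiff_def)
  then obtain F' where F': "\<And>i. ((\<lambda>z. F z $ i) has_derivative F' i) (at z)" "\<And>i c v. F' i (c *s v) = c * F' i v"
    by metis
  obtain g' where g': "(g has_derivative g') (at (F z))" "\<forall>c v. g' (c *s v) = c * g' v"
    using assms(2) unfolding cdiff_def by blast
  have "((\<lambda>z. g (F z)) has_derivative (\<lambda>v. g' (\<chi> i. F' i v))) (at z)"
    using has_derivative_compose[OF has_derivative_components[OF F'(1)] g'(1)] .
  moreover have "g' (\<chi> i. F' i (c *s v)) = c * g' (\<chi> i. F' i v)" for c v
  proof -
    have "(\<chi> i. F' i (c *s v)) = c *s (\<chi> i. F' i v)" by (simp add: vec_eq_iff F'(2))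
    then show ?thesis using g'(2) by simp
  qed
  ultimately show ?thesis unfolding cdiff_def by blast
qed

lemma cdiff_translate: "cdiff f (z + a) \<Longrightarrow> cdiff (\<lambda>z. f (z + a)) z"
  by (rule cdiff_compose) (auto intro: cdiff_add)

lemma bounded_linear_smult_vec: "bounded_linear (\<lambda>h. h *s (v :: complex^'n::finite))"
proof (rule bounded_linear_intro[where K = "norm v"])
  fix x y :: complex and r :: real
  show "(x + y) *s v = x *s v + y *s v" by (simp add: vec_eq_iff algebra_simps)
  show "(r *\<^sub>R x) *s v = r *\<^sub>R (x *s v)" by (simp add: vec_eq_iff)
  show "norm (x *s v) \<le> norm x * norm v"
    by (simp add: norm_vec_def L2_set_def norm_mult power_mult_distrib real_sqrt_mult flip: sum_distrib_left)
qed

lemma has_field_derivative_line: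
  fixes v :: "complex^'n::finite"
  assumes "(f has_derivative f') (at (z + t *s v))" "\<forall>c v. f' (c *s v) = c * f' v"
  shows "((\<lambda>t. f (z + t *s v)) has_field_derivative f' v) (at t)"
proof -
  have "((\<lambda>t. z + t *s v) has_derivative (\<lambda>h. h *s v)) (at t)"
    using has_derivative_add[OF has_derivative_const[of z "at t"]
        bounded_linear_imp_has_derivative[OF bounded_linear_smult_vec[of v]]] by simp
  from has_derivative_compose[OF this assms(1)]
  have "((\<lambda>t. f (z + t *s v)) has_derivative (\<lambda>h. f' v * h)) (at t)"
    using assms(2) by (simp add: mult.commute)
  then show ?thesis unfolding has_field_derivative_def .
qed

lemma cdiff_line:
  assumes "cdiff f (z + t *s v)"
  shows "(\<lambda>t. f (z + t *s v)) field_differentiable (at t)"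
  using assms has_field_derivative_line unfolding cdiff_def field_differentiable_def by blast

lemma mholomorphic_on_line:
  assumes "f mholomorphic_on S" "\<And>t. t \<in> T \<Longrightarrow> z + t *s v \<in> S"
  shows "(\<lambda>t. f (z + t *s v)) holomorphic_on T"
  using assms unfolding holomorphic_on_def mholomorphic_on_iff_cdiff
  by (auto intro!: field_differentiable_at_within cdiff_line)

definition pderiv1 :: "'n::finite \<Rightarrow> (complex^'n \<Rightarrow> complex) \<Rightarrow> complex^'n \<Rightarrow> complex" where
  "pderiv1 i f z = deriv (\<lambda>t. f (z + t *s axis i 1)) 0"

lemma cdiff_has_derivative:
  assumes "cdiff f z"
  shows "(f has_derivative (\<lambda>v. \<Sum>i\<in>UNIV. pderiv1 i f z * v $ i)) (at z)"
proof -
  obtain f' where f': "(f has_derivative f') (at z)" "\<forall>c v. f' (c *s v) = c * f' v"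
    using assms unfolding cdiff_def by blast
  have pd: "f' (axis i 1) = pderiv1 i f z" for i
    unfolding pderiv1_def using has_field_derivative_line[of f f' z 0 "axis i 1"] f'
    by (intro DERIV_imp_deriv[symmetric]) simp
  have lin: "linear f'" using f'(1) has_derivative_bounded_linear bounded_linear.linear by blast
  have "f' v = (\<Sum>i\<in>UNIV. pderiv1 i f z * v $ i)" for v
  proof -
    have "v = (\<Sum>i\<in>UNIV. v $ i *s axis i 1)"
      by (simp add: vec_eq_iff sum_component axis_def if_distrib cong: if_cong)
    then have "f' v = f' (\<Sum>i\<in>UNIV. v $ i *s axis i 1)" by simp
    also have "\<dots> = (\<Sum>i\<in>UNIV. f' (v $ i *s axis i 1))" using lin by (rule linear_sum)
    also have "\<dots> = (\<Sum>i\<in>UNIV. pderiv1 i f z * v $ i)"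
      using f'(2) pd by (simp add: mult.commute)
    finally show ?thesis .
  qed
  then have "f' = (\<lambda>v. \<Sum>i\<in>UNIV. pderiv1 i f z * v $ i)" by blast
  then show ?thesis using f'(1) by simp
qed

section \<open>Cauchy integrals\<close>

text \<open>The circle of radius \<open>r\<close>, parametrized such that Cauchy integrals become plain averages over
  the unit interval.\<close>

definition circ :: "real \<Rightarrow> real \<Rightarrow> complex" where
  "circ r s = of_real r * exp (2 * of_real pi * \<i> * of_real s)"

lemma norm_circ [simp]: "norm (circ r s) = \<bar>r\<bar>"
  by (simp add: circ_def norm_mult norm_exp_eq_Re)

lemma circ_nonzero [simp]: "r \<noteq> 0 \<Longrightarrow> circ r s \<noteq> 0"
  by (simp add: circ_def)

lemma continuous_on_circ [continuous_intros]: "continuous_on A (circ r)"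
  unfolding circ_def[abs_def] by (intro continuous_intros)

lemma Cauchy_circ_integral:
  assumes "f holomorphic_on ball 0 R" "0 < r" "r < R"
  shows "(deriv ^^ k) f 0 / fact k = integral {0..1} (\<lambda>s. f (circ r s) / circ r s ^ k)"
proof -
  have "f holomorphic_on cball 0 r" using assms by (auto intro: holomorphic_on_subset)
  then have *: "contour_integral (circlepath 0 r) (\<lambda>u. f u/(u-0)^(Suc k)) = (2 * pi * \<i>) * (deriv ^^ k) f 0 / (fact k)"
    using assms by (intro Cauchy_contour_integral_circlepath holomorphic_on_imp_continuous_on)
      (auto intro: holomorphic_on_subset)
  have "contour_integral (circlepath 0 r) (\<lambda>u. f u/(u-0)^(Suc k)) =
     integral {0..1} (\<lambda>s. (2 * pi * \<i>) * (f (circ r s) / circ r s ^ k))"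
    unfolding contour_integral_integral vector_derivative_circlepath
    using assms(2) by (intro integral_cong) (simp add: circlepath circ_def field_simps)
  also have "\<dots> = (2 * pi * \<i>) * integral {0..1} (\<lambda>s. f (circ r s) / circ r s ^ k)"
    by (rule integral_mult_right)
  finally show ?thesis using * by (simp add: field_simps)
qed

text \<open>A partial derivative is a Cauchy integral, hence continuous.  This is what allows to
  differentiate under the integral sign below.\<close>

lemma continuous_on_pderiv1:
  fixes f :: "complex^'n::finite \<Rightarrow> complex"
  assumes "open S" "f mholomorphic_on S"
  shows "continuous_on S (pderiv1 i f)"
proof (rule continuous_at_imp_continuous_on, rule ballI)
  fix z0 assume "z0 \<in> S"
  then obtain R where R: "R > 0" "cball z0 R \<subseteq> S" using assms(1) open_contains_cball by blast
  define r where "r = R / 4"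
  have r: "r > 0" using R by (simp add: r_def)
  have mem: "z + t *s axis i 1 \<in> S" if "z \<in> ball z0 r" "norm t < 3 * r" for z t
  proof -
    have "norm (z0 - (z + t *s axis i 1)) \<le> norm (z0 - z) + norm (t *s (axis i 1 :: complex^'n))"
      using norm_triangle_ineq4[of "z0 - z" "t *s axis i 1"] by (simp add: algebra_simps)
    also have "\<dots> \<le> R" using that by (simp add: norm_smult_vec dist_norm r_def)
    finally show ?thesis using R(2) by (auto simp: dist_norm)
  qed
  have eq: "pderiv1 i f z = integral (cbox 0 1) (\<lambda>s. f (z + circ r s *s axis i 1) / circ r s)" if "z \<in> ball z0 r" for z
    unfolding pderiv1_def cbox_interval
    using Cauchy_circ_integral[of "\<lambda>t. f (z + t *s axis i 1)" "3 * r" r 1] r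
      mholomorphic_on_line[OF assms(2), of "ball 0 (3 * r)" z "axis i 1"] mem[OF that] by simp
  have "continuous_on (ball z0 r \<times> cbox 0 1) (\<lambda>(z, s). f (z + circ r s *s axis i 1) / circ r s)"
  proof -
    have c: "continuous_on S f" using assms(2) by (rule mholomorphic_on_continuous)
    have "continuous_on (ball z0 r \<times> cbox 0 1) (\<lambda>p. f (fst p + circ r (snd p) *s axis i 1) / circ r (snd p))"
      using r mem
      by (intro continuous_intros continuous_on_compose2[OF c] bounded_linear.continuous_on[OF bounded_linear_smult_vec]
           continuous_on_compose2[OF continuous_on_circ]) (auto intro!: mem)
    then show ?thesis by (simp add: case_prod_beta)
  qed
  from integral_continuous_on_param[OF this]
  have "continuous_on (ball z0 r) (pderiv1 i f)"
    by (subst continuous_on_cong[OF refl eq]) auto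
  then show "isCont (pderiv1 i f) z0" using r by (simp add: continuous_on_eq_continuous_at)
qed

text \<open>The source of holomorphic functions in what follows: coefficients of power series and the
  extensions in Riemann's theorem are integrals of this kind.\<close>

lemma mholomorphic_on_param_integral:
  fixes \<gamma> :: "real \<Rightarrow> complex^'n::finite"
  assumes U: "open U" "f mholomorphic_on U" and V: "open V"
    and \<gamma>: "continuous_on {0..1} \<gamma>" and w: "continuous_on {0..1} w"
    and VU: "\<And>z s. z \<in> V \<Longrightarrow> s \<in> {0..1} \<Longrightarrow> z + \<gamma> s \<in> U"
  shows "(\<lambda>z. integral {0..1} (\<lambda>s. w s * f (z + \<gamma> s))) mholomorphic_on V"
  unfolding mholomorphic_on_iff_cdiff
proof
  fix z0 assume "z0 \<in> V"
  then obtain r where r: "r > 0" "ball z0 r \<subseteq> V" using V open_contains_ball by blast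
  define Q :: "'n \<Rightarrow> (complex^'n) \<Rightarrow>\<^sub>L complex" where "Q i = Blinfun (\<lambda>v. v $ i)" for i
  have Q: "blinfun_apply (Q i) = (\<lambda>v. v $ i)" for i
    unfolding Q_def by (rule bounded_linear_Blinfun_apply) (rule bounded_linear_vec_nth)
  define fx where "fx z s = (\<Sum>i\<in>UNIV. blinfun_mult_right (w s * pderiv1 i f (z + \<gamma> s)) o\<^sub>L Q i)" for z s
  have fx: "blinfun_apply (fx z s) v = (\<Sum>i\<in>UNIV. w s * pderiv1 i f (z + \<gamma> s) * v $ i)" for z s v
    by (simp add: fx_def blinfun.sum_left Q blinfun_mult_right.rep_eq)
  have cf: "continuous_on U f" using U(2) by (rule mholomorphic_on_continuous)
  have cont1: "continuous_on {0..1} (\<lambda>s. w s * f (z + \<gamma> s))" if "z \<in> V" for z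
    using VU[OF that] by (intro continuous_intros w \<gamma> continuous_on_compose2[OF cf]) auto
  have cont: "continuous_on (ball z0 r \<times> cbox 0 1) (\<lambda>(z, s). fx z s)"
  proof -
    have "continuous_on (ball z0 r \<times> cbox 0 1)
        (\<lambda>p. \<Sum>i\<in>UNIV. blinfun_mult_right (w (snd p) * pderiv1 i f (fst p + \<gamma> (snd p))) o\<^sub>L Q i)"
      using r VU
      by (intro continuous_intros bounded_linear.continuous_on[OF bounded_linear_blinfun_mult_right]
            continuous_on_compose2[OF continuous_on_pderiv1[OF U]]
            continuous_on_compose2[OF w] continuous_on_compose2[OF \<gamma>]) auto
    then show ?thesis by (simp add: case_prod_beta fx_def)
  qed
  have "((\<lambda>z. integral (cbox 0 1) (\<lambda>s. w s * f (z + \<gamma> s))) has_derivative integral (cbox 0 1) (fx z0)) (at z0 within ball z0 r)"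
  proof (rule leibniz_rule[OF _ _ cont])
    fix z s assume zs: "z \<in> ball z0 r" "s \<in> cbox 0 (1::real)"
    then have "cdiff f (z + \<gamma> s)" using U(2) VU r unfolding mholomorphic_on_iff_cdiff by auto
    from cdiff_has_derivative[OF this]
    have "(f has_derivative (\<lambda>v. \<Sum>i\<in>UNIV. pderiv1 i f (z + \<gamma> s) * v $ i)) (at (z + \<gamma> s))" .
    have "((\<lambda>z. z + \<gamma> s) has_derivative (\<lambda>h. h)) (at z)" by (auto intro!: derivative_eq_intros)
    from has_derivative_compose[OF this, where g = f, OF \<open>(f has_derivative _) _\<close>]
    have "((\<lambda>z. f (z + \<gamma> s)) has_derivative (\<lambda>v. \<Sum>i\<in>UNIV. pderiv1 i f (z + \<gamma> s) * v $ i)) (at z)" .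
    then have "((\<lambda>z. w s * f (z + \<gamma> s)) has_derivative (\<lambda>v. w s * (\<Sum>i\<in>UNIV. pderiv1 i f (z + \<gamma> s) * v $ i))) (at z)"
      by (rule has_derivative_mult_right)
    also have "(\<lambda>v. w s * (\<Sum>i\<in>UNIV. pderiv1 i f (z + \<gamma> s) * v $ i)) = blinfun_apply (fx z s)"
      by (auto simp: fx sum_distrib_left mult.assoc)
    finally show "((\<lambda>z. w s * f (z + \<gamma> s)) has_derivative blinfun_apply (fx z s)) (at z within ball z0 r)"
      by (rule has_derivative_at_withinI)
  next
    fix z assume "z \<in> ball z0 r"
    then have "z \<in> V" using r by auto
    then show "(\<lambda>s. w s * f (z + \<gamma> s)) integrable_on cbox 0 1"
      using integrable_continuous_real[OF cont1] by simp
  qed (use r in auto)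
  then have d: "((\<lambda>z. integral {0..1} (\<lambda>s. w s * f (z + \<gamma> s))) has_derivative blinfun_apply (integral {0..1} (fx z0))) (at z0)"
    using r at_within_open[of z0 "ball z0 r"] by simp
  have "(\<lambda>s. (z0, s)) ` cbox 0 1 \<subseteq> ball z0 r \<times> cbox 0 (1::real)" using r by auto
  from continuous_on_compose2[OF cont continuous_on_Pair[OF continuous_on_const continuous_on_id] this]
  have "continuous_on (cbox 0 1) (fx z0)" by simp
  then have int: "fx z0 integrable_on {0..1}" using integrable_continuous_real by simp
  have "blinfun_apply (integral {0..1} (fx z0)) (c *s v) = c * blinfun_apply (integral {0..1} (fx z0)) v" for c v
  proof -
    have "blinfun_apply (integral {0..1} (fx z0)) (c *s v) = integral {0..1} (\<lambda>s. c * blinfun_apply (fx z0 s) v)"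
      using blinfun_apply_integral[OF int] by (simp add: fx sum_distrib_left mult_ac)
    also have "\<dots> = c * blinfun_apply (integral {0..1} (fx z0)) v"
      using blinfun_apply_integral[OF int] by simp
    finally show ?thesis .
  qed
  then show "cdiff (\<lambda>z. integral {0..1} (\<lambda>s. w s * f (z + \<gamma> s))) z0"
    unfolding cdiff_def using d by blast
qed

section \<open>Power series in several variables\<close>

definition vmonom :: "complex^'n::finite \<Rightarrow> nat^'n \<Rightarrow> complex" where
  "vmonom z \<alpha> = (\<Prod>i\<in>UNIV. (z $ i) ^ (\<alpha> $ i))"

definition polydisc :: "real \<Rightarrow> (complex^'n::finite) set" where
  "polydisc R = {z. \<forall>i. norm (z $ i) < R}"

definition wt :: "nat^'n::finite \<Rightarrow> nat" where
  "wt \<alpha> = (\<Sum>i\<in>UNIV. \<alpha> $ i)"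

definition setv :: "'a^'n \<Rightarrow> 'n::finite \<Rightarrow> 'a \<Rightarrow> 'a^'n" where
  "setv z i t = (\<chi> j. if j = i then t else z $ j)"

definition zeros :: "'n set \<Rightarrow> complex^'n \<Rightarrow> complex^'n::finite" where
  "zeros S z = (\<chi> j. if j \<in> S then 0 else z $ j)"

definition supp_in :: "'n set \<Rightarrow> (nat^'n::finite) set" where
  "supp_in S = {\<alpha>. \<forall>i. i \<notin> S \<longrightarrow> \<alpha> $ i = 0}"

lemma setv_nth [simp]: "setv z i t $ j = (if j = i then t else z $ j)"
  by (simp add: setv_def)

lemma zeros_nth [simp]: "zeros S z $ j = (if j \<in> S then 0 else z $ j)"
  by (simp add: zeros_def)

lemma open_polydisc [simp, intro]: "open (polydisc R)"
proof -
  have "polydisc R = (\<Inter>i. {z :: complex^'n. norm (z $ i) < R})" by (auto simp: polydisc_def)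
  also have "open \<dots>" by (intro open_INT ballI open_Collect_less continuous_intros) auto
  finally show ?thesis .
qed

lemma ball_subset_polydisc: "ball 0 R \<subseteq> polydisc R"
  unfolding polydisc_def by (auto intro: le_less_trans[OF Finite_Cartesian_Product.norm_nth_le])

lemma polydisc_subset_ball:
  assumes "0 < r"
  obtains R where "0 < R" "polydisc R \<subseteq> (ball 0 r :: (complex^'n::finite) set)"
proof
  define R where "R = r / (2 * real CARD('n))"
  have c: "0 < real CARD('n)" by (simp add: card_gt_0_iff)
  show "0 < R" using assms by (simp add: R_def)
  show "polydisc R \<subseteq> (ball 0 r :: (complex^'n) set)"
  proof
    fix z :: "complex^'n" assume "z \<in> polydisc R"
    have "norm z \<le> (\<Sum>i\<in>UNIV. norm (z $ i))" by (simp add: norm_vec_def L2_set_le_sum)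
    also have "\<dots> \<le> (\<Sum>i\<in>(UNIV::'n set). R)"
      using \<open>z \<in> polydisc R\<close> unfolding polydisc_def by (intro sum_mono) (auto intro: less_imp_le)
    also have "\<dots> = r / 2" using c by (simp add: R_def field_simps)
    finally show "z \<in> ball 0 r" using assms by simp
  qed
qed

lemma vmonom_bound:
  assumes "z \<in> polydisc \<rho>" "0 < \<rho>"
  shows "norm (vmonom z \<alpha>) / \<rho> ^ wt \<alpha> = (\<Prod>i\<in>UNIV. (norm (z $ i) / \<rho>) ^ (\<alpha> $ i))"
  using assms by (simp add: vmonom_def wt_def prod_norm[symmetric] norm_power power_sum prod_dividef power_divide)

lemma summable_geometric_vec:
  fixes x :: "'n::finite \<Rightarrow> real"
  assumes x: "\<And>i. 0 \<le> x i" "\<And>i. x i < 1"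
  shows "(\<lambda>\<alpha>::nat^'n. \<Prod>i\<in>UNIV. x i ^ (\<alpha> $ i)) summable_on UNIV"
proof (rule nonneg_bdd_above_summable_on)
  show "0 \<le> (\<Prod>i\<in>UNIV. x i ^ (\<alpha> $ i))" for \<alpha> :: "nat^'n" using x by (intro prod_nonneg) auto
  show "bdd_above (sum (\<lambda>\<alpha>. \<Prod>i\<in>UNIV. x i ^ (\<alpha> $ i)) ` {F::(nat^'n) set. F \<subseteq> UNIV \<and> finite F})"
  proof (rule bdd_aboveI2)
    fix F :: "(nat^'n) set" assume F: "F \<in> {F. F \<subseteq> UNIV \<and> finite F}"
    define N where "N = (\<Sum>\<alpha>\<in>F. wt \<alpha>)"
    have le: "\<alpha> $ i \<le> N" if "\<alpha> \<in> F" for \<alpha> i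
    proof -
      have "\<alpha> $ i \<le> wt \<alpha>" unfolding wt_def by (intro member_le_sum) auto
      also have "\<dots> \<le> N" unfolding N_def using that F by (intro member_le_sum) auto
      finally show ?thesis .
    qed
    let ?P = "PiE (UNIV::'n set) (\<lambda>_. {..N})"
    have inj: "inj_on vec_lambda ?P" by (auto simp: inj_on_def vec_lambda_inject)
    have "F \<subseteq> vec_lambda ` ?P"
    proof
      fix \<alpha> assume "\<alpha> \<in> F"
      then show "\<alpha> \<in> vec_lambda ` ?P"
        using le by (intro image_eqI[of _ _ "vec_nth \<alpha>"]) auto
    qed
    then have "(\<Sum>\<alpha>\<in>F. \<Prod>i\<in>UNIV. x i ^ (\<alpha> $ i)) \<le> (\<Sum>\<alpha>\<in>vec_lambda ` ?P. \<Prod>i\<in>UNIV. x i ^ (\<alpha> $ i))"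
      using x by (intro sum_mono2 finite_imageI finite_PiE) (auto intro!: prod_nonneg)
    also have "\<dots> = (\<Sum>g\<in>?P. \<Prod>i\<in>UNIV. x i ^ g i)" by (subst sum.reindex[OF inj]) simp
    also have "\<dots> = (\<Prod>i\<in>UNIV. \<Sum>k\<in>{..N}. x i ^ k)" by (rule prod_sum_PiE[symmetric]) auto
    also have "\<dots> \<le> (\<Prod>i\<in>UNIV. 1 / (1 - x i))"
    proof (rule prod_mono, intro conjI)
      fix i
      show "0 \<le> (\<Sum>k\<in>{..N}. x i ^ k)" using x by (intro sum_nonneg) auto
      have "(\<Sum>k\<in>{..N}. x i ^ k) \<le> (\<Sum>k. x i ^ k)"
        using x by (intro sum_le_suminf summable_geometric) auto
      also have "\<dots> = 1 / (1 - x i)" using x by (intro suminf_geometric) auto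
      finally show "(\<Sum>k\<in>{..N}. x i ^ k) \<le> 1 / (1 - x i)" .
    qed
    finally show "(\<Sum>\<alpha>\<in>F. \<Prod>i\<in>UNIV. x i ^ (\<alpha> $ i)) \<le> (\<Prod>i\<in>UNIV. 1 / (1 - x i))" .
  qed
qed

lemma abs_summable_power_series:
  fixes b :: "nat^'n::finite \<Rightarrow> complex"
  assumes "\<And>\<alpha>. \<alpha> \<in> A \<Longrightarrow> norm (b \<alpha>) \<le> M / \<rho> ^ wt \<alpha>" "z \<in> polydisc \<rho>" "0 < \<rho>"
  shows "(\<lambda>\<alpha>. norm (b \<alpha> * vmonom z \<alpha>)) summable_on A"
proof (rule Infinite_Sum.abs_summable_on_comparison_test')
  have "(\<lambda>\<alpha>::nat^'n. \<Prod>i\<in>UNIV. (norm (z $ i) / \<rho>) ^ (\<alpha> $ i)) summable_on UNIV"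
    using assms by (intro summable_geometric_vec) (auto simp: polydisc_def)
  then show "(\<lambda>\<alpha>::nat^'n. M * (\<Prod>i\<in>UNIV. (norm (z $ i) / \<rho>) ^ (\<alpha> $ i))) summable_on A"
    by (intro summable_on_cmult_right) (rule summable_on_subset_banach, auto)
  fix \<alpha> assume "\<alpha> \<in> A"
  then have "norm (b \<alpha> * vmonom z \<alpha>) \<le> M / \<rho> ^ wt \<alpha> * norm (vmonom z \<alpha>)"
    unfolding norm_mult using assms by (intro mult_right_mono) auto
  also have "\<dots> = M * (\<Prod>i\<in>UNIV. (norm (z $ i) / \<rho>) ^ (\<alpha> $ i))"
    unfolding vmonom_bound[OF assms(2,3), symmetric] by simp
  finally show "norm (b \<alpha> * vmonom z \<alpha>) \<le> M * (\<Prod>i\<in>UNIV. (norm (z $ i) / \<rho>) ^ (\<alpha> $ i))" .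
qed

lemma vmonom_setv:
  assumes "\<alpha> $ i = 0"
  shows "vmonom z (setv \<alpha> i n) = vmonom z \<alpha> * z $ i ^ n"
proof -
  have "vmonom z (setv \<alpha> i n) = z $ i ^ n * (\<Prod>j\<in>UNIV - {i}. z $ j ^ (\<alpha> $ j))"
    unfolding vmonom_def by (subst prod.remove[of _ i]) (auto intro!: prod.cong)
  also have "(\<Prod>j\<in>UNIV - {i}. z $ j ^ (\<alpha> $ j)) = vmonom z \<alpha>"
    unfolding vmonom_def by (subst (2) prod.remove[of _ i]) (auto simp: assms)
  finally show ?thesis by simp
qed

lemma wt_setv:
  assumes "\<alpha> $ i = 0"
  shows "wt (setv \<alpha> i n) = wt \<alpha> + n"
proof -
  have "wt (setv \<alpha> i n) = n + (\<Sum>j\<in>UNIV - {i}. \<alpha> $ j)"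
    unfolding wt_def by (subst sum.remove[of _ i]) (auto intro!: sum.cong)
  also have "(\<Sum>j\<in>UNIV - {i}. \<alpha> $ j) = wt \<alpha>"
    unfolding wt_def by (subst (2) sum.remove[of _ i]) (auto simp: assms)
  finally show ?thesis by simp
qed

lemma norm_integral_01_le:
  fixes f :: "real \<Rightarrow> complex"
  assumes "continuous_on {0..1} f" "\<And>s. s \<in> {0..1} \<Longrightarrow> norm (f s) \<le> B"
  shows "norm (integral {0..1} f) \<le> B"
  using integral_bound[of 0 1 f B] assms by simp

text \<open>Expand in one coordinate after the other.  After the coordinates in \<open>S\<close> the coefficients are
  still holomorphic functions of all variables, by their Cauchy integrals, and are evaluated at
  points where the coordinates in \<open>S\<close> vanish.  Cauchy's estimates make the iterated series
  absolutely summable, so that it may be regarded as one series over all exponents.\<close>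

lemma power_series_partial:
  fixes f :: "complex^'n::finite \<Rightarrow> complex"
  assumes f: "f mholomorphic_on polydisc R" "\<And>z. z \<in> polydisc R \<Longrightarrow> norm (f z) \<le> M"
    and \<rho>: "0 < \<rho>" "\<rho> < R" and "finite S"
  shows "\<exists>b. (\<forall>\<alpha>\<in>supp_in S. b \<alpha> mholomorphic_on polydisc R \<and>
              (\<forall>z\<in>polydisc R. norm (b \<alpha> z) \<le> M / \<rho> ^ wt \<alpha>)) \<and>
           (\<forall>z\<in>polydisc \<rho>. ((\<lambda>\<alpha>. b \<alpha> (zeros S z) * vmonom z \<alpha>) has_sum f z) (supp_in S))"
  using \<open>finite S\<close>
proof (induction S rule: finite_induct)
  case empty
  have A: "supp_in {} = {0 :: nat^'n}" by (auto simp: supp_in_def vec_eq_iff)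
  have z: "zeros {} z = z" for z :: "complex^'n" by (simp add: vec_eq_iff)
  have "((\<lambda>\<alpha>. f z * vmonom z \<alpha>) has_sum f z) {0}" for z
    using has_sum_finite[of "{0}" "\<lambda>\<alpha>. f z * vmonom z \<alpha>"] by (simp add: vmonom_def)
  then show ?case unfolding A using f
    by (intro exI[of _ "\<lambda>_. f"]) (simp add: z wt_def)
next
  case (insert i S)
  then obtain b where b: "\<And>\<alpha>. \<alpha> \<in> supp_in S \<Longrightarrow> b \<alpha> mholomorphic_on polydisc R"
    "\<And>\<alpha> z. \<alpha> \<in> supp_in S \<Longrightarrow> z \<in> polydisc R \<Longrightarrow> norm (b \<alpha> z) \<le> M / \<rho> ^ wt \<alpha>"
    "\<And>z. z \<in> polydisc \<rho> \<Longrightarrow> ((\<lambda>\<alpha>. b \<alpha> (zeros S z) * vmonom z \<alpha>) has_sum f z) (supp_in S)"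
    by blast
  define c where "c \<beta> z = integral {0..1} (\<lambda>s. b (setv \<beta> i 0) (setv z i (circ \<rho> s)) / circ \<rho> s ^ (\<beta> $ i))" for \<beta> z
  have setv_line: "setv z i t = setv z i 0 + t *s axis i 1" for z :: "complex^'n" and t
    by (simp add: vec_eq_iff axis_def)
  have supp0: "setv \<beta> i 0 \<in> supp_in S" if "\<beta> \<in> supp_in (insert i S)" for \<beta>
    using that by (auto simp: supp_in_def)
  have supp1: "setv \<alpha> i n \<in> supp_in (insert i S)" "setv (setv \<alpha> i n) i 0 = \<alpha>" "\<alpha> $ i = 0" if "\<alpha> \<in> supp_in S" for \<alpha> n
    using that insert.hyps by (auto simp: supp_in_def vec_eq_iff)
  have mem: "setv z i t \<in> polydisc R" if "z \<in> polydisc R" "norm t < R" for z t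
    using that by (auto simp: polydisc_def)
  have wt0: "wt (setv \<beta> i 0) + \<beta> $ i = wt \<beta>" for \<beta> :: "nat^'n"
    using wt_setv[of "setv \<beta> i 0" i "\<beta> $ i"] by (simp add: setv_def vec_lambda_eta if_distrib cong: if_cong)
      (smt (verit, del_insts) vec_lambda_eta vec_lambda_unique)
  have hol: "c \<beta> mholomorphic_on polydisc R" if \<beta>: "\<beta> \<in> supp_in (insert i S)" for \<beta>
    unfolding mholomorphic_on_iff_cdiff
  proof
    fix z :: "complex^'n" assume z: "z \<in> polydisc R"
    \<comment> \<open>The integrand uses \<open>z\<close> only with its \<open>i\<close>-th coordinate replaced, so it suffices to differentiate
      where this coordinate is small.\<close>
    let ?V = "{z :: complex^'n. norm (z $ i) < R - \<rho>} \<inter> polydisc R"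
    have V: "open ?V"
      by (intro open_Int open_Collect_less continuous_intros) auto
    have "(\<lambda>z. integral {0..1} (\<lambda>s. inverse (circ \<rho> s ^ (\<beta> $ i)) * b (setv \<beta> i 0) (z + axis i (circ \<rho> s)))) mholomorphic_on ?V"
    proof (rule mholomorphic_on_param_integral[OF open_polydisc b(1)[OF supp0[OF \<beta>]] V])
      show "continuous_on {0..1} (\<lambda>s. axis i (circ \<rho> s))"
        by (intro bounded_linear.continuous_on[OF bounded_linear_axis] continuous_on_circ)
      show "continuous_on {0..1} (\<lambda>s. inverse (circ \<rho> s ^ (\<beta> $ i)))"
        using \<rho> by (intro continuous_intros) auto
      fix z :: "complex^'n" and s :: real assume z: "z \<in> ?V"
      show "z + axis i (circ \<rho> s) \<in> polydisc R"
        unfolding polydisc_def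
      proof safe
        fix j
        show "cmod ((z + axis i (circ \<rho> s)) $ j) < R"
          using z \<rho> norm_triangle_ineq[of "z $ i" "circ \<rho> s"] by (auto simp: axis_def polydisc_def)
      qed
    qed
    moreover have "setv z i 0 \<in> ?V" using z \<rho> by (auto simp: polydisc_def)
    ultimately have "cdiff (\<lambda>z. integral {0..1} (\<lambda>s. inverse (circ \<rho> s ^ (\<beta> $ i)) * b (setv \<beta> i 0) (z + axis i (circ \<rho> s)))) (setv z i 0)"
      unfolding mholomorphic_on_iff_cdiff by blast
    then have "cdiff (\<lambda>z. integral {0..1} (\<lambda>s. inverse (circ \<rho> s ^ (\<beta> $ i)) * b (setv \<beta> i 0) (setv z i 0 + axis i (circ \<rho> s)))) z"
    proof (rule cdiff_compose[rotated])
      show "cdiff (\<lambda>z. setv z i 0 $ j) z" for j by (cases "j = i") auto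
    qed
    moreover have "setv z i 0 + axis i t = setv z i t" for z :: "complex^'n" and t
      by (simp add: vec_eq_iff axis_def)
    ultimately show "cdiff (c \<beta>) z"
      by (simp add: c_def[abs_def] divide_inverse mult.commute)
  qed
  have bound: "norm (c \<beta> z) \<le> M / \<rho> ^ wt \<beta>" if \<beta>: "\<beta> \<in> supp_in (insert i S)" and z: "z \<in> polydisc R" for \<beta> z
    unfolding c_def
  proof (rule norm_integral_01_le)
    have cb: "continuous_on (polydisc R) (b (setv \<beta> i 0))"
      using b(1)[OF supp0[OF \<beta>]] by (rule mholomorphic_on_continuous)
    have "continuous_on {0..1} (\<lambda>s. setv z i (circ \<rho> s))"
      unfolding setv_line[of z "circ \<rho> _"]
      by (intro continuous_intros bounded_linear.continuous_on[OF bounded_linear_smult_vec])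
    then show "continuous_on {0..1} (\<lambda>s. b (setv \<beta> i 0) (setv z i (circ \<rho> s)) / circ \<rho> s ^ (\<beta> $ i))"
      using \<rho> z by (intro continuous_intros continuous_on_compose2[OF cb]) (auto intro!: mem)
    fix s :: real
    have "norm (b (setv \<beta> i 0) (setv z i (circ \<rho> s))) \<le> M / \<rho> ^ wt (setv \<beta> i 0)"
      using \<rho> z by (intro b(2) supp0 \<beta> mem) auto
    then have "norm (b (setv \<beta> i 0) (setv z i (circ \<rho> s))) / \<rho> ^ (\<beta> $ i) \<le> M / \<rho> ^ wt (setv \<beta> i 0) / \<rho> ^ (\<beta> $ i)"
      using \<rho> by (intro divide_right_mono) auto
    also have "\<dots> = M / \<rho> ^ wt \<beta>" by (simp add: power_add flip: wt0[of \<beta>])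
    finally show "norm (b (setv \<beta> i 0) (setv z i (circ \<rho> s)) / circ \<rho> s ^ (\<beta> $ i)) \<le> M / \<rho> ^ wt \<beta>"
      using \<rho> by (simp add: norm_divide norm_power)
  qed
  have zR: "zeros T z \<in> polydisc R" if "z \<in> polydisc \<rho>" for z :: "complex^'n" and T
    using that \<rho> by (auto simp: polydisc_def intro: less_trans)
  have sum: "((\<lambda>\<beta>. c \<beta> (zeros (insert i S) z) * vmonom z \<beta>) has_sum f z) (supp_in (insert i S))"
    if z: "z \<in> polydisc \<rho>" for z
  proof -
    let ?w = "zeros (insert i S) z"
    let ?h = "\<lambda>(\<alpha>, n). c (setv \<alpha> i n) ?w * vmonom z (setv \<alpha> i n)"
    have zi: "norm (z $ i) < \<rho>" using z by (auto simp: polydisc_def)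
    have inner: "((\<lambda>n. ?h (\<alpha>, n)) has_sum (b \<alpha> (zeros S z) * vmonom z \<alpha>)) UNIV" if \<alpha>: "\<alpha> \<in> supp_in S" for \<alpha>
    proof -
      define g where "g t = b \<alpha> (setv ?w i t)" for t
      have g_eq: "g = (\<lambda>t. b \<alpha> (setv ?w i 0 + t *s axis i 1))"
        unfolding g_def[abs_def] by (subst setv_line) (rule refl)
      have "setv ?w i 0 + t *s axis i 1 \<in> polydisc R" if "t \<in> ball 0 R" for t
      proof -
        have "setv ?w i t \<in> polydisc R" using mem[OF zR[OF z], of t] that by simp
        then show ?thesis by (subst (asm) setv_line)
      qed
      then have "g holomorphic_on ball 0 R"
        unfolding g_eq by (rule mholomorphic_on_line[OF b(1)[OF \<alpha>]])
      note g = this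
      have coeff: "(deriv ^^ n) g 0 / fact n = c (setv \<alpha> i n) ?w" for n
        unfolding Cauchy_circ_integral[OF g \<rho>] c_def supp1(2)[OF \<alpha>] g_def by simp
      have "z $ i \<in> ball 0 R" using zi \<rho> by simp
      from holomorphic_power_series[OF g this]
      have ser: "(\<lambda>n. c (setv \<alpha> i n) ?w * z $ i ^ n) sums g (z $ i)"
        by (simp only: coeff diff_zero)
      have "summable (\<lambda>n. norm (c (setv \<alpha> i n) ?w * z $ i ^ n))"
      proof (rule summable_comparison_test')
        show "summable (\<lambda>n. M / \<rho> ^ wt \<alpha> * (norm (z $ i) / \<rho>) ^ n)"
          using zi \<rho> by (intro summable_mult summable_geometric) simp
        fix n
        have "norm (c (setv \<alpha> i n) ?w) * norm (z $ i) ^ n \<le> M / \<rho> ^ wt (setv \<alpha> i n) * norm (z $ i) ^ n"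
          by (intro mult_right_mono bound supp1 \<alpha> zR z) auto
        then show "norm (norm (c (setv \<alpha> i n) ?w * z $ i ^ n)) \<le> M / \<rho> ^ wt \<alpha> * (norm (z $ i) / \<rho>) ^ n"
          using supp1(3)[OF \<alpha>] by (simp add: norm_mult norm_power wt_setv power_add power_divide)
      qed
      then have "((\<lambda>n. c (setv \<alpha> i n) ?w * z $ i ^ n) has_sum g (z $ i)) UNIV"
        by (rule norm_summable_imp_has_sum) (rule ser)
      moreover have "g (z $ i) = b \<alpha> (zeros S z)"
      proof -
        have "setv ?w i (z $ i) = zeros S z" using insert.hyps by (simp add: vec_eq_iff)
        then show ?thesis by (simp add: g_def)
      qed
      ultimately have "((\<lambda>n. c (setv \<alpha> i n) ?w * z $ i ^ n * vmonom z \<alpha>) has_sum (b \<alpha> (zeros S z) * vmonom z \<alpha>)) UNIV"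
        by (intro has_sum_cmult_left) simp
      then show ?thesis using supp1(3)[OF \<alpha>] by (simp add: vmonom_setv mult_ac)
    qed
    have bij: "bij_betw (\<lambda>(\<alpha>, n). setv \<alpha> i n) (supp_in S \<times> UNIV) (supp_in (insert i S))"
      by (rule bij_betw_byWitness[where f' = "\<lambda>\<beta>. (setv \<beta> i 0, \<beta> $ i)"])
        (use supp0 supp1 in \<open>auto simp: vec_eq_iff\<close>)
    have "(\<lambda>\<beta>. norm (c \<beta> ?w * vmonom z \<beta>)) summable_on supp_in (insert i S)"
      using bound zR[OF z] z \<rho> by (intro abs_summable_power_series) auto
    then have "(\<lambda>\<beta>. c \<beta> ?w * vmonom z \<beta>) summable_on supp_in (insert i S)" by (rule abs_summable_summable)
    then have "?h summable_on supp_in S \<times> UNIV"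
      using summable_on_reindex_bij_betw[OF bij, of "\<lambda>\<beta>. c \<beta> ?w * vmonom z \<beta>"] by (simp add: case_prod_beta')
    from has_sum_SigmaI[OF inner b(3)[OF z] this]
    have "(?h has_sum f z) (supp_in S \<times> UNIV)" .
    then show ?thesis
      using has_sum_reindex_bij_betw[OF bij, of "\<lambda>\<beta>. c \<beta> ?w * vmonom z \<beta>"] by (simp add: case_prod_beta')
  qed
  show ?case using hol bound sum by (intro exI[of _ c]) blast
qed

theorem power_series_exists:
  fixes f :: "complex^'n::finite \<Rightarrow> complex"
  assumes f: "f mholomorphic_on polydisc R" "\<And>z. z \<in> polydisc R \<Longrightarrow> norm (f z) \<le> M"
    and \<rho>: "0 < \<rho>" "\<rho> < R"
  shows "\<exists>b. (\<forall>\<alpha>. norm (b \<alpha>) \<le> M / \<rho> ^ wt \<alpha>) \<and>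
    (\<forall>z\<in>polydisc \<rho>. ((\<lambda>\<alpha>. b \<alpha> * vmonom z \<alpha>) has_sum f z) UNIV)"
proof -
  have U: "supp_in UNIV = (UNIV :: (nat^'n) set)" by (auto simp: supp_in_def)
  have z: "zeros UNIV z = 0" for z :: "complex^'n" by (simp add: vec_eq_iff)
  obtain b where "\<forall>\<alpha>\<in>supp_in UNIV. b \<alpha> mholomorphic_on polydisc R \<and>
              (\<forall>z\<in>polydisc R. norm (b \<alpha> z) \<le> M / \<rho> ^ wt \<alpha>)"
           "\<forall>z\<in>polydisc \<rho>. ((\<lambda>\<alpha>. b \<alpha> (zeros UNIV z) * vmonom z \<alpha>) has_sum f z) (supp_in UNIV)"
    using power_series_partial[OF f \<rho> finite_class.finite_UNIV] by blast
  moreover have "0 \<in> polydisc R" using \<rho> by (simp add: polydisc_def)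
  ultimately show ?thesis unfolding U z by (intro exI[of _ "\<lambda>\<alpha>. b \<alpha> 0"]) auto
qed

lemma powser_zero_unique:
  fixes c :: "nat \<Rightarrow> complex"
  assumes "0 < \<epsilon>" "\<And>t. norm t < \<epsilon> \<Longrightarrow> ((\<lambda>k. c k * t ^ k) has_sum 0) UNIV"
  shows "c k = 0"
proof (rule ccontr)
  assume k: "c k \<noteq> 0"
  have sums: "(\<lambda>k. c k * t ^ k) sums 0" if "norm t < \<epsilon>" for t
    using assms(2)[OF that] by (rule has_sum_imp_sums)
  have "c 0 = 0" using sums[of 0] assms(1) by simp
  then have "k > 0" using k by (cases k) auto
  have "\<exists>s>0. \<forall>z\<in>cball 0 s - {0 :: complex}. (0 :: complex) \<noteq> 0"
    by (rule powser_0_nonzero[OF assms(1), of 0 c "\<lambda>_. 0" k]) (use sums k \<open>k > 0\<close> in \<open>simp_all, blast\<close>)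
  then obtain s where s: "0 < s" "\<forall>z\<in>cball 0 s - {0 :: complex}. (0 :: complex) \<noteq> 0" by blast
  have "of_real s \<in> cball 0 s - {0 :: complex}" using s(1) by simp
  then show False using s(2) by blast
qed

text \<open>Successive comparison of coefficients: fixing the exponents of the coordinates in \<open>S\<close> leaves a
  series in the others that still vanishes identically.\<close>

lemma power_series_zero_unique:
  fixes b :: "nat^'n::finite \<Rightarrow> complex"
  assumes \<epsilon>: "0 < \<epsilon>" and b: "\<And>z. z \<in> polydisc \<epsilon> \<Longrightarrow> ((\<lambda>\<alpha>. b \<alpha> * vmonom z \<alpha>) has_sum 0) UNIV"
  shows "b \<alpha> = 0"
proof -
  have main: "\<forall>\<kappa>. \<forall>z\<in>polydisc \<epsilon>. ((\<lambda>\<alpha>. b \<alpha> * (\<Prod>i\<in>-S. z $ i ^ (\<alpha> $ i))) has_sum 0) {\<alpha>. \<forall>i\<in>S. \<alpha> $ i = \<kappa> $ i}"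
    if "finite S" for S :: "'n set"
    using that
  proof (induction S rule: finite_induct)
    case empty then show ?case using b by (simp add: vmonom_def)
  next
    case (insert i S)
    show ?case
    proof (intro allI ballI)
      fix \<kappa> :: "nat^'n" and z :: "complex^'n" assume z: "z \<in> polydisc \<epsilon>"
      let ?A = "{\<alpha>. \<forall>i\<in>S. \<alpha> $ i = \<kappa> $ i}"
      let ?B = "\<lambda>k. {\<alpha>. (\<forall>i\<in>S. \<alpha> $ i = \<kappa> $ i) \<and> \<alpha> $ i = k}"
      let ?p = "\<lambda>z \<alpha>. b \<alpha> * (\<Prod>j\<in>-S. z $ j ^ (\<alpha> $ j))"
      let ?q = "\<lambda>\<alpha>. b \<alpha> * (\<Prod>j\<in>-insert i S. z $ j ^ (\<alpha> $ j))"
      have split: "- S = insert i (- insert i S)" using insert.hyps by auto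
      have pq: "?p (setv z i t) \<alpha> = ?q \<alpha> * t ^ (\<alpha> $ i)" for t \<alpha>
      proof -
        have "(\<Prod>j\<in>-S. setv z i t $ j ^ (\<alpha> $ j)) = t ^ (\<alpha> $ i) * (\<Prod>j\<in>-insert i S. setv z i t $ j ^ (\<alpha> $ j))"
          by (subst split, subst prod.insert) auto
        also have "(\<Prod>j\<in>-insert i S. setv z i t $ j ^ (\<alpha> $ j)) = (\<Prod>j\<in>-insert i S. z $ j ^ (\<alpha> $ j))"
          by (intro prod.cong) auto
        finally show ?thesis by simp
      qed
      have bij: "bij_betw snd (Sigma UNIV ?B) ?A"
        by (rule bij_betw_byWitness[where f' = "\<lambda>\<alpha>. (\<alpha> $ i, \<alpha>)"]) auto
      have full: "((\<lambda>(k, \<alpha>). ?q \<alpha> * t ^ k) has_sum 0) (Sigma UNIV ?B)" if "norm t < \<epsilon>" for t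
      proof -
        have "setv z i t \<in> polydisc \<epsilon>" using z that by (auto simp: polydisc_def)
        then have "(?p (setv z i t) has_sum 0) ?A" using insert.IH by blast
        then have "((\<lambda>x. ?p (setv z i t) (snd x)) has_sum 0) (Sigma UNIV ?B)"
          using has_sum_reindex_bij_betw[OF bij, of "?p (setv z i t)"] by simp
        then show ?thesis
        proof (rule has_sum_cong[THEN iffD1, rotated])
          fix x assume "x \<in> Sigma UNIV ?B"
          then obtain \<alpha> where x: "x = (\<alpha> $ i, \<alpha>)" by auto
          show "?p (setv z i t) (snd x) = (case x of (k, \<alpha>) \<Rightarrow> ?q \<alpha> * t ^ k)"
            by (simp only: x pq snd_conv prod.case)
        qed
      qed
      define t1 where "t1 = complex_of_real (\<epsilon> / 2)"
      have t1: "norm t1 < \<epsilon>" "t1 \<noteq> 0" using \<epsilon> by (auto simp: t1_def)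
      have summ: "?q summable_on ?B k" for k
      proof -
        have "(\<lambda>(k, \<alpha>). ?q \<alpha> * t1 ^ k) summable_on Sigma UNIV ?B"
          using full[OF t1(1)] by (rule has_sum_imp_summable)
        then have "(\<lambda>\<alpha>. ?q \<alpha> * t1 ^ k) summable_on ?B k"
          by (rule summable_on_SigmaD1[of "\<lambda>k \<alpha>. ?q \<alpha> * t1 ^ k"]) simp
        then show ?thesis using t1(2) summable_on_cmult_left'[of "t1 ^ k" ?q "?B k"] by simp
      qed
      define c where "c k = (\<Sum>\<^sub>\<infinity>\<alpha>\<in>?B k. ?q \<alpha>)" for k
      have c: "(?q has_sum c k) (?B k)" for k unfolding c_def using summ by (rule has_sum_infsum)
      have "((\<lambda>k. c k * t ^ k) has_sum 0) UNIV" if t: "norm t < \<epsilon>" for t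
        by (rule has_sum_SigmaD[OF full[OF t]]) (simp add: has_sum_cmult_left c)
      then have "c k = 0" for k using powser_zero_unique[OF \<epsilon>] by blast
      moreover have "?B (\<kappa> $ i) = {\<alpha>. \<forall>i\<in>insert i S. \<alpha> $ i = \<kappa> $ i}" by auto
      ultimately show "(?q has_sum 0) {\<alpha>. \<forall>i\<in>insert i S. \<alpha> $ i = \<kappa> $ i}" using c[of "\<kappa> $ i"] by simp
    qed
  qed
  have "0 \<in> polydisc \<epsilon>" using \<epsilon> by (simp add: polydisc_def)
  from main[OF finite_class.finite_UNIV, rule_format, OF this, of \<alpha>]
  have "(b has_sum 0) {\<beta>. \<forall>i. \<beta> $ i = \<alpha> $ i}" by simp
  moreover have "{\<beta>. \<forall>i. \<beta> $ i = \<alpha> $ i} = {\<alpha>}" by (auto simp: vec_eq_iff)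
  ultimately have "(b has_sum 0) {\<alpha>}" by simp
  moreover have "(b has_sum b \<alpha>) {\<alpha>}" using has_sum_finite[of "{\<alpha>}" b] by simp
  ultimately show ?thesis using has_sum_unique by blast
qed

lemma power_series_at_0_iff:
  "power_series_at_0 f b \<longleftrightarrow> (\<exists>\<epsilon>>0. \<forall>z\<in>ball 0 \<epsilon>. ((\<lambda>\<alpha>. b \<alpha> * vmonom z \<alpha>) has_sum f z) UNIV)"
  unfolding power_series_at_0_def vmonom_def ..

lemma power_series_at_0_unique:
  assumes "power_series_at_0 f b" "power_series_at_0 f c"
  shows "b = c"
proof
  fix \<alpha>
  obtain \<epsilon>1 where e1: "\<epsilon>1 > 0" "\<And>z. z \<in> ball 0 \<epsilon>1 \<Longrightarrow> ((\<lambda>\<alpha>. b \<alpha> * vmonom z \<alpha>) has_sum f z) UNIV"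
    using assms(1) unfolding power_series_at_0_iff by blast
  obtain \<epsilon>2 where e2: "\<epsilon>2 > 0" "\<And>z. z \<in> ball 0 \<epsilon>2 \<Longrightarrow> ((\<lambda>\<alpha>. c \<alpha> * vmonom z \<alpha>) has_sum f z) UNIV"
    using assms(2) unfolding power_series_at_0_iff by blast
  have "min \<epsilon>1 \<epsilon>2 > 0" using e1 e2 by simp
  then obtain R where R: "0 < R" "polydisc R \<subseteq> (ball 0 (min \<epsilon>1 \<epsilon>2) :: (complex^'a) set)"
    by (rule polydisc_subset_ball)
  have "b \<alpha> - c \<alpha> = 0"
  proof (rule power_series_zero_unique[OF R(1)])
    fix z :: "complex^'a" assume "z \<in> polydisc R"
    then have z: "z \<in> ball 0 \<epsilon>1" "z \<in> ball 0 \<epsilon>2" using R(2) by auto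
    show "((\<lambda>\<alpha>. (b \<alpha> - c \<alpha>) * vmonom z \<alpha>) has_sum 0) UNIV"
      using has_sum_add[OF e1(2)[OF z(1)] has_sum_cmult_right[OF e2(2)[OF z(2)], of "- 1"]]
      by (simp add: left_diff_distrib)
  qed
  then show "b \<alpha> = c \<alpha>" by simp
qed

lemma power_series_at_0_cong:
  assumes "power_series_at_0 f b" "open U" "0 \<in> U" "\<And>z. z \<in> U \<Longrightarrow> f z = g z"
  shows "power_series_at_0 g b"
proof -
  obtain \<epsilon> where e: "\<epsilon> > 0" "\<And>z. z \<in> ball 0 \<epsilon> \<Longrightarrow> ((\<lambda>\<alpha>. b \<alpha> * vmonom z \<alpha>) has_sum f z) UNIV"
    using assms(1) unfolding power_series_at_0_iff by blast
  obtain \<delta> where d: "\<delta> > 0" "ball 0 \<delta> \<subseteq> U" using assms(2,3) open_contains_ball by blast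
  have "((\<lambda>\<alpha>. b \<alpha> * vmonom z \<alpha>) has_sum g z) UNIV" if "z \<in> ball 0 (min \<epsilon> \<delta>)" for z
    using e(2)[of z] assms(4)[of z] d(2) that by (simp add: subset_iff)
  then show ?thesis unfolding power_series_at_0_iff using e d by (intro exI[of _ "min \<epsilon> \<delta>"]) auto
qed

lemma power_series_at_0_exists:
  fixes f :: "complex^'n::finite \<Rightarrow> complex"
  assumes "open U" "0 \<in> U" "f mholomorphic_on U"
  obtains b where "power_series_at_0 f b"
proof -
  have "isCont f 0" using assms unfolding mholomorphic_on_iff_cdiff by (intro cdiff_continuous) auto
  then obtain d where d: "d > 0" "\<And>z. norm z < d \<Longrightarrow> norm (f z - f 0) < 1"
    unfolding continuous_at_eps_delta by (auto simp: dist_norm dest: spec[of _ 1])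
  obtain r where r: "r > 0" "ball 0 r \<subseteq> U" using assms(1,2) open_contains_ball by blast
  have "min d r > 0" using d r by simp
  then obtain R where R: "0 < R" "polydisc R \<subseteq> (ball 0 (min d r) :: (complex^'n) set)"
    by (rule polydisc_subset_ball)
  have "polydisc R \<subseteq> U" using R(2) r(2) by force
  then have "f mholomorphic_on polydisc R"
    using assms(3) unfolding mholomorphic_on_iff_cdiff by blast
  moreover have "norm (f z) \<le> norm (f 0) + 1" if "z \<in> polydisc R" for z
    using d(2)[of z] R(2) that norm_triangle_sub[of "f z" "f 0"] by auto
  ultimately have "\<exists>b. (\<forall>\<alpha>. norm (b \<alpha>) \<le> (norm (f 0) + 1) / (R / 2) ^ wt \<alpha>) \<and>
    (\<forall>z\<in>polydisc (R / 2). ((\<lambda>\<alpha>. b \<alpha> * vmonom z \<alpha>) has_sum f z) UNIV)"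
    using R(1) by (intro power_series_exists[of f R]) auto
  then obtain b where "\<And>\<alpha>. norm (b \<alpha>) \<le> (norm (f 0) + 1) / (R / 2) ^ wt \<alpha>"
    "\<And>z. z \<in> polydisc (R / 2) \<Longrightarrow> ((\<lambda>\<alpha>. b \<alpha> * vmonom z \<alpha>) has_sum f z) UNIV"
    by blast
  then have "power_series_at_0 f b" unfolding power_series_at_0_iff
    using R(1) ball_subset_polydisc[of "R / 2"] by (intro exI[of _ "R / 2"]) auto
  then show ?thesis by (rule that)
qed

lemma power_series_at_0_Cauchy:
  fixes f :: "complex^'n::finite \<Rightarrow> complex"
  assumes "power_series_at_0 f b" "f mholomorphic_on polydisc R" "\<And>z. z \<in> polydisc R \<Longrightarrow> norm (f z) \<le> M" "0 < \<rho>" "\<rho> < R"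
  shows "norm (b \<alpha>) \<le> M / \<rho> ^ wt \<alpha>"
proof -
  obtain c where c: "\<And>\<alpha>. norm (c \<alpha>) \<le> M / \<rho> ^ wt \<alpha>"
    "\<And>z. z \<in> polydisc \<rho> \<Longrightarrow> ((\<lambda>\<alpha>. c \<alpha> * vmonom z \<alpha>) has_sum f z) UNIV"
    using power_series_exists[OF assms(2-5)] by blast
  have "power_series_at_0 f c" unfolding power_series_at_0_iff
    using assms(4) ball_subset_polydisc[of \<rho>] c(2) by (intro exI[of _ \<rho>]) auto
  then show ?thesis using power_series_at_0_unique[OF assms(1)] c(1) by simp
qed

lemma power_series_at_0_sum:
  assumes "\<And>u. u \<in> I \<Longrightarrow> power_series_at_0 (f u) (b u)" "finite I"
  shows "power_series_at_0 (\<lambda>z. \<Sum>u\<in>I. c u * f u z) (\<lambda>\<alpha>. \<Sum>u\<in>I. c u * b u \<alpha>)"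
  using assms(2,1)
proof (induction I rule: finite_induct)
  case empty then show ?case unfolding power_series_at_0_iff by (intro exI[of _ 1]) auto
next
  case (insert u I)
  from insert have "power_series_at_0 (\<lambda>z. \<Sum>u\<in>I. c u * f u z) (\<lambda>\<alpha>. \<Sum>u\<in>I. c u * b u \<alpha>)" by blast
  then obtain \<epsilon>1 where e1: "\<epsilon>1 > 0" "\<And>z. z \<in> ball 0 \<epsilon>1 \<Longrightarrow> ((\<lambda>\<alpha>. (\<Sum>u\<in>I. c u * b u \<alpha>) * vmonom z \<alpha>) has_sum (\<Sum>u\<in>I. c u * f u z)) UNIV"
    unfolding power_series_at_0_iff by blast
  obtain \<epsilon>2 where e2: "\<epsilon>2 > 0" "\<And>z. z \<in> ball 0 \<epsilon>2 \<Longrightarrow> ((\<lambda>\<alpha>. b u \<alpha> * vmonom z \<alpha>) has_sum f u z) UNIV"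
    using insert.prems[of u] unfolding power_series_at_0_iff by blast
  have "((\<lambda>\<alpha>. (\<Sum>u\<in>insert u I. c u * b u \<alpha>) * vmonom z \<alpha>) has_sum (\<Sum>u\<in>insert u I. c u * f u z)) UNIV"
    if "z \<in> ball 0 (min \<epsilon>1 \<epsilon>2)" for z
    using has_sum_add[OF has_sum_cmult_right[OF e2(2), of z "c u"] e1(2)[of z]] that insert.hyps
    by (simp add: algebra_simps)
  then show ?case unfolding power_series_at_0_iff using e1(1) e2(1) by (intro exI[of _ "min \<epsilon>1 \<epsilon>2"]) auto
qed

definition conv :: "(nat^'n::finite \<Rightarrow> complex) \<Rightarrow> (nat^'n \<Rightarrow> complex) \<Rightarrow> nat^'n \<Rightarrow> complex" where
  "conv b c \<gamma> = (\<Sum>\<alpha>\<in>{\<alpha>. \<forall>i. \<alpha> $ i \<le> \<gamma> $ i}. b \<alpha> * c (\<gamma> - \<alpha>))"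

lemma finite_vec_le: "finite {\<alpha> :: nat^'n::finite. \<forall>i. \<alpha> $ i \<le> \<gamma> $ i}"
proof -
  have "{\<alpha> :: nat^'n. \<forall>i. \<alpha> $ i \<le> \<gamma> $ i} \<subseteq> vec_lambda ` (PiE UNIV (\<lambda>i. {..\<gamma> $ i}))"
  proof
    fix \<alpha> :: "nat^'n" assume "\<alpha> \<in> {\<alpha>. \<forall>i. \<alpha> $ i \<le> \<gamma> $ i}"
    then show "\<alpha> \<in> vec_lambda ` (PiE UNIV (\<lambda>i. {..\<gamma> $ i}))"
      by (intro image_eqI[of _ _ "vec_nth \<alpha>"]) auto
  qed
  then show ?thesis by (rule finite_subset) (intro finite_imageI finite_PiE, auto)
qed

lemma vmonom_add: "vmonom z (\<alpha> + \<beta>) = vmonom z \<alpha> * vmonom z \<beta>"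
  by (simp add: vmonom_def power_add prod.distrib)

lemma power_series_at_0_mult:
  assumes "power_series_at_0 f b" "power_series_at_0 g c"
  shows "power_series_at_0 (\<lambda>z. f z * g z) (conv b c)"
proof -
  obtain \<epsilon>1 where e1: "\<epsilon>1 > 0" "\<And>z. z \<in> ball 0 \<epsilon>1 \<Longrightarrow> ((\<lambda>\<alpha>. b \<alpha> * vmonom z \<alpha>) has_sum f z) UNIV"
    using assms(1) unfolding power_series_at_0_iff by blast
  obtain \<epsilon>2 where e2: "\<epsilon>2 > 0" "\<And>z. z \<in> ball 0 \<epsilon>2 \<Longrightarrow> ((\<lambda>\<alpha>. c \<alpha> * vmonom z \<alpha>) has_sum g z) UNIV"
    using assms(2) unfolding power_series_at_0_iff by blast
  have "((\<lambda>\<gamma>. conv b c \<gamma> * vmonom z \<gamma>) has_sum (f z * g z)) UNIV" if z: "z \<in> ball 0 (min \<epsilon>1 \<epsilon>2)" for z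
  proof -
    let ?p = "\<lambda>\<alpha>. b \<alpha> * vmonom z \<alpha>" and ?q = "\<lambda>\<beta>. c \<beta> * vmonom z \<beta>"
    let ?h = "\<lambda>(\<alpha>, \<beta>). ?p \<alpha> * ?q \<beta>"
    have p: "(?p has_sum f z) UNIV" and q: "(?q has_sum g z) UNIV" using e1 e2 z by auto
    have "(\<lambda>\<alpha>. norm (?p \<alpha>)) summable_on UNIV" "(\<lambda>\<beta>. norm (?q \<beta>)) summable_on UNIV"
      using has_sum_imp_summable[OF p] has_sum_imp_summable[OF q]
      by (simp_all only: summable_on_iff_abs_summable_on_complex[symmetric])
    note s = this
    have "(\<lambda>x. norm (?h x)) summable_on UNIV \<times> UNIV"
    proof (rule Infinite_Sum.abs_summable_on_Sigma_iff[THEN iffD2], intro conjI ballI)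
      show "(\<lambda>\<beta>. norm (?h (\<alpha>, \<beta>))) summable_on UNIV" for \<alpha>
        using summable_on_cmult_right[OF s(2), of "norm (?p \<alpha>)"] by (simp add: norm_mult)
      have "(\<Sum>\<^sub>\<infinity>\<beta>. norm (?h (\<alpha>, \<beta>))) = norm (?p \<alpha>) * (\<Sum>\<^sub>\<infinity>\<beta>. norm (?q \<beta>))" for \<alpha>
        using infsum_cmult_right[of "norm (?p \<alpha>)" "\<lambda>\<beta>. norm (?q \<beta>)" UNIV] s(2) by (simp add: norm_mult)
      moreover have "0 \<le> (\<Sum>\<^sub>\<infinity>\<beta>. norm (?q \<beta>))" by (intro infsum_nonneg) simp
      ultimately show "(\<lambda>\<alpha>. norm (\<Sum>\<^sub>\<infinity>\<beta>. norm (?h (\<alpha>, \<beta>)))) summable_on UNIV"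
        using summable_on_cmult_left[OF s(1), of "\<Sum>\<^sub>\<infinity>\<beta>. norm (?q \<beta>)"] by (simp add: norm_mult abs_mult)
    qed
    then have "?h summable_on UNIV \<times> UNIV" by (rule abs_summable_summable)
    from has_sum_SigmaI[OF _ _ this, of "\<lambda>\<alpha>. ?p \<alpha> * g z" "f z * g z"]
    have h: "(?h has_sum (f z * g z)) (UNIV \<times> UNIV)"
      using has_sum_cmult_right[OF q] has_sum_cmult_left[OF p] by simp
    let ?S = "Sigma UNIV (\<lambda>\<gamma> :: nat^'a. {\<alpha>. \<forall>i. \<alpha> $ i \<le> \<gamma> $ i})"
    have bij: "bij_betw (\<lambda>(\<gamma>, \<alpha>). (\<alpha>, \<gamma> - \<alpha>)) ?S (UNIV \<times> UNIV)"
      by (rule bij_betw_byWitness[where f' = "\<lambda>(\<alpha>, \<beta>). (\<alpha> + \<beta>, \<alpha>)"]) (auto simp: vec_eq_iff)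
    have "((\<lambda>x. ?h ((\<lambda>(\<gamma>, \<alpha>). (\<alpha>, \<gamma> - \<alpha>)) x)) has_sum (f z * g z)) ?S"
      using has_sum_reindex_bij_betw[OF bij, of ?h] h by simp
    moreover have "((\<lambda>\<alpha>. ?h ((\<lambda>(\<gamma>, \<alpha>). (\<alpha>, \<gamma> - \<alpha>)) (\<gamma>, \<alpha>))) has_sum conv b c \<gamma> * vmonom z \<gamma>) {\<alpha>. \<forall>i. \<alpha> $ i \<le> \<gamma> $ i}" for \<gamma>
    proof -
      have "conv b c \<gamma> * vmonom z \<gamma> = (\<Sum>\<alpha>\<in>{\<alpha>. \<forall>i. \<alpha> $ i \<le> \<gamma> $ i}. ?p \<alpha> * ?q (\<gamma> - \<alpha>))"
        unfolding conv_def sum_distrib_right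
      proof (rule sum.cong[OF refl])
        fix \<alpha> :: "nat^'a" assume "\<alpha> \<in> {\<alpha>. \<forall>i. \<alpha> $ i \<le> \<gamma> $ i}"
        then have "\<gamma> = \<alpha> + (\<gamma> - \<alpha>)" by (simp add: vec_eq_iff)
        then have "vmonom z \<gamma> = vmonom z \<alpha> * vmonom z (\<gamma> - \<alpha>)"
          using vmonom_add[of z \<alpha> "\<gamma> - \<alpha>"] by simp
        then show "b \<alpha> * c (\<gamma> - \<alpha>) * vmonom z \<gamma> = ?p \<alpha> * ?q (\<gamma> - \<alpha>)" by simp
      qed
      then show ?thesis
        using has_sum_finite[OF finite_vec_le[of \<gamma>], of "\<lambda>\<alpha>. ?p \<alpha> * ?q (\<gamma> - \<alpha>)"] by simp
    qed
    ultimately show ?thesis by (rule has_sum_SigmaD)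
  qed
  then show ?thesis unfolding power_series_at_0_iff using e1(1) e2(1) by (intro exI[of _ "min \<epsilon>1 \<epsilon>2"]) auto
qed

section \<open>Leading exponents of power series\<close>

lemma lex_less_irrefl: "\<not> lex_less \<alpha> \<alpha>"
  by (simp add: lex_less_def)

lemma lex_less_trans: "lex_less \<alpha> \<beta> \<Longrightarrow> lex_less \<beta> \<gamma> \<Longrightarrow> lex_less \<alpha> \<gamma>"
proof -
  assume "lex_less \<alpha> \<beta>" "lex_less \<beta> \<gamma>"
  then obtain i j where ij: "\<alpha> $ i < \<beta> $ i" "\<forall>k<i. \<alpha> $ k = \<beta> $ k" "\<beta> $ j < \<gamma> $ j" "\<forall>k<j. \<beta> $ k = \<gamma> $ k"
    unfolding lex_less_def by blast
  have "\<alpha> $ min i j < \<gamma> $ min i j \<and> (\<forall>k<min i j. \<alpha> $ k = \<gamma> $ k)"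
    using ij by (cases i j rule: linorder_cases) (auto simp: min_def)
  then show ?thesis unfolding lex_less_def by blast
qed

lemma lex_less_total: "\<alpha> = \<beta> \<or> lex_less \<alpha> \<beta> \<or> lex_less \<beta> \<alpha>"
proof (cases "\<alpha> = \<beta>")
  case False
  let ?D = "{i. \<alpha> $ i \<noteq> \<beta> $ i}"
  have ne: "?D \<noteq> {}" using False by (auto simp: vec_eq_iff)
  define i where "i = Min ?D"
  have "i \<in> ?D" unfolding i_def using ne by (intro Min_in) auto
  moreover have "\<alpha> $ j = \<beta> $ j" if "j < i" for j
    using that Min_le[of ?D j] unfolding i_def by (auto simp: not_le[symmetric])
  ultimately have "\<forall>j<i. \<alpha> $ j = \<beta> $ j" "\<forall>j<i. \<beta> $ j = \<alpha> $ j" "\<alpha> $ i < \<beta> $ i \<or> \<beta> $ i < \<alpha> $ i" by auto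
  then show ?thesis unfolding lex_less_def by blast
qed simp

text \<open>Compatibility with addition is what makes leading exponents additive under products.\<close>

lemma lex_less_add: "lex_less \<alpha> \<beta> \<Longrightarrow> lex_less (\<alpha> + \<gamma>) (\<beta> + \<gamma>)"
  unfolding lex_less_def by auto

definition is_lead :: "(nat^'n::{finite,linorder} \<Rightarrow> complex) \<Rightarrow> (nat, 'n) vec \<Rightarrow> bool" where
  "is_lead b \<alpha> \<longleftrightarrow> b \<alpha> \<noteq> 0 \<and> (\<forall>\<beta>. b \<beta> \<noteq> 0 \<longrightarrow> \<beta> = \<alpha> \<or> lex_less \<alpha> \<beta>)"

lemma is_lead_unique: "is_lead b \<alpha> \<Longrightarrow> is_lead b \<beta> \<Longrightarrow> \<alpha> = \<beta>"
  unfolding is_lead_def using lex_less_irrefl lex_less_trans by metis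

text \<open>The lexicographic order on \<open>\<nat>\<^sup>n\<close> is a well-order: minimize one coordinate after the other, in
  increasing order of the indices.\<close>

lemma lex_min_exists:
  assumes "A \<noteq> {}"
  shows "\<exists>\<alpha>\<in>A. \<forall>\<beta>\<in>A. \<beta> = \<alpha> \<or> lex_less \<alpha> (\<beta> :: (nat, 'n::{finite,linorder}) vec)"
proof -
  have "\<exists>\<alpha>\<in>A. \<forall>\<beta>\<in>A. (\<forall>i\<in>S. \<alpha> $ i = \<beta> $ i) \<or> (\<exists>i\<in>S. \<alpha> $ i < \<beta> $ i \<and> (\<forall>j\<in>S. j < i \<longrightarrow> \<alpha> $ j = \<beta> $ j))"
    if "finite S" for S
    using that
  proof (induction S rule: finite_linorder_max_induct)
    case empty then show ?case using assms by auto
  next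
    case (insert m S)
    then obtain \<alpha> where \<alpha>: "\<alpha> \<in> A"
      "\<And>\<beta>. \<beta> \<in> A \<Longrightarrow> (\<forall>i\<in>S. \<alpha> $ i = \<beta> $ i) \<or> (\<exists>i\<in>S. \<alpha> $ i < \<beta> $ i \<and> (\<forall>j\<in>S. j < i \<longrightarrow> \<alpha> $ j = \<beta> $ j))"
      by blast
    define B where "B = {\<beta> \<in> A. \<forall>i\<in>S. \<alpha> $ i = \<beta> $ i}"
    have "\<alpha> \<in> B" using \<alpha>(1) by (simp add: B_def)
    from ex_has_least_nat[of "\<lambda>\<beta>. \<beta> \<in> B", OF this, of "\<lambda>\<beta>. \<beta> $ m"]
    obtain \<gamma> where \<gamma>: "\<gamma> \<in> B" "\<And>\<beta>. \<beta> \<in> B \<Longrightarrow> \<gamma> $ m \<le> \<beta> $ m" by blast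
    show ?case
    proof (intro bexI ballI)
      show "\<gamma> \<in> A" using \<gamma>(1) by (simp add: B_def)
      fix \<beta> assume \<beta>: "\<beta> \<in> A"
      have eq: "\<forall>i\<in>S. \<gamma> $ i = \<alpha> $ i" using \<gamma>(1) by (simp add: B_def)
      show "(\<forall>i\<in>insert m S. \<gamma> $ i = \<beta> $ i) \<or>
         (\<exists>i\<in>insert m S. \<gamma> $ i < \<beta> $ i \<and> (\<forall>j\<in>insert m S. j < i \<longrightarrow> \<gamma> $ j = \<beta> $ j))"
      proof (cases "\<beta> \<in> B")
        case True
        then have "\<forall>i\<in>S. \<gamma> $ i = \<beta> $ i" "\<gamma> $ m \<le> \<beta> $ m" using eq \<gamma>(2) by (auto simp: B_def)
        then show ?thesis by (cases "\<gamma> $ m = \<beta> $ m") auto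
      next
        case False
        then obtain i where i: "i \<in> S" "\<alpha> $ i < \<beta> $ i" "\<forall>j\<in>S. j < i \<longrightarrow> \<alpha> $ j = \<beta> $ j"
          using \<alpha>(2)[OF \<beta>] \<beta> by (auto simp: B_def)
        then have "\<gamma> $ i < \<beta> $ i \<and> (\<forall>j\<in>insert m S. j < i \<longrightarrow> \<gamma> $ j = \<beta> $ j)"
          using eq insert.hyps by force
        then show ?thesis using i(1) by blast
      qed
    qed
  qed
  note main = this
  obtain \<alpha> where \<alpha>: "\<alpha> \<in> A" "\<And>\<beta>. \<beta> \<in> A \<Longrightarrow> (\<forall>i. \<alpha> $ i = \<beta> $ i) \<or> (\<exists>i. \<alpha> $ i < \<beta> $ i \<and> (\<forall>j<i. \<alpha> $ j = \<beta> $ j))"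
    using main[OF finite_class.finite_UNIV] by auto
  have "\<beta> = \<alpha> \<or> lex_less \<alpha> \<beta>" if "\<beta> \<in> A" for \<beta>
    using \<alpha>(2)[OF that] by (auto simp: lex_less_def vec_eq_iff)
  then show ?thesis using \<alpha>(1) by blast
qed

lemma is_lead_exists: "b \<noteq> (\<lambda>_. 0) \<Longrightarrow> \<exists>\<alpha>. is_lead b \<alpha>"
proof -
  assume "b \<noteq> (\<lambda>_. 0)"
  then have "{\<alpha>. b \<alpha> \<noteq> 0} \<noteq> {}" by auto
  from lex_min_exists[OF this] show ?thesis unfolding is_lead_def by simp
qed

text \<open>In the coefficient of the product at \<open>\<alpha> + \<beta>\<close> only one term survives, as both factors start there.\<close>

lemma is_lead_conv:
  assumes "is_lead b \<alpha>" "is_lead c \<beta>"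
  shows "conv b c (\<alpha> + \<beta>) = b \<alpha> * c \<beta>" "is_lead (conv b c) (\<alpha> + \<beta>)"
proof -
  have zero: "b \<alpha>' * c (\<gamma> - \<alpha>') = 0"
    if "\<forall>i. \<alpha>' $ i \<le> \<gamma> $ i" "\<gamma> = \<alpha> + \<beta> \<and> \<alpha>' \<noteq> \<alpha> \<or> lex_less \<gamma> (\<alpha> + \<beta>)" for \<alpha>' \<gamma>
  proof (rule ccontr)
    define \<beta>' where "\<beta>' = \<gamma> - \<alpha>'"
    have \<gamma>: "\<gamma> = \<alpha>' + \<beta>'" using that(1) by (simp add: vec_eq_iff \<beta>'_def)
    assume "b \<alpha>' * c (\<gamma> - \<alpha>') \<noteq> 0"
    then have "b \<alpha>' \<noteq> 0" "c \<beta>' \<noteq> 0" by (auto simp: \<beta>'_def)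
    then have "\<alpha>' = \<alpha> \<or> lex_less \<alpha> \<alpha>'" "\<beta>' = \<beta> \<or> lex_less \<beta> \<beta>'" using assms by (auto simp: is_lead_def)
    then have "\<alpha>' = \<alpha> \<and> \<beta>' = \<beta> \<or> lex_less (\<alpha> + \<beta>) \<gamma>"
      unfolding \<gamma> using lex_less_add[of \<alpha> \<alpha>'] lex_less_add[of \<beta> \<beta>' \<alpha>] lex_less_trans
      by (metis add.commute)
    then show False using that(2) \<gamma> lex_less_irrefl lex_less_trans by metis
  qed
  have "conv b c (\<alpha> + \<beta>) = (\<Sum>\<alpha>'\<in>{\<alpha>}. b \<alpha>' * c (\<alpha> + \<beta> - \<alpha>'))"
    unfolding conv_def using zero[of _ "\<alpha> + \<beta>"] by (intro sum.mono_neutral_right finite_vec_le) auto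
  also have "\<dots> = b \<alpha> * c \<beta>" by simp
  finally show 1: "conv b c (\<alpha> + \<beta>) = b \<alpha> * c \<beta>" .
  have "conv b c \<gamma> = 0" if "lex_less \<gamma> (\<alpha> + \<beta>)" for \<gamma>
    unfolding conv_def using zero that by (intro sum.neutral) auto
  then show "is_lead (conv b c) (\<alpha> + \<beta>)"
    unfolding is_lead_def 1 using assms lex_less_total[of _ "\<alpha> + \<beta>"] by (auto simp: is_lead_def)
qed

section \<open>Identity theorem, Schwarz lemma and removable singularities\<close>

text \<open>By the identity theorem on the complex line through \<open>z\<close> and a point of \<open>V\<close>; by convexity the line meets \<open>U\<close> in a
  connected set.\<close>

lemma mholomorphic_identity:
  fixes f :: "complex^'n::finite \<Rightarrow> complex"
  assumes "f mholomorphic_on U" "open U" "convex U" "open V" "V \<noteq> {}" "V \<subseteq> U" "\<And>z. z \<in> V \<Longrightarrow> f z = 0" "z \<in> U"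
  shows "f z = 0"
proof -
  obtain w where w: "w \<in> V" using assms(5) by blast
  define T where "T = (\<lambda>t. w + t *s (z - w)) -` U"
  define S where "S = (\<lambda>t. w + t *s (z - w)) -` V"
  have cont: "continuous_on UNIV (\<lambda>t. w + t *s (z - w))"
    by (intro continuous_intros bounded_linear.continuous_on[OF bounded_linear_smult_vec])
  have o: "open T" "open S" unfolding T_def S_def using cont assms(2,4) open_vimage by blast+
  have "convex T"
  proof (rule convexI)
    fix s t :: complex and u v :: real
    assume *: "s \<in> T" "t \<in> T" "0 \<le> u" "0 \<le> v" "u + v = 1"
    have "w + (u *\<^sub>R s + v *\<^sub>R t) *s (z - w) = (u + v) *\<^sub>R w + (u *\<^sub>R s + v *\<^sub>R t) *s (z - w)" using * by simp
    also have "\<dots> = u *\<^sub>R (w + s *s (z - w)) + v *\<^sub>R (w + t *s (z - w))"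
      by (rule vec_eq_iff[THEN iffD2], rule allI) (simp add: algebra_simps)
    also have "\<dots> \<in> U" using * assms(3) by (intro convexD) (auto simp: T_def)
    finally show "u *\<^sub>R s + v *\<^sub>R t \<in> T" by (simp add: T_def)
  qed
  then have "connected T" by (rule convex_connected)
  have hol: "(\<lambda>t. f (w + t *s (z - w))) holomorphic_on T"
    by (rule mholomorphic_on_line[OF assms(1)]) (simp add: T_def)
  have mem: "0 \<in> S" "1 \<in> T" using w assms(8) by (auto simp: S_def T_def)
  have "S \<subseteq> T" using assms(6) by (auto simp: S_def T_def)
  have "f (w + 1 *s (z - w)) = 0"
  proof (rule analytic_continuation_open[OF o(2,1) _ \<open>connected T\<close> \<open>S \<subseteq> T\<close> hol, of "\<lambda>_. 0"])
    show "f (w + t *s (z - w)) = 0" if "t \<in> S" for t using that assms(7) by (simp add: S_def)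
  qed (use mem in auto)
  then show ?thesis by simp
qed

lemma vmonom_scale: "vmonom (t *s v) \<alpha> = t ^ wt \<alpha> * vmonom v \<alpha>"
  by (simp add: vmonom_def wt_def power_mult_distrib prod.distrib power_sum)

lemma power_series_vanishing_order:
  fixes f :: "complex^'n::finite \<Rightarrow> complex"
  assumes "power_series_at_0 f b" "\<And>\<alpha>. wt \<alpha> < K \<Longrightarrow> b \<alpha> = 0"
  shows "\<exists>C \<delta>. 0 < \<delta> \<and> (\<forall>t. norm t < \<delta> \<longrightarrow> norm (f (t *s v)) \<le> C * norm t ^ K)"
proof -
  obtain \<epsilon> where e: "\<epsilon> > 0" "\<And>z. z \<in> ball 0 \<epsilon> \<Longrightarrow> ((\<lambda>\<alpha>. b \<alpha> * vmonom z \<alpha>) has_sum f z) UNIV"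
    using assms(1) unfolding power_series_at_0_iff by blast
  define \<delta> where "\<delta> = \<epsilon> / (2 * (norm v + 1))"
  have \<delta>: "\<delta> > 0" using e by (simp add: \<delta>_def add_nonneg_pos)
  have small: "t *s v \<in> ball 0 \<epsilon>" if "norm t \<le> \<delta>" for t
  proof -
    have "norm t * norm v \<le> \<delta> * (norm v + 1)" using that \<delta> by (intro mult_mono) auto
    also have "\<dots> = \<epsilon> / 2" by (simp add: \<delta>_def add_nonneg_eq_0_iff divide_simps)
    finally show ?thesis using e by (simp add: norm_smult_vec)
  qed
  define A where "A = (\<Sum>\<^sub>\<infinity>\<alpha>. norm (b \<alpha> * vmonom (of_real \<delta> *s v) \<alpha>))"
  have summ: "(\<lambda>\<alpha>. norm (b \<alpha> * vmonom (t *s v) \<alpha>)) summable_on UNIV" if "norm t \<le> \<delta>" for t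
    using has_sum_imp_summable[OF e(2)[OF small[OF that]]]
    by (simp only: summable_on_iff_abs_summable_on_complex[symmetric])
  have "norm (f (t *s v)) \<le> A / \<delta> ^ K * norm t ^ K" if t: "norm t < \<delta>" for t
  proof -
    have "norm (f (t *s v)) = norm (\<Sum>\<^sub>\<infinity>\<alpha>. b \<alpha> * vmonom (t *s v) \<alpha>)"
      using e(2)[OF small[of t]] t by (simp add: infsumI)
    also have "\<dots> \<le> (\<Sum>\<^sub>\<infinity>\<alpha>. norm (b \<alpha> * vmonom (t *s v) \<alpha>))"
      using t by (intro norm_infsum_bound summ) simp
    also have "\<dots> \<le> (\<Sum>\<^sub>\<infinity>\<alpha>. (norm t / \<delta>) ^ K * norm (b \<alpha> * vmonom (of_real \<delta> *s v) \<alpha>))"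
    proof (rule infsum_mono)
      show "(\<lambda>\<alpha>. norm (b \<alpha> * vmonom (t *s v) \<alpha>)) summable_on UNIV" using t by (intro summ) simp
      show "(\<lambda>\<alpha>. (norm t / \<delta>) ^ K * norm (b \<alpha> * vmonom (of_real \<delta> *s v) \<alpha>)) summable_on UNIV"
        using \<delta> by (intro summable_on_cmult_right summ) simp
      fix \<alpha> :: "nat^'n"
      show "norm (b \<alpha> * vmonom (t *s v) \<alpha>) \<le> (norm t / \<delta>) ^ K * norm (b \<alpha> * vmonom (of_real \<delta> *s v) \<alpha>)"
      proof (cases "wt \<alpha> < K")
        case False
        have "norm (b \<alpha> * vmonom (t *s v) \<alpha>) = (norm t / \<delta>) ^ wt \<alpha> * norm (b \<alpha> * vmonom (of_real \<delta> *s v) \<alpha>)"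
          using \<delta> by (simp add: vmonom_scale norm_mult norm_power power_divide)
        also have "\<dots> \<le> (norm t / \<delta>) ^ K * norm (b \<alpha> * vmonom (of_real \<delta> *s v) \<alpha>)"
          using False t \<delta> by (intro mult_right_mono power_decreasing) auto
        finally show ?thesis .
      qed (simp add: assms(2))
    qed
    also have "\<dots> = A / \<delta> ^ K * norm t ^ K"
      using \<delta> by (subst infsum_cmult_right) (auto simp: A_def power_divide intro!: summ)
    finally show ?thesis .
  qed
  then show ?thesis using \<delta> by blast
qed

text \<open>Divide by \<open>t\<^sup>K\<close>, one factor at a time, and apply the maximum principle.\<close>

lemma Schwarz_order:
  assumes "h holomorphic_on ball 0 R'" "0 < R" "R < R'"
    and "0 < \<delta>" "\<And>t. norm t < \<delta> \<Longrightarrow> norm (h t) \<le> C * norm t ^ K"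
    and "\<And>t. norm t = R \<Longrightarrow> norm (h t) \<le> B" "norm \<xi> \<le> R"
  shows "norm (h \<xi>) \<le> (norm \<xi> / R) ^ K * B"
  using assms(1,5,6)
proof (induction K arbitrary: h B)
  case 0
  have "norm (h \<xi>) \<le> B"
  proof (rule maximum_modulus_frontier[of h "cball 0 R"])
    show "h holomorphic_on interior (cball 0 R)" "continuous_on (closure (cball 0 R)) h"
      using 0(1) assms(2,3) by (auto intro!: holomorphic_on_imp_continuous_on intro: holomorphic_on_subset)
  qed (use 0 assms in auto)
  then show ?case by simp
next
  case (Suc K)
  have h0: "h 0 = 0" using Suc.prems(2)[of 0] assms(4) by simp
  define g where "g t = (if t = 0 then deriv h 0 else h t / t)" for t
  have g: "g holomorphic_on ball 0 R'"
    by (rule pole_theorem_open_0[OF Suc.prems(1), of 0]) (auto simp: g_def h0)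
  have hg: "h t = t * g t" for t by (simp add: g_def h0)
  have g_bound: "norm (g t) \<le> C * norm t ^ K" if t: "t \<noteq> 0" "norm t < \<delta>" for t
    using Suc.prems(2)[of t] t by (simp add: hg norm_mult mult_ac)
  have g0: "norm (g 0) \<le> C * norm (0::complex) ^ K"
  proof (rule tendsto_le)
    have "isCont g 0" using assms(2,3)
      by (intro continuous_on_interior[OF holomorphic_on_imp_continuous_on[OF g]]) simp
    then show "((\<lambda>t. norm (g t)) \<longlongrightarrow> norm (g 0)) (at 0)" unfolding isCont_def by (rule tendsto_norm)
    show "((\<lambda>t::complex. C * norm t ^ K) \<longlongrightarrow> C * norm (0::complex) ^ K) (at 0)"
      by (intro tendsto_mult tendsto_const tendsto_power tendsto_norm[OF tendsto_ident_at])
    show "\<forall>\<^sub>F t in at 0. norm (g t) \<le> C * norm t ^ K"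
      unfolding eventually_at using assms(4) g_bound by (intro exI[of _ \<delta>]) auto
  qed simp
  have "norm (g t) \<le> C * norm t ^ K" if "norm t < \<delta>" for t
    using g_bound[of t] g0 that by (cases "t = 0") auto
  moreover have "norm (g t) \<le> B / R" if "norm t = R" for t
    using Suc.prems(3)[OF that] that assms(2) by (simp add: hg norm_mult field_simps)
  ultimately have "norm (g \<xi>) \<le> (norm \<xi> / R) ^ K * (B / R)" using g by (intro Suc.IH) auto
  then have "norm \<xi> * norm (g \<xi>) \<le> norm \<xi> * ((norm \<xi> / R) ^ K * (B / R))" by (rule mult_left_mono) simp
  then show ?case by (simp add: hg norm_mult mult_ac)
qed

text \<open>In one variable the zeros of \<open>d\<close> are isolated, and the quotient is bounded near each of them.\<close>

lemma holomorphic_quotient_extends: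
  assumes n: "n holomorphic_on S" and d: "d holomorphic_on S" and S: "open S" "connected S"
    and \<beta>: "\<beta> \<in> S" "d \<beta> \<noteq> 0" and bd: "\<And>t. t \<in> S \<Longrightarrow> norm (n t) \<le> B * norm (d t)"
  obtains h where "h holomorphic_on S" "\<And>t. t \<in> S \<Longrightarrow> d t \<noteq> 0 \<Longrightarrow> h t = n t / d t"
proof -
  have "\<exists>V g. open V \<and> \<xi> \<in> V \<and> V \<subseteq> S \<and> g holomorphic_on V \<and> (\<forall>t\<in>V - {\<xi>}. d t \<noteq> 0 \<and> g t = n t / d t)
      \<and> (d \<xi> \<noteq> 0 \<longrightarrow> g \<xi> = n \<xi> / d \<xi>)" if \<xi>: "\<xi> \<in> S" for \<xi>
  proof (cases "d \<xi> = 0")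
    case False
    let ?V = "S \<inter> d -` (- {0})"
    have "open ?V"
      by (rule continuous_open_preimage[OF holomorphic_on_imp_continuous_on[OF d] S(1)]) auto
    moreover have "(\<lambda>t. n t / d t) holomorphic_on ?V"
      using n d by (intro holomorphic_intros) (auto intro: holomorphic_on_subset)
    ultimately show ?thesis using False \<xi> by (intro exI[of _ ?V] exI[of _ "\<lambda>t. n t / d t"]) auto
  next
    case True
    obtain r where r: "0 < r" "ball \<xi> r \<subseteq> S" "\<And>z. z \<in> ball \<xi> r - {\<xi>} \<Longrightarrow> d z \<noteq> 0"
      using isolated_zeros[OF d S \<xi> True \<beta>] by metis
    have hol: "(\<lambda>t. n t / d t) holomorphic_on ball \<xi> r - {\<xi>}"
      using n d r by (intro holomorphic_intros) (auto intro: holomorphic_on_subset)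
    have "norm (n t / d t) \<le> B" if "t \<in> ball \<xi> r - {\<xi>}" for t
      using bd[of t] r that by (auto simp: norm_divide divide_simps)
    then have "\<exists>B. eventually (\<lambda>t. norm (n t / d t) \<le> B) (at \<xi>)"
      using r(1) unfolding eventually_at by (intro exI[of _ B] exI[of _ r]) (auto simp: dist_commute)
    then obtain g where "g holomorphic_on ball \<xi> r" "\<forall>t\<in>ball \<xi> r - {\<xi>}. g t = n t / d t"
      using holomorphic_on_extend_bounded[OF hol] r(1) by auto
    then show ?thesis using r True by (intro exI[of _ "ball \<xi> r"] exI[of _ g]) auto
  qed
  then obtain V g where Vg: "\<And>\<xi>. \<xi> \<in> S \<Longrightarrow> open (V \<xi>) \<and> \<xi> \<in> V \<xi> \<and> V \<xi> \<subseteq> S \<and> g \<xi> holomorphic_on V \<xi> \<and>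
      (\<forall>t\<in>V \<xi> - {\<xi>}. d t \<noteq> 0 \<and> g \<xi> t = n t / d t) \<and> (d \<xi> \<noteq> 0 \<longrightarrow> g \<xi> \<xi> = n \<xi> / d \<xi>)"
    by metis
  define h where "h \<xi> = g \<xi> \<xi>" for \<xi>
  have h1: "h t = n t / d t" if "t \<in> S" "d t \<noteq> 0" for t using Vg that by (simp add: h_def)
  have "h holomorphic_on S"
    unfolding holomorphic_on_def
  proof
    fix \<xi> assume \<xi>: "\<xi> \<in> S"
    have "g \<xi> field_differentiable at \<xi>"
      using Vg[OF \<xi>] by (intro holomorphic_on_imp_differentiable_at[of _ "V \<xi>"]) auto
    moreover have "g \<xi> t = h t" if "t \<in> V \<xi>" for t
      using Vg[OF \<xi>] h1[of t] that by (cases "t = \<xi>") (auto simp: h_def)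
    ultimately have "h field_differentiable at \<xi>"
      using Vg[OF \<xi>] unfolding field_differentiable_def
      by (meson has_field_derivative_transform_within_open)
    then show "h field_differentiable at \<xi> within S" by (rule field_differentiable_at_within)
  qed
  then show ?thesis using h1 that by blast
qed

lemma continuous_on_line: "continuous_on A (\<lambda>t. z + t *s (v :: complex^'n::finite))"
  by (intro continuous_intros bounded_linear.continuous_on[OF bounded_linear_smult_vec])

text \<open>The direction is that of a nearby point where \<open>d\<close> does not vanish; on this line the zeros of
  \<open>d\<close> are isolated.\<close>

lemma punctured_disc_avoiding_zeros:
  fixes d :: "complex^'n::finite \<Rightarrow> complex"
  assumes U: "open U" "z0 \<in> U" and d: "d mholomorphic_on U"
    and nz: "\<And>V. open V \<Longrightarrow> z0 \<in> V \<Longrightarrow> \<exists>z\<in>V. d z \<noteq> 0"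
  shows "\<exists>v R. 0 < R \<and> (\<forall>t. norm t \<le> R \<longrightarrow> z0 + t *s v \<in> U) \<and>
    (\<forall>t. 0 < norm t \<and> norm t \<le> R \<longrightarrow> d (z0 + t *s v) \<noteq> 0)"
proof -
  obtain r where r: "r > 0" "ball z0 r \<subseteq> U" using U open_contains_ball by blast
  obtain w where w: "w \<in> ball z0 r" "d w \<noteq> 0" using nz[of "ball z0 r"] r by auto
  define v where "v = w - z0"
  define h where "h t = d (z0 + t *s v)" for t
  define T where "T = (\<lambda>t. z0 + t *s v) -` ball z0 r"
  have T: "open T" unfolding T_def using continuous_on_line open_vimage by blast
  have T_iff: "t \<in> T \<longleftrightarrow> norm t * norm v < r" for t
    by (simp add: T_def dist_norm norm_smult_vec)
  have "norm v < r" using w(1) by (simp add: v_def dist_norm norm_minus_commute)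
  then have mem: "0 \<in> T" "1 \<in> T" using r(1) by (auto simp: T_iff)
  have "convex T"
  proof (rule convexI)
    fix s t :: complex and a b :: real assume *: "s \<in> T" "t \<in> T" "0 \<le> a" "0 \<le> b" "a + b = 1"
    have "norm (a *\<^sub>R s + b *\<^sub>R t) * norm v \<le> (a * norm s + b * norm t) * norm v"
      using norm_triangle_ineq[of "a *\<^sub>R s" "b *\<^sub>R t"] * by (intro mult_right_mono) auto
    also have "\<dots> = a * (norm s * norm v) + b * (norm t * norm v)" by (simp add: algebra_simps)
    also have "\<dots> < r" using * by (intro convex_bound_lt) (auto simp: T_iff)
    finally show "a *\<^sub>R s + b *\<^sub>R t \<in> T" by (simp add: T_iff)
  qed
  then have conn: "connected T" by (rule convex_connected)
  have hol: "h holomorphic_on T" unfolding h_def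
    by (rule mholomorphic_on_line[OF d]) (use r(2) in \<open>auto simp: T_def\<close>)
  have h1: "h 1 \<noteq> 0" using w(2) by (simp add: h_def v_def)
  have "\<exists>r1>0. ball 0 r1 \<subseteq> T \<and> (\<forall>t\<in>ball 0 r1 - {0}. h t \<noteq> 0)"
  proof (cases "h 0 = 0")
    case True
    show ?thesis
      by (rule isolated_zeros[OF hol T conn mem(1) True mem(2) h1]) blast
  next
    case False
    have "open (T \<inter> h -` (- {0}))"
      by (rule continuous_open_preimage[OF holomorphic_on_imp_continuous_on[OF hol] T]) auto
    moreover have "0 \<in> T \<inter> h -` (- {0})" using False mem by simp
    ultimately show ?thesis unfolding open_contains_ball by blast
  qed
  then obtain r1 where r1: "r1 > 0" "ball 0 r1 \<subseteq> T" "\<forall>t\<in>ball 0 r1 - {0}. h t \<noteq> 0" by blast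
  have "z0 + t *s v \<in> U" if "norm t \<le> r1 / 2" for t
  proof -
    have "t \<in> T" using that r1(1,2) by (intro subsetD[OF r1(2)]) simp
    then show ?thesis using r(2) by (auto simp: T_def)
  qed
  moreover have "d (z0 + t *s v) \<noteq> 0" if "0 < norm t \<and> norm t \<le> r1 / 2" for t
    using bspec[OF r1(3), of t] that r1(1) by (simp add: h_def)
  ultimately show ?thesis using r1(1) by (intro exI[of _ v] exI[of _ "r1 / 2"]) auto
qed

text \<open>Riemann's extension theorem for a quotient bounded by \<open>B\<close>.  On all lines parallel to a suitable one,
  \<open>d\<close> has no zero on a circle of fixed radius, and the mean of the quotient over this circle is
  holomorphic in the center.  By the theorem in one variable the mean is the value of the
  extended quotient at the center.\<close>

lemma Riemann_extension_local:
  fixes n d :: "complex^'n::finite \<Rightarrow> complex"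
  assumes U: "open U" "z0 \<in> U" and n: "n mholomorphic_on U" and d: "d mholomorphic_on U"
    and nz: "\<And>V. open V \<Longrightarrow> z0 \<in> V \<Longrightarrow> \<exists>z\<in>V. d z \<noteq> 0"
    and bd: "\<And>z. z \<in> U \<Longrightarrow> norm (n z) \<le> B * norm (d z)"
  shows "\<exists>V G. open V \<and> z0 \<in> V \<and> V \<subseteq> U \<and> G mholomorphic_on V \<and> (\<forall>z\<in>V. G z * d z = n z)"
proof -
  obtain v R where R: "0 < R" "\<And>t. norm t \<le> R \<Longrightarrow> z0 + t *s v \<in> U"
    "\<And>t. 0 < norm t \<Longrightarrow> norm t \<le> R \<Longrightarrow> d (z0 + t *s v) \<noteq> 0"
    using punctured_disc_avoiding_zeros[OF U d nz] by blast
  \<comment> \<open>The circle of integration has radius \<open>R / 2\<close>; the larger radius leaves room for holomorphy on a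
    neighborhood of the closed disc.\<close>
  define R' where "R' = 3 * R / 4"
  define W where "W = U \<inter> d -` (- {0})"
  have W: "open W" unfolding W_def
    by (rule continuous_open_preimage[OF mholomorphic_on_continuous[OF d] U(1)]) auto
  have "compact ((\<lambda>t. z0 + t *s v) ` (cball 0 R' - ball 0 (R / 2)))"
    by (intro compact_continuous_image continuous_on_line compact_diff) auto
  moreover have "(\<lambda>t. z0 + t *s v) ` (cball 0 R' - ball 0 (R / 2)) \<subseteq> W"
  proof safe
    fix t :: complex assume "t \<in> cball 0 R'" "t \<notin> ball 0 (R / 2)"
    then have "0 < norm t" "norm t \<le> R" using R(1) by (auto simp: R'_def simp del: zero_less_norm_iff)
    then show "z0 + t *s v \<in> W" using R(2,3)[of t] by (simp add: W_def)
  qed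
  ultimately obtain \<epsilon>1 where e1: "\<epsilon>1 > 0" "(\<Union>x\<in>(\<lambda>t. z0 + t *s v) ` (cball 0 R' - ball 0 (R / 2)). ball x \<epsilon>1) \<subseteq> W"
    using compact_subset_open_imp_ball_epsilon_subset[OF _ W] by metis
  have "compact ((\<lambda>t. z0 + t *s v) ` cball 0 R')"
    by (intro compact_continuous_image continuous_on_line) auto
  moreover have "(\<lambda>t. z0 + t *s v) ` cball 0 R' \<subseteq> U" using R by (auto simp: R'_def)
  ultimately obtain \<epsilon>2 where e2: "\<epsilon>2 > 0" "(\<Union>x\<in>(\<lambda>t. z0 + t *s v) ` cball 0 R'. ball x \<epsilon>2) \<subseteq> U"
    using compact_subset_open_imp_ball_epsilon_subset[OF _ U(1)] by metis
  define \<epsilon> where "\<epsilon> = min \<epsilon>1 \<epsilon>2"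
  have e: "\<epsilon> > 0" using e1 e2 by (simp add: \<epsilon>_def)
  have inW: "z + t *s v \<in> W" if "z \<in> ball z0 \<epsilon>" "R / 2 \<le> norm t" "norm t \<le> R'" for z t
  proof -
    have "z + t *s v \<in> ball (z0 + t *s v) \<epsilon>1" using that(1) by (simp add: \<epsilon>_def dist_norm)
    then show ?thesis using e1(2) that(2,3) by force
  qed
  have inU: "z + t *s v \<in> U" if "z \<in> ball z0 \<epsilon>" "norm t \<le> R'" for z t
  proof -
    have "z + t *s v \<in> ball (z0 + t *s v) \<epsilon>2" using that(1) by (simp add: \<epsilon>_def dist_norm)
    then show ?thesis using e2(2) that(2) by force
  qed
  define G where "G z = integral {0..1} (\<lambda>s. 1 * (n (z + circ (R/2) s *s v) / d (z + circ (R/2) s *s v)))" for z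
  have "(\<lambda>z. n z / d z) mholomorphic_on W"
    using n d unfolding mholomorphic_on_iff_cdiff W_def by (auto intro!: cdiff_divide)
  from mholomorphic_on_param_integral[OF W this open_ball, of "\<lambda>s. circ (R/2) s *s v" "\<lambda>_. 1" z0 \<epsilon>]
  have G: "G mholomorphic_on ball z0 \<epsilon>"
    unfolding G_def[abs_def] using R(1)
    by (simp add: inW R'_def continuous_on_circ bounded_linear.continuous_on[OF bounded_linear_smult_vec])
  have eq: "G z * d z = n z" if z: "z \<in> ball z0 \<epsilon>" for z
  proof (cases "d z = 0")
    case True
    have "z \<in> U" using inU[OF z, of 0] R(1) by (simp add: R'_def)
    then show ?thesis using bd[of z] True by simp
  next
    case False
    have hn: "(\<lambda>t. n (z + t *s v)) holomorphic_on ball 0 R'" "(\<lambda>t. d (z + t *s v)) holomorphic_on ball 0 R'"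
      using inU[OF z] by (auto intro!: mholomorphic_on_line n d)
    have "R' > 0" using R(1) by (simp add: R'_def)
    then have mem0: "0 \<in> ball 0 R'" by simp
    have d0: "d (z + 0 *s v) \<noteq> 0" using False by simp
    obtain h where h: "h holomorphic_on ball 0 R'"
      "\<And>t. t \<in> ball 0 R' \<Longrightarrow> d (z + t *s v) \<noteq> 0 \<Longrightarrow> h t = n (z + t *s v) / d (z + t *s v)"
      using holomorphic_quotient_extends[OF hn open_ball connected_ball mem0 d0, of B] bd inU[OF z]
      by (metis less_imp_le mem_ball_0)
    have "(deriv ^^ 0) h 0 / fact 0 = integral {0..1} (\<lambda>s. h (circ (R/2) s) / circ (R/2) s ^ 0)"
      by (rule Cauchy_circ_integral[OF h(1)]) (use R(1) in \<open>auto simp: R'_def\<close>)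
    also have "\<dots> = G z" unfolding G_def
    proof (rule integral_cong)
      fix s
      have "d (z + circ (R/2) s *s v) \<noteq> 0" "circ (R/2) s \<in> ball 0 R'"
        using inW[OF z, of "circ (R/2) s"] R(1) by (auto simp: W_def R'_def)
      then show "h (circ (R/2) s) / circ (R/2) s ^ 0 = 1 * (n (z + circ (R/2) s *s v) / d (z + circ (R/2) s *s v))"
        using h(2) by simp
    qed
    finally have "G z = h 0" by simp
    then show ?thesis using h(2)[OF mem0 d0] False by simp
  qed
  have "ball z0 \<epsilon> \<subseteq> U" using inU[of _ 0] R(1) by (auto simp: R'_def)
  then show ?thesis using e G eq by (intro exI[of _ "ball z0 \<epsilon>"] exI[of _ G]) auto
qed

text \<open>Gaussian elimination of one unknown for each equation.\<close>

lemma underdetermined_system: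
  fixes A :: "'e \<Rightarrow> 'u \<Rightarrow> complex"
  assumes "finite E" "finite U" "card E < card U"
  shows "\<exists>c. (\<exists>u\<in>U. c u \<noteq> 0) \<and> (\<forall>e\<in>E. (\<Sum>u\<in>U. A e u * c u) = 0)"
  using assms
proof (induction E arbitrary: U A rule: finite_induct)
  case empty
  then obtain u where "u \<in> U" by fastforce
  then show ?case by (intro exI[of _ "\<lambda>_. 1"]) auto
next
  case (insert e E)
  show ?case
  proof (cases "\<forall>u\<in>U. A e u = 0")
    case True
    obtain c where "\<exists>u\<in>U. c u \<noteq> 0" "\<forall>e\<in>E. (\<Sum>u\<in>U. A e u * c u) = 0"
      using insert.IH[of U A] insert.prems insert.hyps by auto
    then show ?thesis using True by (intro exI[of _ c]) auto
  next
    case False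
    then obtain w where w: "w \<in> U" "A e w \<noteq> 0" by blast
    define A' where "A' f u = A f u - A f w * A e u / A e w" for f u
    have "card E < card (U - {w})" using insert.prems insert.hyps w by simp
    then obtain c where c: "\<exists>u\<in>U - {w}. c u \<noteq> 0" "\<forall>f\<in>E. (\<Sum>u\<in>U - {w}. A' f u * c u) = 0"
      using insert.IH[of "U - {w}" A'] insert.prems by auto
    define c' where "c' u = (if u = w then - (\<Sum>u\<in>U - {w}. A e u * c u) / A e w else c u)" for u
    have sum: "(\<Sum>u\<in>U. A f u * c' u) = (\<Sum>u\<in>U - {w}. A' f u * c u)" for f
    proof -
      have "(\<Sum>u\<in>U. A f u * c' u) = A f w * c' w + (\<Sum>u\<in>U - {w}. A f u * c u)"
        using insert.prems w by (subst sum.remove[of U w]) (auto simp: c'_def)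
      also have "A f w * c' w = - (\<Sum>u\<in>U - {w}. A f w * A e u / A e w * c u)"
        by (simp add: c'_def sum_distrib_left sum_divide_distrib mult_ac)
      finally show ?thesis by (simp add: A'_def left_diff_distrib sum_subtractf)
    qed
    have "(\<Sum>u\<in>U. A e u * c' u) = 0" unfolding sum using w by (simp add: A'_def)
    moreover have "\<exists>u\<in>U. c' u \<noteq> 0" using c(1) by (auto simp: c'_def)
    ultimately show ?thesis using c(2) sum by (intro exI[of _ c']) auto
  qed
qed

section \<open>Holomorphic functions on complex manifolds\<close>

lemma chart_on_open: "chart_on T \<kappa> \<Longrightarrow> openin T (fst \<kappa>)"
  by (simp add: chart_on_def)

lemma chart_on_inj: "chart_on T \<kappa> \<Longrightarrow> inj_on (snd \<kappa>) (fst \<kappa>)"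
  unfolding chart_on_def using homeomorphic_imp_injective_map[of "subtopology T (fst \<kappa>)"]
  by (auto simp: topspace_subtopology openin_subset Int_absorb1)

lemma chart_inv_chart [simp]: "chart_on T \<kappa> \<Longrightarrow> x \<in> fst \<kappa> \<Longrightarrow> chart_inv \<kappa> (snd \<kappa> x) = x"
  unfolding chart_inv_def by (intro inv_into_f_f chart_on_inj)

lemma chart_on_open_image:
  assumes "chart_on T \<kappa>" "openin T U"
  shows "open (snd \<kappa> ` (fst \<kappa> \<inter> U))"
proof -
  have "open_map (subtopology T (fst \<kappa>)) (top_of_set (snd \<kappa> ` fst \<kappa>)) (snd \<kappa>)"
    using assms(1) by (auto simp: chart_on_def intro: homeomorphic_imp_open_map)
  moreover have "openin (subtopology T (fst \<kappa>)) (fst \<kappa> \<inter> U)"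
    using assms(2) by (simp add: openin_subtopology_Int2)
  ultimately have "openin (top_of_set (snd \<kappa> ` fst \<kappa>)) (snd \<kappa> ` (fst \<kappa> \<inter> U))"
    unfolding open_map_def by blast
  then show ?thesis using assms(1) openin_open_trans unfolding chart_on_def by blast
qed

lemma chart_on_open_vimage:
  assumes "chart_on T \<kappa>" "open V"
  shows "openin T {x \<in> fst \<kappa>. snd \<kappa> x \<in> V}"
proof -
  have sub: "fst \<kappa> \<subseteq> topspace T" using assms(1) by (simp add: chart_on_def openin_subset)
  have "continuous_map (subtopology T (fst \<kappa>)) (top_of_set (snd \<kappa> ` fst \<kappa>)) (snd \<kappa>)"
    using assms(1) by (auto simp: chart_on_def intro: homeomorphic_imp_continuous_map)
  moreover have "openin (top_of_set (snd \<kappa> ` fst \<kappa>)) (snd \<kappa> ` fst \<kappa> \<inter> V)"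
    using assms(2) by (simp add: openin_open_Int)
  ultimately have "openin (subtopology T (fst \<kappa>)) {x \<in> topspace (subtopology T (fst \<kappa>)). snd \<kappa> x \<in> snd \<kappa> ` fst \<kappa> \<inter> V}"
    unfolding continuous_map_def by blast
  also have "{x \<in> topspace (subtopology T (fst \<kappa>)). snd \<kappa> x \<in> snd \<kappa> ` fst \<kappa> \<inter> V} = {x \<in> fst \<kappa>. snd \<kappa> x \<in> V}"
    using sub by auto
  finally show ?thesis using openin_trans_full chart_on_open[OF assms(1)] by blast
qed

lemma cdiff_chart_change:
  assumes \<kappa>: "chart_on T \<kappa>" and \<mu>: "chart_on T \<mu>" and tr: "holomorphic_transition \<kappa> \<mu>"
    and x: "x \<in> fst \<kappa>" "x \<in> fst \<mu>" and f: "cdiff (\<lambda>w. f (chart_inv \<mu> w)) (snd \<mu> x)"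
  shows "cdiff (\<lambda>w. f (chart_inv \<kappa> w)) (snd \<kappa> x)"
proof -
  let ?U = "snd \<kappa> ` (fst \<kappa> \<inter> fst \<mu>)"
  have mem: "snd \<kappa> x \<in> ?U" using x by blast
  have "cdiff (\<lambda>w. f (chart_inv \<mu> (snd \<mu> (chart_inv \<kappa> w)))) (snd \<kappa> x)"
  proof (rule cdiff_compose)
    show "cdiff (\<lambda>w. snd \<mu> (chart_inv \<kappa> w) $ i) (snd \<kappa> x)" for i
      using tr mem unfolding holomorphic_transition_def mholomorphic_on_iff_cdiff by blast
    show "cdiff (\<lambda>w. f (chart_inv \<mu> w)) (snd \<mu> (chart_inv \<kappa> (snd \<kappa> x)))"
      using f \<kappa> x by simp
  qed
  then show ?thesis
  proof (rule cdiff_transform[OF _ chart_on_open_image[OF \<kappa> chart_on_open[OF \<mu>]] mem])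
    fix w assume "w \<in> ?U"
    then show "f (chart_inv \<mu> (snd \<mu> (chart_inv \<kappa> w))) = f (chart_inv \<kappa> w)"
      using \<kappa> \<mu> by auto
  qed
qed

text \<open>Holomorphy at a point, tested in all charts of the atlas.\<close>

definition hol_at :: "('a, 'n::finite) cmanifold \<Rightarrow> ('a \<Rightarrow> complex) \<Rightarrow> 'a \<Rightarrow> bool" where
  "hol_at X f x \<longleftrightarrow> (\<forall>\<kappa>\<in>atlas X. x \<in> fst \<kappa> \<longrightarrow> cdiff (\<lambda>w. f (chart_inv \<kappa> w)) (snd \<kappa> x))"

lemma holomorphic_fun_iff: "holomorphic_fun X U f \<longleftrightarrow> (\<forall>x\<in>U. hol_at X f x)"
  unfolding holomorphic_fun_def mholomorphic_on_iff_cdiff hol_at_def by blast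

lemma hol_at_const [intro]: "hol_at X (\<lambda>_. c) x"
  unfolding hol_at_def by auto

lemma hol_at_add: "hol_at X f x \<Longrightarrow> hol_at X g x \<Longrightarrow> hol_at X (\<lambda>x. f x + g x) x"
  unfolding hol_at_def by (auto intro: cdiff_add)

lemma hol_at_mult: "hol_at X f x \<Longrightarrow> hol_at X g x \<Longrightarrow> hol_at X (\<lambda>x. f x * g x) x"
  unfolding hol_at_def by (auto intro: cdiff_mult)

lemma hol_at_power: "hol_at X f x \<Longrightarrow> hol_at X (\<lambda>x. f x ^ k) x"
  unfolding hol_at_def by (auto intro: cdiff_power)

lemma hol_at_sum: "(\<And>i. i \<in> I \<Longrightarrow> hol_at X (f i) x) \<Longrightarrow> hol_at X (\<lambda>x. \<Sum>i\<in>I. f i x) x"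
  unfolding hol_at_def by (intro ballI impI cdiff_sum) blast

lemma hol_at_prod: "(\<And>i. i \<in> I \<Longrightarrow> hol_at X (f i) x) \<Longrightarrow> hol_at X (\<lambda>x. \<Prod>i\<in>I. f i x) x"
  unfolding hol_at_def by (intro ballI impI cdiff_prod) blast

locale manifold =
  fixes X :: "('a, 'n::finite) cmanifold"
  assumes cm: "complex_manifold X"
begin

lemma atlas_chart: "\<kappa> \<in> atlas X \<Longrightarrow> chart_on (topol X) \<kappa>"
  using cm by (simp add: complex_manifold_def)

lemma atlas_transition: "\<kappa> \<in> atlas X \<Longrightarrow> \<mu> \<in> atlas X \<Longrightarrow> holomorphic_transition \<kappa> \<mu>"
  using cm by (simp add: complex_manifold_def)

lemma atlas_cover:
  assumes "x \<in> points X" obtains \<kappa> where "\<kappa> \<in> atlas X" "x \<in> fst \<kappa>"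
  using cm assms unfolding complex_manifold_def by blast

lemma hol_at_chart:
  assumes "chart_on (topol X) \<mu>" "\<And>\<kappa>. \<kappa> \<in> atlas X \<Longrightarrow> holomorphic_transition \<kappa> \<mu>"
    "x \<in> fst \<mu>" "cdiff (\<lambda>w. f (chart_inv \<mu> w)) (snd \<mu> x)"
  shows "hol_at X f x"
  unfolding hol_at_def using cdiff_chart_change[OF atlas_chart assms(1,2)] assms(3,4) by blast

lemma hol_at_transform:
  assumes "hol_at X f x" "openin (topol X) U" "x \<in> U" "\<And>y. y \<in> U \<Longrightarrow> f y = g y"
  shows "hol_at X g x"
  unfolding hol_at_def
proof (intro ballI impI)
  fix \<kappa> assume \<kappa>: "\<kappa> \<in> atlas X" "x \<in> fst \<kappa>"
  have "cdiff (\<lambda>w. f (chart_inv \<kappa> w)) (snd \<kappa> x)" using assms(1) \<kappa> by (simp add: hol_at_def)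
  then show "cdiff (\<lambda>w. g (chart_inv \<kappa> w)) (snd \<kappa> x)"
    by (rule cdiff_transform[OF _ chart_on_open_image[OF atlas_chart[OF \<kappa>(1)] assms(2)]])
      (use \<kappa> assms(3,4) chart_inv_chart[OF atlas_chart[OF \<kappa>(1)]] in auto)
qed

lemma holomorphic_fun_chart:
  assumes "chart_on (topol X) \<kappa>" "\<And>\<mu>. \<mu> \<in> atlas X \<Longrightarrow> holomorphic_transition \<kappa> \<mu>" "holomorphic_fun X U f" "U \<subseteq> points X"
  shows "(\<lambda>w. f (chart_inv \<kappa> w)) mholomorphic_on (snd \<kappa> ` (fst \<kappa> \<inter> U))"
  unfolding mholomorphic_on_iff_cdiff
proof
  fix w assume "w \<in> snd \<kappa> ` (fst \<kappa> \<inter> U)"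
  then obtain x where x: "x \<in> fst \<kappa>" "x \<in> U" "w = snd \<kappa> x" by blast
  then obtain \<mu> where \<mu>: "\<mu> \<in> atlas X" "x \<in> fst \<mu>" using atlas_cover assms(4) by blast
  have "cdiff (\<lambda>w. f (chart_inv \<mu> w)) (snd \<mu> x)"
    using assms(3) x \<mu> by (simp add: holomorphic_fun_iff hol_at_def)
  then show "cdiff (\<lambda>w. f (chart_inv \<kappa> w)) w"
    unfolding x(3) using cdiff_chart_change[OF assms(1) atlas_chart[OF \<mu>(1)] assms(2)[OF \<mu>(1)]] x \<mu> by blast
qed

lemma openin_holomorphic_preimage:
  assumes "openin (topol X) U" "holomorphic_fun X U f" "open B"
  shows "openin (topol X) {x \<in> U. f x \<in> B}"
proof (rule iffD2[OF openin_subopen], intro ballI)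
  fix x assume x: "x \<in> {x \<in> U. f x \<in> B}"
  then have "x \<in> points X" using assms(1) openin_subset by blast
  then obtain \<kappa> where \<kappa>: "\<kappa> \<in> atlas X" "x \<in> fst \<kappa>" by (rule atlas_cover)
  note ch = atlas_chart[OF \<kappa>(1)]
  let ?U = "snd \<kappa> ` (fst \<kappa> \<inter> U)"
  have U: "open ?U" using chart_on_open_image[OF ch assms(1)] .
  have "continuous_on ?U (\<lambda>w. f (chart_inv \<kappa> w))"
    using assms(2) \<kappa> by (intro mholomorphic_on_continuous) (simp add: holomorphic_fun_def)
  then have "open (?U \<inter> (\<lambda>w. f (chart_inv \<kappa> w)) -` B)"
    using U assms(3) by (rule continuous_open_preimage)
  from chart_on_open_vimage[OF ch this]
  have "openin (topol X) {y \<in> fst \<kappa>. snd \<kappa> y \<in> ?U \<inter> (\<lambda>w. f (chart_inv \<kappa> w)) -` B}" .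
  moreover have "x \<in> {y \<in> fst \<kappa>. snd \<kappa> y \<in> ?U \<inter> (\<lambda>w. f (chart_inv \<kappa> w)) -` B}"
    using x \<kappa> ch by auto
  moreover have "{y \<in> fst \<kappa>. snd \<kappa> y \<in> ?U \<inter> (\<lambda>w. f (chart_inv \<kappa> w)) -` B} \<subseteq> {x \<in> U. f x \<in> B}"
  proof (rule subsetI)
    fix y assume "y \<in> {y \<in> fst \<kappa>. snd \<kappa> y \<in> ?U \<inter> (\<lambda>w. f (chart_inv \<kappa> w)) -` B}"
    then obtain z where *: "y \<in> fst \<kappa>" "snd \<kappa> y = snd \<kappa> z" "z \<in> fst \<kappa>" "z \<in> U" "f (chart_inv \<kappa> (snd \<kappa> y)) \<in> B" by auto
    then have "y = z" using chart_on_inj[OF ch] by (auto dest: inj_onD)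
    then show "y \<in> {x \<in> U. f x \<in> B}" using * ch by auto
  qed
  ultimately show "\<exists>T. openin (topol X) T \<and> x \<in> T \<and> T \<subseteq> {x \<in> U. f x \<in> B}" by blast
qed

lemma openin_nonzero:
  assumes "openin (topol X) U" "holomorphic_fun X U f"
  shows "openin (topol X) {x \<in> U. f x \<noteq> 0}"
  using openin_holomorphic_preimage[OF assms open_Compl[OF closed_singleton[of 0]]] by simp

lemma nowhere_locally_zero_mult:
  assumes U: "openin (topol X) U" and f: "holomorphic_fun X U f" "nowhere_locally_zero (topol X) U f"
    and g: "nowhere_locally_zero (topol X) U g"
  shows "nowhere_locally_zero (topol X) U (\<lambda>x. f x * g x)"
  unfolding nowhere_locally_zero_def
proof (intro allI impI, elim conjE)
  fix V assume V: "openin (topol X) V" "V \<noteq> {}" "V \<subseteq> U"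
  let ?V = "{x \<in> V. f x \<noteq> 0}"
  have "openin (topol X) ?V" using V f by (intro openin_nonzero) (auto simp: holomorphic_fun_iff)
  moreover have "?V \<noteq> {}" using f(2) V unfolding nowhere_locally_zero_def by blast
  moreover have "?V \<subseteq> U" using V by blast
  ultimately obtain x where "x \<in> ?V" "g x \<noteq> 0" using g unfolding nowhere_locally_zero_def by blast
  then show "\<exists>x\<in>V. f x * g x \<noteq> 0" by auto
qed

lemma nowhere_locally_zero_power:
  assumes U: "openin (topol X) U" and f: "holomorphic_fun X U f" "nowhere_locally_zero (topol X) U f"
  shows "nowhere_locally_zero (topol X) U (\<lambda>x. f x ^ k)"
proof (induction k)
  case 0 then show ?case by (auto simp: nowhere_locally_zero_def)
next
  case (Suc k) then show ?case using nowhere_locally_zero_mult[OF U f] by simp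
qed

lemma nowhere_locally_zero_prod:
  assumes U: "openin (topol X) U" and "finite I"
    and f: "\<And>i. i \<in> I \<Longrightarrow> holomorphic_fun X U (f i)" "\<And>i. i \<in> I \<Longrightarrow> nowhere_locally_zero (topol X) U (f i)"
  shows "nowhere_locally_zero (topol X) U (\<lambda>x. \<Prod>i\<in>I. f i x)"
  using assms(2) f
proof (induction I rule: finite_induct)
  case empty then show ?case by (auto simp: nowhere_locally_zero_def)
next
  case (insert i I)
  then show ?case using nowhere_locally_zero_mult[OF U, of "f i" "\<lambda>x. \<Prod>i\<in>I. f i x"] by simp
qed

lemma nowhere_locally_zero_subset: "nowhere_locally_zero T U f \<Longrightarrow> V \<subseteq> U \<Longrightarrow> nowhere_locally_zero T V f"
  unfolding nowhere_locally_zero_def by blast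

lemma holomorphic_fun_subset: "holomorphic_fun X U f \<Longrightarrow> V \<subseteq> U \<Longrightarrow> holomorphic_fun X V f"
  unfolding holomorphic_fun_iff by blast

lemma nowhere_locally_zero_chart:
  assumes \<mu>: "\<mu> \<in> atlas X" "x \<in> fst \<mu>" and U: "openin (topol X) U" "x \<in> U" "nowhere_locally_zero (topol X) U h"
    and V: "open V" "snd \<mu> x \<in> V"
  shows "\<exists>z\<in>V. h (chart_inv \<mu> z) \<noteq> 0"
proof -
  note ch = atlas_chart[OF \<mu>(1)]
  let ?V = "{y \<in> fst \<mu>. snd \<mu> y \<in> V} \<inter> U"
  have "openin (topol X) ?V" using chart_on_open_vimage[OF ch V(1)] U(1) by blast
  moreover have "x \<in> ?V" using V(2) \<mu>(2) U(2) by blast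
  ultimately obtain y where "y \<in> ?V" "h y \<noteq> 0" using U(3) unfolding nowhere_locally_zero_def by blast
  then show ?thesis using chart_inv_chart[OF ch] by (intro bexI[of _ "snd \<mu> y"]) auto
qed

text \<open>How denominators are cancelled: they may vanish, but not on an open set.\<close>

lemma eq_zero_if_mult_zero:
  assumes "openin (topol X) U" "holomorphic_fun X U f" "nowhere_locally_zero (topol X) U g"
    "\<And>x. x \<in> U \<Longrightarrow> f x * g x = 0" "x \<in> U"
  shows "f x = 0"
proof (rule ccontr)
  assume "f x \<noteq> 0"
  then have "{x \<in> U. f x \<noteq> 0} \<noteq> {}" using assms(5) by blast
  then obtain y where "y \<in> {x \<in> U. f x \<noteq> 0}" "g y \<noteq> 0"
    using openin_nonzero[OF assms(1,2)] assms(3) unfolding nowhere_locally_zero_def by blast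
  then show False using assms(4) by auto
qed

lemma holomorphic_fun_diff:
  "holomorphic_fun X U f \<Longrightarrow> holomorphic_fun X U g \<Longrightarrow> holomorphic_fun X U (\<lambda>x. f x - g x)"
  using hol_at_add[of X f _ "\<lambda>x. (-1) * g x"] hol_at_mult[of X "\<lambda>_. -1"] hol_at_const
  unfolding holomorphic_fun_iff by fastforce

text \<open>The cocycle is determined where the local equations of the divisor do not vanish, which is a
  dense set.\<close>

lemma is_transition_unique:
  assumes D: "is_divisor X D" "i \<in> idx D" "j \<in> idx D" and u: "is_transition X D i j u" "is_transition X D i j u'"
    and x: "x \<in> opn D i \<inter> opn D j"
  shows "u x = u' x"
proof -
  let ?U = "opn D i \<inter> opn D j"
  have U: "openin (topol X) ?U" using D by (auto simp: is_divisor_def)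
  have "nowhere_locally_zero (topol X) ?U (\<lambda>x. numer D j x * denom D i x)"
    using D by (intro nowhere_locally_zero_mult[OF U])
      (auto simp: is_divisor_def intro: nowhere_locally_zero_subset holomorphic_fun_subset)
  moreover have "holomorphic_fun X ?U (\<lambda>x. u x - u' x)"
    using u by (intro holomorphic_fun_diff) (auto simp: is_transition_def)
  moreover have "(u x - u' x) * (numer D j x * denom D i x) = 0" if "x \<in> ?U" for x
  proof -
    have "numer D i x * denom D j x = u x * (numer D j x * denom D i x)"
      "numer D i x * denom D j x = u' x * (numer D j x * denom D i x)"
      using u that unfolding is_transition_def by blast+
    then show ?thesis by (auto simp: left_diff_distrib)
  qed
  ultimately have "u x - u' x = 0" using eq_zero_if_mult_zero[OF U] x by blast
  then show ?thesis by simp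
qed

lemma transition_eq:
  assumes "is_divisor X D" "i \<in> idx D" "j \<in> idx D" "is_transition X D i j u" "x \<in> opn D i \<inter> opn D j"
  shows "transition X D i j x = u x"
proof (rule is_transition_unique[OF assms(1-3) _ assms(4,5)])
  show "is_transition X D i j (transition X D i j)"
    unfolding transition_def using someI[of "is_transition X D i j", OF assms(4)] .
qed

lemma is_transition_transition:
  assumes "is_divisor X D" "i \<in> idx D" "j \<in> idx D"
  shows "is_transition X D i j (transition X D i j)"
proof -
  have "\<exists>u. is_transition X D i j u" using assms unfolding is_divisor_def by blast
  then show ?thesis unfolding transition_def by (rule someI_ex)
qed

end

section \<open>Sections of the line bundles of effective combinations\<close>

text \<open>Only combinations with natural coefficients occur, because the cone lies in the nonnegative
  orthant.  For these \<open>DD a\<close>, \<open>Sec a\<close>, \<open>fr a\<close> and \<open>mm a\<close> are the divisor, its sections, the inherited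
  frame and the inherited metric, with simpler formulas than for integer coefficients; \<open>gg a\<close> is
  the cocycle.\<close>

locale manifold_divisors = manifold X for X :: "('a, 'n::finite) cmanifold" +
  fixes D :: "'r::finite \<Rightarrow> ('a, 'i) divisor"
  assumes div: "is_divisor X (D j)"
begin

abbreviation DD :: "('r \<Rightarrow> nat) \<Rightarrow> ('a, 'r \<Rightarrow> 'i) divisor" where
  "DD a \<equiv> comb_divisor D (\<lambda>j. int (a j))"

definition Idx :: "('r \<Rightarrow> 'i) set" where "Idx = {t. \<forall>j. t j \<in> idx (D j)}"

definition Opn :: "('r \<Rightarrow> 'i) \<Rightarrow> 'a set" where "Opn t = (\<Inter>j. opn (D j) (t j))"

definition gg :: "('r \<Rightarrow> nat) \<Rightarrow> ('r \<Rightarrow> 'i) \<Rightarrow> ('r \<Rightarrow> 'i) \<Rightarrow> 'a \<Rightarrow> complex" where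
  "gg a t t' x = (\<Prod>j\<in>UNIV. transition X (D j) (t j) (t' j) x ^ a j)"

lemma DD_simps [simp]:
  "idx (DD a) = Idx" "opn (DD a) = Opn"
  "numer (DD a) t x = (\<Prod>j\<in>UNIV. numer (D j) (t j) x ^ a j)"
  "denom (DD a) t x = (\<Prod>j\<in>UNIV. denom (D j) (t j) x ^ a j)"
  by (auto simp: comb_divisor_def Idx_def Opn_def)

lemma mult_divisor_DD: "mult_divisor k (DD a) = DD (\<lambda>j. k * a j)"
  unfolding mult_divisor_def comb_divisor_def
  by (simp add: fun_eq_iff prod_power_distrib power_mult[symmetric] mult.commute flip: of_nat_mult)

lemma openin_Opn: "t \<in> Idx \<Longrightarrow> openin (topol X) (Opn t)"
  unfolding Opn_def using div by (intro openin_Inter) (auto simp: Idx_def is_divisor_def)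

lemma Opn_subset: "t \<in> Idx \<Longrightarrow> Opn t \<subseteq> points X"
  using openin_Opn openin_subset by blast

lemma Opn_cover:
  assumes "x \<in> points X"
  obtains t where "t \<in> Idx" "x \<in> Opn t"
proof -
  have "\<forall>j. \<exists>i. i \<in> idx (D j) \<and> x \<in> opn (D j) i" using div assms unfolding is_divisor_def by blast
  then obtain t where "\<And>j. t j \<in> idx (D j) \<and> x \<in> opn (D j) (t j)" by metis
  then show ?thesis by (intro that[of t]) (auto simp: Idx_def Opn_def)
qed

lemma transition_props:
  assumes "t \<in> Idx" "t' \<in> Idx" "x \<in> Opn t \<inter> Opn t'"
  shows "transition X (D j) (t j) (t' j) x \<noteq> 0"
    "hol_at X (transition X (D j) (t j) (t' j)) x"
    "numer (D j) (t j) x * denom (D j) (t' j) x = transition X (D j) (t j) (t' j) x * (numer (D j) (t' j) x * denom (D j) (t j) x)"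
  using is_transition_transition[OF div[of j], of "t j" "t' j"] assms
  unfolding is_transition_def holomorphic_fun_iff by (auto simp: Idx_def Opn_def)

lemma gg_nonzero: "t \<in> Idx \<Longrightarrow> t' \<in> Idx \<Longrightarrow> x \<in> Opn t \<inter> Opn t' \<Longrightarrow> gg a t t' x \<noteq> 0"
  using transition_props(1) by (auto simp: gg_def)

lemma hol_at_gg: "t \<in> Idx \<Longrightarrow> t' \<in> Idx \<Longrightarrow> x \<in> Opn t \<inter> Opn t' \<Longrightarrow> hol_at X (gg a t t') x"
  unfolding gg_def[abs_def] using transition_props(2) by (intro hol_at_prod hol_at_power) blast

lemma gg_add: "gg (\<lambda>j. a j + b j) t t' x = gg a t t' x * gg b t t' x"
  by (simp add: gg_def power_add prod.distrib)

lemma gg_mult: "gg (\<lambda>j. k * a j) t t' x = gg a t t' x ^ k"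
  by (simp add: gg_def power_mult[symmetric] mult.commute prod_power_distrib)

lemma is_transition_DD:
  assumes "t \<in> Idx" "t' \<in> Idx"
  shows "is_transition X (DD a) t t' (gg a t t')"
  unfolding is_transition_def holomorphic_fun_iff
proof (intro conjI ballI)
  fix x assume "x \<in> opn (DD a) t \<inter> opn (DD a) t'"
  then have x: "x \<in> Opn t \<inter> Opn t'" by simp
  show "hol_at X (gg a t t') x" "gg a t t' x \<noteq> 0" using hol_at_gg gg_nonzero assms x by blast+
  show "numer (DD a) t x * denom (DD a) t' x = gg a t t' x * (numer (DD a) t' x * denom (DD a) t x)"
    using transition_props(3)[OF assms x] by (simp add: gg_def prod.distrib[symmetric] power_mult_distrib[symmetric])
qed

lemma numer_denom:
  assumes "t \<in> Idx"
  shows "holomorphic_fun X (Opn t) (numer (DD a) t)" "holomorphic_fun X (Opn t) (denom (DD a) t)"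
    "nowhere_locally_zero (topol X) (Opn t) (numer (DD a) t)"
    "nowhere_locally_zero (topol X) (Opn t) (denom (DD a) t)"
proof -
  have sub: "Opn t \<subseteq> opn (D j) (t j)" for j by (auto simp: Opn_def)
  have j: "holomorphic_fun X (Opn t) (numer (D j) (t j))" "holomorphic_fun X (Opn t) (denom (D j) (t j))"
    "nowhere_locally_zero (topol X) (Opn t) (numer (D j) (t j))"
    "nowhere_locally_zero (topol X) (Opn t) (denom (D j) (t j))" for j
    using div[of j] assms holomorphic_fun_subset[OF _ sub[of j]] nowhere_locally_zero_subset[OF _ sub[of j]]
    unfolding is_divisor_def Idx_def by blast+
  have p: "holomorphic_fun X (Opn t) (\<lambda>x. numer (D j) (t j) x ^ a j)" "holomorphic_fun X (Opn t) (\<lambda>x. denom (D j) (t j) x ^ a j)" for j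
    using j(1,2)[of j] unfolding holomorphic_fun_iff by (auto intro: hol_at_power)
  have nd: "numer (DD a) t = (\<lambda>x. \<Prod>j\<in>UNIV. numer (D j) (t j) x ^ a j)" "denom (DD a) t = (\<lambda>x. \<Prod>j\<in>UNIV. denom (D j) (t j) x ^ a j)"
    by (auto simp: fun_eq_iff)
  show "holomorphic_fun X (Opn t) (numer (DD a) t)" "holomorphic_fun X (Opn t) (denom (DD a) t)"
    using p unfolding nd holomorphic_fun_iff by (auto intro!: hol_at_prod)
  show "nowhere_locally_zero (topol X) (Opn t) (numer (DD a) t)" "nowhere_locally_zero (topol X) (Opn t) (denom (DD a) t)"
    unfolding nd using p
    by (auto intro!: nowhere_locally_zero_prod[OF openin_Opn[OF assms]] nowhere_locally_zero_power[OF openin_Opn[OF assms]] j)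
qed

lemma is_divisor_DD: "is_divisor X (DD a)"
proof -
  have "\<Union> (Opn ` Idx) = points X"
  proof
    show "\<Union> (Opn ` Idx) \<subseteq> points X" using Opn_subset by auto
    show "points X \<subseteq> \<Union> (Opn ` Idx)" by (auto elim!: Opn_cover)
  qed
  note cover = this
  show ?thesis unfolding is_divisor_def DD_simps(1,2)
  proof (intro conjI ballI)
    fix t assume t: "t \<in> Idx"
    show "openin (topol X) (Opn t)" by (rule openin_Opn[OF t])
    show "holomorphic_fun X (Opn t) (numer (DD a) t)" "holomorphic_fun X (Opn t) (denom (DD a) t)"
      "nowhere_locally_zero (topol X) (Opn t) (numer (DD a) t)"
      "nowhere_locally_zero (topol X) (Opn t) (denom (DD a) t)"
      by (rule numer_denom[OF t])+
    fix t' assume "t' \<in> Idx"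
    then show "\<exists>u. is_transition X (DD a) t t' u" using is_transition_DD[OF t] by blast
  qed (rule cover)
qed

definition Sec :: "('r \<Rightarrow> nat) \<Rightarrow> (('r \<Rightarrow> 'i) \<Rightarrow> 'a \<Rightarrow> complex) set" where
  "Sec a = {s. (\<forall>t\<in>Idx. holomorphic_fun X (Opn t) (s t)) \<and>
     (\<forall>t\<in>Idx. \<forall>t'\<in>Idx. \<forall>x\<in>Opn t \<inter> Opn t'. s t x = gg a t t' x * s t' x)}"

lemma transition_DD:
  "t \<in> Idx \<Longrightarrow> t' \<in> Idx \<Longrightarrow> x \<in> Opn t \<inter> Opn t' \<Longrightarrow> transition X (DD a) t t' x = gg a t t' x"
  by (rule transition_eq[OF is_divisor_DD _ _ is_transition_DD]) auto

lemma H0_DD: "H0 X (DD a) = Sec a"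
proof -
  have "(\<forall>t\<in>Idx. \<forall>t'\<in>Idx. \<forall>x\<in>Opn t \<inter> Opn t'. s t x = transition X (DD a) t t' x * s t' x) \<longleftrightarrow>
    (\<forall>t\<in>Idx. \<forall>t'\<in>Idx. \<forall>x\<in>Opn t \<inter> Opn t'. s t x = gg a t t' x * s t' x)" for s
    by (rule ball_cong[OF refl], rule ball_cong[OF refl], rule ball_cong[OF refl]) (simp only: transition_DD)
  then show ?thesis unfolding H0_def Sec_def DD_simps(1,2) by (simp only:)
qed

lemma SecD: "s \<in> Sec a \<Longrightarrow> t \<in> Idx \<Longrightarrow> holomorphic_fun X (Opn t) (s t)"
  "s \<in> Sec a \<Longrightarrow> t \<in> Idx \<Longrightarrow> t' \<in> Idx \<Longrightarrow> x \<in> Opn t \<Longrightarrow> x \<in> Opn t' \<Longrightarrow> s t x = gg a t t' x * s t' x"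
  unfolding Sec_def by blast+

lemma SecI:
  assumes "\<And>t x. t \<in> Idx \<Longrightarrow> x \<in> Opn t \<Longrightarrow> hol_at X (s t) x"
    "\<And>t t' x. t \<in> Idx \<Longrightarrow> t' \<in> Idx \<Longrightarrow> x \<in> Opn t \<Longrightarrow> x \<in> Opn t' \<Longrightarrow> s t x = gg a t t' x * s t' x"
  shows "s \<in> Sec a"
  using assms unfolding Sec_def holomorphic_fun_iff by blast

lemma Sec_hol_at: "s \<in> Sec a \<Longrightarrow> t \<in> Idx \<Longrightarrow> x \<in> Opn t \<Longrightarrow> hol_at X (s t) x"
  using SecD(1)[of s a t] unfolding holomorphic_fun_iff by blast

lemma Sec_mult:
  assumes "s \<in> Sec a" "s' \<in> Sec b"
  shows "(\<lambda>t x. s t x * s' t x) \<in> Sec (\<lambda>j. a j + b j)"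
proof (rule SecI)
  fix t t' x assume *: "t \<in> Idx" "t' \<in> Idx" "x \<in> Opn t" "x \<in> Opn t'"
  show "s t x * s' t x = gg (\<lambda>j. a j + b j) t t' x * (s t' x * s' t' x)"
    unfolding SecD(2)[OF assms(1) *] SecD(2)[OF assms(2) *] gg_add by simp
qed (intro hol_at_mult Sec_hol_at[OF assms(1)] Sec_hol_at[OF assms(2)])

lemma Sec_one: "(\<lambda>t x. 1) \<in> Sec (\<lambda>_. 0)"
  by (rule SecI) (auto simp: gg_def)

lemma Sec_sum:
  assumes "\<And>u. u \<in> I \<Longrightarrow> s u \<in> Sec a"
  shows "(\<lambda>t x. \<Sum>u\<in>I. c u * s u t x) \<in> Sec a"
proof (rule SecI)
  fix t t' x assume *: "t \<in> Idx" "t' \<in> Idx" "x \<in> Opn t" "x \<in> Opn t'"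
  show "(\<Sum>u\<in>I. c u * s u t x) = gg a t t' x * (\<Sum>u\<in>I. c u * s u t' x)"
    unfolding sum_distrib_left
  proof (rule sum.cong[OF refl])
    fix u assume "u \<in> I"
    then show "c u * s u t x = gg a t t' x * (c u * s u t' x)"
      using SecD(2)[OF assms *] by simp
  qed
qed (intro hol_at_sum hol_at_mult hol_at_const Sec_hol_at[OF assms])

lemma Sec_cmult: "s \<in> Sec a \<Longrightarrow> (\<lambda>t x. c * s t x) \<in> Sec a"
  using Sec_sum[of "{()}" "\<lambda>_. s" a "\<lambda>_. c"] by simp

definition nz :: "(('r \<Rightarrow> 'i) \<Rightarrow> 'a \<Rightarrow> complex) \<Rightarrow> bool" where
  "nz s \<longleftrightarrow> (\<exists>t\<in>Idx. \<exists>x\<in>Opn t. s t x \<noteq> 0)"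

lemma nonzero_section_DD: "nonzero_section (DD a) s \<longleftrightarrow> nz s"
  by (simp add: nonzero_section_def nz_def)

text \<open>The points near which \<open>s\<close> vanishes form an open set, which is closed by the identity theorem in
  charts.\<close>

lemma Sec_identity:
  assumes conn: "connected_space (topol X)" and s: "s \<in> Sec a"
    and V: "openin (topol X) V" "V \<noteq> {}" "\<And>x. x \<in> V \<Longrightarrow> \<exists>t\<in>Idx. x \<in> Opn t \<and> s t x = 0"
  shows "\<not> nz s"
proof -
  define Z where "Z = \<Union>{W. openin (topol X) W \<and> (\<forall>y\<in>W. \<forall>t\<in>Idx. y \<in> Opn t \<longrightarrow> s t y = 0)}"
  have all: "s t' x = 0" if "t \<in> Idx" "x \<in> Opn t" "s t x = 0" "t' \<in> Idx" "x \<in> Opn t'" for t t' x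
    using SecD(2)[OF s that(4,1,5,2)] that by simp
  have oZ: "openin (topol X) Z" unfolding Z_def by (intro openin_Union) auto
  have Z0: "s t y = 0" if "y \<in> Z" "t \<in> Idx" "y \<in> Opn t" for t y using that by (auto simp: Z_def)
  have VZ: "V \<subseteq> Z" unfolding Z_def using V all by blast
  have "openin (topol X) (points X - Z)"
  proof (rule iffD2[OF openin_subopen], intro ballI)
    fix x assume x: "x \<in> points X - Z"
    obtain \<kappa> where \<kappa>: "\<kappa> \<in> atlas X" "x \<in> fst \<kappa>" using x by (auto intro: atlas_cover)
    obtain t where t: "t \<in> Idx" "x \<in> Opn t" using x by (auto intro: Opn_cover)
    note ch = atlas_chart[OF \<kappa>(1)]
    let ?U = "snd \<kappa> ` (fst \<kappa> \<inter> Opn t)"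
    have "open ?U" using chart_on_open_image[OF ch openin_Opn[OF t(1)]] .
    moreover have "snd \<kappa> x \<in> ?U" using \<kappa> t by blast
    ultimately obtain r where r: "r > 0" "ball (snd \<kappa> x) r \<subseteq> ?U" using open_contains_ball by blast
    define N where "N = {y \<in> fst \<kappa>. snd \<kappa> y \<in> ball (snd \<kappa> x) r}"
    have oN: "openin (topol X) N" unfolding N_def by (rule chart_on_open_vimage[OF ch]) auto
    have NO: "N \<subseteq> Opn t"
    proof
      fix y assume "y \<in> N"
      then obtain y' where "y' \<in> fst \<kappa> \<inter> Opn t" "snd \<kappa> y = snd \<kappa> y'" "y \<in> fst \<kappa>" using r by (auto simp: N_def)
      then show "y \<in> Opn t" using inj_onD[OF chart_on_inj[OF ch], of y y'] by auto
    qed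
    have "N \<inter> Z = {}"
    proof (rule ccontr)
      assume ne: "N \<inter> Z \<noteq> {}"
      let ?V = "snd \<kappa> ` (fst \<kappa> \<inter> (N \<inter> Z))"
      have zero: "s t (chart_inv \<kappa> w) = 0" if w: "w \<in> ball (snd \<kappa> x) r" for w
      proof (rule mholomorphic_identity[of "\<lambda>w. s t (chart_inv \<kappa> w)" "ball (snd \<kappa> x) r" ?V w])
        have "(\<lambda>w. s t (chart_inv \<kappa> w)) mholomorphic_on ?U"
          using SecD(1)[OF s t(1)] \<kappa>(1) by (simp add: holomorphic_fun_def)
        then show "(\<lambda>w. s t (chart_inv \<kappa> w)) mholomorphic_on ball (snd \<kappa> x) r"
          using r(2) unfolding mholomorphic_on_iff_cdiff by blast
        show "open ?V" using chart_on_open_image[OF ch openin_Int[OF oN oZ]] .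
        show "?V \<noteq> {}" "?V \<subseteq> ball (snd \<kappa> x) r" using ne by (auto simp: N_def)
        show "s t (chart_inv \<kappa> z) = 0" if "z \<in> ?V" for z
        proof -
          obtain y where "y \<in> fst \<kappa>" "y \<in> N" "y \<in> Z" "z = snd \<kappa> y" using \<open>z \<in> ?V\<close> by blast
          then show ?thesis using Z0[of y t] NO t(1) chart_inv_chart[OF ch] by auto
        qed
      qed (use w in auto)
      have "s t' y = 0" if "y \<in> N" "t' \<in> Idx" "y \<in> Opn t'" for y t'
      proof -
        have "s t y = 0" using zero[of "snd \<kappa> y"] that(1) ch by (simp add: N_def)
        then show ?thesis using all[OF t(1) _ _ that(2,3)] that(1) NO by blast
      qed
      then have "N \<subseteq> Z" unfolding Z_def using oN by blast
      moreover have "x \<in> N" using \<kappa> r by (simp add: N_def)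
      ultimately show False using x by blast
    qed
    then have "N \<subseteq> points X - Z" using openin_subset[OF oN] by blast
    moreover have "x \<in> N" using \<kappa> r by (simp add: N_def)
    ultimately show "\<exists>T. openin (topol X) T \<and> x \<in> T \<and> T \<subseteq> points X - Z" using oN by blast
  qed
  then have "closedin (topol X) Z" using oZ openin_subset by (auto simp: closedin_def)
  then have "Z = points X" using conn oZ VZ V(2) unfolding connected_space_clopen_in by blast
  then show ?thesis using Z0 Opn_subset unfolding nz_def by blast
qed

end

section \<open>Expansions of sections at a point\<close>

locale framed_manifold = manifold_divisors X D
  for X :: "('a, 'n::{finite,linorder}) cmanifold" and D :: "'r::finite \<Rightarrow> ('a, 'i) divisor" +
  fixes x0 :: 'a and \<kappa> :: "('a, 'n) chart" and e :: "'r \<Rightarrow> 'i \<Rightarrow> 'a \<Rightarrow> complex"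
  assumes conn: "connected_space (topol X)"
    and coord: "coordinates_at X x0 \<kappa>"
    and frame: "local_frame X (D j) x0 (e j)"
begin

lemma \<kappa>_chart: "chart_on (topol X) \<kappa>" and x0_chart: "x0 \<in> fst \<kappa>" "snd \<kappa> x0 = 0"
  and \<kappa>_transition: "\<mu> \<in> atlas X \<Longrightarrow> holomorphic_transition \<kappa> \<mu>"
  using coord by (auto simp: coordinates_at_def)

lemma chart_inv_0: "chart_inv \<kappa> 0 = x0"
  using chart_inv_chart[OF \<kappa>_chart x0_chart(1)] x0_chart(2) by simp

lemma x0_points: "x0 \<in> points X"
  using chart_on_open[OF \<kappa>_chart] x0_chart(1) openin_subset by blast

definition fr :: "('r \<Rightarrow> nat) \<Rightarrow> ('r \<Rightarrow> 'i) \<Rightarrow> 'a \<Rightarrow> complex" where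
  "fr a t x = (\<Prod>j\<in>UNIV. e j (t j) x ^ a j)"

lemma comb_frame_fr: "comb_frame e (\<lambda>j. int (a j)) = fr a"
  by (intro ext) (simp add: comb_frame_def fr_def)

lemma fr_add: "fr (\<lambda>j. a j + b j) t x = fr a t x * fr b t x"
  by (simp add: fr_def power_add prod.distrib)

lemma frame_nbhd:
  obtains W where "openin (topol X) W" "x0 \<in> W"
    "\<forall>t\<in>Idx. \<forall>x\<in>W \<inter> Opn t. \<forall>j. e j (t j) x \<noteq> 0 \<and> hol_at X (e j (t j)) x"
    "\<forall>t\<in>Idx. \<forall>t'\<in>Idx. \<forall>x\<in>W \<inter> Opn t \<inter> Opn t'. \<forall>a. fr a t x = gg a t t' x * fr a t' x"
proof -
  have "\<forall>j. \<exists>W. openin (topol X) W \<and> x0 \<in> W \<and>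
     (\<forall>i\<in>idx (D j). holomorphic_fun X (W \<inter> opn (D j) i) (e j i) \<and> (\<forall>y\<in>W \<inter> opn (D j) i. e j i y \<noteq> 0)) \<and>
     (\<forall>i\<in>idx (D j). \<forall>i'\<in>idx (D j). \<forall>y\<in>W \<inter> opn (D j) i \<inter> opn (D j) i'. e j i y = transition X (D j) i i' y * e j i' y)"
    using frame unfolding local_frame_def by blast
  then obtain W where W: "\<And>j. openin (topol X) (W j)" "\<And>j. x0 \<in> W j"
    "\<And>j i y. i \<in> idx (D j) \<Longrightarrow> y \<in> W j \<inter> opn (D j) i \<Longrightarrow> hol_at X (e j i) y \<and> e j i y \<noteq> 0"
    "\<And>j i i' y. i \<in> idx (D j) \<Longrightarrow> i' \<in> idx (D j) \<Longrightarrow> y \<in> W j \<inter> opn (D j) i \<inter> opn (D j) i' \<Longrightarrow>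
       e j i y = transition X (D j) i i' y * e j i' y"
    unfolding holomorphic_fun_iff by metis
  show ?thesis
  proof (rule that[of "\<Inter>j. W j"])
    show "openin (topol X) (\<Inter>j. W j)" using W(1) by (intro openin_Inter) auto
    show "x0 \<in> (\<Inter>j. W j)" using W(2) by blast
    show "\<forall>t\<in>Idx. \<forall>x\<in>(\<Inter>j. W j) \<inter> Opn t. \<forall>j. e j (t j) x \<noteq> 0 \<and> hol_at X (e j (t j)) x"
      using W(3) by (auto simp: Idx_def Opn_def)
    show "\<forall>t\<in>Idx. \<forall>t'\<in>Idx. \<forall>x\<in>(\<Inter>j. W j) \<inter> Opn t \<inter> Opn t'. \<forall>a. fr a t x = gg a t t' x * fr a t' x"
    proof (intro ballI allI)
      fix t t' x a assume *: "t \<in> Idx" "t' \<in> Idx" "x \<in> (\<Inter>j. W j) \<inter> Opn t \<inter> Opn t'"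
      have "e j (t j) x = transition X (D j) (t j) (t' j) x * e j (t' j) x" for j
        using * by (intro W(4)) (auto simp: Idx_def Opn_def)
      then have "fr a t x = (\<Prod>j\<in>UNIV. (transition X (D j) (t j) (t' j) x * e j (t' j) x) ^ a j)"
        unfolding fr_def by (intro prod.cong refl) metis
      then show "fr a t x = gg a t t' x * fr a t' x"
        by (simp add: fr_def gg_def power_mult_distrib prod.distrib)
    qed
  qed
qed

text \<open>The local expression of a section in the frame, and its power series coefficients.  The latter
  do not depend on the index \<open>t\<close> of the cover, as section and frame change by the same factor.\<close>

definition loc :: "('r \<Rightarrow> nat) \<Rightarrow> (('r \<Rightarrow> 'i) \<Rightarrow> 'a \<Rightarrow> complex) \<Rightarrow> ('r \<Rightarrow> 'i) \<Rightarrow> (complex, 'n) vec \<Rightarrow> complex" where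
  "loc a s t w = s t (chart_inv \<kappa> w) / fr a t (chart_inv \<kappa> w)"

definition cf :: "('r \<Rightarrow> nat) \<Rightarrow> (('r \<Rightarrow> 'i) \<Rightarrow> 'a \<Rightarrow> complex) \<Rightarrow> (nat, 'n) vec \<Rightarrow> complex" where
  "cf a s = coeffs \<kappa> (DD a) (fr a) s"

lemma loc_holomorphic:
  assumes t: "t \<in> Idx" "x0 \<in> Opn t"
  obtains U where "open U" "0 \<in> U" "\<And>a s. s \<in> Sec a \<Longrightarrow> loc a s t mholomorphic_on U"
    "\<And>w. w \<in> U \<Longrightarrow> \<exists>x\<in>fst \<kappa> \<inter> Opn t. w = snd \<kappa> x \<and> (\<forall>a. fr a t x \<noteq> 0)"
    "\<And>w j. w \<in> U \<Longrightarrow> isCont (\<lambda>w. e j (t j) (chart_inv \<kappa> w)) w"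
proof -
  obtain W where W: "openin (topol X) W" "x0 \<in> W"
    "\<forall>t\<in>Idx. \<forall>x\<in>W \<inter> Opn t. \<forall>j. e j (t j) x \<noteq> 0 \<and> hol_at X (e j (t j)) x"
    by (rule frame_nbhd)
  let ?O = "W \<inter> Opn t"
  let ?U = "snd \<kappa> ` (fst \<kappa> \<inter> ?O)"
  have O: "openin (topol X) ?O" using W(1) openin_Opn[OF t(1)] by blast
  have sub: "?O \<subseteq> points X" using O openin_subset by blast
  have e: "(\<lambda>w. e j (t j) (chart_inv \<kappa> w)) mholomorphic_on ?U" for j
    using W(3) t(1) by (intro holomorphic_fun_chart[OF \<kappa>_chart \<kappa>_transition _ sub]) (auto simp: holomorphic_fun_iff)
  have nz: "e j (t j) (chart_inv \<kappa> w) \<noteq> 0" if "w \<in> ?U" for w j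
    using that W(3) t(1) \<kappa>_chart by auto
  show ?thesis
  proof (rule that[of ?U])
    show "open ?U" by (rule chart_on_open_image[OF \<kappa>_chart O])
    show "0 \<in> ?U" using x0_chart W(2) t(2) by (metis IntI image_eqI)
    show "\<exists>x\<in>fst \<kappa> \<inter> Opn t. w = snd \<kappa> x \<and> (\<forall>a. fr a t x \<noteq> 0)" if "w \<in> ?U" for w
      using that W(3) t(1) by (auto simp: fr_def)
    show "isCont (\<lambda>w. e j (t j) (chart_inv \<kappa> w)) w" if "w \<in> ?U" for w j
      using e[of j] that unfolding mholomorphic_on_iff_cdiff by (intro cdiff_continuous) blast
    fix a s assume s: "s \<in> Sec a"
    have "(\<lambda>w. s t (chart_inv \<kappa> w)) mholomorphic_on ?U"
      using SecD(1)[OF s t(1)] by (intro holomorphic_fun_chart[OF \<kappa>_chart \<kappa>_transition _ sub]) (auto simp: holomorphic_fun_iff)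
    then show "loc a s t mholomorphic_on ?U"
      using e nz unfolding mholomorphic_on_iff_cdiff loc_def[abs_def] fr_def
      by (auto intro!: cdiff_divide cdiff_prod cdiff_power)
  qed
qed

lemma loc_indep:
  assumes t: "t \<in> Idx" "x0 \<in> Opn t" "t' \<in> Idx" "x0 \<in> Opn t'"
  obtains U where "open U" "0 \<in> U" "\<And>a s w. s \<in> Sec a \<Longrightarrow> w \<in> U \<Longrightarrow> loc a s t w = loc a s t' w"
proof -
  obtain W where W: "openin (topol X) W" "x0 \<in> W"
    "\<forall>t\<in>Idx. \<forall>x\<in>W \<inter> Opn t. \<forall>j. e j (t j) x \<noteq> 0 \<and> hol_at X (e j (t j)) x"
    "\<forall>t\<in>Idx. \<forall>t'\<in>Idx. \<forall>x\<in>W \<inter> Opn t \<inter> Opn t'. \<forall>a. fr a t x = gg a t t' x * fr a t' x"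
    by (rule frame_nbhd)
  let ?O = "W \<inter> (Opn t \<inter> Opn t')"
  let ?U = "snd \<kappa> ` (fst \<kappa> \<inter> ?O)"
  have O: "openin (topol X) ?O" using W(1) openin_Opn[OF t(1)] openin_Opn[OF t(3)] by blast
  show ?thesis
  proof (rule that[of ?U])
    show "open ?U" by (rule chart_on_open_image[OF \<kappa>_chart O])
    show "0 \<in> ?U" using x0_chart W(2) t by (metis IntI image_eqI)
    fix a s w assume s: "s \<in> Sec a" and "w \<in> ?U"
    then obtain x where x: "w = snd \<kappa> x" "x \<in> fst \<kappa>" "x \<in> W" "x \<in> Opn t" "x \<in> Opn t'" by blast
    have "s t x = gg a t t' x * s t' x" using SecD(2)[OF s t(1,3)] x by blast
    moreover have "fr a t x = gg a t t' x * fr a t' x" using W(4) t x by blast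
    moreover have "gg a t t' x \<noteq> 0" using gg_nonzero[OF t(1,3)] x by blast
    ultimately show "loc a s t w = loc a s t' w"
      using x \<kappa>_chart by (simp add: loc_def)
  qed
qed

lemma cf_power_series:
  assumes s: "s \<in> Sec a" and t: "t \<in> Idx" "x0 \<in> Opn t"
  shows "power_series_at_0 (loc a s t) (cf a s)"
proof -
  obtain U where "open U" "0 \<in> U" "\<And>a s. s \<in> Sec a \<Longrightarrow> loc a s t mholomorphic_on U"
    by (rule loc_holomorphic[OF t]) blast
  then obtain b where b: "power_series_at_0 (loc a s t) b"
    using power_series_at_0_exists[of U "loc a s t"] s by blast
  have b': "power_series_at_0 (loc a s t') b" if t': "t' \<in> Idx" "x0 \<in> Opn t'" for t'
  proof -
    obtain U where "open U" "0 \<in> U" "\<And>a s w. s \<in> Sec a \<Longrightarrow> w \<in> U \<Longrightarrow> loc a s t w = loc a s t' w"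
      by (rule loc_indep[OF t t']) blast
    then show ?thesis using power_series_at_0_cong[OF b] s by blast
  qed
  have "cf a s = b" unfolding cf_def coeffs_def chart_inv_0
  proof (rule the_equality)
    show "\<forall>i\<in>idx (DD a). x0 \<in> opn (DD a) i \<longrightarrow> power_series_at_0 (\<lambda>w. s i (chart_inv \<kappa> w) / fr a i (chart_inv \<kappa> w)) b"
      using b' by (simp add: loc_def[abs_def])
    fix c assume "\<forall>i\<in>idx (DD a). x0 \<in> opn (DD a) i \<longrightarrow> power_series_at_0 (\<lambda>w. s i (chart_inv \<kappa> w) / fr a i (chart_inv \<kappa> w)) c"
    then have "power_series_at_0 (loc a s t) c" using t by (simp add: loc_def[abs_def])
    then show "c = b" using b by (rule power_series_at_0_unique)
  qed
  then show ?thesis using b by simp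
qed

lemma x0_index: obtains t where "t \<in> Idx" "x0 \<in> Opn t"
  using Opn_cover[OF x0_points] by blast

lemma cf_mult:
  assumes "s \<in> Sec a" "s' \<in> Sec b"
  shows "cf (\<lambda>j. a j + b j) (\<lambda>t x. s t x * s' t x) = conv (cf a s) (cf b s')"
proof -
  obtain t where t: "t \<in> Idx" "x0 \<in> Opn t" by (rule x0_index)
  have "loc (\<lambda>j. a j + b j) (\<lambda>t x. s t x * s' t x) t = (\<lambda>w. loc a s t w * loc b s' t w)"
    by (auto simp: loc_def fr_add)
  then show ?thesis
    using power_series_at_0_unique[OF cf_power_series[OF Sec_mult[OF assms] t]]
      power_series_at_0_mult[OF cf_power_series[OF assms(1) t] cf_power_series[OF assms(2) t]] by simp
qed

lemma cf_sum:
  assumes "finite I" "\<And>u. u \<in> I \<Longrightarrow> s u \<in> Sec a"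
  shows "cf a (\<lambda>t x. \<Sum>u\<in>I. c u * s u t x) = (\<lambda>\<alpha>. \<Sum>u\<in>I. c u * cf a (s u) \<alpha>)"
proof -
  obtain t where t: "t \<in> Idx" "x0 \<in> Opn t" by (rule x0_index)
  have "loc a (\<lambda>t x. \<Sum>u\<in>I. c u * s u t x) t = (\<lambda>w. \<Sum>u\<in>I. c u * loc a (s u) t w)"
    by (auto simp: loc_def sum_divide_distrib)
  moreover have "power_series_at_0 (\<lambda>w. \<Sum>u\<in>I. c u * loc a (s u) t w) (\<lambda>\<alpha>. \<Sum>u\<in>I. c u * cf a (s u) \<alpha>)"
    using assms(1) by (intro power_series_at_0_sum cf_power_series t assms(2))
  moreover have "power_series_at_0 (loc a (\<lambda>t x. \<Sum>u\<in>I. c u * s u t x) t) (cf a (\<lambda>t x. \<Sum>u\<in>I. c u * s u t x))"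
    using assms(2) by (intro cf_power_series t Sec_sum) 
  ultimately show ?thesis using power_series_at_0_unique by simp
qed

lemma cf_cmult: "s \<in> Sec a \<Longrightarrow> cf a (\<lambda>t x. c * s t x) = (\<lambda>\<alpha>. c * cf a s \<alpha>)"
  using cf_sum[of "{()}" "\<lambda>_. s" a "\<lambda>_. c"] by simp

lemma cf_one: "cf (\<lambda>_. 0) (\<lambda>t x. 1) = (\<lambda>\<alpha>. if \<alpha> = 0 then 1 else 0)"
proof -
  obtain t where t: "t \<in> Idx" "x0 \<in> Opn t" by (rule x0_index)
  have "power_series_at_0 (\<lambda>w::(complex, 'n) vec. 1) (\<lambda>\<alpha>. if \<alpha> = 0 then 1 else 0)"
    unfolding power_series_at_0_iff
  proof (intro exI[of _ 1] conjI ballI)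
    fix z :: "(complex, 'n) vec"
    have "((\<lambda>\<alpha>. (if \<alpha> = 0 then 1 else 0) * vmonom z \<alpha>) has_sum 1) {0}"
      using has_sum_finite[of "{0}" "\<lambda>\<alpha>. (if \<alpha> = 0 then 1 else 0) * vmonom z \<alpha>"] by (simp add: vmonom_def)
    then show "((\<lambda>\<alpha>. (if \<alpha> = 0 then 1 else 0) * vmonom z \<alpha>) has_sum 1) UNIV"
      by (rule has_sum_cong_neutral[THEN iffD1, rotated -1]) auto
  qed simp
  moreover have "loc (\<lambda>_. 0) (\<lambda>t x. 1) t = (\<lambda>w. 1)" by (auto simp: loc_def fr_def)
  ultimately show ?thesis
    using power_series_at_0_unique[OF cf_power_series[OF Sec_one t]] by simp
qed

text \<open>A section with vanishing expansion is zero near the center, hence everywhere because \<open>X\<close> is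
  connected.\<close>

lemma cf_zero_iff:
  assumes s: "s \<in> Sec a"
  shows "cf a s = (\<lambda>_. 0) \<longleftrightarrow> \<not> nz s"
proof
  obtain t where t: "t \<in> Idx" "x0 \<in> Opn t" by (rule x0_index)
  assume "cf a s = (\<lambda>_. 0)"
  then obtain \<epsilon> where \<epsilon>: "\<epsilon> > 0" "\<And>z. z \<in> ball 0 \<epsilon> \<Longrightarrow> ((\<lambda>\<alpha>. 0 * vmonom z \<alpha>) has_sum loc a s t z) UNIV"
    using cf_power_series[OF s t] unfolding power_series_at_0_iff by auto
  have zero: "loc a s t z = 0" if "z \<in> ball 0 \<epsilon>" for z
    using \<epsilon>(2)[OF that] has_sum_unique[OF _ has_sum_0] by fastforce
  obtain U where U: "open U" "0 \<in> U"
    "\<And>w. w \<in> U \<Longrightarrow> \<exists>x\<in>fst \<kappa> \<inter> Opn t. w = snd \<kappa> x \<and> (\<forall>a. fr a t x \<noteq> 0)"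
    by (rule loc_holomorphic[OF t]) blast
  let ?V = "{x \<in> fst \<kappa>. snd \<kappa> x \<in> ball 0 \<epsilon> \<inter> U}"
  show "\<not> nz s"
  proof (rule Sec_identity[OF conn s])
    show "openin (topol X) ?V" by (rule chart_on_open_vimage[OF \<kappa>_chart]) (use U in auto)
    have "x0 \<in> ?V" using x0_chart U(2) \<epsilon>(1) by simp
    then show "?V \<noteq> {}" by blast
    fix x assume x: "x \<in> ?V"
    then obtain x' where x': "x' \<in> fst \<kappa> \<inter> Opn t" "snd \<kappa> x = snd \<kappa> x'" "fr a t x' \<noteq> 0" using U(3) by blast
    then have "x = x'" using inj_onD[OF chart_on_inj[OF \<kappa>_chart], of x x'] x by auto
    then have "s t x = 0" using zero[of "snd \<kappa> x"] x x' \<kappa>_chart by (simp add: loc_def)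
    then show "\<exists>t\<in>Idx. x \<in> Opn t \<and> s t x = 0" using t(1) x' \<open>x = x'\<close> by blast
  qed
next
  assume nz: "\<not> nz s"
  obtain t where t: "t \<in> Idx" "x0 \<in> Opn t" by (rule x0_index)
  obtain U where U: "open U" "0 \<in> U"
    "\<And>w. w \<in> U \<Longrightarrow> \<exists>x\<in>fst \<kappa> \<inter> Opn t. w = snd \<kappa> x \<and> (\<forall>a. fr a t x \<noteq> 0)"
    by (rule loc_holomorphic[OF t]) blast
  have "loc a s t w = 0" if "w \<in> U" for w
  proof -
    obtain x where "x \<in> fst \<kappa> \<inter> Opn t" "w = snd \<kappa> x" using U(3) \<open>w \<in> U\<close> by blast
    then show ?thesis using nz t(1) \<kappa>_chart by (auto simp: loc_def nz_def)
  qed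
  then have "power_series_at_0 (\<lambda>_. 0) (cf a s)"
    by (intro power_series_at_0_cong[OF cf_power_series[OF s t] U(1,2)])
  moreover have "power_series_at_0 (\<lambda>_. 0) (\<lambda>_::(nat, 'n) vec. 0)"
    unfolding power_series_at_0_iff by (intro exI[of _ 1]) auto
  ultimately show "cf a s = (\<lambda>_. 0)" by (rule power_series_at_0_unique)
qed

lemma lead_exps_iff:
  "\<alpha> \<in> lead_exps X \<kappa> (DD a) (fr a) \<longleftrightarrow> (\<exists>s\<in>Sec a. is_lead (cf a s) \<alpha>)"
proof -
  have lead: "lead_exp \<kappa> (DD a) (fr a) s = \<alpha>" if "is_lead (cf a s) \<alpha>" for s \<alpha>
    unfolding lead_exp_def cf_def[symmetric] is_lead_def[symmetric]
    using that is_lead_unique by (intro the_equality) auto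
  show ?thesis
  proof
    assume "\<alpha> \<in> lead_exps X \<kappa> (DD a) (fr a)"
    then obtain s where s: "s \<in> Sec a" "nz s" "\<alpha> = lead_exp \<kappa> (DD a) (fr a) s"
      unfolding lead_exps_def H0_DD nonzero_section_DD by blast
    then obtain \<beta> where "is_lead (cf a s) \<beta>" using is_lead_exists cf_zero_iff by blast
    then show "\<exists>s\<in>Sec a. is_lead (cf a s) \<alpha>" using lead s by blast
  next
    assume "\<exists>s\<in>Sec a. is_lead (cf a s) \<alpha>"
    then obtain s where s: "s \<in> Sec a" "is_lead (cf a s) \<alpha>" by blast
    then have "cf a s \<noteq> (\<lambda>_. 0)" by (auto simp: is_lead_def)
    then have "nz s" using cf_zero_iff[OF s(1)] by blast
    then show "\<alpha> \<in> lead_exps X \<kappa> (DD a) (fr a)"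
      unfolding lead_exps_def H0_DD nonzero_section_DD using s lead by blast
  qed
qed

lemma monic_sections_eq:
  "monic_sections X \<kappa> (DD a) (fr a) \<alpha> = {s \<in> Sec a. is_lead (cf a s) \<alpha> \<and> cf a s \<alpha> = 1}"
  unfolding monic_sections_def H0_DD cf_def[symmetric] is_lead_def by auto

end

section \<open>Supremum norms\<close>

lemma continuous_on_chart:
  assumes ch: "chart_on T \<kappa>" and O: "openin T O'" and f: "continuous_map (subtopology T O') euclideanreal f"
  shows "continuous_on (snd \<kappa> ` (fst \<kappa> \<inter> O')) (\<lambda>w. f (chart_inv \<kappa> w))"
proof (rule iffD2[OF continuous_on_open_vimage], rule chart_on_open_image[OF ch O], intro allI impI)
  fix B :: "real set" assume B: "open B"
  have "openin (subtopology T O') {x \<in> topspace (subtopology T O'). f x \<in> B}"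
    using f B by (simp add: continuous_map_def)
  then have "openin T {x \<in> topspace (subtopology T O'). f x \<in> B}"
    using O openin_trans_full by blast
  also have "{x \<in> topspace (subtopology T O'). f x \<in> B} = {x \<in> O'. f x \<in> B}"
    using openin_subset[OF O] by auto
  finally have "open (snd \<kappa> ` (fst \<kappa> \<inter> {x \<in> O'. f x \<in> B}))" by (rule chart_on_open_image[OF ch])
  also have "snd \<kappa> ` (fst \<kappa> \<inter> {x \<in> O'. f x \<in> B}) = (\<lambda>w. f (chart_inv \<kappa> w)) -` B \<inter> snd \<kappa> ` (fst \<kappa> \<inter> O')"
    using ch by auto
  finally show "open ((\<lambda>w. f (chart_inv \<kappa> w)) -` B \<inter> snd \<kappa> ` (fst \<kappa> \<inter> O'))" .
qed

lemma compact_space_cover: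
  assumes "compact_space T" "\<And>x. x \<in> topspace T \<Longrightarrow> openin T (W x) \<and> x \<in> W x"
  obtains F where "finite F" "F \<subseteq> topspace T" "topspace T \<subseteq> (\<Union>x\<in>F. W x)"
proof -
  have "compactin T (topspace T)" using assms(1) by (simp add: compact_space_def)
  moreover have "\<forall>U\<in>W ` topspace T. openin T U" "topspace T \<subseteq> \<Union>(W ` topspace T)" using assms(2) by auto
  ultimately obtain \<F> where "finite \<F>" "\<F> \<subseteq> W ` topspace T" "topspace T \<subseteq> \<Union>\<F>"
    unfolding compactin_def by meson
  then obtain F where "F \<subseteq> topspace T" "finite F" "\<F> = W ` F" using finite_subset_image by metis
  then show ?thesis using that \<open>topspace T \<subseteq> \<Union>\<F>\<close> by blast
qed

locale metrized_manifold = framed_manifold X D x0 \<kappa> e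
  for X :: "('a, 'n::{finite,linorder}) cmanifold" and D :: "'r::finite \<Rightarrow> ('a, 'i) divisor"
    and x0 :: 'a and \<kappa> :: "('a, 'n) chart" and e :: "'r \<Rightarrow> 'i \<Rightarrow> 'a \<Rightarrow> complex" +
  fixes \<psi> :: "'r \<Rightarrow> 'i \<Rightarrow> 'a \<Rightarrow> real"
  assumes comp: "compact_space (topol X)"
    and metric: "continuous_metric X (D j) (\<psi> j)"
begin

definition mm :: "('r \<Rightarrow> nat) \<Rightarrow> ('r \<Rightarrow> 'i) \<Rightarrow> 'a \<Rightarrow> real" where
  "mm a t x = (\<Sum>j\<in>UNIV. real (a j) * \<psi> j (t j) x)"

lemma comb_metric_mm: "comb_metric \<psi> (\<lambda>j. real (a j)) = mm a"
  by (intro ext) (simp add: comb_metric_def mm_def)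

lemma exp_mm: "exp (- mm a t x) = (\<Prod>j\<in>UNIV. exp (- \<psi> j (t j) x) ^ a j)"
  by (simp add: mm_def exp_sum exp_of_nat_mult[symmetric] sum_negf[symmetric])

definition nrm :: "('r \<Rightarrow> nat) \<Rightarrow> (('r \<Rightarrow> 'i) \<Rightarrow> 'a \<Rightarrow> complex) \<Rightarrow> ('r \<Rightarrow> 'i) \<Rightarrow> 'a \<Rightarrow> real" where
  "nrm a s t x = (norm (s t x))\<^sup>2 * exp (- mm a t x)"

lemma nrm_nonneg: "0 \<le> nrm a s t x"
  by (simp add: nrm_def)

lemma gg_metric:
  assumes "t \<in> Idx" "t' \<in> Idx" "x \<in> Opn t" "x \<in> Opn t'"
  shows "(norm (gg a t t' x))\<^sup>2 * exp (- mm a t x) = exp (- mm a t' x)"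
proof -
  have j: "(norm (transition X (D j) (t j) (t' j) x))\<^sup>2 * exp (- \<psi> j (t j) x) = exp (- \<psi> j (t' j) x)" for j
    using metric[of j] assms unfolding continuous_metric_def Idx_def Opn_def by blast
  have "(norm (gg a t t' x))\<^sup>2 * exp (- mm a t x) =
    (\<Prod>j\<in>UNIV. ((norm (transition X (D j) (t j) (t' j) x))\<^sup>2 * exp (- \<psi> j (t j) x)) ^ a j)"
    unfolding exp_mm gg_def
    by (simp add: norm_power prod_norm[symmetric] prod_power_distrib power_mult_distrib prod.distrib power_mult[symmetric] mult.commute)
  then show ?thesis unfolding j exp_mm .
qed

lemma nrm_indep:
  assumes "s \<in> Sec a" "t \<in> Idx" "t' \<in> Idx" "x \<in> Opn t" "x \<in> Opn t'"
  shows "nrm a s t x = nrm a s t' x"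
  unfolding nrm_def SecD(2)[OF assms] using gg_metric[OF assms(2-5), of a]
  by (simp add: norm_mult power_mult_distrib mult_ac)

lemma \<psi>_continuous:
  assumes "chart_on (topol X) \<mu>" "t \<in> Idx"
  shows "continuous_on (snd \<mu> ` (fst \<mu> \<inter> Opn t)) (\<lambda>w. \<psi> j (t j) (chart_inv \<mu> w))"
proof -
  have o: "openin (topol X) (opn (D j) (t j))" using div[of j] assms(2) by (simp add: is_divisor_def Idx_def)
  have "continuous_on (snd \<mu> ` (fst \<mu> \<inter> opn (D j) (t j))) (\<lambda>w. \<psi> j (t j) (chart_inv \<mu> w))"
    using metric[of j] assms(2) by (intro continuous_on_chart[OF assms(1) o]) (simp add: continuous_metric_def Idx_def)
  then show ?thesis by (rule continuous_on_subset) (auto simp: Opn_def)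
qed

lemma mm_continuous:
  assumes "chart_on (topol X) \<mu>" "t \<in> Idx"
  shows "continuous_on (snd \<mu> ` (fst \<mu> \<inter> Opn t)) (\<lambda>w. mm a t (chart_inv \<mu> w))"
  unfolding mm_def by (intro continuous_intros \<psi>_continuous assms)

lemma nrm_bounded:
  assumes s: "s \<in> Sec a"
  shows "\<exists>B. \<forall>t\<in>Idx. \<forall>x\<in>Opn t. nrm a s t x \<le> B"
proof -
  have "\<exists>W B. openin (topol X) W \<and> x \<in> W \<and> (\<forall>y\<in>W. \<forall>t\<in>Idx. y \<in> Opn t \<longrightarrow> nrm a s t y \<le> B)"
    if x: "x \<in> points X" for x
  proof -
    obtain \<mu> where \<mu>: "\<mu> \<in> atlas X" "x \<in> fst \<mu>" using x by (rule atlas_cover)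
    obtain t where t: "t \<in> Idx" "x \<in> Opn t" using x by (rule Opn_cover)
    note ch = atlas_chart[OF \<mu>(1)]
    let ?U = "snd \<mu> ` (fst \<mu> \<inter> Opn t)"
    let ?f = "\<lambda>w. nrm a s t (chart_inv \<mu> w)"
    have U: "open ?U" using chart_on_open_image[OF ch openin_Opn[OF t(1)]] .
    have "continuous_on ?U (\<lambda>w. s t (chart_inv \<mu> w))"
      using SecD(1)[OF s t(1)] \<mu>(1) by (intro mholomorphic_on_continuous) (simp add: holomorphic_fun_def)
    then have "continuous_on ?U ?f"
      unfolding nrm_def by (intro continuous_intros mm_continuous ch t)
    then have V: "open (?U \<inter> ?f -` {..<?f (snd \<mu> x) + 1})"
      using U by (rule continuous_open_preimage) auto
    let ?W = "{y \<in> fst \<mu>. snd \<mu> y \<in> ?U \<inter> ?f -` {..<?f (snd \<mu> x) + 1}}"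
    have "openin (topol X) ?W" by (rule chart_on_open_vimage[OF ch V])
    moreover have "x \<in> ?W" using \<mu> t by auto
    moreover have "nrm a s t' y \<le> ?f (snd \<mu> x) + 1" if y: "y \<in> ?W" and t': "t' \<in> Idx" "y \<in> Opn t'" for y t'
    proof -
      obtain z where z: "z \<in> fst \<mu> \<inter> Opn t" "snd \<mu> y = snd \<mu> z" using y by blast
      have "y = z" using inj_onD[OF chart_on_inj[OF ch] z(2)] y z by auto
      then have "nrm a s t' y = nrm a s t y" using nrm_indep[OF s t'(1) t(1)] t' z by auto
      moreover have "?f (snd \<mu> y) < ?f (snd \<mu> x) + 1" using y by blast
      ultimately show ?thesis using chart_inv_chart[OF ch, of y] y by simp
    qed
    ultimately show ?thesis by blast
  qed
  then obtain W B where WB: "\<And>x. x \<in> points X \<Longrightarrow> openin (topol X) (W x) \<and> x \<in> W x"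
    "\<And>x y t. x \<in> points X \<Longrightarrow> y \<in> W x \<Longrightarrow> t \<in> Idx \<Longrightarrow> y \<in> Opn t \<Longrightarrow> nrm a s t y \<le> B x"
    by metis
  obtain F where F: "finite F" "F \<subseteq> points X" "points X \<subseteq> (\<Union>x\<in>F. W x)"
    by (rule compact_space_cover[OF comp WB(1)])
  have "nrm a s t x \<le> (\<Sum>y\<in>F. \<bar>B y\<bar>)" if tx: "t \<in> Idx" "x \<in> Opn t" for t x
  proof -
    have "x \<in> points X" using tx Opn_subset by blast
    then obtain y where y: "y \<in> F" "x \<in> W y" using F(3) by blast
    have "nrm a s t x \<le> B y" using WB(2)[of y x t] F(2) y tx by blast
    also have "\<dots> \<le> \<bar>B y\<bar>" by simp
    also have "\<dots> \<le> (\<Sum>y\<in>F. \<bar>B y\<bar>)" using F(1) y(1) by (intro member_le_sum) auto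
    finally show ?thesis .
  qed
  then show ?thesis by blast
qed

definition sn :: "('r \<Rightarrow> nat) \<Rightarrow> (('r \<Rightarrow> 'i) \<Rightarrow> 'a \<Rightarrow> complex) \<Rightarrow> real" where
  "sn a s = sup_norm2 (DD a) (mm a) s"

lemma sn_eq: "sn a s = Sup {nrm a s t x | t x. t \<in> Idx \<and> x \<in> Opn t}"
  unfolding sn_def sup_norm2_def nrm_def DD_simps(1,2) ..

lemma nrm_le_sn:
  assumes "s \<in> Sec a" "t \<in> Idx" "x \<in> Opn t"
  shows "nrm a s t x \<le> sn a s"
  unfolding sn_eq
proof (rule cSup_upper)
  show "bdd_above {nrm a s t x |t x. t \<in> Idx \<and> x \<in> Opn t}"
    using nrm_bounded[OF assms(1)] by (auto simp: bdd_above_def)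
qed (use assms in blast)

lemma sn_nonneg:
  assumes "s \<in> Sec a"
  shows "0 \<le> sn a s"
proof -
  obtain t where "t \<in> Idx" "x0 \<in> Opn t" by (rule x0_index)
  then show ?thesis using nrm_le_sn[OF assms] nrm_nonneg order_trans by metis
qed

lemma mm_add: "mm (\<lambda>j. a j + b j) t x = mm a t x + mm b t x"
  by (simp add: mm_def algebra_simps sum.distrib)

lemma sn_mult:
  assumes "s \<in> Sec a" "s' \<in> Sec b"
  shows "sn (\<lambda>j. a j + b j) (\<lambda>t x. s t x * s' t x) \<le> sn a s * sn b s'"
  unfolding sn_eq[of "\<lambda>j. a j + b j"]
proof (rule cSup_least)
  obtain t where "t \<in> Idx" "x0 \<in> Opn t" by (rule x0_index)
  then show "{nrm (\<lambda>j. a j + b j) (\<lambda>t x. s t x * s' t x) t x |t x. t \<in> Idx \<and> x \<in> Opn t} \<noteq> {}" by blast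
  fix v assume "v \<in> {nrm (\<lambda>j. a j + b j) (\<lambda>t x. s t x * s' t x) t x |t x. t \<in> Idx \<and> x \<in> Opn t}"
  then obtain t x where v: "v = nrm (\<lambda>j. a j + b j) (\<lambda>t x. s t x * s' t x) t x" "t \<in> Idx" "x \<in> Opn t" by blast
  have "v = nrm a s t x * nrm b s' t x"
    by (simp add: v(1) nrm_def mm_add norm_mult power_mult_distrib exp_diff exp_minus field_simps exp_add)
  also have "\<dots> \<le> sn a s * sn b s'"
    using assms v by (intro mult_mono nrm_le_sn nrm_nonneg sn_nonneg)
  finally show "v \<le> sn a s * sn b s'" .
qed

text \<open>On a fixed polydisc around the center, the metrics of the frames are bounded below by a constant
  for each \<open>D j\<close>, so the sup norm of \<open>s\<close> controls its local expression.  Cauchy's estimate then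
  bounds the coefficient \<open>1\<close> from above by the norm.  The constants do not depend on \<open>a\<close>.\<close>

lemma sn_lower_bound:
  obtains c \<rho> where "0 < c" "c \<le> 1" "0 < \<rho>" "\<rho> \<le> 1"
    "\<forall>a s \<alpha>. s \<in> Sec a \<longrightarrow> cf a s \<alpha> = 1 \<longrightarrow> c ^ (\<Sum>j\<in>UNIV. a j) * \<rho> ^ (2 * wt \<alpha>) \<le> sn a s"
proof -
  obtain t where t: "t \<in> Idx" "x0 \<in> Opn t" by (rule x0_index)
  obtain U where U: "open U" "0 \<in> U" "\<And>a s. s \<in> Sec a \<Longrightarrow> loc a s t mholomorphic_on U"
    "\<And>w. w \<in> U \<Longrightarrow> \<exists>x\<in>fst \<kappa> \<inter> Opn t. w = snd \<kappa> x \<and> (\<forall>a. fr a t x \<noteq> 0)"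
    "\<And>w j. w \<in> U \<Longrightarrow> isCont (\<lambda>w. e j (t j) (chart_inv \<kappa> w)) w"
    by (rule loc_holomorphic[OF t]) blast
  define q where "q j w = (norm (e j (t j) (chart_inv \<kappa> w)))\<^sup>2 * exp (- \<psi> j (t j) (chart_inv \<kappa> w))" for j w
  have e0: "e j (t j) x0 \<noteq> 0" for j
  proof -
    obtain x where x: "x \<in> fst \<kappa>" "0 = snd \<kappa> x" "\<forall>a. fr a t x \<noteq> 0" using U(4)[OF U(2)] by blast
    then have "x = x0" using inj_onD[OF chart_on_inj[OF \<kappa>_chart], of x x0] x0_chart by auto
    then have "fr (\<lambda>i. if i = j then 1 else 0) t x0 \<noteq> 0" using x(3) by blast
    then show ?thesis by (simp add: fr_def) (metis one_neq_zero)
  qed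
  have q0: "q j 0 > 0" for j using e0 by (simp add: q_def chart_inv_0)
  have O: "open (snd \<kappa> ` (fst \<kappa> \<inter> Opn t))" by (rule chart_on_open_image[OF \<kappa>_chart openin_Opn[OF t(1)]])
  have O0: "0 \<in> snd \<kappa> ` (fst \<kappa> \<inter> Opn t)" using x0_chart t(2) by (metis IntI image_eqI)
  have cont: "isCont (q j) 0" for j
  proof -
    have "isCont (\<lambda>w. \<psi> j (t j) (chart_inv \<kappa> w)) 0"
      using \<psi>_continuous[OF \<kappa>_chart t(1)] O O0 continuous_on_eq_continuous_at by blast
    then show ?thesis unfolding q_def[abs_def] using U(5)[OF U(2)] by (intro continuous_intros)
  qed
  have "\<forall>j. \<forall>\<^sub>F w in nhds 0. q j 0 / 2 < q j w"
    using cont q0 by (intro allI order_tendstoD(1)[of "q _" "q _ 0"]) (auto simp: isCont_def tendsto_nhds_iff)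
  then have "\<forall>\<^sub>F w in nhds 0. \<forall>j. q j 0 / 2 < q j w" by (simp add: eventually_all_finite)
  moreover have "\<forall>\<^sub>F w in nhds 0. w \<in> U" using U(1,2) by (rule eventually_nhds_in_open)
  ultimately have "\<forall>\<^sub>F w in nhds 0. (\<forall>j. q j 0 / 2 < q j w) \<and> w \<in> U" by (rule eventually_conj)
  then obtain \<epsilon> where \<epsilon>: "\<epsilon> > 0" "\<And>w. w \<in> ball 0 \<epsilon> \<Longrightarrow> (\<forall>j. q j 0 / 2 < q j w) \<and> w \<in> U"
    unfolding eventually_nhds_metric by (auto simp: dist_commute)
  obtain R where R: "0 < R" "polydisc R \<subseteq> (ball 0 \<epsilon> :: ((complex, 'n) vec) set)"
    by (rule polydisc_subset_ball[OF \<epsilon>(1)])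
  \<comment> \<open>At most \<open>1\<close>, and a lower bound for the squared length of each frame.\<close>
  define c where "c = min 1 (Min (range (\<lambda>j. q j 0 / 2)))"
  have c: "0 < c" "c \<le> 1" using q0 by (auto simp: c_def)
  have c3: "c \<le> q j 0 / 2" for j unfolding c_def by (rule min.coboundedI2, rule Min_le) auto
  note c = c c3
  define \<rho> where "\<rho> = min 1 (R / 2)"
  have \<rho>: "0 < \<rho>" "\<rho> \<le> 1" "\<rho> < R" using R(1) by (auto simp: \<rho>_def)
  have main: "c ^ (\<Sum>j\<in>UNIV. a j) * \<rho> ^ (2 * wt \<alpha>) \<le> sn a s" if s: "s \<in> Sec a" and \<alpha>: "cf a s \<alpha> = 1" for a s \<alpha>
  proof -
    let ?ca = "c ^ (\<Sum>j\<in>UNIV. a j)"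
    have ca: "?ca > 0" using c by simp
    define M where "M = sqrt (sn a s / ?ca)"
    have bound: "norm (loc a s t w) \<le> M" if w: "w \<in> polydisc R" for w
    proof -
      have w': "w \<in> U" "\<And>j. q j 0 / 2 < q j w" using \<epsilon>(2) R(2) w by blast+
      obtain x where x: "x \<in> fst \<kappa>" "x \<in> Opn t" "w = snd \<kappa> x" "fr a t x \<noteq> 0" using U(4)[OF w'(1)] by blast
      have ci: "chart_inv \<kappa> w = x" using x \<kappa>_chart by simp
      have "?ca = (\<Prod>j\<in>UNIV. c ^ a j)" by (simp add: power_sum)
      also have "\<dots> \<le> (\<Prod>j\<in>UNIV. q j w ^ a j)"
      proof (rule prod_mono)
        fix j
        have "c \<le> q j w" using c(3)[of j] w'(2)[of j] by linarith
        then show "0 \<le> c ^ a j \<and> c ^ a j \<le> q j w ^ a j" using c(1) by (auto intro: power_mono)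
      qed
      also have "\<dots> = (norm (fr a t x))\<^sup>2 * exp (- mm a t x)"
        unfolding exp_mm fr_def q_def ci
        by (simp add: norm_power prod_norm[symmetric] prod_power_distrib power_mult_distrib prod.distrib power_mult[symmetric] mult.commute)
      finally have "(norm (loc a s t w))\<^sup>2 * ?ca \<le> (norm (loc a s t w))\<^sup>2 * ((norm (fr a t x))\<^sup>2 * exp (- mm a t x))"
        by (intro mult_left_mono) auto
      also have "\<dots> = nrm a s t x" using x(4) by (simp add: loc_def ci nrm_def norm_divide power_divide)
      also have "\<dots> \<le> sn a s" by (rule nrm_le_sn[OF s t(1) x(2)])
      finally have "(norm (loc a s t w))\<^sup>2 \<le> sn a s / ?ca" using ca by (simp add: field_simps)
      then show ?thesis unfolding M_def by (rule real_le_rsqrt)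
    qed
    have "polydisc R \<subseteq> U" using R(2) \<epsilon>(2) by blast
    then have "loc a s t mholomorphic_on polydisc R"
      using U(3)[OF s] unfolding mholomorphic_on_iff_cdiff by blast
    then have "norm (cf a s \<alpha>) \<le> M / \<rho> ^ wt \<alpha>"
      by (rule power_series_at_0_Cauchy[OF cf_power_series[OF s t] _ bound \<rho>(1,3)])
    then have "\<rho> ^ wt \<alpha> \<le> M" using \<alpha> \<rho>(1) by (simp add: field_simps)
    then have "(\<rho> ^ wt \<alpha>)\<^sup>2 \<le> M\<^sup>2" using \<rho>(1) by (intro power_mono) auto
    also have "M\<^sup>2 = sn a s / ?ca" unfolding M_def using sn_nonneg[OF s] ca by simp
    finally have "?ca * (\<rho> ^ wt \<alpha>)\<^sup>2 \<le> sn a s" using ca by (simp add: field_simps)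
    then show ?thesis by (simp add: power_mult[symmetric] mult.commute)
  qed
  then show ?thesis using that[OF c(1,2) \<rho>(1,2)] by blast
qed

section \<open>Minimal norms of monic sections\<close>

definition monic :: "('r \<Rightarrow> nat) \<Rightarrow> (nat, 'n) vec \<Rightarrow> (('r \<Rightarrow> 'i) \<Rightarrow> 'a \<Rightarrow> complex) set" where
  "monic a \<alpha> = {s \<in> Sec a. is_lead (cf a s) \<alpha> \<and> cf a s \<alpha> = 1}"

definition minlog :: "('r \<Rightarrow> nat) \<Rightarrow> (nat, 'n) vec \<Rightarrow> real" where
  "minlog a \<alpha> = (INF s\<in>monic a \<alpha>. ln (sn a s))"

lemma min_log_norm_eq: "min_log_norm X \<kappa> (DD a) (fr a) (mm a) \<alpha> = minlog a \<alpha>"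
  unfolding min_log_norm_def minlog_def monic_sections_eq monic_def sn_def ..

definition expo :: "('r \<Rightarrow> nat) \<Rightarrow> (nat, 'n) vec set" where
  "expo a = {\<alpha>. \<exists>s\<in>Sec a. is_lead (cf a s) \<alpha>}"

lemma is_lead_cmult: "is_lead b \<alpha> \<Longrightarrow> c \<noteq> 0 \<Longrightarrow> is_lead (\<lambda>\<beta>. c * b \<beta>) \<alpha>"
  by (auto simp: is_lead_def)

lemma monic_nonempty:
  assumes "\<alpha> \<in> expo a"
  shows "monic a \<alpha> \<noteq> {}"
proof -
  obtain s where s: "s \<in> Sec a" "is_lead (cf a s) \<alpha>" using assms by (auto simp: expo_def)
  let ?c = "1 / cf a s \<alpha>"
  have "cf a s \<alpha> \<noteq> 0" using s(2) by (simp add: is_lead_def)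
  then have "(\<lambda>t x. ?c * s t x) \<in> monic a \<alpha>"
    unfolding monic_def using Sec_cmult[OF s(1), of ?c] cf_cmult[OF s(1), of ?c] is_lead_cmult[OF s(2), of ?c] by simp
  then show ?thesis by blast
qed

lemma monic_mult:
  assumes "s \<in> monic a \<alpha>" "s' \<in> monic b \<beta>"
  shows "(\<lambda>t x. s t x * s' t x) \<in> monic (\<lambda>j. a j + b j) (\<alpha> + \<beta>)"
  using assms Sec_mult[of s a s' b] cf_mult[of s a s' b] is_lead_conv[of "cf a s" \<alpha> "cf b s'" \<beta>]
  by (simp add: monic_def)

lemma expo_add: "\<alpha> \<in> expo a \<Longrightarrow> \<beta> \<in> expo b \<Longrightarrow> \<alpha> + \<beta> \<in> expo (\<lambda>j. a j + b j)"
  using monic_nonempty[of \<alpha> a] monic_nonempty[of \<beta> b] monic_mult[of _ a \<alpha> _ b \<beta>]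
  unfolding monic_def expo_def by blast

lemma expo_0: "0 \<in> expo (\<lambda>_. 0)"
  unfolding expo_def using Sec_one cf_one by (intro CollectI bexI[of _ "\<lambda>t x. 1"]) (auto simp: is_lead_def)

text \<open>The bound is linear in \<open>(\<alpha>, a)\<close>; this keeps the convex envelope finite.\<close>

lemma minlog_lower_bound:
  obtains A B where "0 \<le> A" "0 \<le> B"
    "\<forall>a \<alpha>. \<forall>s\<in>monic a \<alpha>. 0 < sn a s \<and> - A * real (\<Sum>j\<in>UNIV. a j) - B * real (wt \<alpha>) \<le> ln (sn a s)"
proof -
  obtain c \<rho> where c: "0 < c" "c \<le> 1" "0 < \<rho>" "\<rho> \<le> 1"
    "\<forall>a s \<alpha>. s \<in> Sec a \<longrightarrow> cf a s \<alpha> = 1 \<longrightarrow> c ^ (\<Sum>j\<in>UNIV. a j) * \<rho> ^ (2 * wt \<alpha>) \<le> sn a s"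
    by (rule sn_lower_bound)
  show ?thesis
  proof (rule that[of "- ln c" "- 2 * ln \<rho>"])
    show "0 \<le> - ln c" "0 \<le> - 2 * ln \<rho>" using c by simp_all
    show "\<forall>a \<alpha>. \<forall>s\<in>monic a \<alpha>. 0 < sn a s \<and> - (- ln c) * real (\<Sum>j\<in>UNIV. a j) - (- 2 * ln \<rho>) * real (wt \<alpha>) \<le> ln (sn a s)"
    proof (intro allI ballI conjI)
      fix a \<alpha> s assume "s \<in> monic a \<alpha>"
      then have le: "c ^ (\<Sum>j\<in>UNIV. a j) * \<rho> ^ (2 * wt \<alpha>) \<le> sn a s" using c(5) by (simp add: monic_def)
      have pos: "0 < c ^ (\<Sum>j\<in>UNIV. a j) * \<rho> ^ (2 * wt \<alpha>)" using c by simp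
      then show "0 < sn a s" using le by linarith
      have "ln (c ^ (\<Sum>j\<in>UNIV. a j) * \<rho> ^ (2 * wt \<alpha>)) \<le> ln (sn a s)" using le pos by simp
      then show "- (- ln c) * real (\<Sum>j\<in>UNIV. a j) - (- 2 * ln \<rho>) * real (wt \<alpha>) \<le> ln (sn a s)"
        using c by (simp add: ln_mult ln_realpow algebra_simps)
    qed
  qed
qed

lemma bdd_below_minlog: "bdd_below ((\<lambda>s. ln (sn a s)) ` monic a \<alpha>)"
proof -
  obtain A B where "\<forall>a \<alpha>. \<forall>s\<in>monic a \<alpha>. 0 < sn a s \<and> - A * real (\<Sum>j\<in>UNIV. a j) - B * real (wt \<alpha>) \<le> ln (sn a s)"
    by (rule minlog_lower_bound)
  then show ?thesis by (intro bdd_belowI2[where m = "- A * real (\<Sum>j\<in>UNIV. a j) - B * real (wt \<alpha>)"]) blast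
qed

lemma minlog_add:
  assumes "\<alpha> \<in> expo a" "\<beta> \<in> expo b"
  shows "minlog (\<lambda>j. a j + b j) (\<alpha> + \<beta>) \<le> minlog a \<alpha> + minlog b \<beta>"
proof -
  obtain A B where pos: "\<forall>a \<alpha>. \<forall>s\<in>monic a \<alpha>. 0 < sn a s \<and> - A * real (\<Sum>j\<in>UNIV. a j) - B * real (wt \<alpha>) \<le> ln (sn a s)"
    by (rule minlog_lower_bound)
  have *: "minlog (\<lambda>j. a j + b j) (\<alpha> + \<beta>) \<le> ln (sn a s) + ln (sn b s')" if s: "s \<in> monic a \<alpha>" "s' \<in> monic b \<beta>" for s s'
  proof -
    let ?p = "\<lambda>t x. s t x * s' t x" and ?ab = "\<lambda>j. a j + b j"
    have p: "?p \<in> monic ?ab (\<alpha> + \<beta>)" by (rule monic_mult[OF s])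
    have pp: "0 < sn a s" "0 < sn b s'" "0 < sn ?ab ?p" using pos s p by blast+
    have "minlog ?ab (\<alpha> + \<beta>) \<le> ln (sn ?ab ?p)" unfolding minlog_def by (rule cINF_lower[OF bdd_below_minlog p])
    also have "\<dots> \<le> ln (sn a s * sn b s')" using sn_mult[of s a s' b] s pp by (simp add: monic_def)
    also have "\<dots> = ln (sn a s) + ln (sn b s')" using pp by (simp add: ln_mult)
    finally show ?thesis .
  qed
  have "minlog (\<lambda>j. a j + b j) (\<alpha> + \<beta>) - ln (sn b s') \<le> minlog a \<alpha>" if s': "s' \<in> monic b \<beta>" for s'
    unfolding minlog_def[of a \<alpha>] using *[OF _ s'] by (intro cINF_greatest monic_nonempty assms) (simp add: diff_le_eq)
  then have "minlog (\<lambda>j. a j + b j) (\<alpha> + \<beta>) - minlog a \<alpha> \<le> minlog b \<beta>"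
    unfolding minlog_def[of b \<beta>] by (intro cINF_greatest monic_nonempty assms) (simp add: diff_le_eq add.commute)
  then show ?thesis by simp
qed

end

section \<open>A Schwarz lemma for meromorphic sections\<close>

lemma compact_bounded_above:
  fixes f :: "'x::topological_space \<Rightarrow> real"
  assumes "compact K" "continuous_on K f"
  shows "\<exists>B. \<forall>x\<in>K. f x \<le> B"
proof -
  have "bounded (f ` K)" using assms compact_continuous_image compact_imp_bounded by blast
  then obtain B where "\<forall>y\<in>f ` K. norm y \<le> B" unfolding bounded_iff by blast
  then show ?thesis by (intro exI[of _ B]) fastforce
qed

context metrized_manifold
begin

text \<open>A finite cover by closed sets \<open>Cl f\<close>, each contained in the open set of index \<open>tt f\<close>.  Closedness
  ensures that near a given point only the sets that contain it matter: \<open>near\<close> and \<open>nbd\<close> are the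
  indices of these sets and a neighborhood that meets no other ones.\<close>

definition closed_refinement :: "'a set \<Rightarrow> ('a \<Rightarrow> 'r \<Rightarrow> 'i) \<Rightarrow> ('a \<Rightarrow> 'a set) \<Rightarrow> bool" where
  "closed_refinement F tt Cl \<longleftrightarrow> finite F \<and> points X \<subseteq> (\<Union>f\<in>F. Cl f) \<and>
     (\<forall>f\<in>F. tt f \<in> Idx \<and> closedin (topol X) (Cl f) \<and> Cl f \<subseteq> Opn (tt f))"

lemma closed_refinement_exists: "\<exists>F tt Cl. closed_refinement F tt Cl"
proof -
  have "Hausdorff_space (topol X)" using cm by (simp add: complex_manifold_def)
  then have reg: "regular_space (topol X)" using comp compact_Hausdorff_imp_regular_space by blast
  have "\<exists>t U Cl. t \<in> Idx \<and> openin (topol X) U \<and> x \<in> U \<and> U \<subseteq> Cl \<and> closedin (topol X) Cl \<and> Cl \<subseteq> Opn t"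
    if x: "x \<in> points X" for x
  proof -
    obtain t where t: "t \<in> Idx" "x \<in> Opn t" using x by (rule Opn_cover)
    have cl: "closedin (topol X) (points X - Opn t)" using openin_Opn[OF t(1)] by blast
    have xt: "x \<in> points X - (points X - Opn t)" using x t by blast
    obtain U V where UV: "openin (topol X) U" "openin (topol X) V" "x \<in> U" "points X - Opn t \<subseteq> V" "disjnt U V"
      using reg[unfolded regular_space_def, rule_format, OF conjI[OF cl xt]] by blast
    have "U \<subseteq> points X - V" using UV openin_subset[OF UV(1)] by (auto simp: disjnt_def)
    moreover have "closedin (topol X) (points X - V)" using UV(2) by blast
    moreover have "points X - V \<subseteq> Opn t" using UV(4) by blast
    ultimately show ?thesis using t(1) UV(1,3) by blast
  qed
  then obtain tt U Cl where *: "\<And>x. x \<in> points X \<Longrightarrow> tt x \<in> Idx \<and> openin (topol X) (U x) \<and> x \<in> U x \<and>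
      U x \<subseteq> Cl x \<and> closedin (topol X) (Cl x) \<and> Cl x \<subseteq> Opn (tt x)"
    by metis
  have U_open: "openin (topol X) (U x) \<and> x \<in> U x" if "x \<in> points X" for x using *[OF that] by blast
  obtain F where F: "finite F" "F \<subseteq> points X" "points X \<subseteq> (\<Union>x\<in>F. U x)"
    by (rule compact_space_cover[OF comp U_open])
  have "points X \<subseteq> (\<Union>x\<in>F. Cl x)"
  proof
    fix x assume "x \<in> points X"
    then obtain f where "f \<in> F" "x \<in> U f" using F(3) by blast
    then show "x \<in> (\<Union>x\<in>F. Cl x)" using *[of f] F(2) by blast
  qed
  then show ?thesis unfolding closed_refinement_def using F * by blast
qed

definition near :: "'a set \<Rightarrow> ('a \<Rightarrow> 'a set) \<Rightarrow> 'a \<Rightarrow> 'a set" where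
  "near F Cl y = {f \<in> F. y \<in> Cl f}"

definition nbd :: "'a set \<Rightarrow> ('a \<Rightarrow> 'r \<Rightarrow> 'i) \<Rightarrow> ('a \<Rightarrow> 'a set) \<Rightarrow> 'a \<Rightarrow> 'a set" where
  "nbd F tt Cl y = {x \<in> points X. \<forall>f\<in>F. x \<in> (if f \<in> near F Cl y then Opn (tt f) else points X - Cl f)}"

lemma nbd_props:
  assumes "closed_refinement F tt Cl" "y \<in> points X"
  shows "openin (topol X) (nbd F tt Cl y)" "y \<in> nbd F tt Cl y"
    "\<And>x f. x \<in> nbd F tt Cl y \<Longrightarrow> f \<in> near F Cl y \<Longrightarrow> tt f \<in> Idx \<and> x \<in> Opn (tt f)"
    "\<And>x f. x \<in> nbd F tt Cl y \<Longrightarrow> f \<in> F \<Longrightarrow> x \<in> Cl f \<Longrightarrow> f \<in> near F Cl y"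
proof -
  let ?S = "\<lambda>f. if f \<in> near F Cl y then Opn (tt f) else points X - Cl f"
  have "openin (topol X) ((\<Inter>f\<in>F. ?S f) \<inter> points X)"
    using assms openin_Opn unfolding closed_refinement_def by (intro openin_INT) auto
  moreover have "(\<Inter>f\<in>F. ?S f) \<inter> points X = nbd F tt Cl y" by (auto simp: nbd_def)
  ultimately show "openin (topol X) (nbd F tt Cl y)" by simp
  show "y \<in> nbd F tt Cl y" using assms unfolding nbd_def near_def closed_refinement_def by auto
  show "tt f \<in> Idx \<and> x \<in> Opn (tt f)" if "x \<in> nbd F tt Cl y" "f \<in> near F Cl y" for x f
  proof -
    have "f \<in> F" using that(2) by (simp add: near_def)
    then show ?thesis using that assms(1) unfolding nbd_def closed_refinement_def by auto
  qed
  show "f \<in> near F Cl y" if "x \<in> nbd F tt Cl y" "f \<in> F" "x \<in> Cl f" for x f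
  proof (rule ccontr)
    assume "f \<notin> near F Cl y"
    then have "x \<in> points X - Cl f" using that unfolding nbd_def by auto
    then show False using that by blast
  qed
qed

lemma near_denominators:
  assumes "closed_refinement F tt Cl" "y \<in> points X" "f \<in> near F Cl y"
  shows "holomorphic_fun X (nbd F tt Cl y) (denom (DD l) (tt f))"
    "nowhere_locally_zero (topol X) (nbd F tt Cl y) (denom (DD l) (tt f))"
proof -
  note N = nbd_props[OF assms(1,2)]
  have "tt f \<in> Idx" "nbd F tt Cl y \<subseteq> Opn (tt f)" using N(3)[OF _ assms(3)] N(2) by blast+
  then show "holomorphic_fun X (nbd F tt Cl y) (denom (DD l) (tt f))"
    "nowhere_locally_zero (topol X) (nbd F tt Cl y) (denom (DD l) (tt f))"
    using numer_denom(2,4)[of "tt f" l] holomorphic_fun_subset nowhere_locally_zero_subset by blast+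
qed

text \<open>Complex discs through a common center \<open>b\<close> with directions \<open>v'\<close> near \<open>v\<close>, in the chart \<open>\<mu>\<close>.  Every
  point of the neighborhood \<open>W\<close> of \<open>y\<close> lies on one of them, at parameter \<open>R / 2\<close>, half way to the
  boundary circle.  The constant \<open>A\<close> bounds metrics and denominators on the discs and keeps the
  denominators away from zero on the boundary circles.\<close>

definition disc_at :: "('r \<Rightarrow> nat) \<Rightarrow> 'a set \<Rightarrow> ('a \<Rightarrow> 'r \<Rightarrow> 'i) \<Rightarrow> ('a \<Rightarrow> 'a set) \<Rightarrow> 'a \<Rightarrow> ('a, 'n) chart \<Rightarrow>
    (complex, 'n) vec \<Rightarrow> (complex, 'n) vec \<Rightarrow> real \<Rightarrow> real \<Rightarrow> real \<Rightarrow> 'a set \<Rightarrow> bool" where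
  "disc_at l F tt Cl y \<mu> b v R \<eta> A W \<longleftrightarrow> \<mu> \<in> atlas X \<and> 0 < R \<and> 0 < \<eta> \<and> 1 \<le> A \<and> openin (topol X) W \<and> y \<in> W \<and>
     (\<forall>x\<in>W. \<exists>v'\<in>cball v \<eta>. x \<in> fst \<mu> \<and> snd \<mu> x = b + of_real (R / 2) *s v') \<and>
     (\<forall>v'\<in>cball v \<eta>. \<forall>t\<in>cball 0 (5 * R / 4). b + t *s v' \<in> snd \<mu> ` (fst \<mu> \<inter> nbd F tt Cl y)) \<and>
     (\<forall>v'\<in>cball v \<eta>. \<forall>t\<in>cball 0 R. \<forall>f\<in>near F Cl y.
        norm (denom (DD l) (tt f) (chart_inv \<mu> (b + t *s v'))) \<le> A \<and> \<bar>mm l (tt f) (chart_inv \<mu> (b + t *s v'))\<bar> \<le> A) \<and>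
     (\<forall>v'\<in>cball v \<eta>. \<forall>t\<in>sphere 0 R. \<forall>f\<in>near F Cl y.
        1 \<le> A * norm (denom (DD l) (tt f) (chart_inv \<mu> (b + t *s v'))))"

lemma continuous_on_smult_vec: "continuous_on S (\<lambda>p. b + fst p *s (snd p :: (complex, 'n) vec))"
proof -
  have "(\<lambda>p. b + fst p *s (snd p :: (complex, 'n) vec)) = (\<lambda>p. \<chi> i. b $ i + fst p * snd p $ i)"
    by (auto simp: vec_eq_iff)
  moreover have "continuous_on S (\<lambda>p. \<chi> i. b $ i + fst p * (snd p :: (complex, 'n) vec) $ i)"
    by (intro continuous_on_vec_lambda continuous_intros)
  ultimately show ?thesis by (simp only:)
qed

text \<open>Choose a punctured disc centered at \<open>y\<close> on which no denominator vanishes, and shift its center along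
  the line so that the point \<open>y\<close> itself, where denominators may vanish, is off the boundary circle.
  Compactness allows to vary the direction.\<close>

lemma disc_at_exists:
  assumes cr: "closed_refinement F tt Cl" and y: "y \<in> points X"
  shows "\<exists>\<mu> b v R \<eta> A W. disc_at l F tt Cl y \<mu> b v R \<eta> A W"
proof -
  let ?N = "nbd F tt Cl y" and ?I = "near F Cl y"
  note N = nbd_props[OF cr y]
  have finI: "finite ?I" using cr by (simp add: near_def closed_refinement_def)
  obtain \<mu> where \<mu>: "\<mu> \<in> atlas X" "y \<in> fst \<mu>" using y by (rule atlas_cover)
  note ch = atlas_chart[OF \<mu>(1)]
  let ?U = "snd \<mu> ` (fst \<mu> \<inter> ?N)"
  have U: "open ?U" by (rule chart_on_open_image[OF ch N(1)])
  have z0: "snd \<mu> y \<in> ?U" using \<mu>(2) N(2) by blast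
  note dh = near_denominators[OF cr y]
  have dc: "(\<lambda>w. denom (DD l) (tt f) (chart_inv \<mu> w)) mholomorphic_on ?U" if "f \<in> ?I" for f
    using dh(1)[OF that] \<mu>(1) unfolding holomorphic_fun_def by blast
  define h where "h x = (\<Prod>f\<in>?I. denom (DD l) (tt f) x)" for x
  have hm: "(\<lambda>w. h (chart_inv \<mu> w)) mholomorphic_on ?U"
    unfolding mholomorphic_on_iff_cdiff h_def
    by (intro ballI cdiff_prod) (use dc in \<open>auto simp only: mholomorphic_on_iff_cdiff\<close>)
  have hz: "nowhere_locally_zero (topol X) ?N h"
    unfolding h_def[abs_def] by (intro nowhere_locally_zero_prod[OF N(1) finI] dh)
  have nzV: "\<exists>z\<in>V. h (chart_inv \<mu> z) \<noteq> 0" if V: "open V" "snd \<mu> y \<in> V" for V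
    by (rule nowhere_locally_zero_chart[OF \<mu> N(1,2) hz V])
  obtain v R0 where R0: "0 < R0" "\<forall>t. norm t \<le> R0 \<longrightarrow> snd \<mu> y + t *s v \<in> ?U"
    "\<forall>t. 0 < norm t \<and> norm t \<le> R0 \<longrightarrow> h (chart_inv \<mu> (snd \<mu> y + t *s v)) \<noteq> 0"
    using punctured_disc_avoiding_zeros[OF U z0 hm nzV] by blast
  \<comment> \<open>With center shifted by \<open>R / 2\<close>, the disc of radius \<open>5 R / 4\<close> stays within distance \<open>R0 = 2 R\<close> of
    \<open>y\<close>, and its circle of radius \<open>R\<close> has distance at least \<open>R / 2\<close> from \<open>y\<close>.\<close>
  define R where "R = R0 / 2"
  define b where "b = snd \<mu> y - of_real (R / 2) *s v"
  have R: "0 < R" using R0 by (simp add: R_def)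
  have b_line: "b + t *s v = snd \<mu> y + (t - of_real (R / 2)) *s v" for t
    by (simp add: b_def vec_eq_iff algebra_simps)
  define W where "W = ?U \<inter> (\<lambda>w. h (chart_inv \<mu> w)) -` (- {0})"
  have W: "open W" unfolding W_def
    by (rule continuous_open_preimage[OF mholomorphic_on_continuous[OF hm] U]) auto
  have "(\<lambda>t. b + t *s v) ` cball 0 (5 * R / 4) \<subseteq> ?U"
  proof (rule image_subsetI)
    fix t :: complex assume "t \<in> cball 0 (5 * R / 4)"
    then have "norm (t - of_real (R / 2)) \<le> R0"
      using norm_triangle_ineq4[of t "of_real (R / 2)"] R by (simp add: R_def)
    then show "b + t *s v \<in> ?U" unfolding b_line using R0(2) by blast
  qed
  moreover have "compact ((\<lambda>t. b + t *s v) ` cball 0 (5 * R / 4))"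
    by (intro compact_continuous_image continuous_on_line) auto
  ultimately obtain \<epsilon>1 where e1: "\<epsilon>1 > 0" "(\<Union>x\<in>(\<lambda>t. b + t *s v) ` cball 0 (5 * R / 4). ball x \<epsilon>1) \<subseteq> ?U"
    using compact_subset_open_imp_ball_epsilon_subset[OF _ U] by metis
  have "(\<lambda>t. b + t *s v) ` sphere 0 R \<subseteq> W"
  proof (rule image_subsetI)
    fix t :: complex assume t: "t \<in> sphere 0 R"
    have "norm (t - of_real (R / 2)) \<le> R0"
      using norm_triangle_ineq4[of t "of_real (R / 2)"] R t by (simp add: R_def)
    moreover have "0 < norm (t - of_real (R / 2))"
      using norm_triangle_ineq2[of t "of_real (R / 2)"] R t by (simp del: zero_less_norm_iff)
    ultimately show "b + t *s v \<in> W" unfolding b_line W_def using R0(2,3) by blast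
  qed
  moreover have "compact ((\<lambda>t. b + t *s v) ` sphere 0 R)"
    by (intro compact_continuous_image continuous_on_line) auto
  ultimately obtain \<epsilon>2 where e2: "\<epsilon>2 > 0" "(\<Union>x\<in>(\<lambda>t. b + t *s v) ` sphere 0 R. ball x \<epsilon>2) \<subseteq> W"
    using compact_subset_open_imp_ball_epsilon_subset[OF _ W] by metis
  define \<eta> where "\<eta> = min \<epsilon>1 \<epsilon>2 / (2 * R)"
  have \<eta>: "0 < \<eta>" using e1 e2 R by (simp add: \<eta>_def)
  have close: "b + t *s v' \<in> ball (b + t *s v) (min \<epsilon>1 \<epsilon>2)" if "v' \<in> cball v \<eta>" "norm t \<le> 5 * R / 4" for t v'
  proof -
    have "t *s v' - t *s v = t *s (v' - v)" by (simp add: vec_eq_iff algebra_simps)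
    note eq = this
    have "dist (b + t *s v) (b + t *s v') = norm (t *s v' - t *s v)"
      by (simp add: dist_norm norm_minus_commute)
    also have "\<dots> = norm t * norm (v' - v)" unfolding eq norm_smult_vec ..
    also have "\<dots> \<le> (5 * R / 4) * \<eta>" using that R by (intro mult_mono) (auto simp: dist_norm norm_minus_commute)
    also have "\<dots> < min \<epsilon>1 \<epsilon>2" using R e1(1) e2(1) by (simp add: \<eta>_def min_def)
    finally show ?thesis by simp
  qed
  have inU: "b + t *s v' \<in> ?U" if "v' \<in> cball v \<eta>" "t \<in> cball 0 (5 * R / 4)" for t v'
  proof -
    have "b + t *s v' \<in> ball (b + t *s v) \<epsilon>1" using close[OF that(1), of t] that(2) by simp
    then show ?thesis using e1(2) that(2) by blast
  qed
  have inW: "b + t *s v' \<in> W" if "v' \<in> cball v \<eta>" "t \<in> sphere 0 R" for t v'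
  proof -
    have "b + t *s v' \<in> ball (b + t *s v) \<epsilon>2" using close[OF that(1), of t] that(2) R by simp
    then show ?thesis using e2(2) that(2) by blast
  qed
  let ?m = "\<lambda>p. b + fst p *s snd p"
  have cK: "compact (?m ` (cball 0 R \<times> cball v \<eta>))" "compact (?m ` (sphere 0 R \<times> cball v \<eta>))"
    by (intro compact_continuous_image continuous_on_smult_vec compact_Times compact_cball compact_sphere)+
  have subU: "?m ` (cball 0 R \<times> cball v \<eta>) \<subseteq> ?U" using inU R by auto
  have subW: "?m ` (sphere 0 R \<times> cball v \<eta>) \<subseteq> W" using inW by auto
  have cd: "continuous_on ?U (\<lambda>w. denom (DD l) (tt f) (chart_inv \<mu> w))" if "f \<in> ?I" for f
    using dc[OF that] by (rule mholomorphic_on_continuous)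
  have cmm: "continuous_on ?U (\<lambda>w. mm l (tt f) (chart_inv \<mu> w))" if f: "f \<in> ?I" for f
  proof -
    have "tt f \<in> Idx" "?N \<subseteq> Opn (tt f)" using N(3)[OF _ f] N(2) by blast+
    then show ?thesis by (intro continuous_on_subset[OF mm_continuous[OF ch, of "tt f" l]]) blast+
  qed
  have "continuous_on (?m ` (cball 0 R \<times> cball v \<eta>))
      (\<lambda>w. \<Sum>f\<in>?I. norm (denom (DD l) (tt f) (chart_inv \<mu> w)) + \<bar>mm l (tt f) (chart_inv \<mu> w)\<bar>)"
    by (intro continuous_intros continuous_on_subset[OF cd subU] continuous_on_subset[OF cmm subU])
  from compact_bounded_above[OF cK(1) this] obtain A1 where
    A1: "\<forall>w\<in>?m ` (cball 0 R \<times> cball v \<eta>). (\<Sum>f\<in>?I. norm (denom (DD l) (tt f) (chart_inv \<mu> w)) + \<bar>mm l (tt f) (chart_inv \<mu> w)\<bar>) \<le> A1" by blast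
  have dW: "denom (DD l) (tt f) (chart_inv \<mu> w) \<noteq> 0" if "f \<in> ?I" "w \<in> W" for f w
    using that finI unfolding W_def h_def by (auto simp del: DD_simps)
  have WU: "W \<subseteq> ?U" by (simp add: W_def)
  have "continuous_on (?m ` (sphere 0 R \<times> cball v \<eta>)) (\<lambda>w. \<Sum>f\<in>?I. 1 / norm (denom (DD l) (tt f) (chart_inv \<mu> w)))"
  proof (intro continuous_on_sum continuous_on_divide continuous_on_const continuous_on_norm ballI)
    fix f assume f: "f \<in> ?I"
    show "continuous_on (?m ` (sphere 0 R \<times> cball v \<eta>)) (\<lambda>w. denom (DD l) (tt f) (chart_inv \<mu> w))"
      by (rule continuous_on_subset[OF cd[OF f] order_trans[OF subW WU]])
    fix w assume "w \<in> ?m ` (sphere 0 R \<times> cball v \<eta>)"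
    then have "w \<in> W" using subW by blast
    then show "norm (denom (DD l) (tt f) (chart_inv \<mu> w)) \<noteq> 0" using dW[OF f] by (simp del: DD_simps)
  qed
  from compact_bounded_above[OF cK(2) this] obtain A2 where
    A2: "\<forall>w\<in>?m ` (sphere 0 R \<times> cball v \<eta>). (\<Sum>f\<in>?I. 1 / norm (denom (DD l) (tt f) (chart_inv \<mu> w))) \<le> A2" by blast
  define A where "A = max 1 (max A1 A2)"
  let ?O = "{x \<in> fst \<mu>. snd \<mu> x \<in> ball (snd \<mu> y) (\<eta> * R / 2)}"
  have "disc_at l F tt Cl y \<mu> b v R \<eta> A ?O"
    unfolding disc_at_def
  proof (intro conjI ballI)
    show "\<mu> \<in> atlas X" "0 < R" "0 < \<eta>" "1 \<le> A" using \<mu> R \<eta> by (auto simp: A_def)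
    show "openin (topol X) ?O" by (rule chart_on_open_vimage[OF ch]) auto
    show "y \<in> ?O" using \<mu> R \<eta> by simp
  next
    fix x assume x: "x \<in> ?O"
    let ?v = "v + of_real (2 / R) *s (snd \<mu> x - snd \<mu> y)"
    have "norm (of_real (2 / R) *s (snd \<mu> x - snd \<mu> y)) \<le> \<eta>"
    proof -
      have "norm (of_real (2 / R) *s (snd \<mu> x - snd \<mu> y)) = 2 / R * norm (snd \<mu> x - snd \<mu> y)"
        using R by (simp only: norm_smult_vec) (simp add: norm_divide)
      also have "\<dots> \<le> \<eta>" using x R by (simp add: dist_norm norm_minus_commute field_simps)
      finally show ?thesis .
    qed
    then have "?v \<in> cball v \<eta>" by (simp only: mem_cball dist_norm norm_minus_commute[of v]) (simp only: add_diff_cancel_left')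
    moreover have "snd \<mu> x = b + of_real (R / 2) *s ?v"
      using R by (simp add: b_def vec_eq_iff algebra_simps)
    ultimately show "\<exists>v'\<in>cball v \<eta>. x \<in> fst \<mu> \<and> snd \<mu> x = b + of_real (R / 2) *s v'" using x by blast
  next
    fix v' t assume "v' \<in> cball v \<eta>" "t \<in> cball (0::complex) (5 * R / 4)"
    then show "b + t *s v' \<in> ?U" by (rule inU)
  next
    fix v' f and t :: complex assume *: "v' \<in> cball v \<eta>" "t \<in> cball 0 R" "f \<in> ?I"
    have "(\<Sum>f\<in>?I. norm (denom (DD l) (tt f) (chart_inv \<mu> (b + t *s v'))) + \<bar>mm l (tt f) (chart_inv \<mu> (b + t *s v'))\<bar>) \<le> A1"
      using *(1,2) by (intro bspec[OF A1] image_eqI[of _ _ "(t, v')"]) auto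
    moreover have "norm (denom (DD l) (tt f) (chart_inv \<mu> (b + t *s v'))) + \<bar>mm l (tt f) (chart_inv \<mu> (b + t *s v'))\<bar>
       \<le> (\<Sum>f\<in>?I. norm (denom (DD l) (tt f) (chart_inv \<mu> (b + t *s v'))) + \<bar>mm l (tt f) (chart_inv \<mu> (b + t *s v'))\<bar>)"
      by (rule member_le_sum[OF *(3)]) (use finI in auto)
    ultimately have le: "norm (denom (DD l) (tt f) (chart_inv \<mu> (b + t *s v'))) + \<bar>mm l (tt f) (chart_inv \<mu> (b + t *s v'))\<bar> \<le> A"
      unfolding A_def by linarith
    show "norm (denom (DD l) (tt f) (chart_inv \<mu> (b + t *s v'))) \<le> A"
      using le abs_ge_zero[of "mm l (tt f) (chart_inv \<mu> (b + t *s v'))"] by linarith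
    show "\<bar>mm l (tt f) (chart_inv \<mu> (b + t *s v'))\<bar> \<le> A"
      using le norm_ge_zero[of "denom (DD l) (tt f) (chart_inv \<mu> (b + t *s v'))"] by linarith
  next
    fix v' f and t :: complex assume *: "v' \<in> cball v \<eta>" "t \<in> sphere 0 R" "f \<in> ?I"
    let ?d = "\<lambda>f. norm (denom (DD l) (tt f) (chart_inv \<mu> (b + t *s v')))"
    have "(\<Sum>f\<in>?I. 1 / ?d f) \<le> A2"
      using *(1,2) by (intro bspec[OF A2] image_eqI[of _ _ "(t, v')"]) auto
    moreover have "1 / ?d f \<le> (\<Sum>f\<in>?I. 1 / ?d f)" by (rule member_le_sum[OF *(3)]) (use finI in auto)
    ultimately have "1 / ?d f \<le> A" unfolding A_def by linarith
    moreover have "0 < ?d f" using dW[OF *(3) inW[OF *(1,2)]] by (simp del: DD_simps)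
    ultimately show "1 \<le> A * ?d f" by (simp add: field_simps del: DD_simps)
  qed
  then show ?thesis by blast
qed

text \<open>The family \<open>G\<close> represents a meromorphic section \<open>G t / denom\<^sup>e\<^sup>e\<close> of the \<open>k\<close>-th power of the bundle of \<open>l\<close>.  It must
  vanish if its numerators vanish to order \<open>K\<close> at finitely many points, the centers of the discs
  above, and \<open>K\<close> exceeds a multiple of \<open>ee + k\<close>.  Let \<open>S\<close> be the supremum of the squared norm of the meromorphic
  section over all boundary circles, where the denominators are under control.  By the Schwarz
  lemma on the discs, \<open>G\<close> is at most \<open>2\<^sup>-\<^sup>K\<close> times its boundary values on the sets \<open>W y\<close>.  These
  sets cover the manifold, in particular the boundary circles themselves, and this gives
  \<open>S \<le> 4\<^sup>-\<^sup>K C\<^sup>e\<^sup>e\<^sup>+\<^sup>k S\<close>.\<close>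

lemma Schwarz_vanishing:
  obtains Pts :: "(('a, 'n) chart \<times> ('r \<Rightarrow> 'i) \<times> (complex, 'n) vec) set" and C1 :: nat where "finite Pts"
   "\<forall>(\<mu>, t, w)\<in>Pts. \<mu> \<in> atlas X \<and> t \<in> Idx \<and> w \<in> snd \<mu> ` (fst \<mu> \<inter> Opn t)"
   "\<forall>ee k K G. C1 * (ee + k) < K \<longrightarrow> (\<forall>t\<in>Idx. holomorphic_fun X (Opn t) (G t)) \<longrightarrow>
      (\<forall>t\<in>Idx. \<forall>t'\<in>Idx. \<forall>x\<in>Opn t \<inter> Opn t'.
         G t x * denom (DD l) t' x ^ ee = gg l t t' x ^ k * (denom (DD l) t x ^ ee * G t' x)) \<longrightarrow>
      (\<forall>(\<mu>, t, w)\<in>Pts. \<exists>b. power_series_at_0 (\<lambda>z. G t (chart_inv \<mu> (w + z))) b \<and> (\<forall>\<alpha>. wt \<alpha> < K \<longrightarrow> b \<alpha> = 0)) \<longrightarrow>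
      (\<forall>t\<in>Idx. \<forall>x\<in>Opn t. G t x = 0)"
proof -
  obtain F tt Cl where cr: "closed_refinement F tt Cl" using closed_refinement_exists by blast
  have crD: "finite F" "points X \<subseteq> (\<Union>f\<in>F. Cl f)" "\<And>f. f \<in> F \<Longrightarrow> tt f \<in> Idx"
    using cr by (auto simp: closed_refinement_def)
  have "\<forall>y\<in>points X. \<exists>\<mu> b v R \<eta> A W. disc_at l F tt Cl y \<mu> b v R \<eta> A W"
    using disc_at_exists[OF cr] by blast
  then obtain \<mu> b v R \<eta> A W where disc: "\<And>y. y \<in> points X \<Longrightarrow> disc_at l F tt Cl y (\<mu> y) (b y) (v y) (R y) (\<eta> y) (A y) (W y)"
    by metis
  note disc' = disc[unfolded disc_at_def]
  have d1: "\<mu> y \<in> atlas X" "0 < R y" "0 < \<eta> y" "1 \<le> A y" "openin (topol X) (W y)" "y \<in> W y" if "y \<in> points X" for y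
    using disc'[OF that] by blast+
  have d2: "\<exists>v'\<in>cball (v y) (\<eta> y). x \<in> fst (\<mu> y) \<and> snd (\<mu> y) x = b y + of_real (R y / 2) *s v'"
    if "y \<in> points X" "x \<in> W y" for x y
    using disc'[OF that(1)] that(2) by blast
  have d3: "b y + t *s v' \<in> snd (\<mu> y) ` (fst (\<mu> y) \<inter> nbd F tt Cl y)"
    if "y \<in> points X" "v' \<in> cball (v y) (\<eta> y)" "t \<in> cball 0 (5 * R y / 4)" for y v' t
    using disc'[OF that(1)] that(2,3) by blast
  have d4: "norm (denom (DD l) (tt f) (chart_inv (\<mu> y) (b y + t *s v'))) \<le> A y"
       "\<bar>mm l (tt f) (chart_inv (\<mu> y) (b y + t *s v'))\<bar> \<le> A y"
    if "y \<in> points X" "v' \<in> cball (v y) (\<eta> y)" "t \<in> cball 0 (R y)" "f \<in> near F Cl y" for y v' t f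
    using disc'[OF that(1)] that(2-) by blast+
  have d5: "1 \<le> A y * norm (denom (DD l) (tt f) (chart_inv (\<mu> y) (b y + t *s v')))"
    if "y \<in> points X" "v' \<in> cball (v y) (\<eta> y)" "t \<in> sphere 0 (R y)" "f \<in> near F Cl y" for y v' t f
    using disc'[OF that(1)] that(2-) by blast
  have W_open: "openin (topol X) (W x) \<and> x \<in> W x" if "x \<in> points X" for x using d1(5,6)[OF that] by blast
  obtain Y where Y: "finite Y" "Y \<subseteq> points X" "points X \<subseteq> (\<Union>y\<in>Y. W y)"
    by (rule compact_space_cover[OF comp W_open])
  define A' where "A' = 1 + (\<Sum>y\<in>Y. A y)"
  have A'1: "1 \<le> A'" unfolding A'_def using d1(4) Y(2) by (smt (verit) sum_nonneg subsetD)
  have AA': "A y \<le> A'" if "y \<in> Y" for y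
  proof -
    have "A y \<le> (\<Sum>y\<in>Y. A y)"
      by (rule member_le_sum[OF that]) (use d1(4) Y in \<open>auto intro: order_trans[OF zero_le_one]\<close>)
    then show ?thesis by (simp add: A'_def)
  qed
  obtain C1 where C1: "A' ^ 4 * exp (2 * A') < 4 ^ C1" using real_arch_pow[of 4] by auto
  define Pts where "Pts = (\<lambda>(y, f). (\<mu> y, tt f, b y)) ` (Sigma Y (near F Cl))"
  have finnear: "finite (near F Cl y)" for y using crD(1) by (simp add: near_def)
  have ch: "chart_on (topol X) (\<mu> y)" if "y \<in> points X" for y using atlas_chart d1(1) that by blast
  have nearD: "f \<in> F" "tt f \<in> Idx" if "f \<in> near F Cl y" for f y using that crD(3) by (auto simp: near_def)
  have inN: "chart_inv (\<mu> y) (b y + t *s v') \<in> nbd F tt Cl y"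
    if "y \<in> points X" "v' \<in> cball (v y) (\<eta> y)" "t \<in> cball 0 (5 * R y / 4)" for y v' t
    using d3[OF that] chart_inv_chart[OF ch[OF that(1)]] by auto
  have WN: "x \<in> nbd F tt Cl y" if yx: "y \<in> points X" "x \<in> W y" for x y
  proof -
    obtain v' where v': "v' \<in> cball (v y) (\<eta> y)" "x \<in> fst (\<mu> y)" "snd (\<mu> y) x = b y + of_real (R y / 2) *s v'"
      using d2[OF yx] by blast
    have "chart_inv (\<mu> y) (b y + of_real (R y / 2) *s v') \<in> nbd F tt Cl y"
      using d1(2)[OF yx(1)] by (intro inN yx v') auto
    then show ?thesis using chart_inv_chart[OF ch[OF yx(1)] v'(2)] v'(3) by simp
  qed
  have main: "G t x = 0"
    if K: "C1 * (ee + k) < K" and G: "\<forall>t\<in>Idx. holomorphic_fun X (Opn t) (G t)"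
    and rel: "\<forall>t\<in>Idx. \<forall>t'\<in>Idx. \<forall>x\<in>Opn t \<inter> Opn t'.
         G t x * denom (DD l) t' x ^ ee = gg l t t' x ^ k * (denom (DD l) t x ^ ee * G t' x)"
    and van: "\<forall>(\<mu>, t, w)\<in>Pts. \<exists>b. power_series_at_0 (\<lambda>z. G t (chart_inv \<mu> (w + z))) b \<and> (\<forall>\<alpha>. wt \<alpha> < K \<longrightarrow> b \<alpha> = 0)"
    and t: "t \<in> Idx" "x \<in> Opn t" for ee k K G t x
  proof -
    define dn where "dn f x = denom (DD l) (tt f) x" for f x
    \<comment> \<open>The squared norm of the meromorphic section, computed on the open set of index \<open>tt f\<close>.\<close>
    define V where "V f x = (norm (G (tt f) x))\<^sup>2 / (norm (dn f x) ^ ee)\<^sup>2 * exp (- (real k * mm l (tt f) x))" for f x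
    have V_indep: "V f x = V f' x" if f: "tt f \<in> Idx" "tt f' \<in> Idx" "x \<in> Opn (tt f)" "x \<in> Opn (tt f')" "dn f x \<noteq> 0" "dn f' x \<noteq> 0" for f f' x
    proof -
      let ?g = "norm (gg l (tt f) (tt f') x)"
      have "G (tt f) x * dn f' x ^ ee = gg l (tt f) (tt f') x ^ k * (dn f x ^ ee * G (tt f') x)"
        using rel f unfolding dn_def by blast
      then have "G (tt f) x / dn f x ^ ee = gg l (tt f) (tt f') x ^ k * (G (tt f') x / dn f' x ^ ee)"
        using f(5,6) by (simp add: field_simps)
      then have "norm (G (tt f) x / dn f x ^ ee) = norm (gg l (tt f) (tt f') x ^ k * (G (tt f') x / dn f' x ^ ee))" by (rule arg_cong)
      then have 1: "norm (G (tt f) x) / norm (dn f x) ^ ee = ?g ^ k * (norm (G (tt f') x) / norm (dn f' x) ^ ee)"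
        by (simp add: norm_mult norm_divide norm_power)
      have "exp (- (real k * mm l (tt f) x)) = exp (- mm l (tt f) x) ^ k" "exp (- (real k * mm l (tt f') x)) = exp (- mm l (tt f') x) ^ k"
        by (simp_all add: exp_of_nat_mult[symmetric])
      then have 2: "(?g ^ k)\<^sup>2 * exp (- (real k * mm l (tt f) x)) = exp (- (real k * mm l (tt f') x))"
      proof -
        have "(?g ^ k)\<^sup>2 = (?g\<^sup>2) ^ k" by (simp only: power_mult[symmetric] mult.commute)
        then show ?thesis
          unfolding \<open>exp (- (real k * mm l (tt f) x)) = _\<close> \<open>exp (- (real k * mm l (tt f') x)) = _\<close>
          using gg_metric[OF f(1-4), of l] by (simp only: power_mult_distrib[symmetric])
      qed
      have "V f x = (norm (G (tt f) x) / norm (dn f x) ^ ee)\<^sup>2 * exp (- (real k * mm l (tt f) x))"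
        by (simp add: V_def power_divide)
      also have "\<dots> = (norm (G (tt f') x) / norm (dn f' x) ^ ee)\<^sup>2 * ((?g ^ k)\<^sup>2 * exp (- (real k * mm l (tt f) x)))"
        unfolding 1 by (simp only: power_mult_distrib mult_ac)
      also have "\<dots> = V f' x" unfolding 2 by (simp add: V_def power_divide)
      finally show ?thesis .
    qed
    \<comment> \<open>The value \<open>0\<close> is added to have a nonempty set.\<close>
    define SV where "SV = insert 0 {V f (chart_inv (\<mu> y) (b y + t *s v')) | y f v' t. y \<in> Y \<and> f \<in> near F Cl y \<and>
        v' \<in> cball (v y) (\<eta> y) \<and> t \<in> sphere 0 (R y)}"
    have Gh: "(\<lambda>w. G (tt f) (chart_inv (\<mu> y) w)) mholomorphic_on snd (\<mu> y) ` (fst (\<mu> y) \<inter> nbd F tt Cl y)"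
      if y: "y \<in> points X" and f: "f \<in> near F Cl y" for y f
    proof -
      have "nbd F tt Cl y \<subseteq> Opn (tt f)" using nbd_props(3)[OF cr y _ f] by blast
      then have "holomorphic_fun X (nbd F tt Cl y) (G (tt f))" using G nearD(2)[OF f] holomorphic_fun_subset by blast
      then show ?thesis using d1(1)[OF y] unfolding holomorphic_fun_def by blast
    qed
    let ?q1 = "(A' ^ ee)\<^sup>2 * exp (real k * A')"
    have q1: "0 < ?q1" using A'1 by simp
    have V_upper: "V f x \<le> (norm (G (tt f) x))\<^sup>2 * ?q1"
      if y: "y \<in> Y" "f \<in> near F Cl y" "v' \<in> cball (v y) (\<eta> y)" "t \<in> sphere 0 (R y)"
        "x = chart_inv (\<mu> y) (b y + t *s v')" for y f v' t x
    proof -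
      have yp: "y \<in> points X" using y(1) Y(2) by blast
      have dpos: "1 \<le> A y * norm (dn f x)" unfolding y(5) dn_def by (rule d5[OF yp y(3,4,2)])
      then have pos: "0 < norm (dn f x)" using d1(4)[OF yp] by (cases "dn f x = 0") auto
      have "1 \<le> A' * norm (dn f x)" using dpos AA'[OF y(1)] pos by (smt (verit) mult_right_mono)
      then have "1 ^ ee \<le> (A' * norm (dn f x)) ^ ee" by (intro power_mono) auto
      then have "1 / norm (dn f x) ^ ee \<le> A' ^ ee" using pos by (simp add: power_mult_distrib field_simps)
      then have "(1 / norm (dn f x) ^ ee)\<^sup>2 \<le> (A' ^ ee)\<^sup>2" by (intro power_mono) auto
      moreover have "\<bar>mm l (tt f) x\<bar> \<le> A'" using d4(2)[OF yp y(3) _ y(2), of t] AA'[OF y(1)] y(4) unfolding y(5) by simp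
      then have "real k * (- mm l (tt f) x) \<le> real k * A'" by (intro mult_left_mono) auto
      then have "exp (- (real k * mm l (tt f) x)) \<le> exp (real k * A')" by simp
      ultimately have "(1 / norm (dn f x) ^ ee)\<^sup>2 * exp (- (real k * mm l (tt f) x)) \<le> ?q1" by (intro mult_mono) auto
      then have "(norm (G (tt f) x))\<^sup>2 * ((1 / norm (dn f x) ^ ee)\<^sup>2 * exp (- (real k * mm l (tt f) x))) \<le> (norm (G (tt f) x))\<^sup>2 * ?q1"
        by (rule mult_left_mono) simp
      then show ?thesis by (simp add: V_def power_divide)
    qed
    have bdd: "bdd_above SV"
    proof -
      have "\<exists>B. \<forall>w\<in>(\<lambda>p. b y + fst p *s snd p) ` (cball 0 (R y) \<times> cball (v y) (\<eta> y)). (norm (G (tt f) (chart_inv (\<mu> y) w)))\<^sup>2 \<le> B"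
        if y: "y \<in> Y" and f: "f \<in> near F Cl y" for y f
      proof (rule compact_bounded_above)
        have yp: "y \<in> points X" using y Y(2) by blast
        show "compact ((\<lambda>p. b y + fst p *s snd p) ` (cball 0 (R y) \<times> cball (v y) (\<eta> y)))"
          by (intro compact_continuous_image continuous_on_smult_vec compact_Times compact_cball)
        have "(\<lambda>p. b y + fst p *s snd p) ` (cball 0 (R y) \<times> cball (v y) (\<eta> y)) \<subseteq> snd (\<mu> y) ` (fst (\<mu> y) \<inter> nbd F tt Cl y)"
          using d3[OF yp] d1(2)[OF yp] by (intro image_subsetI) (simp add: mem_Times_iff)
        then show "continuous_on ((\<lambda>p. b y + fst p *s snd p) ` (cball 0 (R y) \<times> cball (v y) (\<eta> y))) (\<lambda>w. (norm (G (tt f) (chart_inv (\<mu> y) w)))\<^sup>2)"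
          by (intro continuous_intros continuous_on_subset[OF mholomorphic_on_continuous[OF Gh[OF yp f]]])
      qed
      note ex = this
      define B where "B y f = (SOME B. \<forall>w\<in>(\<lambda>p. b y + fst p *s snd p) ` (cball 0 (R y) \<times> cball (v y) (\<eta> y)).
          (norm (G (tt f) (chart_inv (\<mu> y) w)))\<^sup>2 \<le> B)" for y f
      have B: "(norm (G (tt f) (chart_inv (\<mu> y) w)))\<^sup>2 \<le> B y f"
        if "y \<in> Y" "f \<in> near F Cl y" "w \<in> (\<lambda>p. b y + fst p *s snd p) ` (cball 0 (R y) \<times> cball (v y) (\<eta> y))" for y f w
        using someI_ex[OF ex[OF that(1,2)]] that(3) unfolding B_def by blast
      have "s \<le> (\<Sum>(y, f)\<in>Sigma Y (near F Cl). \<bar>B y f\<bar> * ?q1)" if sSV: "s \<in> SV" for s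
      proof -
        have nn: "0 \<le> (case p of (y, f) \<Rightarrow> \<bar>B y f\<bar> * ?q1)" for p using q1 by (cases p) simp
        consider "s = 0" | y f v' t where "y \<in> Y" "f \<in> near F Cl y" "v' \<in> cball (v y) (\<eta> y)" "t \<in> sphere 0 (R y)"
          "s = V f (chart_inv (\<mu> y) (b y + t *s v'))"
          using sSV unfolding SV_def by blast
        then show ?thesis
        proof cases
          case 1 then show ?thesis using nn by (auto intro!: sum_nonneg)
        next
          case (2 y f v' t)
          have "s \<le> (norm (G (tt f) (chart_inv (\<mu> y) (b y + t *s v'))))\<^sup>2 * ?q1"
            unfolding 2(5) by (rule V_upper[OF 2(1-4) refl])
          also have "\<dots> \<le> \<bar>B y f\<bar> * ?q1"
          proof (rule mult_right_mono)
            have "(norm (G (tt f) (chart_inv (\<mu> y) (b y + t *s v'))))\<^sup>2 \<le> B y f"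
              by (rule B[OF 2(1,2)], rule image_eqI[of _ _ "(t, v')"]) (use 2(3,4) in auto)
            then show "(norm (G (tt f) (chart_inv (\<mu> y) (b y + t *s v'))))\<^sup>2 \<le> \<bar>B y f\<bar>" by linarith
          qed (use q1 in simp)
          also have "\<dots> = (case (y, f) of (y, f) \<Rightarrow> \<bar>B y f\<bar> * ?q1)" by simp
          also have "\<dots> \<le> (\<Sum>(y, f)\<in>Sigma Y (near F Cl). \<bar>B y f\<bar> * ?q1)"
            using nn 2(1,2) Y(1) finnear by (intro member_le_sum) auto
          finally show ?thesis .
        qed
      qed
      then show ?thesis by (rule bdd_aboveI)
    qed
    define S where "S = Sup SV"
    have S_upper: "s \<le> S" if "s \<in> SV" for s unfolding S_def using that bdd by (rule cSup_upper)
    have S0: "0 \<le> S" using S_upper[of 0] by (simp add: SV_def)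
    have G_bound: "(norm (G (tt m) x))\<^sup>2 \<le> (1 / 4) ^ K * (S * ?q1)"
      if y: "y \<in> Y" and x: "x \<in> W y" and m: "m \<in> near F Cl y" for y x m
    proof -
      have yp: "y \<in> points X" using y Y(2) by blast
      obtain v' where v': "v' \<in> cball (v y) (\<eta> y)" "x \<in> fst (\<mu> y)" "snd (\<mu> y) x = b y + of_real (R y / 2) *s v'"
        using d2[OF yp x] by blast
      define h where "h t = G (tt m) (chart_inv (\<mu> y) (b y + t *s v'))" for t
      have "(\<mu> y, tt m, b y) \<in> Pts" unfolding Pts_def using y m by force
      then obtain c where c: "power_series_at_0 (\<lambda>z. G (tt m) (chart_inv (\<mu> y) (b y + z))) c" "\<And>\<alpha>. wt \<alpha> < K \<Longrightarrow> c \<alpha> = 0"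
        using van by blast
      obtain C \<delta> where C: "0 < \<delta>" "\<And>t. norm t < \<delta> \<Longrightarrow> norm (h t) \<le> C * norm t ^ K"
        using power_series_vanishing_order[OF c, where v = v'] unfolding h_def by blast
      have hh: "h holomorphic_on ball 0 (5 * R y / 4)"
        unfolding h_def by (rule mholomorphic_on_line[OF Gh[OF yp m]]) (use d3[OF yp v'(1)] in auto)
      have bd: "norm (h t) \<le> sqrt (S * ?q1)" if t: "norm t = R y" for t
      proof (rule real_le_rsqrt)
        let ?x = "chart_inv (\<mu> y) (b y + t *s v')"
        have ts: "t \<in> sphere 0 (R y)" "t \<in> cball 0 (R y)" using t by auto
        have "V m ?x \<in> SV" unfolding SV_def using y m v'(1) ts(1) by blast
        then have VS: "V m ?x \<le> S" by (rule S_upper)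
        have pos: "dn m ?x \<noteq> 0" using d5[OF yp v'(1) ts(1) m] by (auto simp: dn_def simp del: DD_simps)
        have "(norm (h t))\<^sup>2 = V m ?x * ((norm (dn m ?x) ^ ee)\<^sup>2 * exp (real k * mm l (tt m) ?x))"
          using pos by (simp add: V_def h_def exp_minus field_simps)
        also have "\<dots> \<le> S * ?q1"
        proof (rule mult_mono[OF VS])
          have "norm (dn m ?x) \<le> A'" using d4(1)[OF yp v'(1) ts(2) m] AA'[OF y] by (simp add: dn_def del: DD_simps)
          moreover have "mm l (tt m) ?x \<le> A'" using d4(2)[OF yp v'(1) ts(2) m] AA'[OF y] by linarith
          ultimately show "(norm (dn m ?x) ^ ee)\<^sup>2 * exp (real k * mm l (tt m) ?x) \<le> ?q1"
            by (intro mult_mono power_mono) (auto intro: mult_left_mono)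
        qed (use S0 in auto)
        finally show "(norm (h t))\<^sup>2 \<le> S * ?q1" .
      qed
      have Ry: "0 < R y" using d1(2)[OF yp] .
      have "norm (h (of_real (R y / 2))) \<le> (norm (of_real (R y / 2) :: complex) / R y) ^ K * sqrt (S * ?q1)"
        by (rule Schwarz_order[OF hh Ry _ C bd]) (use Ry in auto)
      also have "norm (of_real (R y / 2) :: complex) / R y = 1 / 2" using Ry by simp
      finally have "(norm (h (of_real (R y / 2))))\<^sup>2 \<le> ((1 / 2) ^ K * sqrt (S * ?q1))\<^sup>2" by (intro power_mono) auto
      also have "\<dots> = (1 / 4) ^ K * (S * ?q1)"
        using S0 q1 by (simp add: power_mult_distrib power_mult[symmetric] mult.commute[of K 2]) (simp add: power_mult power2_eq_square)
      also have "h (of_real (R y / 2)) = G (tt m) x"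
        using chart_inv_chart[OF ch[OF yp] v'(2)] v'(3) by (simp add: h_def)
      finally show ?thesis .
    qed
    have cover: "\<exists>m\<in>F. x \<in> Cl m" "\<exists>y\<in>Y. x \<in> W y" if "x \<in> points X" for x
      using that crD(2) Y(3) by blast+
    \<comment> \<open>A point on a boundary circle is in some \<open>Cl m\<close> and some \<open>W y'\<close>, so the interior estimate applies to it,
      in the trivialization of index \<open>tt m\<close>.\<close>
    have "s \<le> (1 / 4) ^ K * (S * ?q1) * ?q1" if sSV: "s \<in> SV" for s
    proof -
      consider "s = 0" | y f v' t where "y \<in> Y" "f \<in> near F Cl y" "v' \<in> cball (v y) (\<eta> y)" "t \<in> sphere 0 (R y)"
        "s = V f (chart_inv (\<mu> y) (b y + t *s v'))"
        using sSV unfolding SV_def by blast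
      then show ?thesis
      proof cases
        case 1 then show ?thesis using S0 q1 by simp
      next
        case (2 y f v' t)
        let ?x = "chart_inv (\<mu> y) (b y + t *s v')"
        have yp: "y \<in> points X" using 2(1) Y(2) by blast
        have xN: "?x \<in> nbd F tt Cl y" using 2(3,4) d1(2)[OF yp] by (intro inN[OF yp]) auto
        then have xp: "?x \<in> points X" by (simp add: nbd_def)
        obtain m where m: "m \<in> F" "?x \<in> Cl m" using cover(1)[OF xp] by blast
        obtain y' where y': "y' \<in> Y" "?x \<in> W y'" using cover(2)[OF xp] by blast
        have m1: "m \<in> near F Cl y" by (rule nbd_props(4)[OF cr yp xN m])
        have yp': "y' \<in> points X" using y'(1) Y(2) by blast
        have m2: "m \<in> near F Cl y'" by (rule nbd_props(4)[OF cr yp' WN[OF yp' y'(2)] m])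
        have dnz: "dn g ?x \<noteq> 0" if "g \<in> near F Cl y" for g
          using d5[OF yp 2(3,4) that] by (auto simp: dn_def simp del: DD_simps)
        have "s = V m ?x" unfolding 2(5)
          using nbd_props(3)[OF cr yp xN] 2(2) m1 dnz by (intro V_indep) auto
        also have "\<dots> \<le> (norm (G (tt m) ?x))\<^sup>2 * ?q1" by (rule V_upper[OF 2(1) m1 2(3,4) refl])
        also have "\<dots> \<le> (1 / 4) ^ K * (S * ?q1) * ?q1"
          using G_bound[OF y' m2] q1 by (intro mult_right_mono) auto
        finally show ?thesis .
      qed
    qed
    then have "S \<le> (1 / 4) ^ K * (S * ?q1) * ?q1" unfolding S_def by (intro cSup_least) (auto simp: SV_def)
    also have "\<dots> = S * ((1 / 4) ^ K * ?q1\<^sup>2)" by (simp add: power2_eq_square)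
    finally have S1: "S \<le> S * ((1 / 4) ^ K * ?q1\<^sup>2)" .
    have "?q1\<^sup>2 < 4 ^ K"
    proof -
      have "(exp (real k * A'))\<^sup>2 = exp (2 * A') ^ k" by (simp add: exp_of_nat_mult[symmetric] power2_eq_square exp_add[symmetric] algebra_simps)
      then have "?q1\<^sup>2 = (A' ^ 4) ^ ee * exp (2 * A') ^ k"
        by (simp add: power_mult_distrib power_mult[symmetric] mult.commute)
      also have "\<dots> \<le> (A' ^ 4 * exp (2 * A')) ^ ee * (A' ^ 4 * exp (2 * A')) ^ k"
      proof (intro mult_mono power_mono)
        have e1: "1 \<le> exp (2 * A')" using A'1 by simp
        have a1: "1 \<le> A' ^ 4" using A'1 by simp
        show "A' ^ 4 \<le> A' ^ 4 * exp (2 * A')" using mult_left_mono[OF e1, of "A' ^ 4"] a1 by simp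
        show "exp (2 * A') \<le> A' ^ 4 * exp (2 * A')" using mult_right_mono[OF a1, of "exp (2 * A')"] by simp
      qed (use A'1 in auto)
      also have "\<dots> = (A' ^ 4 * exp (2 * A')) ^ (ee + k)" by (simp add: power_add)
      also have "\<dots> \<le> (4 ^ C1) ^ (ee + k)" using C1 A'1 by (intro power_mono) auto
      also have "\<dots> = 4 ^ (C1 * (ee + k))" by (simp add: power_mult)
      also have "\<dots> < (4::real) ^ K" using K by (intro power_strict_increasing) auto
      finally show ?thesis .
    qed
    then have "(1 / 4) ^ K * ?q1\<^sup>2 < 1" by (simp add: power_divide field_simps)
    note q_lt = this
    have "S = 0"
    proof (rule ccontr)
      assume "S \<noteq> 0"
      then have "0 < S" using S0 by simp
      from mult_strict_left_mono[OF q_lt this] S1 show False by simp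
    qed
    then have G0: "G (tt m) x = 0" if "y \<in> Y" "x \<in> W y" "m \<in> near F Cl y" for y x m
      using G_bound[OF that] by simp
    \<comment> \<open>Where no denominator vanishes, \<open>G t\<close> is determined by the \<open>G (tt m)\<close>; such points are dense.\<close>
    show "G t x = 0"
    proof (rule ccontr)
      assume Gtx: "G t x \<noteq> 0"
      have xp: "x \<in> points X" using t Opn_subset by blast
      let ?O = "{x' \<in> Opn t \<inter> nbd F tt Cl x. G t x' \<noteq> 0}"
      have "openin (topol X) ?O"
        using openin_Opn[OF t(1)] nbd_props(1)[OF cr xp] G t(1) holomorphic_fun_subset
        by (intro openin_nonzero openin_Int) blast+
      moreover have "x \<in> ?O" using t(2) nbd_props(2)[OF cr xp] Gtx by blast
      moreover have "nowhere_locally_zero (topol X) (nbd F tt Cl x) (\<lambda>x'. \<Prod>f\<in>near F Cl x. dn f x')"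
        unfolding dn_def
        by (intro nowhere_locally_zero_prod[OF nbd_props(1)[OF cr xp] finnear] near_denominators[OF cr xp])
      moreover have "?O \<subseteq> nbd F tt Cl x" by blast
      ultimately obtain x'' where x'': "x'' \<in> ?O" "(\<Prod>f\<in>near F Cl x. dn f x'') \<noteq> 0"
        unfolding nowhere_locally_zero_def by blast
      have xp'': "x'' \<in> points X" using x''(1) by (simp add: nbd_def)
      obtain m where m: "m \<in> F" "x'' \<in> Cl m" using cover(1)[OF xp''] by blast
      obtain y' where y': "y' \<in> Y" "x'' \<in> W y'" using cover(2)[OF xp''] by blast
      have m1: "m \<in> near F Cl x" using nbd_props(4)[OF cr xp _ m] x''(1) by blast
      have yp': "y' \<in> points X" using y'(1) Y(2) by blast
      have m2: "m \<in> near F Cl y'" by (rule nbd_props(4)[OF cr yp' WN[OF yp' y'(2)] m])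
      have "G (tt m) x'' = 0" by (rule G0[OF y' m2])
      moreover have "dn m x'' \<noteq> 0" using x''(2) m1 finnear by simp
      moreover have "tt m \<in> Idx" "x'' \<in> Opn (tt m)" using nbd_props(3)[OF cr xp _ m1] x''(1) by blast+
      moreover have "G t x'' * denom (DD l) (tt m) x'' ^ ee = gg l t (tt m) x'' ^ k * (denom (DD l) t x'' ^ ee * G (tt m) x'')"
        using rel t(1) x''(1) \<open>tt m \<in> Idx\<close> \<open>x'' \<in> Opn (tt m)\<close> by blast
      ultimately have "G t x'' = 0" by (simp add: dn_def del: DD_simps)
      then show False using x''(1) by blast
    qed
  qed
  have "\<forall>(\<mu>, t, w)\<in>Pts. \<mu> \<in> atlas X \<and> t \<in> Idx \<and> w \<in> snd \<mu> ` (fst \<mu> \<inter> Opn t)"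
  proof -
    have "\<mu> y \<in> atlas X \<and> tt f \<in> Idx \<and> b y \<in> snd (\<mu> y) ` (fst (\<mu> y) \<inter> Opn (tt f))"
      if y: "y \<in> Y" and f: "f \<in> near F Cl y" for y f
    proof -
      have yp: "y \<in> points X" using y Y(2) by blast
      have "v y \<in> cball (v y) (\<eta> y)" using d1(3)[OF yp] by simp
      then have "b y + 0 *s v y \<in> snd (\<mu> y) ` (fst (\<mu> y) \<inter> nbd F tt Cl y)"
        using d1(2)[OF yp] by (intro d3[OF yp]) auto
      then have "b y \<in> snd (\<mu> y) ` (fst (\<mu> y) \<inter> nbd F tt Cl y)" by simp
      then show ?thesis using nbd_props(3)[OF cr yp _ f] nearD(2)[OF f] d1(1)[OF yp] by blast
    qed
    then show ?thesis unfolding Pts_def by auto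
  qed
  note Pts_props = this
  have finPts: "finite Pts" unfolding Pts_def using Y(1) finnear by auto
  show ?thesis
  proof (rule that[OF finPts Pts_props, of C1], intro allI impI ballI)
    fix ee k K G t x
    assume a: "C1 * (ee + k) < K" "\<forall>t\<in>Idx. holomorphic_fun X (Opn t) (G t)"
      "\<forall>t\<in>Idx. \<forall>t'\<in>Idx. \<forall>x\<in>Opn t \<inter> Opn t'.
         G t x * denom (DD l) t' x ^ ee = gg l t t' x ^ k * (denom (DD l) t x ^ ee * G t' x)"
      "\<forall>(\<mu>, t, w)\<in>Pts. \<exists>b. power_series_at_0 (\<lambda>z. G t (chart_inv \<mu> (w + z))) b \<and> (\<forall>\<alpha>. wt \<alpha> < K \<longrightarrow> b \<alpha> = 0)"
      "t \<in> Idx" "x \<in> Opn t"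
    show "G t x = 0" by (rule main[of ee k K G t x, OF a])
  qed
qed

end

section \<open>Sections of all large multiples\<close>

text \<open>A cube of exponents contained in a simplex.\<close>

lemma card_wt_le:
  "(q + 1) ^ CARD('n) \<le> card {\<beta> :: (nat, 'n::finite) vec. wt \<beta> \<le> CARD('n) * q}"
proof -
  let ?P = "PiE (UNIV::'n set) (\<lambda>_. {..q})"
  have fin: "finite {\<beta> :: (nat, 'n) vec. wt \<beta> \<le> CARD('n) * q}"
  proof (rule finite_subset[OF _ finite_vec_le[of "\<chi> i. CARD('n) * q"]])
    show "{\<beta> :: (nat, 'n) vec. wt \<beta> \<le> CARD('n) * q} \<subseteq> {\<alpha>. \<forall>i. \<alpha> $ i \<le> (\<chi> i. CARD('n) * q) $ i}"
    proof safe
      fix \<beta> :: "(nat, 'n) vec" and i assume "wt \<beta> \<le> CARD('n) * q"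
      moreover have "\<beta> $ i \<le> wt \<beta>" unfolding wt_def by (intro member_le_sum) auto
      ultimately show "\<beta> $ i \<le> (\<chi> i. CARD('n) * q) $ i" by simp
    qed
  qed
  have "vec_lambda ` ?P \<subseteq> {\<beta> :: (nat, 'n) vec. wt \<beta> \<le> CARD('n) * q}"
  proof (rule image_subsetI)
    fix g assume "g \<in> ?P"
    then have "(\<Sum>i\<in>UNIV. g i) \<le> (\<Sum>i\<in>(UNIV::'n set). q)" by (intro sum_mono) auto
    then show "vec_lambda g \<in> {\<beta> :: (nat, 'n) vec. wt \<beta> \<le> CARD('n) * q}" by (simp add: wt_def)
  qed
  then have "card (vec_lambda ` ?P) \<le> card {\<beta> :: (nat, 'n) vec. wt \<beta> \<le> CARD('n) * q}" by (rule card_mono[OF fin])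
  moreover have "card (vec_lambda ` ?P) = card ?P" by (intro card_image) (auto simp: inj_on_def vec_lambda_inject)
  moreover have "card ?P = (q + 1) ^ CARD('n)" by (simp add: card_PiE)
  ultimately show ?thesis by simp
qed

lemma card_wt_less:
  "finite {\<beta> :: (nat, 'n::finite) vec. wt \<beta> < K}" "card {\<beta> :: (nat, 'n::finite) vec. wt \<beta> < K} \<le> K ^ CARD('n)"
proof -
  let ?P = "PiE (UNIV::'n set) (\<lambda>_. {..<K})"
  have sub: "{\<beta> :: (nat, 'n) vec. wt \<beta> < K} \<subseteq> vec_lambda ` ?P"
  proof
    fix \<beta> :: "(nat, 'n) vec" assume "\<beta> \<in> {\<beta>. wt \<beta> < K}"
    moreover have "\<beta> $ i \<le> wt \<beta>" for i unfolding wt_def by (intro member_le_sum) auto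
    ultimately show "\<beta> \<in> vec_lambda ` ?P"
      by (intro image_eqI[of _ _ "vec_nth \<beta>"]) (auto intro: le_less_trans)
  qed
  have fin: "finite (vec_lambda ` ?P)" by (intro finite_imageI finite_PiE) auto
  show "finite {\<beta> :: (nat, 'n) vec. wt \<beta> < K}" using sub fin by (rule finite_subset)
  have "card {\<beta> :: (nat, 'n) vec. wt \<beta> < K} \<le> card (vec_lambda ` ?P)" by (rule card_mono[OF fin sub])
  also have "\<dots> \<le> card ?P" by (rule card_image_le) (intro finite_PiE, auto)
  also have "\<dots> = K ^ CARD('n)" by (simp add: card_PiE)
  finally show "card {\<beta> :: (nat, 'n) vec. wt \<beta> < K} \<le> K ^ CARD('n)" .
qed

text \<open>The root bound for monic polynomials, applied to \<open>p J * z\<close>, which is integral over the ring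
  generated by \<open>Y\<close> and the coefficients: multiply the relation by \<open>p J ^ (J - 1)\<close>.\<close>

lemma integral_element_bound:
  fixes z Y :: complex
  assumes rel: "(\<Sum>j\<le>J. z ^ j * Y ^ (J - j) * p j) = 0" and J: "1 \<le> J"
    and B: "1 \<le> B" "\<And>j. j \<le> J \<Longrightarrow> norm (p j) \<le> B"
  shows "norm (p J * z) \<le> real J * B ^ J * norm Y"
proof (rule ccontr)
  define X where "X = p J * z"
  assume "\<not> norm (p J * z) \<le> real J * B ^ J * norm Y"
  then have X: "real J * B ^ J * norm Y < norm X" by (simp add: X_def)
  have JB: "1 \<le> real J * B ^ J" using J B(1) mult_mono[of 1 "real J" 1 "B ^ J"] by simp
  have YX: "norm Y \<le> norm X"
    using X mult_right_mono[OF JB, of "norm Y"] by simp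
  have Xpos: "0 < norm X" using X JB by (smt (verit) mult_nonneg_nonneg norm_ge_zero)
  have "{..J} = insert J {..<J}" by auto
  then have "z ^ J * p J = - (\<Sum>j<J. z ^ j * Y ^ (J - j) * p j)"
    using rel by (simp add: add_eq_0_iff)
  then have "p J ^ (J - 1) * (z ^ J * p J) = - (\<Sum>j<J. p J ^ (J - 1) * (z ^ j * Y ^ (J - j) * p j))"
    by (simp add: sum_distrib_left)
  also have "(\<Sum>j<J. p J ^ (J - 1) * (z ^ j * Y ^ (J - j) * p j)) = (\<Sum>j<J. X ^ j * Y ^ (J - j) * (p J ^ (J - 1 - j) * p j))"
  proof (rule sum.cong[OF refl])
    fix j assume "j \<in> {..<J}"
    then have "p J ^ (J - 1) = p J ^ j * p J ^ (J - 1 - j)" by (simp add: power_add[symmetric])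
    then show "p J ^ (J - 1) * (z ^ j * Y ^ (J - j) * p j) = X ^ j * Y ^ (J - j) * (p J ^ (J - 1 - j) * p j)"
      by (simp only: X_def power_mult_distrib mult_ac)
  qed
  also have "p J ^ (J - 1) * (z ^ J * p J) = X ^ J"
    using J by (cases J) (simp_all add: X_def power_mult_distrib mult_ac)
  finally have "X ^ J = - (\<Sum>j<J. X ^ j * Y ^ (J - j) * (p J ^ (J - 1 - j) * p j))" .
  then have "norm X ^ J = norm (\<Sum>j<J. X ^ j * Y ^ (J - j) * (p J ^ (J - 1 - j) * p j))"
    by (metis norm_minus_cancel norm_power)
  also have "\<dots> \<le> (\<Sum>j<J. norm X ^ (J - 1) * norm Y * B ^ J)"
  proof (rule sum_norm_le)
    fix j assume "j \<in> {..<J}"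
    then have j: "j < J" by simp
    have "norm (p J ^ (J - 1 - j) * p j) \<le> B ^ (J - 1 - j) * B"
      unfolding norm_mult norm_power using B j by (intro mult_mono power_mono) auto
    also have "\<dots> = B ^ (J - j)" using j by (simp flip: power_Suc2 add: Suc_diff_Suc)
    also have "\<dots> \<le> B ^ J" using B(1) by (intro power_increasing) auto
    finally have 1: "norm (p J ^ (J - 1 - j) * p j) \<le> B ^ J" .
    have "norm X ^ j * norm Y ^ (J - j) = norm X ^ j * (norm Y ^ (J - 1 - j) * norm Y)"
      using j by (simp flip: power_Suc2 add: Suc_diff_Suc)
    also have "\<dots> \<le> norm X ^ j * (norm X ^ (J - 1 - j) * norm Y)"
      using YX by (intro mult_left_mono mult_right_mono power_mono) auto
    also have "\<dots> = norm X ^ (J - 1) * norm Y" using j by (simp add: power_add[symmetric] mult.assoc[symmetric])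
    finally have 2: "norm X ^ j * norm Y ^ (J - j) \<le> norm X ^ (J - 1) * norm Y" .
    show "norm (X ^ j * Y ^ (J - j) * (p J ^ (J - 1 - j) * p j)) \<le> norm X ^ (J - 1) * norm Y * B ^ J"
      unfolding norm_mult norm_power
      by (rule mult_mono[OF 2 1[unfolded norm_mult norm_power]]) (auto intro: mult_nonneg_nonneg)
  qed
  also have "\<dots> = norm X ^ (J - 1) * (real J * B ^ J * norm Y)" by simp
  also have "\<dots> < norm X ^ (J - 1) * norm X" using X Xpos by (intro mult_strict_left_mono) auto
  also have "\<dots> = norm X ^ J" using J by (cases J) (simp_all add: mult.commute)
  finally show False by simp
qed

context framed_manifold
begin

definition lead :: "('r \<Rightarrow> nat) \<Rightarrow> (('r \<Rightarrow> 'i) \<Rightarrow> 'a \<Rightarrow> complex) \<Rightarrow> (nat, 'n) vec \<Rightarrow> bool" where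
  "lead a s \<alpha> \<longleftrightarrow> s \<in> Sec a \<and> is_lead (cf a s) \<alpha>"

lemma lead_mult:
  assumes "lead a s \<alpha>" "lead b s' \<beta>"
  shows "lead (\<lambda>j. a j + b j) (\<lambda>t x. s t x * s' t x) (\<alpha> + \<beta>)"
  using assms Sec_mult[of s a s' b] cf_mult[of s a s' b] is_lead_conv(2)[of "cf a s" \<alpha> "cf b s'" \<beta>]
  by (simp add: lead_def)

lemma lead_one: "lead (\<lambda>_. 0) (\<lambda>t x. 1) 0"
  using Sec_one cf_one by (simp add: lead_def is_lead_def)

lemma lead_power: "lead a s \<alpha> \<Longrightarrow> lead (\<lambda>j. k * a j) (\<lambda>t x. s t x ^ k) (k *s \<alpha>)"
proof (induction k)
  case 0
  then show ?case using lead_one by (simp add: vector_smult_lzero)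
next
  case (Suc k)
  have "Suc k *s \<alpha> = \<alpha> + k *s \<alpha>" by (simp add: vec_eq_iff)
  then show ?case using lead_mult[OF Suc.prems Suc.IH[OF Suc.prems]] by simp
qed

lemma lead_prod:
  assumes "finite I" "\<And>i. i \<in> I \<Longrightarrow> lead (a i) (s i) (\<alpha> i)"
  shows "lead (\<lambda>j. \<Sum>i\<in>I. a i j) (\<lambda>t x. \<Prod>i\<in>I. s i t x) (\<Sum>i\<in>I. \<alpha> i)"
  using assms
proof (induction I rule: finite_induct)
  case empty then show ?case using lead_one by simp
next
  case (insert i I)
  then have "lead (a i) (s i) (\<alpha> i)" "lead (\<lambda>j. \<Sum>i\<in>I. a i j) (\<lambda>t x. \<Prod>i\<in>I. s i t x) (\<Sum>i\<in>I. \<alpha> i)" by auto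
  from lead_mult[OF this] show ?case using insert.hyps by simp
qed

text \<open>In a combination of sections with distinct leading exponents, the smallest one with nonzero
  coefficient cannot cancel.\<close>

lemma lead_independent:
  assumes "finite I" "\<And>u. u \<in> I \<Longrightarrow> lead a (s u) (\<alpha> u)" "inj_on \<alpha> I" "u0 \<in> I" "c u0 \<noteq> 0"
  shows "nz (\<lambda>t x. \<Sum>u\<in>I. c u * s u t x)"
proof -
  have s: "s u \<in> Sec a" if "u \<in> I" for u using assms(2)[OF that] by (simp add: lead_def)
  have "\<alpha> ` {u \<in> I. c u \<noteq> 0} \<noteq> {}" using assms(4,5) by blast
  from lex_min_exists[OF this] obtain v where v: "v \<in> I" "c v \<noteq> 0"
    "\<And>u. u \<in> I \<Longrightarrow> c u \<noteq> 0 \<Longrightarrow> \<alpha> u = \<alpha> v \<or> lex_less (\<alpha> v) (\<alpha> u)" by auto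
  have zero: "c u * cf a (s u) (\<alpha> v) = 0" if u: "u \<in> I" "u \<noteq> v" for u
  proof (rule ccontr)
    assume nzero: "c u * cf a (s u) (\<alpha> v) \<noteq> 0"
    then have "\<alpha> v = \<alpha> u \<or> lex_less (\<alpha> u) (\<alpha> v)" using assms(2)[OF u(1)] by (auto simp: lead_def is_lead_def)
    moreover have "\<alpha> u \<noteq> \<alpha> v" using inj_onD[OF assms(3) _ u(1) v(1)] u(2) by blast
    moreover have "\<alpha> u = \<alpha> v \<or> lex_less (\<alpha> v) (\<alpha> u)" using v(3)[OF u(1)] nzero by simp
    ultimately show False using lex_less_irrefl lex_less_trans by metis
  qed
  have "cf a (\<lambda>t x. \<Sum>u\<in>I. c u * s u t x) (\<alpha> v) = (\<Sum>u\<in>I. c u * cf a (s u) (\<alpha> v))"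
    using cf_sum[OF assms(1), of s a c] s by simp
  also have "\<dots> = (\<Sum>u\<in>{v}. c u * cf a (s u) (\<alpha> v))"
    using zero v(1) assms(1) by (intro sum.mono_neutral_right) auto
  also have "\<dots> \<noteq> 0" using v assms(2)[OF v(1)] by (simp add: lead_def is_lead_def)
  finally have "cf a (\<lambda>t x. \<Sum>u\<in>I. c u * s u t x) \<noteq> (\<lambda>_. 0)" by auto
  moreover have "(\<lambda>t x. \<Sum>u\<in>I. c u * s u t x) \<in> Sec a" using s by (rule Sec_sum)
  ultimately show ?thesis using cf_zero_iff by blast
qed

end

context manifold_divisors
begin

text \<open>Here \<open>numer / denom\<close> is the tautological meromorphic section of the bundle of \<open>l\<close>.  Its product
  with \<open>P\<close> is locally bounded, hence extends holomorphically on each open set of the cover, and the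
  cocycle condition holds where the denominators do not vanish, hence everywhere.\<close>

lemma bounded_quotient_section:
  assumes P: "P \<in> Sec a" "nz P"
    and bd: "\<And>t x. t \<in> Idx \<Longrightarrow> x \<in> Opn t \<Longrightarrow> \<exists>W B. openin (topol X) W \<and> x \<in> W \<and> W \<subseteq> Opn t \<and>
      (\<forall>y\<in>W. norm (P t y * numer (DD l) t y) \<le> B * norm (denom (DD l) t y))"
  shows "\<exists>Q\<in>Sec (\<lambda>j. a j + l j). nz Q"
proof -
  define local_ext where "local_ext t N q \<longleftrightarrow> openin (topol X) N \<and> N \<subseteq> Opn t \<and> holomorphic_fun X N q \<and>
      (\<forall>y\<in>N. q y * denom (DD l) t y = P t y * numer (DD l) t y)" for t N q
  have ex: "\<exists>N q. x \<in> N \<and> local_ext t N q" if t: "t \<in> Idx" and x: "x \<in> Opn t" for t x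
  proof -
    obtain W B where W: "openin (topol X) W" "x \<in> W" "W \<subseteq> Opn t"
      "\<And>y. y \<in> W \<Longrightarrow> norm (P t y * numer (DD l) t y) \<le> B * norm (denom (DD l) t y)"
      using bd[OF t x] by blast
    have "x \<in> points X" using x Opn_subset[OF t] by blast
    then obtain \<mu> where \<mu>: "\<mu> \<in> atlas X" "x \<in> fst \<mu>" by (rule atlas_cover)
    note ch = atlas_chart[OF \<mu>(1)]
    let ?U = "snd \<mu> ` (fst \<mu> \<inter> W)"
    have U: "open ?U" by (rule chart_on_open_image[OF ch W(1)])
    have z0: "snd \<mu> x \<in> ?U" using \<mu>(2) W(2) by blast
    have hW: "holomorphic_fun X W f \<Longrightarrow> (\<lambda>w. f (chart_inv \<mu> w)) mholomorphic_on ?U" for f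
      using \<mu>(1) unfolding holomorphic_fun_def by blast
    have PW: "holomorphic_fun X W (\<lambda>y. P t y * numer (DD l) t y)"
      using Sec_hol_at[OF P(1) t] numer_denom(1)[OF t, of l] W(3) unfolding holomorphic_fun_iff
      by (intro ballI hol_at_mult) blast+
    have dW: "holomorphic_fun X W (denom (DD l) t)" by (rule holomorphic_fun_subset[OF numer_denom(2)[OF t] W(3)])
    have nW: "nowhere_locally_zero (topol X) W (denom (DD l) t)" by (rule nowhere_locally_zero_subset[OF numer_denom(4)[OF t] W(3)])
    have "\<exists>V G. open V \<and> snd \<mu> x \<in> V \<and> V \<subseteq> ?U \<and> G mholomorphic_on V \<and>
       (\<forall>z\<in>V. G z * denom (DD l) t (chart_inv \<mu> z) = P t (chart_inv \<mu> z) * numer (DD l) t (chart_inv \<mu> z))"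
    proof (rule Riemann_extension_local[OF U z0 hW[OF PW] hW[OF dW]])
      show "\<exists>z\<in>V. denom (DD l) t (chart_inv \<mu> z) \<noteq> 0" if "open V" "snd \<mu> x \<in> V" for V
        by (rule nowhere_locally_zero_chart[OF \<mu> W(1,2) nW that])
      fix z assume "z \<in> ?U"
      then obtain y where "y \<in> fst \<mu>" "y \<in> W" "z = snd \<mu> y" by blast
      then show "norm (P t (chart_inv \<mu> z) * numer (DD l) t (chart_inv \<mu> z)) \<le> B * norm (denom (DD l) t (chart_inv \<mu> z))"
        using W(4)[of y] chart_inv_chart[OF ch] by (simp del: DD_simps)
    qed
    then obtain V G where V: "open V" "snd \<mu> x \<in> V" "V \<subseteq> ?U" "G mholomorphic_on V"
       "\<And>z. z \<in> V \<Longrightarrow> G z * denom (DD l) t (chart_inv \<mu> z) = P t (chart_inv \<mu> z) * numer (DD l) t (chart_inv \<mu> z)"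
      by blast
    let ?N = "{y \<in> fst \<mu>. snd \<mu> y \<in> V}"
    have "openin (topol X) ?N" by (rule chart_on_open_vimage[OF ch V(1)])
    moreover have "?N \<subseteq> Opn t"
    proof
      fix y assume y: "y \<in> ?N"
      then obtain y' where "y' \<in> fst \<mu> \<inter> W" "snd \<mu> y = snd \<mu> y'" using V(3) by blast
      then show "y \<in> Opn t" using inj_onD[OF chart_on_inj[OF ch], of y y'] y W(3) by auto
    qed
    moreover have "holomorphic_fun X ?N (\<lambda>y. G (snd \<mu> y))"
      unfolding holomorphic_fun_iff
    proof
      fix y assume y: "y \<in> ?N"
      have "cdiff G (snd \<mu> y)" using V(4) y unfolding mholomorphic_on_iff_cdiff by blast
      then have "cdiff (\<lambda>w. G (snd \<mu> (chart_inv \<mu> w))) (snd \<mu> y)"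
      proof (rule cdiff_transform[OF _ V(1)])
        show "snd \<mu> y \<in> V" using y by blast
        fix w assume "w \<in> V"
        then obtain y' where "y' \<in> fst \<mu>" "w = snd \<mu> y'" using V(3) by blast
        then show "G w = G (snd \<mu> (chart_inv \<mu> w))" using chart_inv_chart[OF ch] by simp
      qed
      then show "hol_at X (\<lambda>y. G (snd \<mu> y)) y"
        using y atlas_transition[OF _ \<mu>(1)] by (intro hol_at_chart[OF ch]) auto
    qed
    moreover have "\<forall>y\<in>?N. G (snd \<mu> y) * denom (DD l) t y = P t y * numer (DD l) t y"
    proof
      fix y assume "y \<in> ?N"
      then show "G (snd \<mu> y) * denom (DD l) t y = P t y * numer (DD l) t y"
        using V(5)[of "snd \<mu> y"] chart_inv_chart[OF ch] by (simp del: DD_simps)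
    qed
    ultimately have "local_ext t ?N (\<lambda>y. G (snd \<mu> y))" unfolding local_ext_def by blast
    moreover have "x \<in> ?N" using \<mu>(2) V(2) by simp
    ultimately show ?thesis by (intro exI conjI)
  qed
  have uniq: "q y = q' y" if t: "t \<in> Idx" and l: "local_ext t N q" "local_ext t N' q'" and y: "y \<in> N" "y \<in> N'" for t N q N' q' y
  proof -
    have "q y - q' y = 0"
    proof (rule eq_zero_if_mult_zero[of "N \<inter> N'" "\<lambda>y. q y - q' y" "denom (DD l) t"])
      show "openin (topol X) (N \<inter> N')" using l by (auto simp: local_ext_def)
      show "holomorphic_fun X (N \<inter> N') (\<lambda>y. q y - q' y)"
        using l holomorphic_fun_subset by (intro holomorphic_fun_diff) (auto simp: local_ext_def)
      show "nowhere_locally_zero (topol X) (N \<inter> N') (denom (DD l) t)"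
        using l by (intro nowhere_locally_zero_subset[OF numer_denom(4)[OF t]]) (auto simp: local_ext_def)
      fix z assume "z \<in> N \<inter> N'"
      then have "q z * denom (DD l) t z = q' z * denom (DD l) t z" using l unfolding local_ext_def by auto
      then show "(q z - q' z) * denom (DD l) t z = 0" by (simp only: left_diff_distrib) simp
    qed (use y in blast)
    then show ?thesis by simp
  qed
  define Q where "Q t x = (SOME v. \<exists>N q. x \<in> N \<and> local_ext t N q \<and> v = q x)" for t x
  have Q: "Q t y = q y" if t: "t \<in> Idx" and l: "local_ext t N q" "y \<in> N" for t N q y
  proof -
    have "\<exists>N q. y \<in> N \<and> local_ext t N q \<and> Q t y = q y"
      unfolding Q_def by (rule someI_ex) (use l in blast)
    then show ?thesis using uniq[OF t] l by metis
  qed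
  have Qhol: "hol_at X (Q t) x" if tx: "t \<in> Idx" "x \<in> Opn t" for t x
  proof -
    obtain N q where N: "x \<in> N" "local_ext t N q" using ex[OF tx] by blast
    then have "hol_at X q x" "openin (topol X) N" unfolding local_ext_def holomorphic_fun_iff by blast+
    then show ?thesis using N(1) by (rule hol_at_transform) (rule Q[OF tx(1) N(2), symmetric])
  qed
  have Qeq: "Q t x * denom (DD l) t x = P t x * numer (DD l) t x" if tx: "t \<in> Idx" "x \<in> Opn t" for t x
  proof -
    obtain N q where N: "x \<in> N" "local_ext t N q" using ex[OF tx] by blast
    then have "q x * denom (DD l) t x = P t x * numer (DD l) t x" unfolding local_ext_def by blast
    then show ?thesis unfolding Q[OF tx(1) N(2,1)] .
  qed
  have "Q \<in> Sec (\<lambda>j. a j + l j)"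
  proof (rule SecI)
    show "hol_at X (Q t) x" if "t \<in> Idx" "x \<in> Opn t" for t x by (rule Qhol[OF that])
    fix t t' x assume t: "t \<in> Idx" "t' \<in> Idx" and x: "x \<in> Opn t" "x \<in> Opn t'"
    let ?O = "Opn t \<inter> Opn t'"
    let ?g = "gg (\<lambda>j. a j + l j) t t'"
    let ?d = "\<lambda>y. denom (DD l) t y * denom (DD l) t' y"
    have "Q t x - ?g x * Q t' x = 0"
    proof (rule eq_zero_if_mult_zero[of ?O "\<lambda>y. Q t y - ?g y * Q t' y" ?d])
      show O: "openin (topol X) ?O" using openin_Opn t by blast
      show "holomorphic_fun X ?O (\<lambda>y. Q t y - ?g y * Q t' y)"
      proof (rule holomorphic_fun_diff)
        show "holomorphic_fun X ?O (Q t)" using Qhol[OF t(1)] unfolding holomorphic_fun_iff by blast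
        show "holomorphic_fun X ?O (\<lambda>y. ?g y * Q t' y)" unfolding holomorphic_fun_iff
          using Qhol[OF t(2)] hol_at_gg[OF t] by (intro ballI hol_at_mult) blast+
      qed
      show "nowhere_locally_zero (topol X) ?O ?d"
        using numer_denom(2,4)[OF t(1), of l] numer_denom(4)[OF t(2), of l]
        by (intro nowhere_locally_zero_mult[OF O]) (blast intro: nowhere_locally_zero_subset holomorphic_fun_subset)+
      fix y assume y: "y \<in> ?O"
      let ?n = "numer (DD l)" and ?e = "denom (DD l)"
      have tr: "?n t y * ?e t' y = gg l t t' y * (?n t' y * ?e t y)"
        using is_transition_DD[OF t, of l] y unfolding is_transition_def by (simp del: DD_simps(3,4))
      have q1: "Q t y * ?e t y = P t y * ?n t y" "Q t' y * ?e t' y = P t' y * ?n t' y" using Qeq t y by blast+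
      have p: "P t y = gg a t t' y * P t' y" using SecD(2)[OF P(1) t] y by blast
      have "Q t y * (?e t y * ?e t' y) = P t y * (?n t y * ?e t' y)"
        using q1(1) by (simp only: mult.assoc[symmetric])
      also have "\<dots> = (gg a t t' y * gg l t t' y) * (P t' y * ?n t' y) * ?e t y" unfolding tr p by (simp only: mult_ac)
      also have "\<dots> = ?g y * Q t' y * (?e t y * ?e t' y)" unfolding q1(2)[symmetric] gg_add by (simp only: mult_ac)
      finally show "(Q t y - ?g y * Q t' y) * (?e t y * ?e t' y) = 0" by (simp only: left_diff_distrib) simp
    qed (use x in blast)
    then show "Q t x = ?g x * Q t' x" by simp
  qed
  moreover have "nz Q"
  proof (rule ccontr)
    assume "\<not> nz Q"
    then have Q0: "Q t x = 0" if "t \<in> Idx" "x \<in> Opn t" for t x using that unfolding nz_def by blast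
    have "P t x = 0" if t: "t \<in> Idx" and x: "x \<in> Opn t" for t x
    proof (rule eq_zero_if_mult_zero[OF openin_Opn[OF t] SecD(1)[OF P(1) t] numer_denom(3)[OF t, of l] _ x])
      fix y assume "y \<in> Opn t"
      then show "P t y * numer (DD l) t y = 0" using Qeq[OF t, of y] Q0[OF t, of y] by (simp del: DD_simps)
    qed
    then show False using P(2) unfolding nz_def by blast
  qed
  ultimately show ?thesis by blast
qed

end

context framed_manifold
begin

text \<open>Monomials of degree \<open>d\<close> in \<open>n + 1\<close> sections, homogeneous in the sense that the exponent of \<open>T None\<close> is
  determined by those of the others.\<close>

definition mon :: "('n option \<Rightarrow> ('r \<Rightarrow> 'i) \<Rightarrow> 'a \<Rightarrow> complex) \<Rightarrow> nat \<Rightarrow> (nat, 'n) vec \<Rightarrow> ('r \<Rightarrow> 'i) \<Rightarrow> 'a \<Rightarrow> complex" where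
  "mon T d \<beta> t x = T None t x ^ (d - wt \<beta>) * (\<Prod>i\<in>UNIV. T (Some i) t x ^ (\<beta> $ i))"

lemma lead_mon:
  assumes T: "lead b (T None) \<alpha>" "\<And>i. lead b (T (Some i)) (\<alpha> + axis i m)" and \<beta>: "wt \<beta> \<le> d"
  shows "lead (\<lambda>j. d * b j) (mon T d \<beta>) (d *s \<alpha> + m *s \<beta>)"
proof -
  have "lead (\<lambda>j. (d - wt \<beta>) * b j + (\<Sum>i\<in>UNIV. (\<beta> $ i) * b j)) (\<lambda>t x. T None t x ^ (d - wt \<beta>) * (\<Prod>i\<in>UNIV. T (Some i) t x ^ (\<beta> $ i)))
    ((d - wt \<beta>) *s \<alpha> + (\<Sum>i\<in>UNIV. (\<beta> $ i) *s (\<alpha> + axis i m)))"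
    by (intro lead_mult lead_power[OF T(1)] lead_prod lead_power[OF T(2)]) simp
  moreover have "(d - wt \<beta>) * b j + (\<Sum>i\<in>UNIV. (\<beta> $ i) * b j) = d * b j" for j
    using \<beta> by (simp add: wt_def flip: sum_distrib_right distrib_right)
  moreover have "(d - wt \<beta>) *s \<alpha> + (\<Sum>i\<in>UNIV. (\<beta> $ i) *s (\<alpha> + axis i m)) = d *s \<alpha> + m *s \<beta>"
  proof (rule vec_eq_iff[THEN iffD2], intro allI)
    fix k
    have "(\<Sum>i\<in>UNIV. (\<beta> $ i) * (if k = i then m else 0)) = m * \<beta> $ k" by (simp add: if_distrib sum.delta' cong: if_cong)
    then have "((d - wt \<beta>) *s \<alpha> + (\<Sum>i\<in>UNIV. (\<beta> $ i) *s (\<alpha> + axis i m))) $ k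
        = (d - wt \<beta>) * \<alpha> $ k + wt \<beta> * \<alpha> $ k + m * \<beta> $ k"
      by (simp add: axis_def distrib_left sum.distrib wt_def sum_distrib_right)
    also have "\<dots> = (d *s \<alpha> + m *s \<beta>) $ k" using \<beta> by (simp flip: distrib_right)
    finally show "((d - wt \<beta>) *s \<alpha> + (\<Sum>i\<in>UNIV. (\<beta> $ i) *s (\<alpha> + axis i m))) $ k = (d *s \<alpha> + m *s \<beta>) $ k" .
  qed
  ultimately show ?thesis by (simp add: mon_def[abs_def])
qed

text \<open>The product of \<open>P\<close> with \<open>(numer / denom) ^ (M * j)\<close>, multiplied by the common denominator
  \<open>denom ^ (M * N)\<close>.\<close>

definition twist :: "('r \<Rightarrow> nat) \<Rightarrow> nat \<Rightarrow> nat \<Rightarrow> nat \<Rightarrow> (('r \<Rightarrow> 'i) \<Rightarrow> 'a \<Rightarrow> complex) \<Rightarrow> ('r \<Rightarrow> 'i) \<Rightarrow> 'a \<Rightarrow> complex" where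
  "twist l M N j P t x = numer (DD l) t x ^ (M * j) * denom (DD l) t x ^ (M * (N - j)) * P t x"

lemma twist_holomorphic:
  assumes "P \<in> Sec a" "t \<in> Idx"
  shows "holomorphic_fun X (Opn t) (twist l M N j P t)"
  using SecD(1)[OF assms] numer_denom(1,2)[OF assms(2), of l] unfolding holomorphic_fun_iff twist_def[abs_def]
  by (intro ballI hol_at_mult hol_at_power) blast+

lemma twist_transition:
  assumes P: "P \<in> Sec (\<lambda>r. (2 * N - j) * (M * l r))" and j: "j \<le> N"
    and t: "t \<in> Idx" "t' \<in> Idx" and x: "x \<in> Opn t" "x \<in> Opn t'"
  shows "twist l M N j P t x * denom (DD l) t' x ^ (M * N)
    = gg l t t' x ^ (2 * N * M) * (denom (DD l) t x ^ (M * N) * twist l M N j P t' x)"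
proof -
  have tr: "numer (DD l) t x * denom (DD l) t' x = gg l t t' x * (numer (DD l) t' x * denom (DD l) t x)"
    using is_transition_DD[OF t, of l] x unfolding is_transition_def by (simp del: DD_simps(3,4))
  have p: "P t x = gg l t t' x ^ ((2 * N - j) * M) * P t' x"
    using SecD(2)[OF P t x] gg_mult[of "(2 * N - j) * M" l t t' x] by (simp add: mult.assoc)
  define n d n' d' g where defs: "n = numer (DD l) t x" "d = denom (DD l) t x" "n' = numer (DD l) t' x"
    "d' = denom (DD l) t' x" "g = gg l t t' x"
  have MN: "M * N = M * j + M * (N - j)" using j by (simp flip: distrib_left)
  have k: "2 * N * M = M * j + (2 * N - j) * M" using j by (simp add: mult.commute flip: distrib_left)
  have 1: "n ^ (M * j) * d' ^ (M * j) = g ^ (M * j) * (n' ^ (M * j) * d ^ (M * j))"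
    using tr unfolding defs by (simp only: power_mult_distrib[symmetric])
  have "n ^ (M * j) * d ^ (M * (N - j)) * P t x * d' ^ (M * N)
    = (n ^ (M * j) * d' ^ (M * j)) * (d ^ (M * (N - j)) * d' ^ (M * (N - j)) * P t x)"
    unfolding MN power_add by (simp only: mult_ac)
  also have "\<dots> = g ^ (2 * N * M) * (d ^ (M * N) * (n' ^ (M * j) * d' ^ (M * (N - j)) * P t' x))"
    unfolding 1 k p MN power_add defs(5)[symmetric] by (simp only: mult_ac)
  finally show ?thesis unfolding twist_def defs .
qed

text \<open>The relation is a polynomial equation for \<open>\<sigma>\<^sup>M\<close> with \<open>\<sigma> = numer / denom\<close>, whose coefficients are
  sections.  If \<open>J\<close> is its degree, \<open>P J * \<sigma>\<^sup>M\<close> is locally bounded, and since \<open>P J\<close> is so as well, the same holds for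
  the \<open>M\<close>-th power of \<open>P J * \<sigma>\<close>.\<close>

lemma section_from_relation:
  assumes M: "1 \<le> M" and P: "\<And>j. j \<le> N \<Longrightarrow> P j \<in> Sec (\<lambda>r. (2 * N - j) * (M * l r))"
    and j0: "j0 \<le> N" "nz (P j0)"
    and rel: "\<And>t x. t \<in> Idx \<Longrightarrow> x \<in> Opn t \<Longrightarrow> (\<Sum>j\<le>N. twist l M N j (P j) t x) = 0"
  shows "\<exists>K s. s \<in> Sec (\<lambda>r. (K * M + 1) * l r) \<and> nz s"
proof -
  \<comment> \<open>The degree of the relation.\<close>
  define J where "J = Max {j. j \<le> N \<and> nz (P j)}"
  have fin: "finite {j. j \<le> N \<and> nz (P j)}" by simp
  have "J \<in> {j. j \<le> N \<and> nz (P j)}" unfolding J_def using fin j0 by (intro Max_in) blast+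
  then have J: "J \<le> N" "nz (P J)" by auto
  have above: "P j t x = 0" if "j \<le> N" "J < j" "t \<in> Idx" "x \<in> Opn t" for j t x
  proof (rule ccontr)
    assume "P j t x \<noteq> 0"
    then have "j \<in> {j. j \<le> N \<and> nz (P j)}" using that unfolding nz_def by blast
    then have "j \<le> J" unfolding J_def using fin by (rule Max_ge[rotated])
    then show False using that by simp
  qed
  have relJ: "(\<Sum>j\<le>J. (numer (DD l) t x ^ M) ^ j * (denom (DD l) t x ^ M) ^ (J - j) * P j t x) = 0"
    if t: "t \<in> Idx" and x: "x \<in> Opn t" for t x
  proof (rule eq_zero_if_mult_zero[OF openin_Opn[OF t] _ _ _ x, where g = "\<lambda>x. denom (DD l) t x ^ (M * (N - J))"])
    show "holomorphic_fun X (Opn t) (\<lambda>x. \<Sum>j\<le>J. (numer (DD l) t x ^ M) ^ j * (denom (DD l) t x ^ M) ^ (J - j) * P j t x)"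
      unfolding holomorphic_fun_iff
    proof (intro ballI hol_at_sum hol_at_mult hol_at_power)
      fix y j assume y: "y \<in> Opn t" and "j \<in> {..J}"
      then show "hol_at X (P j t) y" using J(1) by (intro Sec_hol_at[OF P] t) auto
      show "hol_at X (numer (DD l) t) y" "hol_at X (denom (DD l) t) y"
        using numer_denom(1,2)[OF t, of l] y unfolding holomorphic_fun_iff by blast+
    qed
    show "nowhere_locally_zero (topol X) (Opn t) (\<lambda>x. denom (DD l) t x ^ (M * (N - J)))"
      by (rule nowhere_locally_zero_power[OF openin_Opn[OF t] numer_denom(2,4)[OF t]])
    fix y assume y: "y \<in> Opn t"
    have "(\<Sum>j\<le>J. (numer (DD l) t y ^ M) ^ j * (denom (DD l) t y ^ M) ^ (J - j) * P j t y) * denom (DD l) t y ^ (M * (N - J))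
      = (\<Sum>j\<le>J. twist l M N j (P j) t y)"
      unfolding sum_distrib_right
    proof (rule sum.cong[OF refl])
      fix j assume "j \<in> {..J}"
      then have e: "N - j = (J - j) + (N - J)" using J(1) by simp
      have "denom (DD l) t y ^ (M * (N - j)) = (denom (DD l) t y ^ M) ^ (J - j) * denom (DD l) t y ^ (M * (N - J))"
        unfolding e distrib_left power_add power_mult ..
      then show "(numer (DD l) t y ^ M) ^ j * (denom (DD l) t y ^ M) ^ (J - j) * P j t y * denom (DD l) t y ^ (M * (N - J))
         = twist l M N j (P j) t y"
        unfolding twist_def power_mult[of _ M j] by (simp only: mult_ac)
    qed
    also have "\<dots> = (\<Sum>j\<le>N. twist l M N j (P j) t y)"
      using J(1) above[OF _ _ t y] by (intro sum.mono_neutral_left) (auto simp: twist_def simp del: DD_simps)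
    finally show "(\<Sum>j\<le>J. (numer (DD l) t y ^ M) ^ j * (denom (DD l) t y ^ M) ^ (J - j) * P j t y) * denom (DD l) t y ^ (M * (N - J)) = 0"
      unfolding rel[OF t y] .
  qed
  have J1: "1 \<le> J"
  proof (rule ccontr)
    assume "\<not> 1 \<le> J"
    then have J0: "J = 0" by simp
    then have "P J t x = 0" if "t \<in> Idx" "x \<in> Opn t" for t x using relJ[OF that] by simp
    then show False using J(2) unfolding nz_def by blast
  qed
  have "\<exists>s\<in>Sec (\<lambda>r. (2 * N - J) * (M * l r) + l r). nz s"
  proof (rule bounded_quotient_section[OF P[OF J(1)] J(2)])
    fix t x assume t: "t \<in> Idx" and x: "x \<in> Opn t"
    \<comment> \<open>By continuity each \<open>P j\<close> is bounded by \<open>B\<close> on the neighborhood \<open>W\<close> of \<open>x\<close>.\<close>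
    define B where "B = 1 + (\<Sum>j\<le>J. norm (P j t x) + 1)"
    define W where "W = (\<Inter>j\<in>{..J}. {y \<in> Opn t. P j t y \<in> ball 0 (norm (P j t x) + 1)})"
    have B1: "1 \<le> B" unfolding B_def by (simp add: sum_nonneg)
    have "openin (topol X) W" unfolding W_def
    proof (intro openin_INT2 openin_holomorphic_preimage openin_Opn t)
      show "holomorphic_fun X (Opn t) (P j t)" if "j \<in> {..J}" for j
        using that J(1) by (intro SecD(1)[OF P] t) simp
    qed auto
    moreover have "x \<in> W" using x by (auto simp: W_def)
    moreover have "W \<subseteq> Opn t" by (auto simp: W_def)
    moreover have "norm (P J t y * numer (DD l) t y) \<le> (B ^ (M - 1) * (real J * B ^ J)) * norm (denom (DD l) t y)" if y: "y \<in> W" for y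
    proof -
      have yO: "y \<in> Opn t" using y by (auto simp: W_def)
      have PB: "norm (P j t y) \<le> B" if "j \<le> J" for j
      proof -
        have "norm (P j t y) \<le> norm (P j t x) + 1" using y that by (auto simp: W_def less_imp_le)
        also have "\<dots> \<le> (\<Sum>j\<le>J. norm (P j t x) + 1)" using that by (intro member_le_sum) auto
        finally show ?thesis unfolding B_def by simp
      qed
      have JB: "1 \<le> real J * B ^ J" using J1 B1 mult_mono[of 1 "real J" 1 "B ^ J"] by simp
      have C1: "1 \<le> B ^ (M - 1) * (real J * B ^ J)"
        using mult_mono[of 1 "B ^ (M - 1)" 1 "real J * B ^ J"] B1 JB by simp
      have 1: "norm (P J t y * numer (DD l) t y ^ M) \<le> real J * B ^ J * norm (denom (DD l) t y ^ M)"
        using relJ[OF t yO] J1 B1 PB by (rule integral_element_bound)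
      have "norm (P J t y * numer (DD l) t y) ^ M = norm (P J t y) ^ (M - 1) * norm (P J t y * numer (DD l) t y ^ M)"
        using M by (cases M) (simp_all add: norm_mult norm_power power_mult_distrib mult_ac del: DD_simps)
      also have "\<dots> \<le> B ^ (M - 1) * (real J * B ^ J * norm (denom (DD l) t y ^ M))"
        using 1 PB[of J] B1 by (intro mult_mono power_mono) auto
      also have "\<dots> = (B ^ (M - 1) * (real J * B ^ J)) * norm (denom (DD l) t y) ^ M"
        by (simp add: norm_power mult_ac del: DD_simps)
      also have "\<dots> \<le> (B ^ (M - 1) * (real J * B ^ J)) ^ M * norm (denom (DD l) t y) ^ M"
        using C1 M power_increasing[of 1 M "B ^ (M - 1) * (real J * B ^ J)"] by (intro mult_right_mono) (auto simp del: DD_simps)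
      also have "\<dots> = ((B ^ (M - 1) * (real J * B ^ J)) * norm (denom (DD l) t y)) ^ M" by (simp only: power_mult_distrib)
      finally have "norm (P J t y * numer (DD l) t y) ^ Suc (M - 1)
        \<le> ((B ^ (M - 1) * (real J * B ^ J)) * norm (denom (DD l) t y)) ^ Suc (M - 1)" using M by simp
      then show ?thesis
        by (rule power_le_imp_le_base) (rule mult_nonneg_nonneg, use C1 in linarith, rule norm_ge_zero)
    qed
    ultimately show "\<exists>W B. openin (topol X) W \<and> x \<in> W \<and> W \<subseteq> Opn t \<and>
      (\<forall>y\<in>W. norm (P J t y * numer (DD l) t y) \<le> B * norm (denom (DD l) t y))"
      by (intro exI[of _ W] exI[of _ "B ^ (M - 1) * (real J * B ^ J)"]) blast
  qed
  moreover have "(\<lambda>r. (2 * N - J) * (M * l r) + l r) = (\<lambda>r. ((2 * N - J) * M + 1) * l r)"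
    by (simp add: fun_eq_iff algebra_simps)
  ultimately show ?thesis by metis
qed

end

context metrized_manifold
begin

text \<open>Siegel's counting argument.  The unknowns are the coefficients of the monomials of degree
  \<open>2 * N - j\<close> in the given sections, multiplied with \<open>(numer / denom) ^ (M * j)\<close> for \<open>j \<le> N\<close>; all of
  these products are sections of the bundle of \<open>2 * N * M * l\<close>.  Their number grows like \<open>N ^ (n + 1)\<close>, but
  vanishing to order \<open>K = O(N)\<close> at a fixed set of points imposes only \<open>O(N ^ n)\<close> conditions.\<close>

lemma relation_exists:
  assumes M: "1 \<le> M" and m: "1 \<le> m"
    and T: "lead (\<lambda>r. M * l r) (T None) \<alpha>0" "\<And>i. lead (\<lambda>r. M * l r) (T (Some i)) (\<alpha>0 + axis i m)"
  shows "\<exists>N P j0. (\<forall>j\<le>N. P j \<in> Sec (\<lambda>r. (2 * N - j) * (M * l r))) \<and> j0 \<le> N \<and> nz (P j0) \<and>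
    (\<forall>t\<in>Idx. \<forall>x\<in>Opn t. (\<Sum>j\<le>N. twist l M N j (P j) t x) = 0)"
proof -
  obtain Pts :: "(('a, 'n) chart \<times> ('r \<Rightarrow> 'i) \<times> (complex, 'n) vec) set" and C1 :: nat
    where Pts: "finite Pts" "\<forall>(\<mu>, t, w)\<in>Pts. \<mu> \<in> atlas X \<and> t \<in> Idx \<and> w \<in> snd \<mu> ` (fst \<mu> \<inter> Opn t)"
    and vanish: "\<forall>ee k K G. C1 * (ee + k) < K \<longrightarrow> (\<forall>t\<in>Idx. holomorphic_fun X (Opn t) (G t)) \<longrightarrow>
      (\<forall>t\<in>Idx. \<forall>t'\<in>Idx. \<forall>x\<in>Opn t \<inter> Opn t'.
         G t x * denom (DD l) t' x ^ ee = gg l t t' x ^ k * (denom (DD l) t x ^ ee * G t' x)) \<longrightarrow>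
      (\<forall>(\<mu>, t, w)\<in>Pts. \<exists>b. power_series_at_0 (\<lambda>z. G t (chart_inv \<mu> (w + z))) b \<and> (\<forall>\<alpha>. wt \<alpha> < K \<longrightarrow> b \<alpha> = 0)) \<longrightarrow>
      (\<forall>t\<in>Idx. \<forall>x\<in>Opn t. G t x = 0)"
    by (rule Schwarz_vanishing[of l])
  define n where "n = CARD('n)"
  \<comment> \<open>The constants are chosen such that \<open>K \<le> c0 * (q + 1)\<close>, while \<open>N\<close> is at least the number of points
    times \<open>c0 ^ n\<close>.\<close>
  define c0 where "c0 = 3 * C1 * M * n + 1"
  define q where "q = card Pts * c0 ^ n"
  define N where "N = n * q"
  define K where "K = C1 * (M * N + 2 * N * M) + 1"
  have n1: "1 \<le> n" by (simp add: n_def Suc_le_eq)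
  have qN: "q \<le> N" using n1 by (simp add: N_def)
  have Kle: "K \<le> c0 * (q + 1)" by (simp add: K_def c0_def N_def algebra_simps)
  define B where "B j = {\<beta> :: (nat, 'n) vec. wt \<beta> \<le> 2 * N - j}" for j
  have finB: "finite (B j)" for j
    by (rule finite_subset[OF _ card_wt_less(1)[of "Suc (2 * N - j)"]]) (auto simp: B_def)
  have cardB: "(q + 1) ^ n \<le> card (B j)" if "j \<le> N" for j
  proof -
    have "(q + 1) ^ n \<le> card {\<beta> :: (nat, 'n) vec. wt \<beta> \<le> CARD('n) * q}" unfolding n_def by (rule card_wt_le)
    also have "\<dots> \<le> card (B j)" by (rule card_mono[OF finB]) (use that in \<open>auto simp: B_def N_def n_def\<close>)
    finally show ?thesis .
  qed
  define U where "U = Sigma {..N} B"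
  define E where "E = Pts \<times> {\<alpha> :: (nat, 'n) vec. wt \<alpha> < K}"
  have finU: "finite U" unfolding U_def using finB by (intro finite_SigmaI) auto
  have finE: "finite E" unfolding E_def using Pts(1) card_wt_less(1) by (rule finite_cartesian_product)
  have "card E \<le> card Pts * K ^ n"
    unfolding E_def card_cartesian_product n_def by (rule mult_left_mono[OF card_wt_less(2)]) simp
  also have "\<dots> \<le> card Pts * (c0 * (q + 1)) ^ n" using Kle by (intro mult_left_mono power_mono) auto
  also have "\<dots> = q * (q + 1) ^ n" by (simp only: q_def power_mult_distrib mult_ac)
  also have "\<dots> < (N + 1) * (q + 1) ^ n" using qN by (intro mult_strict_right_mono) auto
  also have "\<dots> = (\<Sum>j\<le>N. (q + 1) ^ n)" by simp
  also have "\<dots> \<le> (\<Sum>j\<le>N. card (B j))" using cardB by (intro sum_mono) simp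
  also have "\<dots> = card U" unfolding U_def using finB by (subst card_SigmaI) auto
  finally have cardEU: "card E < card U" .
  define Gu where "Gu u = twist l M N (fst u) (mon T (2 * N - fst u) (snd u))" for u
  have monlead: "lead (\<lambda>r. (2 * N - j) * (M * l r)) (mon T (2 * N - j) \<beta>) ((2 * N - j) *s \<alpha>0 + m *s \<beta>)"
    if "\<beta> \<in> B j" for j \<beta>
    using that by (intro lead_mon T) (simp add: B_def)
  have monSec: "mon T (2 * N - j) \<beta> \<in> Sec (\<lambda>r. (2 * N - j) * (M * l r))" if "\<beta> \<in> B j" for j \<beta>
    using monlead[OF that] unfolding lead_def by blast
  have Guhol: "holomorphic_fun X (Opn t) (Gu u t)" if "u \<in> U" "t \<in> Idx" for u t
    unfolding Gu_def using that by (intro twist_holomorphic[OF monSec]) (auto simp: U_def)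
  have "\<forall>pt\<in>Pts. \<forall>u\<in>U. \<exists>b. power_series_at_0 (\<lambda>z. Gu u (fst (snd pt)) (chart_inv (fst pt) (snd (snd pt) + z))) b"
  proof (intro ballI)
    fix pt u assume "pt \<in> Pts" and u: "u \<in> U"
    moreover obtain \<mu> t w where pt: "pt = (\<mu>, t, w)" by (cases pt)
    ultimately have p: "\<mu> \<in> atlas X" "t \<in> Idx" "w \<in> snd \<mu> ` (fst \<mu> \<inter> Opn t)" using Pts(2) by blast+
    let ?S = "snd \<mu> ` (fst \<mu> \<inter> Opn t)"
    have S: "open ?S" by (rule chart_on_open_image[OF atlas_chart[OF p(1)] openin_Opn[OF p(2)]])
    have h: "(\<lambda>w. Gu u t (chart_inv \<mu> w)) mholomorphic_on ?S"
      using Guhol[OF u p(2)] p(1) unfolding holomorphic_fun_def by blast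
    have "(\<lambda>z. Gu u t (chart_inv \<mu> (z + w))) mholomorphic_on ((\<lambda>z. z + w) -` ?S)"
      using h unfolding mholomorphic_on_iff_cdiff by (blast intro: cdiff_translate[of "\<lambda>w. Gu u t (chart_inv \<mu> w)"])
    moreover have "open ((\<lambda>z. z + w) -` ?S)"
      by (rule open_vimage[OF S]) (intro continuous_intros)
    moreover have "0 \<in> (\<lambda>z. z + w) -` ?S" using p(3) by (simp only: vimage_eq add_0)
    ultimately obtain b where "power_series_at_0 (\<lambda>z. Gu u t (chart_inv \<mu> (z + w))) b"
      using power_series_at_0_exists by metis
    then show "\<exists>b. power_series_at_0 (\<lambda>z. Gu u (fst (snd pt)) (chart_inv (fst pt) (snd (snd pt) + z))) b"
      unfolding pt fst_conv snd_conv by (subst add.commute) blast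
  qed
  from this[unfolded bchoice_iff] obtain bb where bb:
    "\<And>pt u. pt \<in> Pts \<Longrightarrow> u \<in> U \<Longrightarrow> power_series_at_0 (\<lambda>z. Gu u (fst (snd pt)) (chart_inv (fst pt) (snd (snd pt) + z))) (bb pt u)"
    by blast
  from underdetermined_system[OF finE finU cardEU, of "\<lambda>e u. bb (fst e) u (snd e)"]
  obtain c u0 where c: "u0 \<in> U" "c u0 \<noteq> 0" "\<And>e. e \<in> E \<Longrightarrow> (\<Sum>u\<in>U. bb (fst e) u (snd e) * c u) = 0" by blast
  define G where "G t x = (\<Sum>u\<in>U. c u * Gu u t x)" for t x
  have G0: "\<forall>t\<in>Idx. \<forall>x\<in>Opn t. G t x = 0"
  proof (rule vanish[rule_format, of "M * N" "2 * N * M" K G, THEN ballI[THEN ballI]])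
    show "C1 * (M * N + 2 * N * M) < K" by (simp add: K_def)
    show "holomorphic_fun X (Opn t) (G t)" if "t \<in> Idx" for t
      using Guhol[OF _ that] unfolding holomorphic_fun_iff G_def[abs_def]
      by (intro ballI hol_at_sum hol_at_mult hol_at_const) blast
  next
    fix t t' x assume t: "t \<in> Idx" "t' \<in> Idx" and x: "x \<in> Opn t \<inter> Opn t'"
    have "Gu u t x * denom (DD l) t' x ^ (M * N) = gg l t t' x ^ (2 * N * M) * (denom (DD l) t x ^ (M * N) * Gu u t' x)"
      if "u \<in> U" for u
      unfolding Gu_def using that t x by (intro twist_transition monSec) (auto simp: U_def)
    then have "(\<Sum>u\<in>U. c u * (Gu u t x * denom (DD l) t' x ^ (M * N)))
      = (\<Sum>u\<in>U. c u * (gg l t t' x ^ (2 * N * M) * (denom (DD l) t x ^ (M * N) * Gu u t' x)))"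
      by (intro sum.cong[OF refl]) (simp only:)
    then show "G t x * denom (DD l) t' x ^ (M * N) = gg l t t' x ^ (2 * N * M) * (denom (DD l) t x ^ (M * N) * G t' x)"
      unfolding G_def sum_distrib_left sum_distrib_right by (simp only: mult_ac)
  next
    fix pt assume pt: "pt \<in> Pts"
    obtain \<mu> t w where pt': "pt = (\<mu>, t, w)" by (cases pt)
    have "power_series_at_0 (\<lambda>z. \<Sum>u\<in>U. c u * Gu u t (chart_inv \<mu> (w + z))) (\<lambda>\<alpha>. \<Sum>u\<in>U. c u * bb pt u \<alpha>)"
      using bb[OF pt] unfolding pt' fst_conv snd_conv by (intro power_series_at_0_sum finU) blast
    moreover have "(\<Sum>u\<in>U. c u * bb pt u \<alpha>) = 0" if "wt \<alpha> < K" for \<alpha>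
      using c(3)[of "(pt, \<alpha>)"] pt that unfolding E_def by (simp add: mult.commute)
    ultimately have "\<exists>b. power_series_at_0 (\<lambda>z. G t (chart_inv \<mu> (w + z))) b \<and> (\<forall>\<alpha>. wt \<alpha> < K \<longrightarrow> b \<alpha> = 0)"
      unfolding G_def by (intro exI conjI) (assumption, blast)
    then show "case pt of (\<mu>, t, w) \<Rightarrow> \<exists>b. power_series_at_0 (\<lambda>z. G t (chart_inv \<mu> (w + z))) b \<and> (\<forall>\<alpha>. wt \<alpha> < K \<longrightarrow> b \<alpha> = 0)"
      unfolding pt' prod.case .
  qed
  define P where "P j t x = (\<Sum>\<beta>\<in>B j. c (j, \<beta>) * mon T (2 * N - j) \<beta> t x)" for j t x
  have "\<forall>j\<le>N. P j \<in> Sec (\<lambda>r. (2 * N - j) * (M * l r))"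
    unfolding P_def[abs_def] using monSec by (intro allI impI Sec_sum) blast
  moreover have "fst u0 \<le> N" using c(1) by (auto simp: U_def)
  moreover have "nz (P (fst u0))"
    unfolding P_def[abs_def]
  proof (rule lead_independent[OF finB monlead, where ?u0.0 = "snd u0"])
    show "inj_on (\<lambda>\<beta>. (2 * N - fst u0) *s \<alpha>0 + m *s \<beta>) (B (fst u0))"
      using m by (auto simp: inj_on_def vec_eq_iff)
    show "snd u0 \<in> B (fst u0)" using c(1) by (auto simp: U_def)
  qed (use c(2) in auto)
  moreover have "(\<Sum>j\<le>N. twist l M N j (P j) t x) = 0" if "t \<in> Idx" "x \<in> Opn t" for t x
  proof -
    have "(\<Sum>j\<le>N. twist l M N j (P j) t x) = (\<Sum>j\<le>N. \<Sum>\<beta>\<in>B j. c (j, \<beta>) * Gu (j, \<beta>) t x)"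
      unfolding twist_def P_def Gu_def fst_conv snd_conv sum_distrib_left by (simp only: mult_ac)
    also have "\<dots> = G t x"
      unfolding G_def U_def using finB by (subst sum.Sigma) (auto simp: case_prod_beta simp del: DD_simps)
    finally show ?thesis using G0 that by simp
  qed
  ultimately show ?thesis by (intro exI[of _ N] exI[of _ P] exI[of _ "fst u0"]) blast
qed

lemma section_of_multiple_succ:
  assumes "1 \<le> M" "1 \<le> m"
    and "lead (\<lambda>r. M * l r) (T None) \<alpha>0" "\<And>i. lead (\<lambda>r. M * l r) (T (Some i)) (\<alpha>0 + axis i m)"
  obtains K \<alpha> where "\<alpha> \<in> expo (\<lambda>r. (K * M + 1) * l r)"
proof -
  obtain N P j0 where P: "\<forall>j\<le>N. P j \<in> Sec (\<lambda>r. (2 * N - j) * (M * l r))" "j0 \<le> N" "nz (P j0)"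
    "\<forall>t\<in>Idx. \<forall>x\<in>Opn t. (\<Sum>j\<le>N. twist l M N j (P j) t x) = 0"
    using relation_exists[of M m l T \<alpha>0, OF assms] by blast
  then obtain K s where s: "s \<in> Sec (\<lambda>r. (K * M + 1) * l r)" "nz s"
    using section_from_relation[OF assms(1), of N P l j0] by blast
  then have "cf (\<lambda>r. (K * M + 1) * l r) s \<noteq> (\<lambda>_. 0)" using cf_zero_iff by blast
  then obtain \<alpha> where "is_lead (cf (\<lambda>r. (K * M + 1) * l r) s) \<alpha>" using is_lead_exists by blast
  then show ?thesis using s(1) that unfolding expo_def by blast
qed

end

section \<open>The two transforms as limits\<close>

definition lattice :: "((real, 'n::finite) vec \<times> (real, 'r::finite) vec) set" where
  "lattice = {x. (\<forall>i. fst x $ i \<in> \<int>) \<and> (\<forall>j. snd x $ j \<in> \<int>)}"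

lemma lattice_diff: "x \<in> lattice \<Longrightarrow> y \<in> lattice \<Longrightarrow> x - y \<in> lattice"
  by (auto simp: lattice_def)

lemma finite_lattice_ball: "finite {x \<in> lattice :: ((real, 'n::finite) vec \<times> (real, 'r::finite) vec) set. norm x \<le> R}"
proof -
  let ?I = "{- \<lceil>R\<rceil>..\<lceil>R\<rceil>}"
  let ?f = "\<lambda>(f, g). (\<chi> i. real_of_int (f i), \<chi> j. real_of_int (g j)) :: (real, 'n) vec \<times> (real, 'r) vec"
  let ?P = "PiE (UNIV::'n set) (\<lambda>_. ?I) \<times> PiE (UNIV::'r set) (\<lambda>_. ?I)"
  have "{x \<in> lattice. norm x \<le> R} \<subseteq> ?f ` ?P"
  proof
    fix x :: "(real, 'n) vec \<times> (real, 'r) vec" assume x: "x \<in> {x \<in> lattice. norm x \<le> R}"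
    have int: "real_of_int \<lfloor>y\<rfloor> = y \<and> \<lfloor>y\<rfloor> \<in> ?I" if "y \<in> \<int>" "\<bar>y\<bar> \<le> R" for y
      using that by (auto elim!: Ints_cases) linarith+
    have 1: "\<bar>fst x $ i\<bar> \<le> R" for i
    proof -
      have "\<bar>fst x $ i\<bar> \<le> norm (fst x)" by (rule component_le_norm_cart)
      also have "\<dots> \<le> norm x" by (cases x) (auto simp: norm_Pair)
      finally show ?thesis using x by simp
    qed
    have 2: "\<bar>snd x $ j\<bar> \<le> R" for j
    proof -
      have "\<bar>snd x $ j\<bar> \<le> norm (snd x)" by (rule component_le_norm_cart)
      also have "\<dots> \<le> norm x" by (cases x) (auto simp: norm_Pair)
      finally show ?thesis using x by simp
    qed
    show "x \<in> ?f ` ?P"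
    proof (rule image_eqI)
      show "x = ?f (\<lambda>i. \<lfloor>fst x $ i\<rfloor>, \<lambda>j. \<lfloor>snd x $ j\<rfloor>)"
        using x int 1 2 by (simp add: lattice_def vec_eq_iff prod_eq_iff)
      show "(\<lambda>i. \<lfloor>fst x $ i\<rfloor>, \<lambda>j. \<lfloor>snd x $ j\<rfloor>) \<in> ?P"
        using x int 1 2 by (simp add: lattice_def PiE_UNIV_domain Pi_iff)
    qed
  qed
  moreover have "finite (?f ` ?P)" by (intro finite_imageI finite_cartesian_product finite_PiE) auto
  ultimately show ?thesis by (rule finite_subset)
qed

lemma norm_fst_le_sum:
  fixes x :: "(real, 'n::finite) vec \<times> (real, 'r::finite) vec"
  assumes "snd x = 0" "\<And>i. \<bar>fst x $ i\<bar> \<le> c"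
  shows "norm x \<le> real CARD('n) * c"
proof -
  have "norm x = norm (fst x)" using assms(1) by (cases x) (simp add: norm_Pair)
  also have "\<dots> \<le> (\<Sum>i\<in>UNIV. \<bar>fst x $ i\<bar>)" by (rule norm_le_l1_cart)
  also have "\<dots> \<le> (\<Sum>i\<in>(UNIV::'n set). c)" using assms(2) by (intro sum_mono)
  finally show ?thesis by simp
qed

lemma norm_rescaled_le:
  assumes "0 < k" "norm (x - k *\<^sub>R y) \<le> c"
  shows "norm (x /\<^sub>R k - y) \<le> c / k"
proof -
  have "x /\<^sub>R k - y = (x - k *\<^sub>R y) /\<^sub>R k" using assms(1) by (simp add: scaleR_diff_right)
  then have "norm (x /\<^sub>R k - y) = norm (x - k *\<^sub>R y) / k" using assms(1) by (simp add: divide_inverse mult.commute)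
  then show ?thesis using assms by (simp add: divide_right_mono)
qed

definition emb :: "(nat, 'n::finite) vec \<Rightarrow> ('r::finite \<Rightarrow> nat) \<Rightarrow> (real, 'n) vec \<times> (real, 'r) vec" where
  "emb \<alpha> a = (real_vec \<alpha>, \<chi> j. real (a j))"

lemma emb_nth [simp]: "fst (emb \<alpha> a) $ i = real (\<alpha> $ i)" "snd (emb \<alpha> a) = (\<chi> j. real (a j))"
  by (simp_all add: emb_def real_vec_def)

lemma emb_add: "emb \<alpha> a + emb \<beta> b = emb (\<alpha> + \<beta>) (\<lambda>j. a j + b j)"
  by (simp add: prod_eq_iff vec_eq_iff)

lemma emb_0: "emb 0 (\<lambda>_. 0) = 0"
  by (simp add: prod_eq_iff vec_eq_iff)

lemma emb_inject: "emb \<alpha> a = emb \<beta> b \<longleftrightarrow> \<alpha> = \<beta> \<and> a = b"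
  by (simp add: prod_eq_iff vec_eq_iff fun_eq_iff)

lemma emb_real_vec: "(real_vec \<alpha>, real_vec a) = emb \<alpha> (vec_nth a)"
  by (simp add: emb_def real_vec_def)

context discrete_semigroup
begin

lemma grp_scale:
  assumes "x \<in> grp"
  shows "real_of_int z *\<^sub>R x \<in> grp"
proof -
  obtain g h where gh: "x = g - h" "g \<in> G" "h \<in> G" using assms unfolding grp_def by blast
  have *: "real n *\<^sub>R x \<in> grp" for n
    unfolding gh(1) scaleR_diff_right grp_def using scale_mem gh by blast
  show ?thesis
  proof (cases "0 \<le> z")
    case True then show ?thesis using *[of "nat z"] by simp
  next
    case False then show ?thesis using grp_uminus[OF *[of "nat (- z)"]] by simp
  qed
qed

lemma grp_sum: "finite I \<Longrightarrow> (\<And>i. i \<in> I \<Longrightarrow> f i \<in> grp) \<Longrightarrow> (\<Sum>i\<in>I. f i) \<in> grp"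
proof (induction I rule: finite_induct)
  case empty then show ?case using G_subset_grp zero_mem by auto
qed (auto intro: grp_add)

end

context metrized_manifold
begin

text \<open>The global semigroup as a set of real vectors.\<close>

definition Gm :: "((real, 'n) vec \<times> (real, 'r) vec) set" where
  "Gm = {emb \<alpha> a | \<alpha> a. \<alpha> \<in> expo a}"

definition deg :: "(real, 'n) vec \<times> (real, 'r) vec \<Rightarrow> real" where
  "deg x = (\<Sum>i\<in>UNIV. fst x $ i) + (\<Sum>j\<in>UNIV. snd x $ j)"

text \<open>\<open>F\<close> as a function on the real vector space, by inverting the embedding of natural vectors.\<close>

definition Fm :: "(real, 'n) vec \<times> (real, 'r) vec \<Rightarrow> real" where
  "Fm x = minlog (\<lambda>j. nat \<lfloor>snd x $ j\<rfloor>) (\<chi> i. nat \<lfloor>fst x $ i\<rfloor>)"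

lemma Fm_emb: "Fm (emb \<alpha> a) = minlog a \<alpha>"
  by (simp add: Fm_def)

lemma emb_mem_Gm [simp]: "emb \<alpha> a \<in> Gm \<longleftrightarrow> \<alpha> \<in> expo a"
  by (auto simp: Gm_def emb_inject)

lemma Gm_lattice: "Gm \<subseteq> lattice"
  by (auto simp: Gm_def lattice_def)

lemma deg_emb: "deg (emb \<alpha> a) = real (wt \<alpha>) + real (\<Sum>j\<in>UNIV. a j)"
  by (simp add: deg_def wt_def)

sublocale sg: discrete_semigroup Gm deg
proof (rule discrete_semigroup.intro)
  show "0 \<in> Gm" using expo_0 unfolding emb_0[symmetric] by simp
  show "x + y \<in> Gm" if xy: "x \<in> Gm" "y \<in> Gm" for x y
  proof -
    obtain \<alpha> a \<beta> b where "x = emb \<alpha> a" "\<alpha> \<in> expo a" "y = emb \<beta> b" "\<beta> \<in> expo b" using xy unfolding Gm_def by blast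
    then show ?thesis using expo_add by (simp add: emb_add)
  qed
  show "linear deg" by (rule linearI) (simp_all add: deg_def sum.distrib sum_distrib_left algebra_simps)
  show "1 \<le> deg x" if x_mem: "x \<in> Gm" "x \<noteq> 0" for x
  proof -
    obtain \<alpha> a where x: "x = emb \<alpha> a" using x_mem(1) unfolding Gm_def by blast
    have "\<not> (wt \<alpha> = 0 \<and> (\<Sum>j\<in>UNIV. a j) = 0)"
    proof
      assume "wt \<alpha> = 0 \<and> (\<Sum>j\<in>UNIV. a j) = 0"
      then have "\<alpha> = 0" "a = (\<lambda>_. 0)" by (auto simp: wt_def vec_eq_iff)
      then show False using x_mem(2) x by (simp add: emb_0)
    qed
    then have "1 \<le> wt \<alpha> + (\<Sum>j\<in>UNIV. a j)" by linarith
    then have "real 1 \<le> real (wt \<alpha> + (\<Sum>j\<in>UNIV. a j))" by (rule of_nat_mono)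
    then show ?thesis unfolding x deg_emb by simp
  qed
  show "finite {x - y |x y. x \<in> Gm \<and> y \<in> Gm \<and> norm (x - y) \<le> R}" for R
    by (rule finite_subset[OF _ finite_lattice_ball[of R]]) (use Gm_lattice lattice_diff in blast)
qed

lemma Fm_add: "x \<in> Gm \<Longrightarrow> y \<in> Gm \<Longrightarrow> Fm (x + y) \<le> Fm x + Fm y"
  using minlog_add unfolding Gm_def by (auto simp: emb_add Fm_emb)

lemma Fm_linear_bound:
  obtains l0 where "linear l0" "\<And>x. x \<in> Gm \<Longrightarrow> l0 x \<le> Fm x"
proof -
  obtain A B where AB: "\<forall>a \<alpha>. \<forall>s\<in>monic a \<alpha>. 0 < sn a s \<and> - A * real (\<Sum>j\<in>UNIV. a j) - B * real (wt \<alpha>) \<le> ln (sn a s)"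
    by (rule minlog_lower_bound)
  define l0 where "l0 x = - A * (\<Sum>j\<in>UNIV. snd x $ j) - B * (\<Sum>i\<in>UNIV. fst x $ i)" for x :: "(real, 'n) vec \<times> (real, 'r) vec"
  have "linear l0" by (rule linearI) (simp_all add: l0_def sum.distrib sum_distrib_left algebra_simps)
  moreover have "l0 x \<le> Fm x" if "x \<in> Gm" for x
  proof -
    obtain \<alpha> a where x: "x = emb \<alpha> a" "\<alpha> \<in> expo a" using \<open>x \<in> Gm\<close> unfolding Gm_def by blast
    have "l0 x = - A * real (\<Sum>j\<in>UNIV. a j) - B * real (wt \<alpha>)" by (simp add: l0_def x(1) wt_def)
    also have "\<dots> \<le> minlog a \<alpha>" unfolding minlog_def using AB by (intro cINF_greatest monic_nonempty x(2)) blast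
    finally show ?thesis by (simp add: x(1) Fm_emb)
  qed
  ultimately show ?thesis by (rule that)
qed

lemma interior_nonneg:
  assumes "y \<in> interior sg.cone"
  shows "0 \<le> fst y $ i" "0 \<le> snd y $ j"
proof -
  have y: "y \<in> sg.cone" using assms interior_subset by blast
  have G: "0 \<le> fst x $ i" "0 \<le> snd x $ j" if "x \<in> Gm" for x
    using that unfolding Gm_def by auto
  show "0 \<le> fst y $ i" by (rule sg.linear_nonneg_on_cone[OF _ G(1) y]) (auto intro!: linearI)
  show "0 \<le> snd y $ j" by (rule sg.linear_nonneg_on_cone[OF _ G(2) y]) (auto intro!: linearI)
qed

text \<open>Integer points close to \<open>k *\<^sub>R y\<close> have multiples in the group, and such multiples near the ray of \<open>y\<close> are in the semigroup.
  Taking a point over \<open>k l\<close> and its neighbors in the directions of the first factor, one obtains sections of a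
  multiple \<open>M l\<close> as required for the existence of a section of \<open>(K * M + 1) * l\<close>.\<close>

lemma group_directions:
  assumes y: "(p, \<chi> j. real (l j)) \<in> interior sg.cone"
  obtains m :: nat and \<eta> where "0 < m" "\<forall>i. (axis i (real m), 0) \<in> sg.grp"
    "(\<eta>, \<chi> j. real (l j)) \<in> sg.grp"
proof -
  let ?n = "real CARD('n)" and ?y = "(p, \<chi> j. real (l j)) :: (real, 'n) vec \<times> (real, 'r) vec"
  obtain \<rho> C N where near: "0 < \<rho>" "0 < N"
    "\<forall>t x. N \<le> t \<longrightarrow> x \<in> sg.grp \<longrightarrow> norm (x /\<^sub>R t - ?y) < \<rho> \<longrightarrow> x \<in> Gm \<and> (0::real) \<le> C * t"
    using sg.semigroup_near_interior[of "\<lambda>_. 0", OF _ y] by (metis add_0 order_refl)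
  have "filterlim (\<lambda>k. real k) at_top sequentially" by (rule filterlim_real_sequentially)
  obtain k :: nat where k: "max N (?n * 2 / \<rho>) < real k" using reals_Archimedean2 by blast
  have k0: "0 < real k" using k near(2) by linarith
  define pt where "pt = (\<lambda>u. ((\<chi> i. real_of_int \<lfloor>real k * p $ i\<rfloor>) + (case u of None \<Rightarrow> 0 | Some i \<Rightarrow> axis i 1),
    \<chi> j. real (k * l j)) :: (real, 'n) vec \<times> (real, 'r) vec)"
  have pt_lattice: "pt u \<in> lattice" for u
    by (auto simp: pt_def lattice_def axis_def split: option.split)
  have pt_near: "norm (pt u /\<^sub>R real k - ?y) < \<rho>" for u
  proof -
    have "norm (pt u - real k *\<^sub>R ?y) \<le> ?n * 2"
    proof (rule norm_fst_le_sum)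
      show "snd (pt u - real k *\<^sub>R ?y) = 0" by (simp add: pt_def vec_eq_iff)
      fix i
      have "\<bar>real_of_int \<lfloor>real k * p $ i\<rfloor> - real k * p $ i\<bar> \<le> 1" by linarith
      moreover have "\<bar>(case u of None \<Rightarrow> 0 | Some i \<Rightarrow> axis i 1) $ i\<bar> \<le> (1::real)"
        by (auto simp: axis_def split: option.split)
      ultimately have "\<bar>real_of_int \<lfloor>real k * p $ i\<rfloor> - real k * p $ i + (case u of None \<Rightarrow> 0 | Some i \<Rightarrow> axis i 1) $ i\<bar> \<le> 2"
        by (intro order_trans[OF abs_triangle_ineq]) simp
      then show "\<bar>fst (pt u - real k *\<^sub>R ?y) $ i\<bar> \<le> 2" by (simp add: pt_def algebra_simps)
    qed
    from norm_rescaled_le[OF k0 this] have "norm (pt u /\<^sub>R real k - ?y) \<le> ?n * 2 / real k" .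
    also have "\<dots> < \<rho>" using k k0 near(1) by (simp add: field_simps)
    finally show ?thesis .
  qed
  have "\<exists>m::nat. 0 < m \<and> real m *\<^sub>R pt u \<in> sg.grp" for u
    using sg.multiple_in_group[OF lattice_diff Gm_lattice finite_lattice_ball y pt_lattice[of u]] by blast
  then obtain mu where mu: "\<And>u. 0 < mu u" "\<And>u. real (mu u) *\<^sub>R pt u \<in> sg.grp" by metis
  \<comment> \<open>A common multiple for all points.\<close>
  define m where "m = (\<Prod>u\<in>UNIV. mu u)"
  have m0: "0 < m" unfolding m_def using mu(1) by (simp add: prod_pos)
  have m_grp: "real m *\<^sub>R pt u \<in> sg.grp" for u
  proof -
    have "m = (\<Prod>v\<in>UNIV - {u}. mu v) * mu u" unfolding m_def by (simp add: prod.remove[of UNIV u] mult.commute)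
    then show ?thesis using sg.grp_scale[OF mu(2)[of u], of "int (\<Prod>v\<in>UNIV - {u}. mu v)"] by simp
  qed
  have m_Gm: "real m *\<^sub>R pt u \<in> Gm" for u
  proof -
    have "(real m *\<^sub>R pt u) /\<^sub>R (real m * real k) = pt u /\<^sub>R real k" using m0 by simp
    moreover have "N \<le> real m * real k"
      using k m0 mult_right_mono[of 1 "real m" "real k"] by simp
    ultimately show ?thesis
      using near(3)[rule_format, OF _ m_grp, of "real m * real k" u] pt_near[of u] by (simp only:)
  qed
  have "\<exists>\<alpha>. real m *\<^sub>R pt u = emb \<alpha> (\<lambda>j. (m * k) * l j) \<and> \<alpha> \<in> expo (\<lambda>j. (m * k) * l j)" for u
  proof -
    obtain \<alpha> a where a: "real m *\<^sub>R pt u = emb \<alpha> a" "\<alpha> \<in> expo a" using m_Gm[of u] unfolding Gm_def by blast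
    have "a j = (m * k) * l j" for j
    proof -
      have "real (a j) = snd (real m *\<^sub>R pt u) $ j" unfolding a(1) by simp
      also have "\<dots> = real ((m * k) * l j)" by (simp add: pt_def)
      finally show ?thesis by (simp only: of_nat_eq_iff)
    qed
    then have "a = (\<lambda>j. (m * k) * l j)" by (rule ext)
    then show ?thesis using a by blast
  qed
  then obtain \<alpha> where \<alpha>: "\<And>u. real m *\<^sub>R pt u = emb (\<alpha> u) (\<lambda>j. (m * k) * l j)" "\<And>u. \<alpha> u \<in> expo (\<lambda>j. (m * k) * l j)" by metis
  have \<alpha>_Some: "\<alpha> (Some i) = \<alpha> None + axis i m" for i
  proof -
    have "real (\<alpha> (Some i) $ i') = real ((\<alpha> None + axis i m) $ i')" for i'
    proof -
      have "real (\<alpha> u $ i') = fst (real m *\<^sub>R pt u) $ i'" for u unfolding \<alpha>(1) by simp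
      then show ?thesis by (simp add: pt_def axis_def distrib_left)
    qed
    then show ?thesis by (simp add: vec_eq_iff del: of_nat_add)
  qed
  from \<alpha>(2) obtain T where T: "\<And>u. lead (\<lambda>j. (m * k) * l j) (T u) (\<alpha> u)" unfolding expo_def lead_def by (simp add: Bex_def) metis
  obtain K \<alpha>1 where \<alpha>1: "\<alpha>1 \<in> expo (\<lambda>r. (K * (m * k) + 1) * l r)"
  proof (rule section_of_multiple_succ[of "m * k" m l T "\<alpha> None"])
    show "1 \<le> m * k" "1 \<le> m" using m0 k0 by (simp_all add: Suc_le_eq)
    show "lead (\<lambda>r. (m * k) * l r) (T None) (\<alpha> None)" by (rule T)
    show "lead (\<lambda>r. (m * k) * l r) (T (Some i)) (\<alpha> None + axis i m)" for i unfolding \<alpha>_Some[symmetric] by (rule T)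
  qed
  \<comment> \<open>Subtract \<open>K\<close> times the section of \<open>M l\<close> from the one of \<open>(K * M + 1) * l\<close>.\<close>
  define \<eta> where "\<eta> = real_vec \<alpha>1 - real K *\<^sub>R real_vec (\<alpha> None)"
  show ?thesis
  proof (rule that[OF m0, of \<eta>], intro allI)
    fix i
    have "(axis i (real m), 0) = real m *\<^sub>R pt (Some i) - real m *\<^sub>R pt None"
      by (simp add: pt_def vec_eq_iff axis_def distrib_left)
    then show "(axis i (real m), 0) \<in> sg.grp" using sg.grp_diff[OF m_grp m_grp] by simp
  next
    have "emb \<alpha>1 (\<lambda>r. (K * (m * k) + 1) * l r) \<in> sg.grp" using \<alpha>1 sg.G_subset_grp by (auto intro!: subsetD[OF sg.G_subset_grp])
    moreover have "real_of_int (int K) *\<^sub>R emb (\<alpha> None) (\<lambda>j. (m * k) * l j) \<in> sg.grp"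
      using \<alpha>(2) by (intro sg.grp_scale subsetD[OF sg.G_subset_grp]) simp
    ultimately have "emb \<alpha>1 (\<lambda>r. (K * (m * k) + 1) * l r) - real_of_int (int K) *\<^sub>R emb (\<alpha> None) (\<lambda>j. (m * k) * l j) \<in> sg.grp"
      by (rule sg.grp_diff)
    also have "emb \<alpha>1 (\<lambda>r. (K * (m * k) + 1) * l r) - real_of_int (int K) *\<^sub>R emb (\<alpha> None) (\<lambda>j. (m * k) * l j)
      = (\<eta>, \<chi> j. real (l j))"
      by (simp add: emb_def \<eta>_def vec_eq_iff algebra_simps)
    finally show "(\<eta>, \<chi> j. real (l j)) \<in> sg.grp" .
  qed
qed

text \<open>Starting from \<open>k *\<^sub>R (\<eta>, l)\<close>, steps in the directions \<open>axis i (real m)\<close> lead to a group element over \<open>k l\<close> at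
  bounded distance from \<open>k *\<^sub>R (p, l)\<close>; for large \<open>k\<close> it is in the semigroup.\<close>

lemma exponent_sequence:
  assumes y: "(p, \<chi> j. real (l j)) \<in> interior sg.cone"
  obtains m where "\<forall>\<^sub>F k in sequentially. m k \<in> expo (\<lambda>j. k * l j)" "(\<lambda>k. real_vec (m k) /\<^sub>R real k) \<longlonglongrightarrow> p"
proof -
  let ?n = "real CARD('n)" and ?y = "(p, \<chi> j. real (l j)) :: (real, 'n) vec \<times> (real, 'r) vec"
  obtain m :: nat and \<eta> where m: "0 < m" "\<forall>i. (axis i (real m), 0) \<in> sg.grp"
    and \<eta>: "(\<eta>, \<chi> j. real (l j)) \<in> sg.grp" by (rule group_directions[OF y])
  obtain \<rho> C N where near: "0 < \<rho>" "0 < N"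
    "\<forall>t x. N \<le> t \<longrightarrow> x \<in> sg.grp \<longrightarrow> norm (x /\<^sub>R t - ?y) < \<rho> \<longrightarrow> x \<in> Gm \<and> (0::real) \<le> C * t"
    using sg.semigroup_near_interior[of "\<lambda>_. 0", OF _ y] by (metis add_0 order_refl)
  define z where "z k i = \<lfloor>real k * (p $ i - \<eta> $ i) / real m\<rfloor>" for k :: nat and i
  define x where "x k = real k *\<^sub>R (\<eta>, \<chi> j. real (l j)) + (\<Sum>i\<in>UNIV. real_of_int (z k i) *\<^sub>R (axis i (real m), 0))" for k :: nat
  have x_fst: "fst (x k) $ i = real k * \<eta> $ i + real_of_int (z k i) * real m" for k i
    by (simp add: x_def fst_sum sum_component axis_def if_distrib cong: if_cong)
  have x_snd: "snd (x k) = (\<chi> j. real (k * l j))" for k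
    by (simp add: x_def snd_sum vec_eq_iff)
  have x_grp: "x k \<in> sg.grp" for k
    unfolding x_def using sg.grp_scale[OF \<eta>, of "int k"] m(2)
    by (intro sg.grp_add sg.grp_sum sg.grp_scale) auto
  have x_near: "norm (x k - real k *\<^sub>R ?y) \<le> ?n * real m" for k
  proof (rule norm_fst_le_sum)
    show "snd (x k - real k *\<^sub>R ?y) = 0" by (simp add: x_snd vec_eq_iff)
    fix i
    let ?w = "real k * (p $ i - \<eta> $ i) / real m"
    have "\<bar>real_of_int \<lfloor>?w\<rfloor> - ?w\<bar> \<le> 1" by linarith
    then have "\<bar>real_of_int (z k i) - ?w\<bar> * real m \<le> 1 * real m"
      unfolding z_def by (intro mult_right_mono) auto
    moreover have "\<bar>real_of_int (z k i) - ?w\<bar> * real m = \<bar>(real_of_int (z k i) - ?w) * real m\<bar>" by (simp add: abs_mult)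
    moreover have "(real_of_int (z k i) - ?w) * real m = fst (x k - real k *\<^sub>R ?y) $ i"
      using m(1) by (simp add: x_fst left_diff_distrib) (simp add: right_diff_distrib)
    ultimately show "\<bar>fst (x k - real k *\<^sub>R ?y) $ i\<bar> \<le> real m" by simp
  qed
  have x_lim: "(\<lambda>k. x k /\<^sub>R real k) \<longlonglongrightarrow> ?y"
  proof (rule LIM_zero_cancel, rule Lim_null_comparison)
    show "\<forall>\<^sub>F k in sequentially. norm (x k /\<^sub>R real k - ?y) \<le> ?n * real m / real k"
      using eventually_gt_at_top[of 0]
    proof eventually_elim
      case (elim k)
      then show ?case using x_near[of k] by (intro norm_rescaled_le) auto
    qed
    show "(\<lambda>k. ?n * real m / real k) \<longlonglongrightarrow> 0" by (rule lim_const_over_n)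
  qed
  have "\<forall>\<^sub>F k in sequentially. norm (x k /\<^sub>R real k - ?y) < \<rho>"
    using tendstoD[OF x_lim near(1)] by (simp add: dist_norm)
  moreover have "\<forall>\<^sub>F k in sequentially. N \<le> real k"
    by (rule eventually_mono[OF eventually_ge_at_top[of "nat \<lceil>N\<rceil>"]]) linarith
  ultimately have ev: "\<forall>\<^sub>F k in sequentially. x k \<in> Gm"
    by eventually_elim (use near(3) x_grp in blast)
  have form: "\<exists>\<alpha>. x k = emb \<alpha> (\<lambda>j. k * l j) \<and> \<alpha> \<in> expo (\<lambda>j. k * l j)" if "x k \<in> Gm" for k
  proof -
    obtain \<alpha> a where a: "x k = emb \<alpha> a" "\<alpha> \<in> expo a" using \<open>x k \<in> Gm\<close> unfolding Gm_def by blast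
    have "real (a j) = real (k * l j)" for j using x_snd[of k] unfolding a(1) by (simp add: vec_eq_iff)
    then have "a = (\<lambda>j. k * l j)" by (simp only: of_nat_eq_iff) auto
    then show ?thesis using a by blast
  qed
  define mk where "mk k = (SOME \<alpha>. x k = emb \<alpha> (\<lambda>j. k * l j) \<and> \<alpha> \<in> expo (\<lambda>j. k * l j))" for k
  have mk: "x k = emb (mk k) (\<lambda>j. k * l j) \<and> mk k \<in> expo (\<lambda>j. k * l j)" if "x k \<in> Gm" for k
    unfolding mk_def by (rule someI_ex) (rule form[OF that])
  show ?thesis
  proof (rule that)
    show "\<forall>\<^sub>F k in sequentially. mk k \<in> expo (\<lambda>j. k * l j)" using ev by eventually_elim (use mk in blast)
    have "(\<lambda>k. fst (x k /\<^sub>R real k)) \<longlonglongrightarrow> p" using tendsto_fst[OF x_lim] by simp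
    then show "(\<lambda>k. real_vec (mk k) /\<^sub>R real k) \<longlonglongrightarrow> p"
    proof (rule Lim_transform_eventually)
      show "\<forall>\<^sub>F k in sequentially. fst (x k /\<^sub>R real k) = real_vec (mk k) /\<^sub>R real k"
        using ev
      proof eventually_elim
        case (elim k)
        from mk[OF elim] have "fst (x k) = real_vec (mk k)" by (simp add: emb_def)
        then show ?case by simp
      qed
    qed
  qed
qed

text \<open>The parameter \<open>q\<close> makes it possible to read the same limit at the points \<open>(p, l)\<close> and \<open>(p, l) / q\<close>.\<close>

lemma minlog_limit:
  assumes y: "(p, \<chi> j. real (l j)) \<in> interior sg.cone" and q: "0 < q"
    and m: "\<forall>\<^sub>F k in sequentially. m k \<in> expo (\<lambda>j. k * l j)" "(\<lambda>k. real_vec (m k) /\<^sub>R real k) \<longlonglongrightarrow> p"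
  shows "(\<lambda>k. minlog (\<lambda>j. k * l j) (m k) / (q * real k)) \<longlonglongrightarrow> sg.envelope Fm ((p, \<chi> j. real (l j)) /\<^sub>R q)"
proof -
  let ?x = "\<lambda>k. emb (m k) (\<lambda>j. k * l j)"
  obtain l0 where l0: "linear l0" "\<And>x. x \<in> Gm \<Longrightarrow> l0 x \<le> Fm x" by (rule Fm_linear_bound) blast
  have "(\<lambda>k. Fm (?x k) / (q * real k)) \<longlonglongrightarrow> sg.envelope Fm ((p, \<chi> j. real (l j)) /\<^sub>R q)"
  proof (rule sg.envelope_limit[OF Fm_add l0])
    show "(p, \<chi> j. real (l j)) /\<^sub>R q \<in> interior sg.cone" using sg.interior_cone_scale[OF y, of "inverse q"] q by simp
    show "\<forall>\<^sub>F k in sequentially. ?x k \<in> Gm" using m(1) by simp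
    show "filterlim (\<lambda>k. q * real k) at_top sequentially"
      using q by (intro filterlim_tendsto_pos_mult_at_top[OF tendsto_const] filterlim_real_sequentially)
    have "(\<lambda>k. ((\<lambda>k. real_vec (m k) /\<^sub>R real k) k /\<^sub>R q, (\<chi> j. real (l j)) /\<^sub>R q)) \<longlonglongrightarrow> (p /\<^sub>R q, (\<chi> j. real (l j)) /\<^sub>R q)"
      by (intro tendsto_Pair tendsto_scaleR tendsto_const m(2))
    moreover have "\<forall>\<^sub>F k in sequentially. ((\<lambda>k. real_vec (m k) /\<^sub>R real k) k /\<^sub>R q, (\<chi> j. real (l j)) /\<^sub>R q) = ?x k /\<^sub>R (q * real k)"
      using eventually_gt_at_top[of 0] by eventually_elim (simp add: emb_def vec_eq_iff field_simps)
    ultimately have "(\<lambda>k. ?x k /\<^sub>R (q * real k)) \<longlonglongrightarrow> (p /\<^sub>R q, (\<chi> j. real (l j)) /\<^sub>R q)" by (rule Lim_transform_eventually)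
    then show "(\<lambda>k. ?x k /\<^sub>R (q * real k)) \<longlonglongrightarrow> (p, \<chi> j. real (l j)) /\<^sub>R q" by simp
  qed
  then show ?thesis by (simp add: Fm_emb)
qed

lemma fr_mult: "(\<lambda>t x. fr l t x ^ k) = fr (\<lambda>j. k * l j)"
  by (simp add: fr_def fun_eq_iff prod_power_distrib power_mult[symmetric] mult.commute)

lemma mm_mult: "(\<lambda>t x. real k * mm l t x) = mm (\<lambda>j. k * l j)"
  by (simp add: mm_def fun_eq_iff sum_distrib_left mult.assoc)

lemma lead_exps_eq: "lead_exps X \<kappa> (DD a) (fr a) = expo a"
  using lead_exps_iff by (auto simp: expo_def)

lemma chebyshev_eq:
  assumes y: "(p, \<chi> j. real (l j)) \<in> interior sg.cone"
  shows "chebyshev X \<kappa> (DD l) (fr l) (mm l) p = sg.envelope Fm (p, \<chi> j. real (l j))"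
  unfolding chebyshev_def mult_divisor_DD fr_mult mm_mult min_log_norm_eq lead_exps_eq
proof (rule the_equality)
  have lim: "(\<lambda>k. minlog (\<lambda>j. k * l j) (m k) / real k) \<longlonglongrightarrow> sg.envelope Fm (p, \<chi> j. real (l j))"
    if "\<forall>\<^sub>F k in sequentially. m k \<in> expo (\<lambda>j. k * l j)" "(\<lambda>k. real_vec (m k) /\<^sub>R real k) \<longlonglongrightarrow> p" for m
    using minlog_limit[OF y, of 1, OF _ that] by simp
  show "\<forall>m. (\<forall>\<^sub>F k in sequentially. m k \<in> expo (\<lambda>j. k * l j)) \<longrightarrow> (\<lambda>k. real_vec (m k) /\<^sub>R real k) \<longlonglongrightarrow> p \<longrightarrow>
     (\<lambda>k. minlog (\<lambda>j. k * l j) (m k) / real k) \<longlonglongrightarrow> sg.envelope Fm (p, \<chi> j. real (l j))"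
    using lim by blast
  fix c assume c: "\<forall>m. (\<forall>\<^sub>F k in sequentially. m k \<in> expo (\<lambda>j. k * l j)) \<longrightarrow> (\<lambda>k. real_vec (m k) /\<^sub>R real k) \<longlonglongrightarrow> p \<longrightarrow>
     (\<lambda>k. minlog (\<lambda>j. k * l j) (m k) / real k) \<longlonglongrightarrow> c"
  obtain m where m: "\<forall>\<^sub>F k in sequentially. m k \<in> expo (\<lambda>j. k * l j)" "(\<lambda>k. real_vec (m k) /\<^sub>R real k) \<longlonglongrightarrow> p"
    by (rule exponent_sequence[OF y])
  show "c = sg.envelope Fm (p, \<chi> j. real (l j))"
    by (rule LIMSEQ_unique[OF c[rule_format, OF m] lim[OF m]])
qed

text \<open>Homogeneity of the envelope follows from uniqueness of limits along one sequence.\<close>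

lemma envelope_scale:
  assumes y: "(p, \<chi> j. real (l j)) \<in> interior sg.cone" and q: "0 < q"
  shows "sg.envelope Fm ((p, \<chi> j. real (l j)) /\<^sub>R q) = sg.envelope Fm (p, \<chi> j. real (l j)) / q"
proof -
  obtain m where m: "\<forall>\<^sub>F k in sequentially. m k \<in> expo (\<lambda>j. k * l j)" "(\<lambda>k. real_vec (m k) /\<^sub>R real k) \<longlonglongrightarrow> p"
    by (rule exponent_sequence[OF y])
  have "(\<lambda>k. minlog (\<lambda>j. k * l j) (m k) / (1 * real k) / q) \<longlonglongrightarrow> sg.envelope Fm ((p, \<chi> j. real (l j)) /\<^sub>R 1) / q"
    by (intro tendsto_divide minlog_limit[OF y _ m] tendsto_const) (use q in auto)
  then have "(\<lambda>k. minlog (\<lambda>j. k * l j) (m k) / (q * real k)) \<longlonglongrightarrow> sg.envelope Fm (p, \<chi> j. real (l j)) / q"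
    by (simp add: mult.commute)
  then show ?thesis using minlog_limit[OF y q m] LIMSEQ_unique by blast
qed

lemma global_semigroup_iff: "(\<alpha>, a) \<in> global_semigroup X \<kappa> D e \<longleftrightarrow> \<alpha> \<in> expo (vec_nth a)"
  unfolding global_semigroup_def mem_Collect_eq prod.case comb_frame_fr lead_exps_eq ..

lemma global_cone_eq: "global_cone X \<kappa> D e = sg.cone"
proof -
  have "map_prod real_vec real_vec ` global_semigroup X \<kappa> D e = Gm"
  proof (intro equalityI subsetI)
    fix x assume "x \<in> map_prod real_vec real_vec ` global_semigroup X \<kappa> D e"
    then obtain \<alpha> a where "(\<alpha>, a) \<in> global_semigroup X \<kappa> D e" "x = (real_vec \<alpha>, real_vec a)" by (auto simp: map_prod_def)
    then show "x \<in> Gm" unfolding global_semigroup_iff emb_real_vec by simp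
  next
    fix x assume "x \<in> Gm"
    then obtain \<alpha> a where x: "x = emb \<alpha> a" "\<alpha> \<in> expo a" unfolding Gm_def by blast
    then have "(\<alpha>, vec_lambda a) \<in> global_semigroup X \<kappa> D e" unfolding global_semigroup_iff by (simp add: vec_lambda_inverse eta_contract_eq)
    moreover have "x = map_prod real_vec real_vec (\<alpha>, vec_lambda a)" using x(1) by (simp add: emb_real_vec emb_def real_vec_def)
    ultimately show "x \<in> map_prod real_vec real_vec ` global_semigroup X \<kappa> D e" by (rule rev_image_eqI)
  qed
  then show ?thesis unfolding global_cone_def sg.cone_def by simp
qed

lemma global_chebyshev_eq: "global_chebyshev X \<kappa> D e \<psi> y = sg.envelope Fm y"
proof -
  have F: "global_F X \<kappa> D e \<psi> \<alpha> a = Fm (emb \<alpha> (vec_nth a))" for \<alpha> a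
    unfolding global_F_def comb_frame_fr comb_metric_mm min_log_norm_eq Fm_emb ..
  have "(\<forall>(\<alpha>, a)\<in>global_semigroup X \<kappa> D e. (real_vec \<alpha>, real_vec a) \<in> interior (global_cone X \<kappa> D e) \<longrightarrow>
        l (real_vec \<alpha>, real_vec a) \<le> global_F X \<kappa> D e \<psi> \<alpha> a)
     \<longleftrightarrow> (\<forall>\<gamma>\<in>Gm. \<gamma> \<in> interior sg.cone \<longrightarrow> l \<gamma> \<le> Fm \<gamma>)" (is "?L \<longleftrightarrow> ?R") for l :: "_ \<Rightarrow> real"
  proof
    assume L: ?L
    show ?R
    proof (intro ballI impI)
      fix \<gamma> assume g: "\<gamma> \<in> Gm" "\<gamma> \<in> interior sg.cone"
      then obtain \<alpha> a where x: "\<gamma> = emb \<alpha> a" "\<alpha> \<in> expo a" unfolding Gm_def by blast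
      have "vec_nth (vec_lambda a) = a" by (simp add: fun_eq_iff)
      then show "l \<gamma> \<le> Fm \<gamma>"
        using bspec[OF L, of "(\<alpha>, vec_lambda a)"] x g unfolding prod.case global_semigroup_iff F emb_real_vec global_cone_eq by simp
    qed
  next
    assume R: ?R
    show ?L
      unfolding F emb_real_vec global_cone_eq using R by (auto simp: global_semigroup_iff)
  qed
  then show ?thesis unfolding global_chebyshev_def sg.envelope_def by (simp only:)
qed

end

theorem proposition13p7:
  fixes X :: "('a, 'n::{finite, linorder}) cmanifold"
    and D :: "'r::finite \<Rightarrow> ('a, nat) divisor"
    and x\<^sub>0 :: 'a
    and \<kappa> :: "('a, 'n) chart"
    and e :: "'r \<Rightarrow> nat \<Rightarrow> 'a \<Rightarrow> complex"
    and \<psi> :: "'r \<Rightarrow> nat \<Rightarrow> 'a \<Rightarrow> real"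
    and p :: "(real, 'n) vec" and a :: "rat^'r" and q :: nat
  assumes "projective_manifold X"
    and "numerical_basis X D"
    and "coordinates_at X x\<^sub>0 \<kappa>"
    and "\<And>j. local_frame X (D j) x\<^sub>0 (e j)"
    and "\<And>j. continuous_metric X (D j) (\<psi> j)"
    and "(p, \<chi> j. of_rat (a $ j)) \<in> interior (global_cone X \<kappa> D e)"
    and "q > 0" and "\<And>j. of_nat q * a $ j \<in> \<int>"
  shows "global_chebyshev X \<kappa> D e \<psi> (p, \<chi> j. of_rat (a $ j)) = rational_chebyshev X \<kappa> D e \<psi> a q p"
proof -
  interpret metrized_manifold X D x\<^sub>0 \<kappa> e \<psi>
    by unfold_locales
      (use assms(1-5) in \<open>auto simp: projective_manifold_def numerical_basis_def\<close>)
  define y :: "(real, 'n) vec \<times> (real, 'r) vec" where "y = (p, \<chi> j. of_rat (a $ j))"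
  have y: "y \<in> interior sg.cone" using assms(6) unfolding global_cone_eq y_def .
  define l where "l j = nat \<lfloor>of_nat q * a $ j\<rfloor>" for j
  have a0: "0 \<le> a $ j" for j using interior_nonneg(2)[OF y, of j] by (simp add: y_def)
  have l: "\<lfloor>of_nat q * a $ j\<rfloor> = int (l j)" "real (l j) = real q * of_rat (a $ j)" for j
  proof -
    show 1: "\<lfloor>of_nat q * a $ j\<rfloor> = int (l j)" using a0[of j] by (simp add: l_def)
    have "of_nat q * a $ j = of_int \<lfloor>of_nat q * a $ j\<rfloor>" using assms(8)[of j] by (auto elim!: Ints_cases)
    then have "of_nat q * a $ j = of_nat (l j)" unfolding 1 by simp
    then have "(of_rat (of_nat q * a $ j) :: real) = of_rat (of_nat (l j))" by (rule arg_cong)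
    then show "real (l j) = real q * of_rat (a $ j)" by (simp add: of_rat_mult)
  qed
  let ?y = "(real q *\<^sub>R p, \<chi> j. real (l j)) :: (real, 'n) vec \<times> (real, 'r) vec"
  have qy: "?y = real q *\<^sub>R y" by (simp add: y_def l(2) vec_eq_iff)
  have iy: "?y \<in> interior sg.cone" unfolding qy using assms(7) by (intro sg.interior_cone_scale[OF y]) simp
  have mm: "(\<lambda>t x. real q * comb_metric \<psi> (\<lambda>j. of_rat (a $ j)) t x) = mm l"
    by (simp add: fun_eq_iff comb_metric_def mm_def l(2) sum_distrib_left mult.assoc)
  have "rational_chebyshev X \<kappa> D e \<psi> a q p = chebyshev X \<kappa> (DD l) (fr l) (mm l) (real q *\<^sub>R p) / real q"
    unfolding rational_chebyshev_def Let_def l(1) comb_frame_fr mm ..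
  also have "\<dots> = sg.envelope Fm ?y / real q" unfolding chebyshev_eq[OF iy] ..
  also have "\<dots> = sg.envelope Fm (?y /\<^sub>R real q)" using assms(7) by (intro envelope_scale[OF iy, symmetric]) simp
  also have "?y /\<^sub>R real q = y" unfolding qy using assms(7) by simp
  finally show ?thesis unfolding global_chebyshev_eq y_def[symmetric] ..
qed

end
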